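(* Let $X$ be a Noetherian catenary scheme such that all irreducible components of $X$ have the same finite dimension $d$, and let $\mathcal F$ be an abelian sheaf on $X$ that is Cohen--Macaulay. Then the natural morphism $\mathcal F\to\underline{\mathbf A}'(X,\mathcal F)^{\bullet}$ is a quasi-isomorphism.
   Context: **Cousin complex.** $X^{(p)}$ is the set of points of codimension $p$; for $\eta\in X^{(p)}$, $H^i_\eta(X,\mathcal F)$ is the local cohomology at $\eta$, i.e. the stalk at $\eta$ of $R^i\gamma_{\overline\eta}\mathcal F$, where $\gamma_{\overline\eta}$ takes the subsheaf of sections supported on $\overline\eta$. For $\xi\in\overline\eta$ with $\overline\xi$ of codimension one in $\overline\eta$, $\nu_{\eta\xi}:H^p_\eta(X,\mathcal F)\to H^{p+1}_\xi(X,\mathcal F)$ is the natural (connecting) map: with $X_\xi=\mathrm{Spec}(\mathcal O_{X,\xi})$ and $Y$ the closure of $\eta$ in $X_\xi$, it is $H^p_{Y\setminus\{\xi\}}(X_\xi\setminus\{\xi\},\mathcal F)\to H^{p+1}_{\{\xi\}}(X_\xi,\mathcal F)$. The sheafified Cousin complex is $\underline{Cous}(X,\mathcal F)^p=\bigoplus_{\eta\in X^{(p)}}(i_{\overline\eta})_*H^p_\eta(X,\mathcal F)$ (constant sheaves on $\overline\eta$, differential the sum of the $\nu_{\eta\xi}$). $\mathcal F$ is *Cohen--Macaulay* (in the sense of Hartshorne, Residues and Duality) if the natural morphism $\mathcal F\to\underline{Cous}(X,\mathcal F)^\bullet$ is a quasi-isomorphism. **$\mathbf A'$-adelic groups.**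 A flag of type $(i_0\ldots i_p)$, $0\le i_0<\dots<i_p\le d$, is a sequence $\eta_0\ldots\eta_p$ of points with $\eta_j\in\overline\eta_{j-1}$ and $\eta_j\in X^{(i_j)}$. $C((i_0\ldots i_p),\mathcal F)=\prod_{\eta_0\ldots\eta_p}\mathcal F_{\eta_0}$ over flags of this type. The depth $l$ of $(i_0\ldots i_p)$ is the largest $l\ge0$ with $(i_0,\dots,i_l)=(0,\dots,l)$ if $i_0=0$, and $-1$ if $i_0>0$. $\mathbf A'((i_0\ldots i_p),\mathcal F)\subseteq C((i_0\ldots i_p),\mathcal F)$ is the subgroup of those $f$ such that for every $m$, $0\le m\le l$, and every flag $\eta_{m+1}\ldots\eta_p$ of type $(i_{m+1}\ldots i_p)$ there are only finitely many flags $\eta_0\ldots\eta_m$ of type $(0\ldots m)$ (with $\eta_{m+1}\in\overline\eta_m$) such that $(\nu_{\eta_{m-1}\eta_m}\circ\dots\circ\nu_{\eta_0\eta_1})(f_{\eta_0\ldots\eta_m\eta_{m+1}\ldots\eta_p})\in H^m_{\eta_m}(X,\mathcal F)$ is nonzero. **Complex.** $\mathbf A'(X,\mathcal F)^p=\prod_{0\le i_0<\dots<i_p\le d}\mathbf A'((i_0\ldots i_p),\mathcal F)$, with $(df)_{\eta_0\ldots\eta_{p+1}}=\sum_{i=0}^{p+1}(-1)^if_{\eta_0\ldots\hat\eta_i\ldots\eta_{p+1}}\in\mathcal F_{\eta_0}$. $\underline{\mathbf A}'(X,\mathcal F)^\bullet$ is the complex of sheaves $U\mapsto\mathbf A'(U,\mathcal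 F|_U)^\bullet$ (restriction by projection to flags in the smaller open set). The natural morphism $\mathcal F\to\underline{\mathbf A}'(X,\mathcal F)^\bullet$ sends a section over $U$ to the collection of its germs at the points of $U$.
   Formalization: For d ≥ 2 the differential need not map A'^p into A'^{p+1} (e.g. X = A², F = O), so the cohomology of A' is taken as cocycles in A'^p modulo those elements of A'^p of the form dg with g in A'^{p-1}, i.e. that of the largest subcomplex of A'. *)

theory Defs
  imports
    "HOL-Algebra.Coset"
    "HOL-Algebra.QuotRing"
    "HOL-Algebra.Ring_Divisibility"
    "HOL-Analysis.Abstract_Topology"
    "HOL-Library.Extended_Nat"
begin

section \<open>Dimension theory of topological spaces\<close>

definition irreducible_closed :: "'x topology \<Rightarrow> 'x set \<Rightarrow> bool" where
  "irreducible_closed X Z \<longleftrightarrow> closedin X Z \<and> Z \<noteq> {} \<and>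
     (\<forall>A B. closedin X A \<longrightarrow> closedin X B \<longrightarrow> Z \<subseteq> A \<union> B \<longrightarrow> Z \<subseteq> A \<or> Z \<subseteq> B)"

definition irreducible_components :: "'x topology \<Rightarrow> 'x set set" where
  "irreducible_components X =
     {Z. irreducible_closed X Z \<and> (\<forall>W. irreducible_closed X W \<longrightarrow> Z \<subseteq> W \<longrightarrow> W = Z)}"

text \<open>A chain \<open>Z\<^sub>0 \<subset> \<dots> \<subset> Z\<^sub>n\<close> of irreducible closed subsets is a list of
  length \<open>n + 1\<close>.\<close>

definition irr_chain :: "'x topology \<Rightarrow> 'x set list \<Rightarrow> bool" where
  "irr_chain X Zs \<longleftrightarrow>
     Zs \<noteq> [] \<and> (\<forall>Z\<in>set Zs. irreducible_closed X Z) \<and> sorted_wrt (\<subset>) Zs"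

definition krull_dim :: "'x topology \<Rightarrow> enat" where
  "krull_dim X = Sup {enat (length Zs - 1) |Zs. irr_chain X Zs}"

definition codim :: "'x topology \<Rightarrow> 'x set \<Rightarrow> enat" where
  "codim X Z = Sup {enat (length Zs - 1) |Zs. irr_chain X Zs \<and> hd Zs = Z}"

definition codim_in :: "'x topology \<Rightarrow> 'x set \<Rightarrow> 'x set \<Rightarrow> enat" where
  "codim_in X Y Z = Sup {enat (length Zs - 1) |Zs. irr_chain X Zs \<and> hd Zs = Y \<and> last Zs = Z}"

definition saturated_chain :: "'x topology \<Rightarrow> 'x set list \<Rightarrow> bool" where
  "saturated_chain X Zs \<longleftrightarrow> irr_chain X Zs \<and>
     (\<forall>i. Suc i < length Zs \<longrightarrow> (\<nexists>W. irreducible_closed X W \<and> Zs ! i \<subset> W \<and> W \<subset> Zs ! Suc i))"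

definition catenary :: "'x topology \<Rightarrow> bool" where
  "catenary X \<longleftrightarrow> (\<forall>Y Z. irreducible_closed X Y \<longrightarrow> irreducible_closed X Z \<longrightarrow> Y \<subseteq> Z \<longrightarrow>
     codim_in X Y Z \<noteq> \<infinity> \<and>
     (\<forall>Zs. saturated_chain X Zs \<longrightarrow> hd Zs = Y \<longrightarrow> last Zs = Z \<longrightarrow>
        enat (length Zs - 1) = codim_in X Y Z))"

text \<open>\<open>X\<^sup>(\<^sup>p\<^sup>)\<close>\<close>

definition points_codim :: "'x topology \<Rightarrow> nat \<Rightarrow> 'x set" where
  "points_codim X p = {x \<in> topspace X. codim X (X closure_of {x}) = enat p}"


section \<open>Presheaves and sheaves\<close>

text \<open>The type of the algebraic structure on the sections is a parameter, so that
  the same record serves for sheaves of groups and of rings.  Only the values on open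
  sets matter; hence the restriction of a sheaf to an open subspace is the same record,
  used over another topology.\<close>

record ('x, 'g, 'b) presheaf =
  sections :: "'x set \<Rightarrow> 'g"
  restr :: "'x set \<Rightarrow> 'x set \<Rightarrow> 'b \<Rightarrow> 'b"

type_synonym ('x, 'b) ab_presheaf = "('x, 'b monoid, 'b) presheaf"
type_synonym ('x, 'a) ring_presheaf = "('x, 'a ring, 'a) presheaf"

definition is_presheaf :: "'x topology \<Rightarrow> ('x, ('b, 'm) monoid_scheme, 'b) presheaf \<Rightarrow> bool" where
  "is_presheaf X F \<longleftrightarrow>
     (\<forall>U V. openin X U \<longrightarrow> openin X V \<longrightarrow> V \<subseteq> U \<longrightarrow>
        restr F U V \<in> carrier (sections F U) \<rightarrow> carrier (sections F V)) \<and>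
     (\<forall>U. openin X U \<longrightarrow> (\<forall>s\<in>carrier (sections F U). restr F U U s = s)) \<and>
     (\<forall>U V W. openin X U \<longrightarrow> openin X V \<longrightarrow> openin X W \<longrightarrow> V \<subseteq> U \<longrightarrow> W \<subseteq> V \<longrightarrow>
        (\<forall>s\<in>carrier (sections F U). restr F V W (restr F U V s) = restr F U W s))"

definition gluing :: "'x topology \<Rightarrow> ('x, ('b, 'm) monoid_scheme, 'b) presheaf \<Rightarrow> bool" where
  "gluing X F \<longleftrightarrow>
     (\<forall>\<U> s. (\<forall>U\<in>\<U>. openin X U \<and> s U \<in> carrier (sections F U)) \<longrightarrow>
        (\<forall>U\<in>\<U>. \<forall>V\<in>\<U>. restr F U (U \<inter> V) (s U) = restr F V (U \<inter> V) (s V)) \<longrightarrow>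
        (\<exists>!t. t \<in> carrier (sections F (\<Union>\<U>)) \<and> (\<forall>U\<in>\<U>. restr F (\<Union>\<U>) U t = s U)))"

definition ab_sheaf :: "'x topology \<Rightarrow> ('x, 'b) ab_presheaf \<Rightarrow> bool" where
  "ab_sheaf X F \<longleftrightarrow> is_presheaf X F \<and> gluing X F \<and>
     (\<forall>U. openin X U \<longrightarrow> comm_group (sections F U)) \<and>
     (\<forall>U V. openin X U \<longrightarrow> openin X V \<longrightarrow> V \<subseteq> U \<longrightarrow>
        restr F U V \<in> hom (sections F U) (sections F V))"

definition ring_sheaf :: "'x topology \<Rightarrow> ('x, 'a) ring_presheaf \<Rightarrow> bool" where
  "ring_sheaf X F \<longleftrightarrow> is_presheaf X F \<and> gluing X F \<and>
     (\<forall>U. openin X U \<longrightarrow> cring (sections F U)) \<and>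
     (\<forall>U V. openin X U \<longrightarrow> openin X V \<longrightarrow> V \<subseteq> U \<longrightarrow>
        restr F U V \<in> ring_hom (sections F U) (sections F V))"

definition sheaf_hom ::
  "'x topology \<Rightarrow> ('x, 'b) ab_presheaf \<Rightarrow> ('x, 'c) ab_presheaf \<Rightarrow> ('x set \<Rightarrow> 'b \<Rightarrow> 'c) \<Rightarrow> bool" where
  "sheaf_hom X F G \<phi> \<longleftrightarrow>
     (\<forall>U. openin X U \<longrightarrow> \<phi> U \<in> hom (sections F U) (sections G U)) \<and>
     (\<forall>U V. openin X U \<longrightarrow> openin X V \<longrightarrow> V \<subseteq> U \<longrightarrow>
        (\<forall>s\<in>carrier (sections F U). restr G U V (\<phi> U s) = \<phi> V (restr F U V s)))"

definition germ :: "'x topology \<Rightarrow> ('x, 'b) ab_presheaf \<Rightarrow> 'x \<Rightarrow> 'x set \<Rightarrow> 'b \<Rightarrow> ('x set \<times> 'b) set" where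
  "germ X F x U s = {(V, t). openin X V \<and> x \<in> V \<and> t \<in> carrier (sections F V) \<and>
     (\<exists>W. openin X W \<and> x \<in> W \<and> W \<subseteq> U \<inter> V \<and> restr F U W s = restr F V W t)}"

definition stalk :: "'x topology \<Rightarrow> ('x, 'b) ab_presheaf \<Rightarrow> 'x \<Rightarrow> ('x set \<times> 'b) set monoid" where
  "stalk X F x =
     \<lparr>carrier = {germ X F x U s |U s. openin X U \<and> x \<in> U \<and> s \<in> carrier (sections F U)},
      mult = (\<lambda>A B. \<Union>(U, s)\<in>A. \<Union>(V, t)\<in>B. germ X F x (U \<inter> V)
        (restr F U (U \<inter> V) s \<otimes>\<^bsub>sections F (U \<inter> V)\<^esub> restr F V (U \<inter> V) t)),
      one = germ X F x (topspace X) \<one>\<^bsub>sections F (topspace X)\<^esub>\<rparr>"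

text \<open>\<open>stalk_map X G x \<phi>\<close> sends the germ of \<open>s\<close> at any point \<open>y\<close> to the germ
  of \<open>\<phi> s\<close> at \<open>x\<close>.  For \<open>y = x\<close> it is the map induced by \<open>\<phi>\<close> on stalks; for \<open>y\<close> in the
  closure of \<open>x\<close> and \<open>\<phi> = id\<close> it is the cospecialization map \<open>F\<^sub>y \<rightarrow> F\<^sub>x\<close>.\<close>

definition stalk_map ::
  "'x topology \<Rightarrow> ('x, 'c) ab_presheaf \<Rightarrow> 'x \<Rightarrow> ('x set \<Rightarrow> 'b \<Rightarrow> 'c) \<Rightarrow>
     ('x set \<times> 'b) set \<Rightarrow> ('x set \<times> 'c) set" where
  "stalk_map X G x \<phi> A = (\<Union>(U, s)\<in>A. germ X G x U (\<phi> U s))"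

text \<open>The subsheaf \<open>\<gamma>\<^sub>Z F\<close> of sections supported on the closed set \<open>Z\<close>.\<close>

definition with_support :: "'x set \<Rightarrow> ('x, 'b) ab_presheaf \<Rightarrow> ('x, 'b) ab_presheaf" where
  "with_support Z F = F\<lparr>sections := (\<lambda>U. (sections F U)
     \<lparr>carrier := {s \<in> carrier (sections F U). restr F U (U - Z) s = \<one>\<^bsub>sections F (U - Z)\<^esub>}\<rparr>)\<rparr>"


section \<open>Schemes\<close>

definition spec_points :: "('a, 'm) ring_scheme \<Rightarrow> 'a set set" where
  "spec_points R = {P. primeideal P R}"

definition spec_open :: "('a, 'm) ring_scheme \<Rightarrow> 'a set set \<Rightarrow> bool" where
  "spec_open R U \<longleftrightarrow> (\<exists>E \<subseteq> carrier R. U = {P \<in> spec_points R. \<not> E \<subseteq> P})"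

definition spec_topology :: "('a, 'm) ring_scheme \<Rightarrow> 'a set topology" where
  "spec_topology R = topology (spec_open R)"

lemma spec_open_Int:
  assumes "spec_open R U" "spec_open R V"
  shows "spec_open R (U \<inter> V)"
proof -
  from assms obtain E G where
    E: "E \<subseteq> carrier R" "U = {P \<in> spec_points R. \<not> E \<subseteq> P}" and
    G: "G \<subseteq> carrier R" "V = {P \<in> spec_points R. \<not> G \<subseteq> P}"
    unfolding spec_open_def by blast
  show ?thesis
  proof (cases "spec_points R = {}")
    case True
    then have "U \<inter> V = {P \<in> spec_points R. \<not> {} \<subseteq> P}" using E by auto
    then show ?thesis unfolding spec_open_def by (intro exI[of _ "{}"]) auto
  next
    case False
    then obtain P0 where "primeideal P0 R" unfolding spec_points_def by auto
    then interpret cring R by (simp add: primeideal_def)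
    let ?H = "{e \<otimes>\<^bsub>R\<^esub> g |e g. e \<in> E \<and> g \<in> G}"
    have H: "?H \<subseteq> carrier R" using E(1) G(1) by blast
    have "U \<inter> V = {P \<in> spec_points R. \<not> ?H \<subseteq> P}"
    proof (intro equalityI subsetI)
      fix P assume P: "P \<in> U \<inter> V"
      then have pr: "primeideal P R" using E(2) by (auto simp: spec_points_def)
      from P obtain e g where eg: "e \<in> E" "e \<notin> P" "g \<in> G" "g \<notin> P" using E(2) G(2) by auto
      have "e \<otimes>\<^bsub>R\<^esub> g \<notin> P"
        using primeideal.I_prime[OF pr, of e g] eg E(1) G(1) by blast
      with eg P E(2) show "P \<in> {P \<in> spec_points R. \<not> ?H \<subseteq> P}" by blast
    next
      fix P assume P: "P \<in> {P \<in> spec_points R. \<not> ?H \<subseteq> P}"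
      then have "ideal P R" by (auto simp: spec_points_def primeideal_def)
      from P obtain e g where eg: "e \<in> E" "g \<in> G" "e \<otimes>\<^bsub>R\<^esub> g \<notin> P" by blast
      have "e \<notin> P" using ideal.I_r_closed[OF \<open>ideal P R\<close>, of e g] eg G(1) by blast
      moreover have "g \<notin> P" using ideal.I_l_closed[OF \<open>ideal P R\<close>, of g e] eg E(1) by blast
      ultimately show "P \<in> U \<inter> V" using P eg E(2) G(2) by blast
    qed
    with H show ?thesis unfolding spec_open_def by blast
  qed
qed

lemma openin_spec_topology: "openin (spec_topology R) = spec_open R"
proof -
  have "istopology (spec_open R)"
    unfolding istopology_def
  proof (intro conjI allI impI)
    fix U V assume "spec_open R U" "spec_open R V"
    then show "spec_open R (U \<inter> V)" by (rule spec_open_Int)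
  next
    fix \<K> assume "\<forall>K\<in>\<K>. spec_open R K"
    then obtain E where E: "\<And>K. K \<in> \<K> \<Longrightarrow> E K \<subseteq> carrier R \<and> K = {P \<in> spec_points R. \<not> E K \<subseteq> P}"
      unfolding spec_open_def by metis
    have "\<Union>\<K> = {P \<in> spec_points R. \<not> \<Union>(E ` \<K>) \<subseteq> P}" using E by blast
    moreover have "\<Union>(E ` \<K>) \<subseteq> carrier R" using E by blast
    ultimately show "spec_open R (\<Union>\<K>)" unfolding spec_open_def by blast
  qed
  then show ?thesis unfolding spec_topology_def by (rule topology_inverse')
qed

text \<open>Fractions and the localization \<open>R\<^sub>P\<close> at a prime ideal.\<close>

definition fraction :: "('a, 'm) ring_scheme \<Rightarrow> 'a set \<Rightarrow> 'a \<Rightarrow> 'a \<Rightarrow> ('a \<times> 'a) set" where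
  "fraction R P r s = {(r', s'). r' \<in> carrier R \<and> s' \<in> carrier R - P \<and>
     (\<exists>t\<in>carrier R - P. t \<otimes>\<^bsub>R\<^esub> (r \<otimes>\<^bsub>R\<^esub> s') = t \<otimes>\<^bsub>R\<^esub> (r' \<otimes>\<^bsub>R\<^esub> s))}"

definition localization :: "('a, 'm) ring_scheme \<Rightarrow> 'a set \<Rightarrow> ('a \<times> 'a) set ring" where
  "localization R P =
     \<lparr>carrier = {fraction R P r s |r s. r \<in> carrier R \<and> s \<in> carrier R - P},
      mult = (\<lambda>A B. \<Union>(r, s)\<in>A. \<Union>(r', s')\<in>B. fraction R P (r \<otimes>\<^bsub>R\<^esub> r') (s \<otimes>\<^bsub>R\<^esub> s')),
      one = fraction R P \<one>\<^bsub>R\<^esub> \<one>\<^bsub>R\<^esub>,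
      zero = fraction R P \<zero>\<^bsub>R\<^esub> \<one>\<^bsub>R\<^esub>,
      add = (\<lambda>A B. \<Union>(r, s)\<in>A. \<Union>(r', s')\<in>B.
        fraction R P ((r \<otimes>\<^bsub>R\<^esub> s') \<oplus>\<^bsub>R\<^esub> (r' \<otimes>\<^bsub>R\<^esub> s)) (s \<otimes>\<^bsub>R\<^esub> s'))\<rparr>"

definition spec_sheaf :: "('a, 'm) ring_scheme \<Rightarrow> ('a set, 'a set \<Rightarrow> ('a \<times> 'a) set) ring_presheaf" where
  "spec_sheaf R =
     \<lparr>sections = (\<lambda>U.
        \<lparr>carrier = {\<sigma> \<in> (\<Pi>\<^sub>E P\<in>U. carrier (localization R P)).
           \<forall>P\<in>U. \<exists>V r s. openin (spec_topology R) V \<and> P \<in> V \<and> V \<subseteq> U \<and>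
             r \<in> carrier R \<and> s \<in> carrier R \<and> (\<forall>Q\<in>V. s \<notin> Q \<and> \<sigma> Q = fraction R Q r s)},
         mult = (\<lambda>\<sigma> \<tau>. \<lambda>P\<in>U. \<sigma> P \<otimes>\<^bsub>localization R P\<^esub> \<tau> P),
         one = (\<lambda>P\<in>U. \<one>\<^bsub>localization R P\<^esub>),
         zero = (\<lambda>P\<in>U. \<zero>\<^bsub>localization R P\<^esub>),
         add = (\<lambda>\<sigma> \<tau>. \<lambda>P\<in>U. \<sigma> P \<oplus>\<^bsub>localization R P\<^esub> \<tau> P)\<rparr>),
      restr = (\<lambda>U V \<sigma>. restrict \<sigma> V)\<rparr>"

text \<open>The ringed space \<open>(X, \<O>)\<close> is isomorphic to the spectrum of \<open>R\<close>.  An isomorphism of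
  ringed spaces induces isomorphisms of stalks, so when the right-hand side is a spectrum
  it is automatically an isomorphism of locally ringed spaces.\<close>

definition iso_to_spec :: "'x topology \<Rightarrow> ('x, 'a) ring_presheaf \<Rightarrow> 'r ring \<Rightarrow> bool" where
  "iso_to_spec X OX R \<longleftrightarrow> (\<exists>h \<theta>. homeomorphic_map X (spec_topology R) h \<and>
     (\<forall>V. openin (spec_topology R) V \<longrightarrow>
        \<theta> V \<in> ring_iso (sections (spec_sheaf R) V) (sections OX {x \<in> topspace X. h x \<in> V})) \<and>
     (\<forall>V W. openin (spec_topology R) V \<longrightarrow> openin (spec_topology R) W \<longrightarrow> W \<subseteq> V \<longrightarrow>
        (\<forall>\<sigma>\<in>carrier (sections (spec_sheaf R) V).
           restr OX {x \<in> topspace X. h x \<in> V} {x \<in> topspace X. h x \<in> W} (\<theta> V \<sigma>)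
           = \<theta> W (restr (spec_sheaf R) V W \<sigma>))))"

text \<open>As in EGA I (2.1.2), a scheme is a ringed space that is locally isomorphic to spectra; its
  stalks are then local rings.  There is no loss in taking \<open>R\<close> over the type of the sections
  of the structure sheaf, since \<open>R\<close> is isomorphic to the ring of sections over \<open>U\<close>.
  Noetherian means covered by finitely many spectra of Noetherian rings.\<close>

definition affine_open :: "'x topology \<Rightarrow> ('x, 'a) ring_presheaf \<Rightarrow> 'x set \<Rightarrow> 'a ring \<Rightarrow> bool" where
  "affine_open X OX U R \<longleftrightarrow> openin X U \<and> cring R \<and> iso_to_spec (subtopology X U) OX R"

definition is_scheme :: "'x topology \<Rightarrow> ('x, 'a) ring_presheaf \<Rightarrow> bool" where
  "is_scheme X OX \<longleftrightarrow> ring_sheaf X OX \<and> (\<forall>x\<in>topspace X. \<exists>U R. x \<in> U \<and> affine_open X OX U R)"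

definition noetherian_scheme :: "'x topology \<Rightarrow> ('x, 'a) ring_presheaf \<Rightarrow> bool" where
  "noetherian_scheme X OX \<longleftrightarrow> is_scheme X OX \<and>
     (\<exists>\<U>. finite \<U> \<and> \<Union>\<U> = topspace X \<and>
        (\<forall>U\<in>\<U>. \<exists>R. affine_open X OX U R \<and> noetherian_ring R))"


section \<open>Complexes of abelian groups and of sheaves\<close>

text \<open>Cochain complexes in degrees \<open>\<ge> 0\<close>.  Abelian groups are written multiplicatively.\<close>

record 'b cochain_complex =
  grp :: "nat \<Rightarrow> 'b monoid"
  cobd :: "nat \<Rightarrow> 'b \<Rightarrow> 'b"

record ('x, 'b) sheaf_complex =
  obj :: "nat \<Rightarrow> ('x, 'b) ab_presheaf"
  diff :: "nat \<Rightarrow> 'x set \<Rightarrow> 'b \<Rightarrow> 'b"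

definition cocycles :: "('b, 'z) cochain_complex_scheme \<Rightarrow> nat \<Rightarrow> 'b set" where
  "cocycles K n = {z \<in> carrier (grp K n). cobd K n z = \<one>\<^bsub>grp K (Suc n)\<^esub>}"

definition coboundaries :: "('b, 'z) cochain_complex_scheme \<Rightarrow> nat \<Rightarrow> 'b set" where
  "coboundaries K n = {z \<in> carrier (grp K n).
     (case n of 0 \<Rightarrow> z = \<one>\<^bsub>grp K 0\<^esub> | Suc m \<Rightarrow> \<exists>y\<in>carrier (grp K m). cobd K m y = z)}"

definition cohomology :: "('b, 'z) cochain_complex_scheme \<Rightarrow> nat \<Rightarrow> 'b set monoid" where
  "cohomology K n = ((grp K n)\<lparr>carrier := cocycles K n\<rparr>) Mod coboundaries K n"

definition cohomology_class :: "('b, 'z) cochain_complex_scheme \<Rightarrow> nat \<Rightarrow> 'b \<Rightarrow> 'b set" where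
  "cohomology_class K n z = coboundaries K n #>\<^bsub>grp K n\<^esub> z"

definition cohomology_map ::
  "('c, 'z) cochain_complex_scheme \<Rightarrow> nat \<Rightarrow> ('b \<Rightarrow> 'c) \<Rightarrow> 'b set \<Rightarrow> 'c set" where
  "cohomology_map L n \<phi> A = (\<Union>z\<in>A. cohomology_class L n (\<phi> z))"

text \<open>The connecting homomorphism \<open>H\<^sup>n(C) \<rightarrow> H\<^sup>n\<^sup>+\<^sup>1(A)\<close> of a short exact sequence of complexes
  \<open>0 \<rightarrow> A \<rightarrow> B \<rightarrow> C \<rightarrow> 0\<close> with maps \<open>i\<close> and \<open>q\<close>.\<close>

definition connecting_hom ::
  "'b cochain_complex \<Rightarrow> 'c cochain_complex \<Rightarrow> 'e cochain_complex \<Rightarrow>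
     (nat \<Rightarrow> 'b \<Rightarrow> 'c) \<Rightarrow> (nat \<Rightarrow> 'c \<Rightarrow> 'e) \<Rightarrow> nat \<Rightarrow> 'e set \<Rightarrow> 'b set" where
  "connecting_hom A B C i q n c =
     (THE h. \<exists>b\<in>carrier (grp B n). \<exists>a\<in>carrier (grp A (Suc n)).
        q n b \<in> c \<and> i (Suc n) a = cobd B n b \<and> h = cohomology_class A (Suc n) a)"

definition stalk_complex ::
  "'x topology \<Rightarrow> ('x, 'b) sheaf_complex \<Rightarrow> 'x \<Rightarrow> ('x set \<times> 'b) set cochain_complex" where
  "stalk_complex X K x =
     \<lparr>grp = (\<lambda>n. stalk X (obj K n) x),
      cobd = (\<lambda>n. stalk_map X (obj K (Suc n)) x (diff K n))\<rparr>"

text \<open>A quasi-isomorphism induces isomorphisms of all cohomology sheaves; this is tested on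
  stalks, where the cohomology sheaves become the cohomology of the stalk complexes.\<close>

definition quasi_iso ::
  "'x topology \<Rightarrow> ('x, 'b) sheaf_complex \<Rightarrow> ('x, 'c) sheaf_complex \<Rightarrow>
     (nat \<Rightarrow> 'x set \<Rightarrow> 'b \<Rightarrow> 'c) \<Rightarrow> bool" where
  "quasi_iso X K L \<phi> \<longleftrightarrow> (\<forall>x\<in>topspace X. \<forall>n.
     cohomology_map (stalk_complex X L x) n (stalk_map X (obj L n) x (\<phi> n))
       \<in> iso (cohomology (stalk_complex X K x) n) (cohomology (stalk_complex X L x) n))"

text \<open>The complex with \<open>F\<close> in degree \<open>0\<close> and trivial sheaves in the other degrees, and the
  morphism from it to \<open>L\<close> given by a morphism \<open>\<epsilon>\<close> from \<open>F\<close> to \<open>L\<^sup>0\<close>.\<close>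

definition in_degree_0 :: "('x, 'b) ab_presheaf \<Rightarrow> ('x, 'b) sheaf_complex" where
  "in_degree_0 F =
     \<lparr>obj = (\<lambda>n. if n = 0 then F
        else F\<lparr>sections := (\<lambda>U. (sections F U)\<lparr>carrier := {\<one>\<^bsub>sections F U\<^esub>}\<rparr>)\<rparr>),
      diff = (\<lambda>n U s. \<one>\<^bsub>sections F U\<^esub>)\<rparr>"

definition from_degree_0 ::
  "('x, 'c) sheaf_complex \<Rightarrow> ('x set \<Rightarrow> 'b \<Rightarrow> 'c) \<Rightarrow> nat \<Rightarrow> 'x set \<Rightarrow> 'b \<Rightarrow> 'c" where
  "from_degree_0 L \<epsilon> n U s = (if n = 0 then \<epsilon> U s else \<one>\<^bsub>sections (obj L n) U\<^esub>)"


section \<open>Injective resolutions\<close>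

text \<open>Injectivity would have to be tested against monomorphisms between abelian sheaves over all
  types, which HOL cannot express.  The test sheaves below have sections in the type of functions
  from \<open>X\<close> to the integers.  This type carries the sheaves \<open>\<int>\<^sub>U\<close> (extension by zero of the constant
  sheaf on an open \<open>U\<close>) and all their subsheaves.  Since the \<open>\<int>\<^sub>U\<close> generate the category of abelian
  sheaves, Baer's criterion (Grothendieck, Tohoku, 1.10, Lemma 1) shows that nothing is lost.\<close>

definition injective_sheaf :: "'x topology \<Rightarrow> ('x, 'c) ab_presheaf \<Rightarrow> bool" where
  "injective_sheaf X J \<longleftrightarrow> ab_sheaf X J \<and>
     (\<forall>(A :: ('x, 'x \<Rightarrow> int) ab_presheaf) (B :: ('x, 'x \<Rightarrow> int) ab_presheaf) i f.
        ab_sheaf X A \<longrightarrow> ab_sheaf X B \<longrightarrow> sheaf_hom X A B i \<longrightarrow>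
        (\<forall>U. openin X U \<longrightarrow> inj_on (i U) (carrier (sections A U))) \<longrightarrow> sheaf_hom X A J f \<longrightarrow>
        (\<exists>g. sheaf_hom X B J g \<and>
           (\<forall>U. openin X U \<longrightarrow> (\<forall>s\<in>carrier (sections A U). g U (i U s) = f U s))))"

definition injective_resolution ::
  "'x topology \<Rightarrow> ('x, 'b) ab_presheaf \<Rightarrow> ('x, 'c) sheaf_complex \<Rightarrow> ('x set \<Rightarrow> 'b \<Rightarrow> 'c) \<Rightarrow> bool" where
  "injective_resolution X F I \<epsilon> \<longleftrightarrow>
     (\<forall>n. injective_sheaf X (obj I n)) \<and>
     (\<forall>n. sheaf_hom X (obj I n) (obj I (Suc n)) (diff I n)) \<and>
     (\<forall>n U. openin X U \<longrightarrow> (\<forall>s\<in>carrier (sections (obj I n) U).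
        diff I (Suc n) U (diff I n U s) = \<one>\<^bsub>sections (obj I (Suc (Suc n))) U\<^esub>)) \<and>
     sheaf_hom X F (obj I 0) \<epsilon> \<and>
     (\<forall>U. openin X U \<longrightarrow> (\<forall>s\<in>carrier (sections F U).
        diff I 0 U (\<epsilon> U s) = \<one>\<^bsub>sections (obj I 1) U\<^esub>)) \<and>
     quasi_iso X (in_degree_0 F) I (from_degree_0 I \<epsilon>)"


section \<open>Local cohomology and the Cousin complex\<close>

text \<open>Derived functors of \<open>F\<close> are computed from a given injective resolution \<open>\<epsilon> : F \<rightarrow> I\<close>.\<close>

definition supp_complex :: "'x set \<Rightarrow> ('x, 'c) sheaf_complex \<Rightarrow> ('x, 'c) sheaf_complex" where
  "supp_complex Z I = I\<lparr>obj := (\<lambda>n. with_support Z (obj I n))\<rparr>"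

text \<open>\<open>(\<gamma>\<^sub>Z I)\<^sub>x\<close> for \<open>Z\<close> the closure of \<open>\<eta>\<close>.\<close>

abbreviation supp_stalk_complex ::
  "'x topology \<Rightarrow> ('x, 'c) sheaf_complex \<Rightarrow> 'x \<Rightarrow> 'x \<Rightarrow> ('x set \<times> 'c) set cochain_complex" where
  "supp_stalk_complex X I \<eta> x \<equiv> stalk_complex X (supp_complex (X closure_of {\<eta>}) I) x"

text \<open>\<open>H\<^sup>p\<^sub>\<eta>(X, F)\<close>: stalks are exact, so the stalk at \<open>\<eta>\<close> of the \<open>p\<close>-th cohomology sheaf of
  \<open>\<gamma>\<^sub>Z I\<close> is the \<open>p\<close>-th cohomology of the stalk.\<close>

definition local_cohomology ::
  "'x topology \<Rightarrow> ('x, 'c) sheaf_complex \<Rightarrow> nat \<Rightarrow> 'x \<Rightarrow> ('x set \<times> 'c) set set monoid" where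
  "local_cohomology X I p \<eta> = cohomology (supp_stalk_complex X I \<eta> \<eta>) p"

text \<open>For \<open>\<xi>\<close> a point of the closure of \<open>\<eta>\<close>, of codimension one in it,
  \<open>X\<^sub>\<xi> = Spec \<O>\<^sub>X\<^sub>,\<^sub>\<xi>\<close> and \<open>Y\<close> the closure of \<open>\<eta>\<close> in \<open>X\<^sub>\<xi>\<close>, one has \<open>Y = {\<eta>, \<xi>}\<close>.  Hence, for the
  pullback of \<open>I\<close> to \<open>X\<^sub>\<xi>\<close>, the exact sequence
  \<open>0 \<rightarrow> \<Gamma>\<^sub>{\<^sub>\<xi>\<^sub>}(X\<^sub>\<xi>, I) \<rightarrow> \<Gamma>\<^sub>Y(X\<^sub>\<xi>, I) \<rightarrow> \<Gamma>\<^bsub>Y - {\<xi>}\<^esub>(X\<^sub>\<xi> - {\<xi>}, I) \<rightarrow> 0\<close>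
  consists of the stalks at \<open>\<xi>\<close>, \<open>\<xi>\<close>, \<open>\<eta>\<close> of the sheaves of sections of \<open>I\<close> supported on
  the closures of \<open>\<xi>\<close>, \<open>\<eta>\<close>, \<open>\<eta>\<close>, with the inclusion and the cospecialization map.  The
  natural map \<open>\<nu>\<^sub>\<eta>\<^sub>\<xi>\<close> is its connecting homomorphism.\<close>

definition nu ::
  "'x topology \<Rightarrow> ('x, 'c) sheaf_complex \<Rightarrow> nat \<Rightarrow> 'x \<Rightarrow> 'x \<Rightarrow>
     ('x set \<times> 'c) set set \<Rightarrow> ('x set \<times> 'c) set set" where
  "nu X I p \<eta> \<xi> = connecting_hom
     (supp_stalk_complex X I \<xi> \<xi>) (supp_stalk_complex X I \<eta> \<xi>) (supp_stalk_complex X I \<eta> \<eta>)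
     (\<lambda>n. stalk_map X (with_support (X closure_of {\<eta>}) (obj I n)) \<xi> (\<lambda>U s. s))
     (\<lambda>n. stalk_map X (with_support (X closure_of {\<eta>}) (obj I n)) \<eta> (\<lambda>U s. s)) p"

text \<open>The identification \<open>F\<^sub>\<eta> = H\<^sup>0\<^sub>\<eta>(X, F)\<close> at a point \<open>\<eta>\<close> of codimension \<open>0\<close>: the closure of \<open>\<eta>\<close> is
  a neighbourhood of \<open>\<eta>\<close>, so every germ has a representative \<open>s\<close> supported on it.\<close>

definition stalk_to_H0 ::
  "'x topology \<Rightarrow> ('x, 'c) sheaf_complex \<Rightarrow> ('x set \<Rightarrow> 'b \<Rightarrow> 'c) \<Rightarrow> 'x \<Rightarrow>
     ('x set \<times> 'b) set \<Rightarrow> ('x set \<times> 'c) set set" where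
  "stalk_to_H0 X I \<epsilon> \<eta> A = (THE h. \<exists>V s. (V, s) \<in> A \<and> V \<subseteq> X closure_of {\<eta>} \<and>
     h = cohomology_class (supp_stalk_complex X I \<eta> \<eta>) 0
       (germ X (with_support (X closure_of {\<eta>}) (obj I 0)) \<eta> V (\<epsilon> V s)))"

text \<open>A section over \<open>U\<close> of the constant sheaf on the closure of \<open>\<eta>\<close>, pushed forward to \<open>X\<close>, is a
  locally constant function on the part of the closure in \<open>U\<close>.  On a Noetherian space the direct sum
  of sheaves is formed sectionwise.\<close>

definition cousin_sections ::
  "'x topology \<Rightarrow> ('x, 'c) sheaf_complex \<Rightarrow> nat \<Rightarrow> 'x set \<Rightarrow>
     ('x \<Rightarrow> 'x \<Rightarrow> ('x set \<times> 'c) set set) monoid" where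
  "cousin_sections X I p U =
     \<lparr>carrier = {f \<in> (\<Pi>\<^sub>E \<eta>\<in>points_codim X p. \<Pi>\<^sub>E y\<in>U \<inter> X closure_of {\<eta>}.
          carrier (local_cohomology X I p \<eta>)).
        (\<forall>\<eta>\<in>points_codim X p. continuous_map (subtopology X (U \<inter> X closure_of {\<eta>}))
          (discrete_topology (carrier (local_cohomology X I p \<eta>))) (f \<eta>)) \<and>
        finite {\<eta>\<in>points_codim X p.
          \<exists>y\<in>U \<inter> X closure_of {\<eta>}. f \<eta> y \<noteq> \<one>\<^bsub>local_cohomology X I p \<eta>\<^esub>}},
      mult = (\<lambda>f g. \<lambda>\<eta>\<in>points_codim X p. \<lambda>y\<in>U \<inter> X closure_of {\<eta>}.
        f \<eta> y \<otimes>\<^bsub>local_cohomology X I p \<eta>\<^esub> g \<eta> y),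
      one = (\<lambda>\<eta>\<in>points_codim X p. \<lambda>y\<in>U \<inter> X closure_of {\<eta>}. \<one>\<^bsub>local_cohomology X I p \<eta>\<^esub>)\<rparr>"

text \<open>In the differential the product is restricted to the nontrivial components because
  \<open>finprod\<close> is only meaningful over finite sets.\<close>

definition cousin_complex ::
  "'x topology \<Rightarrow> ('x, 'c) sheaf_complex \<Rightarrow> ('x, 'x \<Rightarrow> 'x \<Rightarrow> ('x set \<times> 'c) set set) sheaf_complex" where
  "cousin_complex X I =
     \<lparr>obj = (\<lambda>p. \<lparr>sections = cousin_sections X I p,
        restr = (\<lambda>U V f. \<lambda>\<eta>\<in>points_codim X p. restrict (f \<eta>) (V \<inter> X closure_of {\<eta>}))\<rparr>),
      diff = (\<lambda>p U f. \<lambda>\<xi>\<in>points_codim X (Suc p). \<lambda>y\<in>U \<inter> X closure_of {\<xi>}.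
        finprod (local_cohomology X I (Suc p) \<xi>) (\<lambda>\<eta>. nu X I p \<eta> \<xi> (f \<eta> y))
          {\<eta>\<in>points_codim X p. \<xi> \<in> X closure_of {\<eta>} \<and> f \<eta> y \<noteq> \<one>\<^bsub>local_cohomology X I p \<eta>\<^esub>})\<rparr>"

definition cousin_aug ::
  "'x topology \<Rightarrow> ('x, 'b) ab_presheaf \<Rightarrow> ('x, 'c) sheaf_complex \<Rightarrow> ('x set \<Rightarrow> 'b \<Rightarrow> 'c) \<Rightarrow>
     'x set \<Rightarrow> 'b \<Rightarrow> ('x \<Rightarrow> 'x \<Rightarrow> ('x set \<times> 'c) set set)" where
  "cousin_aug X F I \<epsilon> U s = (\<lambda>\<eta>\<in>points_codim X 0. \<lambda>y\<in>U \<inter> X closure_of {\<eta>}.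
     stalk_to_H0 X I \<epsilon> \<eta> (germ X F \<eta> U s))"

definition cohen_macaulay ::
  "'x topology \<Rightarrow> ('x, 'b) ab_presheaf \<Rightarrow> ('x, 'c) sheaf_complex \<Rightarrow> ('x set \<Rightarrow> 'b \<Rightarrow> 'c) \<Rightarrow> bool" where
  "cohen_macaulay X F I \<epsilon> \<longleftrightarrow> quasi_iso X (in_degree_0 F) (cousin_complex X I)
     (from_degree_0 (cousin_complex X I) (cousin_aug X F I \<epsilon>))"


section \<open>Adelic groups\<close>

text \<open>Everything is defined over an open \<open>U\<close>, which gives \<open>A'(U, F|\<^sub>U)\<close>.  Codimensions, stalks,
  local cohomology and the maps \<open>\<nu>\<close> at points of \<open>U\<close> are the same in \<open>U\<close> and in \<open>X\<close>, so only the
  flags have to be restricted to \<open>U\<close>.\<close>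

definition flags :: "'x topology \<Rightarrow> 'x set \<Rightarrow> nat list \<Rightarrow> 'x list set" where
  "flags X U is = {\<eta>s. length \<eta>s = length is \<and> set \<eta>s \<subseteq> U \<and>
     (\<forall>j<length is. \<eta>s ! j \<in> points_codim X (is ! j)) \<and>
     (\<forall>j. Suc j < length is \<longrightarrow> \<eta>s ! Suc j \<in> X closure_of {\<eta>s ! j})}"

definition depth :: "nat list \<Rightarrow> int" where
  "depth is = (if hd is = 0
     then int (GREATEST l. l < length is \<and> take (Suc l) is = [0..<Suc l]) else - 1)"

definition adele_C :: "'x topology \<Rightarrow> ('x, 'b) ab_presheaf \<Rightarrow> 'x set \<Rightarrow> nat list \<Rightarrow>
     ('x list \<Rightarrow> ('x set \<times> 'b) set) set" where
  "adele_C X F U is = (\<Pi>\<^sub>E \<eta>s\<in>flags X U is. carrier (stalk X F (hd \<eta>s)))"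

text \<open>\<open>nu_comp X I p [\<eta>\<^sub>p, \<dots>, \<eta>\<^sub>m]\<close> is the composite of the \<open>\<nu>\<close> from \<open>H\<^sup>p\<close> at \<open>\<eta>\<^sub>p\<close> to
  \<open>H\<^sup>m\<close> at \<open>\<eta>\<^sub>m\<close>.\<close>

fun nu_comp :: "'x topology \<Rightarrow> ('x, 'c) sheaf_complex \<Rightarrow> nat \<Rightarrow> 'x list \<Rightarrow>
     ('x set \<times> 'c) set set \<Rightarrow> ('x set \<times> 'c) set set" where
  "nu_comp X I p (\<eta> # \<xi> # \<eta>s) h = nu_comp X I (Suc p) (\<xi> # \<eta>s) (nu X I p \<eta> \<xi> h)"
| "nu_comp X I p \<eta>s h = h"

definition adele_A :: "'x topology \<Rightarrow> ('x, 'b) ab_presheaf \<Rightarrow> ('x, 'c) sheaf_complex \<Rightarrow>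
     ('x set \<Rightarrow> 'b \<Rightarrow> 'c) \<Rightarrow> 'x set \<Rightarrow> nat list \<Rightarrow> ('x list \<Rightarrow> ('x set \<times> 'b) set) set" where
  "adele_A X F I \<epsilon> U is = {f \<in> adele_C X F U is.
     \<forall>m. int m \<le> depth is \<longrightarrow> (\<forall>\<tau>\<in>flags X U (drop (Suc m) is).
       finite {\<sigma>\<in>flags X U [0..<Suc m]. \<sigma> @ \<tau> \<in> flags X U is \<and>
         nu_comp X I 0 \<sigma> (stalk_to_H0 X I \<epsilon> (hd \<sigma>) (f (\<sigma> @ \<tau>)))
           \<noteq> \<one>\<^bsub>local_cohomology X I m (last \<sigma>)\<^esub>})}"

definition flag_types :: "nat \<Rightarrow> nat \<Rightarrow> nat list set" where
  "flag_types d p = {is. length is = Suc p \<and> sorted_wrt (<) is \<and> set is \<subseteq> {..d}}"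

definition all_flags :: "'x topology \<Rightarrow> 'x set \<Rightarrow> nat \<Rightarrow> nat \<Rightarrow> 'x list set" where
  "all_flags X U d p = (\<Union>is\<in>flag_types d p. flags X U is)"

text \<open>A flag has only one type, so an element of the product over all types is a single family
  indexed by all flags.\<close>

definition adele_sections :: "'x topology \<Rightarrow> ('x, 'b) ab_presheaf \<Rightarrow> ('x, 'c) sheaf_complex \<Rightarrow>
     ('x set \<Rightarrow> 'b \<Rightarrow> 'c) \<Rightarrow> nat \<Rightarrow> nat \<Rightarrow> 'x set \<Rightarrow> ('x list \<Rightarrow> ('x set \<times> 'b) set) monoid" where
  "adele_sections X F I \<epsilon> d p U =
     \<lparr>carrier = {f \<in> extensional (all_flags X U d p).
        \<forall>is\<in>flag_types d p. restrict f (flags X U is) \<in> adele_A X F I \<epsilon> U is},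
      mult = (\<lambda>f g. \<lambda>\<eta>s\<in>all_flags X U d p. f \<eta>s \<otimes>\<^bsub>stalk X F (hd \<eta>s)\<^esub> g \<eta>s),
      one = (\<lambda>\<eta>s\<in>all_flags X U d p. \<one>\<^bsub>stalk X F (hd \<eta>s)\<^esub>)\<rparr>"

definition omit :: "nat \<Rightarrow> 'x list \<Rightarrow> 'x list" where
  "omit i \<eta>s = take i \<eta>s @ drop (Suc i) \<eta>s"

definition adele_diff :: "'x topology \<Rightarrow> ('x, 'b) ab_presheaf \<Rightarrow> nat \<Rightarrow> nat \<Rightarrow> 'x set \<Rightarrow>
     ('x list \<Rightarrow> ('x set \<times> 'b) set) \<Rightarrow> 'x list \<Rightarrow> ('x set \<times> 'b) set" where
  "adele_diff X F d p U f = (\<lambda>\<eta>s\<in>all_flags X U d (Suc p).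
     finprod (stalk X F (hd \<eta>s))
       (\<lambda>i. let a = stalk_map X F (hd \<eta>s) (\<lambda>V s. s) (f (omit i \<eta>s))
            in if even i then a else inv\<^bsub>stalk X F (hd \<eta>s)\<^esub> a)
       {..Suc p})"

text \<open>The formula for the differential need not map \<open>A'\<^sup>p\<close> into \<open>A'\<^sup>p\<^sup>+\<^sup>1\<close> once \<open>d \<ge> 2\<close>: type
  \<open>(0,2)\<close> has depth \<open>0\<close>, hence essentially no finiteness condition, whereas \<open>(0,1,2)\<close> has
  depth \<open>2\<close>.  The definition of \<open>coboundaries\<close> therefore takes those elements of the group in
  degree \<open>n\<close> that are values of the differential; for an honest complex this is the usual image.\<close>

definition adelic_complex :: "'x topology \<Rightarrow> ('x, 'b) ab_presheaf \<Rightarrow> ('x, 'c) sheaf_complex \<Rightarrow>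
     ('x set \<Rightarrow> 'b \<Rightarrow> 'c) \<Rightarrow> nat \<Rightarrow> ('x, 'x list \<Rightarrow> ('x set \<times> 'b) set) sheaf_complex" where
  "adelic_complex X F I \<epsilon> d =
     \<lparr>obj = (\<lambda>p. \<lparr>sections = adele_sections X F I \<epsilon> d p,
        restr = (\<lambda>U V f. restrict f (all_flags X V d p))\<rparr>),
      diff = adele_diff X F d\<rparr>"

definition adelic_aug :: "'x topology \<Rightarrow> ('x, 'b) ab_presheaf \<Rightarrow> nat \<Rightarrow> 'x set \<Rightarrow> 'b \<Rightarrow>
     'x list \<Rightarrow> ('x set \<times> 'b) set" where
  "adelic_aug X F d U s = (\<lambda>\<eta>s\<in>all_flags X U d 0. germ X F (hd \<eta>s) U s)"

end

theory Submission imports Defs begin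

text \<open>The proof reduces the theorem to the exactness of the Cousin complex.  On the stalk at a point \<open>x\<close> the
  Cohen--Macaulay hypothesis says that the finitely supported families of elements of the groups
  \<open>H\<^sup>p\<close> at the points of codimension \<open>p\<close> that specialize to \<open>x\<close> form an exact complex, with the differential
  \<open>D\<close> given by the maps \<open>\<nu>\<close>, and that the stalk of \<open>F\<close> at \<open>x\<close> is the kernel of its first differential
  (\<open>exact_stalk\<close>, \<open>stalk_inj\<close>, \<open>stalk_surj\<close>).  In particular the stalk embeds in the product of the stalks at
  the points of codimension \<open>0\<close>.

  An adelic cocycle \<open>f\<close> therefore amounts to the elements \<open>f (\<eta> # xs)\<close> for \<open>\<eta>\<close> of codimension \<open>0\<close>: by the cocycle
  condition their alternating sum over the faces of \<open>xs\<close> is the image of \<open>f xs\<close>, hence in the kernel of \<open>D\<close>, as a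
  family in \<open>\<eta>\<close>.  Applying \<open>-D\<close> to the family \<open>f (\<eta> # \<xi> # xs)\<close> in \<open>\<eta>\<close> gives, for each flag \<open>\<xi> # xs\<close> with \<open>\<xi>\<close> of
  codimension \<open>1\<close>, an element of \<open>H\<^sup>1\<close> at \<open>\<xi>\<close>, and these residues satisfy the analogous condition one level
  higher because \<open>D \<circ> D\<close> is trivial (\<open>datum_res\<close>).  The finiteness conditions in the definition of the adelic groups
  are inherited by the residues.  After as many steps as the degree nothing remains to be solved.  From there a
  solution is lifted back level by level (\<open>lift_solution\<close>): exactness of the Cousin complex supplies preimages under
  \<open>D\<close>, separately for each flag, and choosing trivial preimages of trivial elements preserves the finiteness
  conditions.  At level \<open>0\<close> the result is a family \<open>g\<close> near \<open>x\<close> with \<open>dg = f\<close> (\<open>adelic_exact\<close>).  Only for the empty flag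
  is a preimage needed on a whole neighbourhood and not just at a point; there the neighbourhood is shrunk
  (\<open>exact_nbhd\<close>).

  The differential need not map adelic families to adelic families.  The argument shows that each cocycle is the
  value of the differential at an adelic family; since the coboundaries form a subgroup, the cohomology in positive
  degrees is trivial (\<open>quasi_iso_degree_0I\<close>).

  The properties of \<open>\<nu>\<close> that make \<open>D\<close> the differential of a complex of finitely supported families, \<open>D \<circ> D = 0\<close> and
  finiteness, are proved for representatives.  Injective sheaves are flasque (\<open>injective_flasque\<close>), so local
  cohomology classes are represented by global sections with support in the closure of a point, and \<open>\<nu>\<close> by the
  differential of such a section (\<open>nu_cls\<close>, \<open>nu_nu\<close>).  Of the scheme only the underlying space enters: each closed set
  is the closure of a finite set, and points are determined by their closures (\<open>noetherian_scheme_sober\<close>).\<close>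


section \<open>Abelian groups\<close>

lemma subgroup_commI:
  assumes "comm_group G" "H \<subseteq> carrier G" "\<one>\<^bsub>G\<^esub> \<in> H"
    "\<And>a b. a \<in> H \<Longrightarrow> b \<in> H \<Longrightarrow> a \<otimes>\<^bsub>G\<^esub> b \<in> H" "\<And>a. a \<in> H \<Longrightarrow> inv\<^bsub>G\<^esub> a \<in> H"
  shows "subgroup H G"
  using assms by (intro subgroup.intro) auto

lemma comm_subgroup:
  assumes "comm_group G" "subgroup H G"
  shows "comm_group (G\<lparr>carrier := H\<rparr>)"
proof -
  interpret comm_group G by fact
  interpret S: group "G\<lparr>carrier := H\<rparr>" using assms(2) by (rule subgroup_imp_group)
  show ?thesis
    using subgroup.mem_carrier[OF assms(2)] by (intro S.group_comm_groupI) (simp add: m_comm)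
qed

lemma hom_inv_comm:
  assumes "comm_group G" "comm_group H" "h \<in> hom G H" "x \<in> carrier G"
  shows "h (inv\<^bsub>G\<^esub> x) = inv\<^bsub>H\<^esub> h x"
  by (rule group_hom.hom_inv) (use assms in \<open>auto simp: group_hom_def group_hom_axioms_def comm_group_def\<close>)

lemma hom_one_comm:
  assumes "comm_group G" "comm_group H" "h \<in> hom G H"
  shows "h \<one>\<^bsub>G\<^esub> = \<one>\<^bsub>H\<^esub>"
  by (rule group_hom.hom_one) (use assms in \<open>auto simp: group_hom_def group_hom_axioms_def comm_group_def\<close>)

lemma hom_finprod_comm:
  assumes G: "comm_group G" and H: "comm_group H" and h: "h \<in> hom G H" and f: "f \<in> A \<rightarrow> carrier G"
  shows "h (finprod G f A) = finprod H (\<lambda>x. h (f x)) A"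
proof -
  interpret G: comm_group G by fact
  interpret H: comm_group H by fact
  show ?thesis using f
  proof (induction A rule: infinite_finite_induct)
    case (infinite A) then show ?case by (simp add: hom_one_comm[OF G H h])
  next
    case empty then show ?case by (simp add: hom_one_comm[OF G H h])
  next
    case (insert a A)
    have "h (f x) \<in> carrier H" if "x \<in> insert a A" for x using insert.prems h that by (auto simp: hom_def Pi_iff)
    moreover have "h (f a \<otimes>\<^bsub>G\<^esub> finprod G f A) = h (f a) \<otimes>\<^bsub>H\<^esub> h (finprod G f A)"
      using h insert.prems by (intro hom_mult[OF h]) (auto intro!: G.finprod_closed)
    ultimately show ?case using insert by (simp add: Pi_iff)
  qed
qed

lemma div_one_iff:
  assumes "comm_group G" "a \<in> carrier G" "b \<in> carrier G"
  shows "a \<otimes>\<^bsub>G\<^esub> inv\<^bsub>G\<^esub> b = \<one>\<^bsub>G\<^esub> \<longleftrightarrow> a = b"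
proof -
  interpret comm_group G by fact
  show ?thesis
  proof
    assume "a \<otimes>\<^bsub>G\<^esub> inv\<^bsub>G\<^esub> b = \<one>\<^bsub>G\<^esub>"
    then have "a \<otimes>\<^bsub>G\<^esub> inv\<^bsub>G\<^esub> b \<otimes>\<^bsub>G\<^esub> b = b" using assms by simp
    then show "a = b" using assms by (simp add: m_assoc)
  qed (use assms in simp)
qed

lemma subgroup_coset_self:
  assumes "comm_group G" "subgroup H G" "z \<in> H"
  shows "H #>\<^bsub>G\<^esub> z = H"
proof -
  interpret comm_group G by fact
  show ?thesis by (rule coset_join2[OF subgroup.mem_carrier[OF assms(2,3)] assms(2,3)])
qed

section \<open>Presheaves of abelian groups and their stalks\<close>

locale group_presheaf =
  fixes X :: "'x topology" and G :: "('x, 'b) ab_presheaf"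
  assumes comm: "openin X U \<Longrightarrow> comm_group (sections G U)"
    and restr_hom: "openin X U \<Longrightarrow> openin X V \<Longrightarrow> V \<subseteq> U \<Longrightarrow>
      restr G U V \<in> hom (sections G U) (sections G V)"
    and restr_id: "openin X U \<Longrightarrow> s \<in> carrier (sections G U) \<Longrightarrow> restr G U U s = s"
    and restr_comp: "openin X U \<Longrightarrow> openin X V \<Longrightarrow> openin X W \<Longrightarrow> V \<subseteq> U \<Longrightarrow> W \<subseteq> V \<Longrightarrow>
      s \<in> carrier (sections G U) \<Longrightarrow> restr G V W (restr G U V s) = restr G U W s"

lemma group_presheaf_of_ab_sheaf:
  assumes "ab_sheaf X G"
  shows "group_presheaf X G"
proof (rule group_presheaf.intro)
  have p: "is_presheaf X G" using assms by (simp add: ab_sheaf_def)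
  show "comm_group (sections G U)" if "openin X U" for U
    using assms that by (simp add: ab_sheaf_def)
  show "restr G U V \<in> hom (sections G U) (sections G V)"
    if "openin X U" "openin X V" "V \<subseteq> U" for U V
    using assms that by (simp add: ab_sheaf_def)
  show "restr G U U s = s" if "openin X U" "s \<in> carrier (sections G U)" for U s
    using p that by (simp add: is_presheaf_def)
  show "restr G V W (restr G U V s) = restr G U W s"
    if "openin X U" "openin X V" "openin X W" "V \<subseteq> U" "W \<subseteq> V" "s \<in> carrier (sections G U)" for U V W s
    using p that by (simp add: is_presheaf_def)
qed

context group_presheaf
begin

abbreviation sec :: "'x set \<Rightarrow> 'b set" where "sec U \<equiv> carrier (sections G U)"

lemma restr_carrier:
  "openin X U \<Longrightarrow> openin X V \<Longrightarrow> V \<subseteq> U \<Longrightarrow> s \<in> sec U \<Longrightarrow> restr G U V s \<in> sec V"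
  using restr_hom by (auto simp: hom_def)

lemma restr_mult:
  "openin X U \<Longrightarrow> openin X V \<Longrightarrow> V \<subseteq> U \<Longrightarrow> s \<in> sec U \<Longrightarrow> t \<in> sec U \<Longrightarrow>
    restr G U V (s \<otimes>\<^bsub>sections G U\<^esub> t) = restr G U V s \<otimes>\<^bsub>sections G V\<^esub> restr G U V t"
  using restr_hom by (auto simp: hom_def)

lemma restr_one:
  "openin X U \<Longrightarrow> openin X V \<Longrightarrow> V \<subseteq> U \<Longrightarrow> restr G U V \<one>\<^bsub>sections G U\<^esub> = \<one>\<^bsub>sections G V\<^esub>"
  by (rule hom_one_comm[OF comm comm restr_hom])

lemma restr_inv:
  "openin X U \<Longrightarrow> openin X V \<Longrightarrow> V \<subseteq> U \<Longrightarrow> s \<in> sec U \<Longrightarrow>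
    restr G U V (inv\<^bsub>sections G U\<^esub> s) = inv\<^bsub>sections G V\<^esub> restr G U V s"
  by (rule hom_inv_comm[OF comm comm restr_hom])

lemma one_sec: "openin X U \<Longrightarrow> \<one>\<^bsub>sections G U\<^esub> \<in> sec U"
  by (rule monoid.one_closed[OF group.is_monoid[OF comm_group.axioms(2)[OF comm]]])

lemma mult_sec: "openin X U \<Longrightarrow> s \<in> sec U \<Longrightarrow> t \<in> sec U \<Longrightarrow> s \<otimes>\<^bsub>sections G U\<^esub> t \<in> sec U"
  by (rule monoid.m_closed[OF group.is_monoid[OF comm_group.axioms(2)[OF comm]]])

lemma germ_self:
  "openin X U \<Longrightarrow> x \<in> U \<Longrightarrow> s \<in> sec U \<Longrightarrow> (U, s) \<in> germ X G x U s"
  unfolding germ_def by auto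

lemma germ_eqI:
  assumes "openin X U" "openin X V" "openin X W" "x \<in> W" "W \<subseteq> U \<inter> V" "s \<in> sec U" "t \<in> sec V"
    "restr G U W s = restr G V W t"
  shows "germ X G x U s = germ X G x V t"
proof -
  have *: "germ X G x U s \<subseteq> germ X G x V t"
    if a: "openin X U" "openin X V" "W \<subseteq> U \<inter> V" "s \<in> sec U" "t \<in> sec V"
      "restr G U W s = restr G V W t" for U V s t
  proof
    fix A assume "A \<in> germ X G x U s"
    then obtain V' t' W' where A: "A = (V', t')" "openin X V'" "x \<in> V'" "t' \<in> sec V'"
      "openin X W'" "x \<in> W'" "W' \<subseteq> U \<inter> V'" "restr G U W' s = restr G V' W' t'"
      unfolding germ_def by auto
    have o: "openin X (W \<inter> W')" using A assms by blast
    have "restr G V (W \<inter> W') t = restr G W (W \<inter> W') (restr G V W t)"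
      using restr_comp[of V W "W \<inter> W'" t] a assms(3) o by auto
    also have "\<dots> = restr G U (W \<inter> W') s"
      using restr_comp[of U W "W \<inter> W'" s] a assms(3) o by auto
    also have "\<dots> = restr G W' (W \<inter> W') (restr G U W' s)"
      using restr_comp[of U W' "W \<inter> W'" s] a A o by auto
    also have "\<dots> = restr G V' (W \<inter> W') t'"
      using restr_comp[of V' W' "W \<inter> W'" t'] A o by auto
    finally show "A \<in> germ X G x V t"
      unfolding germ_def using A a assms(3,4) o by (auto intro!: exI[of _ "W \<inter> W'"])
  qed
  show ?thesis using *[of U V s t] *[of V U t s] assms by auto
qed

lemma germ_eq_iff:
  assumes "openin X U" "openin X V" "x \<in> U" "s \<in> sec U" "t \<in> sec V"
  shows "germ X G x U s = germ X G x V t \<longleftrightarrow>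
    (\<exists>W. openin X W \<and> x \<in> W \<and> W \<subseteq> U \<inter> V \<and> restr G U W s = restr G V W t)" (is "?l \<longleftrightarrow> ?r")
proof
  assume ?l
  then have "(U, s) \<in> germ X G x V t" using germ_self assms by metis
  then obtain W where "openin X W" "x \<in> W" "W \<subseteq> V \<inter> U" "restr G V W t = restr G U W s"
    unfolding germ_def by auto
  then show ?r by (intro exI[of _ W]) auto
next
  assume ?r then show ?l using germ_eqI assms by blast
qed

lemma germ_restr:
  assumes "openin X U" "openin X W" "x \<in> W" "W \<subseteq> U" "s \<in> sec U"
  shows "germ X G x W (restr G U W s) = germ X G x U s"
  by (rule germ_eqI[of W U W]) (use assms in \<open>auto simp: restr_carrier restr_id\<close>)

lemma stalk_carrier: "carrier (stalk X G x) = {germ X G x U s |U s. openin X U \<and> x \<in> U \<and> s \<in> sec U}"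
  by (simp add: stalk_def)

lemma stalk_obtain:
  assumes "A \<in> carrier (stalk X G x)"
  obtains U s where "openin X U" "x \<in> U" "s \<in> sec U" "A = germ X G x U s"
  using assms by (auto simp: stalk_carrier)

lemma germ_carrier: "openin X U \<Longrightarrow> x \<in> U \<Longrightarrow> s \<in> sec U \<Longrightarrow> germ X G x U s \<in> carrier (stalk X G x)"
  by (auto simp: stalk_carrier)

lemma stalk_obtain2:
  assumes "A \<in> carrier (stalk X G x)" "B \<in> carrier (stalk X G x)"
  obtains U s t where "openin X U" "x \<in> U" "s \<in> sec U" "t \<in> sec U"
    "A = germ X G x U s" "B = germ X G x U t"
proof -
  from assms obtain U s V t where *: "openin X U" "x \<in> U" "s \<in> sec U" "A = germ X G x U s"
    "openin X V" "x \<in> V" "t \<in> sec V" "B = germ X G x V t" by (auto simp: stalk_carrier)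
  then have "openin X (U \<inter> V)" by blast
  then show thesis using * germ_restr[of U "U \<inter> V" x s] germ_restr[of V "U \<inter> V" x t]
    by (intro that[of "U \<inter> V" "restr G U (U \<inter> V) s" "restr G V (U \<inter> V) t"])
      (auto simp: restr_carrier)
qed

lemma stalk_mult_germ:
  assumes "openin X U" "x \<in> U" "s \<in> sec U" "t \<in> sec U"
  shows "germ X G x U s \<otimes>\<^bsub>stalk X G x\<^esub> germ X G x U t = germ X G x U (s \<otimes>\<^bsub>sections G U\<^esub> t)"
proof -
  have *: "germ X G x (U' \<inter> V') (restr G U' (U' \<inter> V') s' \<otimes>\<^bsub>sections G (U' \<inter> V')\<^esub> restr G V' (U' \<inter> V') t')
     = germ X G x U (s \<otimes>\<^bsub>sections G U\<^esub> t)"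
    if s': "(U', s') \<in> germ X G x U s" and t': "(V', t') \<in> germ X G x U t" for U' s' V' t'
  proof -
    obtain W where W: "openin X U'" "s' \<in> sec U'" "openin X W" "x \<in> W" "W \<subseteq> U \<inter> U'"
      "restr G U W s = restr G U' W s'" using s' unfolding germ_def by auto
    obtain W' where W': "openin X V'" "t' \<in> sec V'" "openin X W'" "x \<in> W'" "W' \<subseteq> U \<inter> V'"
      "restr G U W' t = restr G V' W' t'" using t' unfolding germ_def by auto
    let ?W = "W \<inter> W'"
    have o: "openin X (U' \<inter> V')" "openin X ?W" using W W' by auto
    have 1: "restr G U' ?W s' = restr G U ?W s"
      using W o restr_comp[of U W ?W s] restr_comp[of U' W ?W s'] assms by auto
    have 2: "restr G V' ?W t' = restr G U ?W t"
      using W' o restr_comp[of U W' ?W t] restr_comp[of V' W' ?W t'] assms by auto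
    have sub: "?W \<subseteq> U' \<inter> V'" "?W \<subseteq> U" using W W' by auto
    have c: "restr G U' (U' \<inter> V') s' \<in> sec (U' \<inter> V')" "restr G V' (U' \<inter> V') t' \<in> sec (U' \<inter> V')"
      using W W' o by (auto intro!: restr_carrier)
    show ?thesis
    proof (rule germ_eqI[of _ _ ?W])
      have "restr G (U' \<inter> V') ?W (restr G U' (U' \<inter> V') s' \<otimes>\<^bsub>sections G (U' \<inter> V')\<^esub> restr G V' (U' \<inter> V') t')
        = restr G U' ?W s' \<otimes>\<^bsub>sections G ?W\<^esub> restr G V' ?W t'"
        using W W' o sub c by (simp add: restr_mult restr_comp)
      also have "\<dots> = restr G U ?W (s \<otimes>\<^bsub>sections G U\<^esub> t)"
        using 1 2 o sub assms by (simp add: restr_mult)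
      finally show "restr G (U' \<inter> V') ?W (restr G U' (U' \<inter> V') s' \<otimes>\<^bsub>sections G (U' \<inter> V')\<^esub> restr G V' (U' \<inter> V') t')
        = restr G U ?W (s \<otimes>\<^bsub>sections G U\<^esub> t)" .
    qed (use W W' o sub assms c in \<open>auto simp: mult_sec\<close>)
  qed
  have "germ X G x U s \<otimes>\<^bsub>stalk X G x\<^esub> germ X G x U t =
    (\<Union>(U', s')\<in>germ X G x U s. \<Union>(V', t')\<in>germ X G x U t. germ X G x U (s \<otimes>\<^bsub>sections G U\<^esub> t))"
    using * by (simp add: stalk_def split_def cong: SUP_cong)
  also have "\<dots> = germ X G x U (s \<otimes>\<^bsub>sections G U\<^esub> t)"
    using germ_self[OF assms(1,2,3)] germ_self[OF assms(1,2,4)] by auto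
  finally show ?thesis .
qed

lemma stalk_one: "openin X U \<Longrightarrow> x \<in> U \<Longrightarrow> \<one>\<^bsub>stalk X G x\<^esub> = germ X G x U \<one>\<^bsub>sections G U\<^esub>"
proof -
  assume U: "openin X U" "x \<in> U"
  have "U \<subseteq> topspace X" using U openin_subset by auto
  then show ?thesis unfolding stalk_def
    using germ_restr[OF openin_topspace U, of "\<one>\<^bsub>sections G (topspace X)\<^esub>"] U
      restr_one[of "topspace X" U] one_sec by auto
qed

lemma stalk_comm_group:
  assumes "x \<in> topspace X"
  shows "comm_group (stalk X G x)"
proof (rule comm_groupI)
  have oneX: "\<one>\<^bsub>stalk X G x\<^esub> = germ X G x (topspace X) \<one>\<^bsub>sections G (topspace X)\<^esub>"
    using stalk_one assms by blast
  show "\<one>\<^bsub>stalk X G x\<^esub> \<in> carrier (stalk X G x)"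
    unfolding oneX using assms by (auto intro!: germ_carrier one_sec)
  fix A assume A: "A \<in> carrier (stalk X G x)"
  then obtain U s where U: "openin X U" "x \<in> U" "s \<in> sec U" "A = germ X G x U s"
    by (rule stalk_obtain)
  interpret U: comm_group "sections G U" using comm U by simp
  show "\<one>\<^bsub>stalk X G x\<^esub> \<otimes>\<^bsub>stalk X G x\<^esub> A = A"
    using U by (simp add: stalk_one[OF U(1,2)] stalk_mult_germ)
  show "\<exists>B\<in>carrier (stalk X G x). B \<otimes>\<^bsub>stalk X G x\<^esub> A = \<one>\<^bsub>stalk X G x\<^esub>"
    by (rule bexI[of _ "germ X G x U (inv\<^bsub>sections G U\<^esub> s)"])
      (use U in \<open>auto simp: stalk_one[OF U(1,2)] stalk_mult_germ germ_carrier\<close>)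
  fix B assume B: "B \<in> carrier (stalk X G x)"
  obtain V t t' where V: "openin X V" "x \<in> V" "t \<in> sec V" "t' \<in> sec V" "A = germ X G x V t"
    "B = germ X G x V t'" using stalk_obtain2[OF A B] by blast
  interpret V: comm_group "sections G V" using comm V by simp
  show "A \<otimes>\<^bsub>stalk X G x\<^esub> B \<in> carrier (stalk X G x)"
    using V by (simp add: stalk_mult_germ germ_carrier)
  show "A \<otimes>\<^bsub>stalk X G x\<^esub> B = B \<otimes>\<^bsub>stalk X G x\<^esub> A"
    using V by (simp add: stalk_mult_germ V.m_comm)
  fix C assume C: "C \<in> carrier (stalk X G x)"
  obtain W w where W: "openin X W" "x \<in> W" "w \<in> sec W" "C = germ X G x W w"
    using C by (rule stalk_obtain)
  let ?Z = "V \<inter> W"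
  have o: "openin X ?Z" "x \<in> ?Z" using V W by auto
  interpret Z: comm_group "sections G ?Z" using comm o by simp
  have e: "A = germ X G x ?Z (restr G V ?Z t)" "B = germ X G x ?Z (restr G V ?Z t')"
    "C = germ X G x ?Z (restr G W ?Z w)"
    using V W o germ_restr by auto
  have "restr G V ?Z t \<in> sec ?Z" "restr G V ?Z t' \<in> sec ?Z" "restr G W ?Z w \<in> sec ?Z"
    using V W o by (auto intro!: restr_carrier)
  then show "A \<otimes>\<^bsub>stalk X G x\<^esub> B \<otimes>\<^bsub>stalk X G x\<^esub> C = A \<otimes>\<^bsub>stalk X G x\<^esub> (B \<otimes>\<^bsub>stalk X G x\<^esub> C)"
    unfolding e using o by (simp add: stalk_mult_germ Z.m_assoc)
qed

lemma stalk_inv_germ: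
  assumes "openin X U" "x \<in> U" "s \<in> sec U"
  shows "inv\<^bsub>stalk X G x\<^esub> germ X G x U s = germ X G x U (inv\<^bsub>sections G U\<^esub> s)"
proof -
  have x: "x \<in> topspace X" using assms openin_subset by auto
  interpret S: comm_group "stalk X G x" using stalk_comm_group x by simp
  interpret U: comm_group "sections G U" using comm assms by simp
  show ?thesis
    by (rule S.inv_equality) (use assms in \<open>auto simp: stalk_mult_germ stalk_one[OF assms(1,2)] germ_carrier\<close>)
qed

end

text \<open>In the next two lemmas \<open>x\<close> is a generalization of \<open>y\<close>.  Instead of naturality of \<open>\<phi>\<close> only the
  independence of the germ of \<open>\<phi> s\<close> from the representative is required, because the formula for
  the adelic differential may leave the adelic group.\<close>

lemma stalk_map_germ:
  assumes F: "group_presheaf X F"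
    and U: "openin X U" "y \<in> U" "s \<in> carrier (sections F U)"
    and xy: "\<And>W. openin X W \<Longrightarrow> y \<in> W \<Longrightarrow> x \<in> W"
    and rep: "\<And>U W s. openin X U \<Longrightarrow> openin X W \<Longrightarrow> y \<in> W \<Longrightarrow> W \<subseteq> U \<Longrightarrow> s \<in> carrier (sections F U) \<Longrightarrow>
       germ X G x U (\<phi> U s) = germ X G x W (\<phi> W (restr F U W s))"
  shows "stalk_map X G x \<phi> (germ X F y U s) = germ X G x U (\<phi> U s)"
proof -
  interpret F: group_presheaf X F by fact
  have "germ X G x V (\<phi> V t) = germ X G x U (\<phi> U s)" if Vt: "(V, t) \<in> germ X F y U s" for V t
  proof -
    obtain W where W: "openin X V" "t \<in> carrier (sections F V)" "openin X W" "y \<in> W" "W \<subseteq> U \<inter> V"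
      "restr F U W s = restr F V W t" using Vt unfolding germ_def by auto
    have "germ X G x V (\<phi> V t) = germ X G x W (\<phi> W (restr F V W t))"
      by (rule rep) (use W in auto)
    also have "\<dots> = germ X G x U (\<phi> U s)"
      unfolding W(6)[symmetric] by (rule rep[symmetric]) (use W U in auto)
    finally show ?thesis .
  qed
  then have "stalk_map X G x \<phi> (germ X F y U s) = (\<Union>(V, t)\<in>germ X F y U s. germ X G x U (\<phi> U s))"
    by (simp add: stalk_map_def split_def cong: SUP_cong)
  also have "\<dots> = germ X G x U (\<phi> U s)" using F.germ_self U by auto
  finally show ?thesis .
qed

lemma stalk_map_germ_hom:
  assumes F: "group_presheaf X F" and G: "group_presheaf X G" and \<phi>: "sheaf_hom X F G \<phi>"
    and U: "openin X U" "y \<in> U" "s \<in> carrier (sections F U)"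
    and xy: "\<And>W. openin X W \<Longrightarrow> y \<in> W \<Longrightarrow> x \<in> W"
  shows "stalk_map X G x \<phi> (germ X F y U s) = germ X G x U (\<phi> U s)"
proof (rule stalk_map_germ[OF F U xy])
  interpret G: group_presheaf X G by fact
  fix U W s assume a: "openin X U" "openin X W" "y \<in> W" "W \<subseteq> U" "s \<in> carrier (sections F U)"
  have "\<phi> U s \<in> carrier (sections G U)" using \<phi> a by (auto simp: sheaf_hom_def hom_def)
  moreover have "restr G U W (\<phi> U s) = \<phi> W (restr F U W s)" using \<phi> a by (auto simp: sheaf_hom_def)
  ultimately show "germ X G x U (\<phi> U s) = germ X G x W (\<phi> W (restr F U W s))"
    using G.germ_restr[of U W x "\<phi> U s"] a xy[of W] by auto
qed auto

lemma stalk_map_hom: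
  assumes F: "group_presheaf X F" and G: "group_presheaf X G" and \<phi>: "sheaf_hom X F G \<phi>"
    and xy: "\<And>W. openin X W \<Longrightarrow> y \<in> W \<Longrightarrow> x \<in> W"
  shows "stalk_map X G x \<phi> \<in> hom (stalk X F y) (stalk X G x)"
proof -
  interpret F: group_presheaf X F by fact
  interpret G: group_presheaf X G by fact
  have c: "\<phi> U s \<in> G.sec U" if "openin X U" "s \<in> F.sec U" for U s
    using \<phi> that by (auto simp: sheaf_hom_def hom_def)
  show ?thesis
  proof (rule homI)
    fix A assume "A \<in> carrier (stalk X F y)"
    then obtain U s where U: "openin X U" "y \<in> U" "s \<in> F.sec U" "A = germ X F y U s"
      by (rule F.stalk_obtain)
    then show "stalk_map X G x \<phi> A \<in> carrier (stalk X G x)"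
      using stalk_map_germ_hom[OF F G \<phi> U(1,2,3) xy] xy c by (auto intro!: G.germ_carrier)
  next
    fix A B assume "A \<in> carrier (stalk X F y)" "B \<in> carrier (stalk X F y)"
    then obtain U s t where U: "openin X U" "y \<in> U" "s \<in> F.sec U" "t \<in> F.sec U"
      "A = germ X F y U s" "B = germ X F y U t" by (rule F.stalk_obtain2)
    have "\<phi> U (s \<otimes>\<^bsub>sections F U\<^esub> t) = \<phi> U s \<otimes>\<^bsub>sections G U\<^esub> \<phi> U t"
      using \<phi> U by (auto simp: sheaf_hom_def hom_def)
    then show "stalk_map X G x \<phi> (A \<otimes>\<^bsub>stalk X F y\<^esub> B) =
        stalk_map X G x \<phi> A \<otimes>\<^bsub>stalk X G x\<^esub> stalk_map X G x \<phi> B"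
      using U stalk_map_germ_hom[OF F G \<phi> U(1,2) _ xy] xy c
      by (simp add: F.stalk_mult_germ G.stalk_mult_germ F.mult_sec)
  qed
qed

lemma sheaf_hom_id: "group_presheaf X F \<Longrightarrow> sheaf_hom X F F (\<lambda>U s. s)"
  by (auto simp: sheaf_hom_def hom_def)

lemma closure_of_nbhd: "y \<in> X closure_of {x} \<Longrightarrow> openin X W \<Longrightarrow> y \<in> W \<Longrightarrow> x \<in> W"
  by (auto simp: in_closure_of)

section \<open>Cohomology groups\<close>

locale group_complex =
  fixes K :: "'b cochain_complex"
  assumes comm: "comm_group (grp K n)"
    and cobd_hom: "cobd K n \<in> hom (grp K n) (grp K (Suc n))"
    and cobd_cobd: "z \<in> carrier (grp K n) \<Longrightarrow> cobd K (Suc n) (cobd K n z) = \<one>\<^bsub>grp K (Suc (Suc n))\<^esub>"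
begin

lemma cobd_carrier: "z \<in> carrier (grp K n) \<Longrightarrow> cobd K n z \<in> carrier (grp K (Suc n))"
  using cobd_hom by (auto simp: hom_def)

lemma cobd_mult: "z \<in> carrier (grp K n) \<Longrightarrow> w \<in> carrier (grp K n) \<Longrightarrow>
    cobd K n (z \<otimes>\<^bsub>grp K n\<^esub> w) = cobd K n z \<otimes>\<^bsub>grp K (Suc n)\<^esub> cobd K n w"
  using cobd_hom by (auto simp: hom_def)

lemma cocycles_subgroup: "subgroup (cocycles K n) (grp K n)"
proof -
  interpret A: comm_group "grp K n" by (rule comm)
  interpret B: comm_group "grp K (Suc n)" by (rule comm)
  show ?thesis
    by (rule subgroup_commI[OF comm])
      (auto simp: cocycles_def cobd_mult hom_one_comm[OF comm comm cobd_hom]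
        hom_inv_comm[OF comm comm cobd_hom])
qed

lemma coboundaries_subgroup: "subgroup (coboundaries K n) (grp K n)"
proof -
  interpret A: comm_group "grp K n" by (rule comm)
  show ?thesis
  proof (cases n)
    case 0
    have "coboundaries K n = {\<one>\<^bsub>grp K n\<^esub>}"
      using 0 A.one_closed by (auto simp: coboundaries_def)
    then show ?thesis by (simp add: A.triv_subgroup)
  next
    case (Suc m)
    interpret B: comm_group "grp K m" by (rule comm)
    have "coboundaries K n = cobd K m ` carrier (grp K m)"
      using Suc cobd_carrier by (auto simp: coboundaries_def)
    moreover have "group_hom (grp K m) (grp K n) (cobd K m)"
      using comm cobd_hom[of m] Suc by (auto simp: group_hom_def group_hom_axioms_def comm_group_def)
    ultimately show ?thesis by (simp add: group_hom.img_is_subgroup)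
  qed
qed

lemma coboundaries_cocycles: "coboundaries K n \<subseteq> cocycles K n"
proof (cases n)
  case 0
  have "cobd K 0 \<one>\<^bsub>grp K 0\<^esub> = \<one>\<^bsub>grp K (Suc 0)\<^esub>" by (rule hom_one_comm[OF comm comm cobd_hom])
  then show ?thesis using 0 by (auto simp: coboundaries_def cocycles_def)
next
  case (Suc m)
  then show ?thesis using cobd_cobd[of _ m] cobd_carrier by (auto simp: coboundaries_def cocycles_def)
qed

abbreviation Zgrp :: "nat \<Rightarrow> 'b monoid" where "Zgrp n \<equiv> (grp K n)\<lparr>carrier := cocycles K n\<rparr>"

lemma Zgrp_comm: "comm_group (Zgrp n)"
  by (rule comm_subgroup[OF comm cocycles_subgroup])

lemma coboundaries_Zgrp: "subgroup (coboundaries K n) (Zgrp n)"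
proof -
  interpret A: comm_group "grp K n" by (rule comm)
  show ?thesis
    using coboundaries_subgroup cocycles_subgroup coboundaries_cocycles by (rule A.subgroup_incl)
qed

lemma class_eq_rcos: "cohomology_class K n z = coboundaries K n #>\<^bsub>Zgrp n\<^esub> z"
  by (simp add: cohomology_class_def r_coset_def)

lemma cohomology_comm_group: "comm_group (cohomology K n)"
  unfolding cohomology_def
  by (rule comm_group.abelian_FactGroup[OF Zgrp_comm coboundaries_Zgrp])

lemma cohomology_carrier: "carrier (cohomology K n) = cohomology_class K n ` cocycles K n"
  by (auto simp: cohomology_def FactGroup_def RCOSETS_def class_eq_rcos)

lemma class_mult:
  assumes "z \<in> cocycles K n" "w \<in> cocycles K n"
  shows "cohomology_class K n (z \<otimes>\<^bsub>grp K n\<^esub> w) =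
    cohomology_class K n z \<otimes>\<^bsub>cohomology K n\<^esub> cohomology_class K n w"
proof -
  interpret Z: comm_group "Zgrp n" by (rule Zgrp_comm)
  have "coboundaries K n \<lhd> Zgrp n" by (rule Z.subgroup_imp_normal[OF coboundaries_Zgrp])
  from normal.rcos_sum[OF this, of z w] assms show ?thesis
    by (simp add: cohomology_def FactGroup_def class_eq_rcos)
qed

lemma class_eq_iff:
  assumes "z \<in> cocycles K n" "w \<in> cocycles K n"
  shows "cohomology_class K n z = cohomology_class K n w \<longleftrightarrow>
    z \<otimes>\<^bsub>grp K n\<^esub> inv\<^bsub>grp K n\<^esub> w \<in> coboundaries K n"
proof -
  interpret Z: comm_group "Zgrp n" by (rule Zgrp_comm)
  interpret A: comm_group "grp K n" by (rule comm)
  have i: "inv\<^bsub>Zgrp n\<^esub> w = inv\<^bsub>grp K n\<^esub> w"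
    using A.m_inv_consistent[OF cocycles_subgroup assms(2)] .
  have "coboundaries K n #>\<^bsub>Zgrp n\<^esub> z = coboundaries K n #>\<^bsub>Zgrp n\<^esub> w \<longleftrightarrow>
     z \<otimes>\<^bsub>Zgrp n\<^esub> inv\<^bsub>Zgrp n\<^esub> w \<in> coboundaries K n"
  proof
    assume "coboundaries K n #>\<^bsub>Zgrp n\<^esub> z = coboundaries K n #>\<^bsub>Zgrp n\<^esub> w"
    then have "z \<in> coboundaries K n #>\<^bsub>Zgrp n\<^esub> w"
      using Z.rcos_self[OF _ coboundaries_Zgrp, of z] assms by auto
    then show "z \<otimes>\<^bsub>Zgrp n\<^esub> inv\<^bsub>Zgrp n\<^esub> w \<in> coboundaries K n"
      using subgroup.rcos_module_imp[OF coboundaries_Zgrp Z.is_group, of w z] assms by auto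
  next
    assume "z \<otimes>\<^bsub>Zgrp n\<^esub> inv\<^bsub>Zgrp n\<^esub> w \<in> coboundaries K n"
    then have "z \<in> coboundaries K n #>\<^bsub>Zgrp n\<^esub> w"
      using subgroup.rcos_module_rev[OF coboundaries_Zgrp Z.is_group, of w z] assms by auto
    then show "coboundaries K n #>\<^bsub>Zgrp n\<^esub> z = coboundaries K n #>\<^bsub>Zgrp n\<^esub> w"
      using Z.repr_independence[OF _ _ coboundaries_Zgrp] assms by auto
  qed
  then show ?thesis by (simp add: class_eq_rcos i)
qed

lemma class_one: "cohomology_class K n \<one>\<^bsub>grp K n\<^esub> = \<one>\<^bsub>cohomology K n\<^esub>"
proof -
  interpret A: comm_group "grp K n" by (rule comm)
  have "coboundaries K n #>\<^bsub>grp K n\<^esub> \<one>\<^bsub>grp K n\<^esub> = coboundaries K n"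
    by (rule subgroup_coset_self[OF comm coboundaries_subgroup subgroup.one_closed[OF coboundaries_subgroup]])
  then show ?thesis
    unfolding cohomology_def FactGroup_def cohomology_class_def by simp
qed

end

section \<open>Quasi-isomorphisms from a sheaf in degree zero\<close>

lemma class0:
  assumes "comm_group (grp L 0)" "z \<in> carrier (grp L 0)"
  shows "cohomology_class L 0 z = {z}"
proof -
  interpret comm_group "grp L 0" by fact
  have "coboundaries L 0 = {\<one>\<^bsub>grp L 0\<^esub>}" by (auto simp: coboundaries_def)
  then show ?thesis using assms(2) by (simp add: cohomology_class_def r_coset_def)
qed

lemma cohomology_carrier': "carrier (cohomology L n) = cohomology_class L n ` cocycles L n"
  by (auto simp: cohomology_def FactGroup_def RCOSETS_def cohomology_class_def r_coset_def)

lemma cohomology_mult: "A \<otimes>\<^bsub>cohomology L n\<^esub> B = (\<Union>a\<in>A. \<Union>b\<in>B. {a \<otimes>\<^bsub>grp L n\<^esub> b})"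
  by (simp add: cohomology_def FactGroup_def set_mult_def)

lemma in_degree_0_presheaf:
  assumes "group_presheaf X F"
  shows "group_presheaf X (obj (in_degree_0 F) n)"
proof (cases "n = 0")
  case True then show ?thesis using assms by (simp add: in_degree_0_def)
next
  case False
  interpret group_presheaf X F by fact
  have o: "\<one>\<^bsub>sections F U\<^esub> \<otimes>\<^bsub>sections F U\<^esub> \<one>\<^bsub>sections F U\<^esub> = \<one>\<^bsub>sections F U\<^esub>" if "openin X U" for U
    using monoid.l_one[OF group.is_monoid[OF comm_group.axioms(2)[OF comm[OF that]]]] one_sec[OF that] .
  show ?thesis
  proof (rule group_presheaf.intro)
    fix U assume "openin X U"
    then show "comm_group (sections (obj (in_degree_0 F) n) U)"
      using False comm_subgroup[OF comm group.triv_subgroup[OF comm_group.axioms(2)[OF comm]]]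
      by (simp add: in_degree_0_def)
  qed (use False in \<open>simp_all add: in_degree_0_def one_sec restr_one restr_id hom_def o\<close>)
qed

lemma in_degree_0_diff:
  assumes "group_presheaf X F"
  shows "sheaf_hom X (obj (in_degree_0 F) n) (obj (in_degree_0 F) (Suc n)) (diff (in_degree_0 F) n)"
proof -
  interpret group_presheaf X F by fact
  have o: "\<one>\<^bsub>sections F U\<^esub> \<otimes>\<^bsub>sections F U\<^esub> \<one>\<^bsub>sections F U\<^esub> = \<one>\<^bsub>sections F U\<^esub>" if "openin X U" for U
    using monoid.l_one[OF group.is_monoid[OF comm_group.axioms(2)[OF comm[OF that]]]] one_sec[OF that] .
  show ?thesis
    unfolding sheaf_hom_def hom_def in_degree_0_def by (simp add: restr_one one_sec o)
qed

lemma in_degree_0_cobd: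
  assumes F: "group_presheaf X F" and x: "x \<in> topspace X"
    and z: "z \<in> carrier (grp (stalk_complex X (in_degree_0 F) x) n)"
  shows "cobd (stalk_complex X (in_degree_0 F) x) n z =
    \<one>\<^bsub>grp (stalk_complex X (in_degree_0 F) x) (Suc n)\<^esub>"
proof -
  let ?K = "in_degree_0 F"
  interpret A: group_presheaf X "obj ?K n" by (rule in_degree_0_presheaf[OF F])
  interpret B: group_presheaf X "obj ?K (Suc n)" by (rule in_degree_0_presheaf[OF F])
  obtain U s where U: "openin X U" "x \<in> U" "s \<in> A.sec U" "z = germ X (obj ?K n) x U s"
    using A.stalk_obtain[of z x] z by (auto simp: stalk_complex_def)
  have "stalk_map X (obj ?K (Suc n)) x (diff ?K n) z = germ X (obj ?K (Suc n)) x U (diff ?K n U s)"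
    unfolding U(4) using stalk_map_germ_hom[OF in_degree_0_presheaf[OF F] in_degree_0_presheaf[OF F] in_degree_0_diff[OF F] U(1,2,3)] .
  also have "diff ?K n U s = \<one>\<^bsub>sections (obj ?K (Suc n)) U\<^esub>" by (simp add: in_degree_0_def)
  finally show ?thesis using B.stalk_one[OF U(1,2)] by (simp add: stalk_complex_def)
qed

lemma in_degree_0_complex:
  assumes F: "group_presheaf X F" and x: "x \<in> topspace X"
  shows "group_complex (stalk_complex X (in_degree_0 F) x)"
proof -
  let ?K = "stalk_complex X (in_degree_0 F) x"
  have c: "comm_group (grp ?K n)" for n
    using group_presheaf.stalk_comm_group[OF in_degree_0_presheaf[OF F] x]
    by (simp add: stalk_complex_def)
  have h: "cobd ?K n \<in> hom (grp ?K n) (grp ?K (Suc n))" for n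
    using stalk_map_hom[OF in_degree_0_presheaf[OF F] in_degree_0_presheaf[OF F] in_degree_0_diff[OF F]]
    by (simp add: stalk_complex_def)
  show ?thesis
  proof (rule group_complex.intro[OF c h])
    fix z n assume z: "z \<in> carrier (grp ?K n)"
    then have "cobd ?K n z \<in> carrier (grp ?K (Suc n))" using h[of n] by (auto simp: hom_def)
    then show "cobd ?K (Suc n) (cobd ?K n z) = \<one>\<^bsub>grp ?K (Suc (Suc n))\<^esub>"
      by (rule in_degree_0_cobd[OF F x])
  qed
qed

lemma in_degree_0_cohomology_0:
  assumes F: "group_presheaf X F" and x: "x \<in> topspace X"
  shows "carrier (cohomology (stalk_complex X (in_degree_0 F) x) 0) = (\<lambda>z. {z}) ` carrier (stalk X F x)"
proof -
  let ?K = "stalk_complex X (in_degree_0 F) x"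
  interpret group_complex ?K by (rule in_degree_0_complex[OF F x])
  have g: "grp ?K 0 = stalk X F x" by (simp add: stalk_complex_def in_degree_0_def)
  have "cocycles ?K 0 = carrier (grp ?K 0)"
    using in_degree_0_cobd[OF F x] by (auto simp: cocycles_def)
  then show ?thesis using class0[OF comm] by (auto simp: cohomology_carrier g)
qed

lemma in_degree_0_cohomology_pos:
  assumes F: "group_presheaf X F" and x: "x \<in> topspace X" and n: "n > 0"
  shows "carrier (cohomology (stalk_complex X (in_degree_0 F) x) n)
    = {cohomology_class (stalk_complex X (in_degree_0 F) x) n \<one>\<^bsub>grp (stalk_complex X (in_degree_0 F) x) n\<^esub>}"
    "carrier (grp (stalk_complex X (in_degree_0 F) x) n) = {\<one>\<^bsub>grp (stalk_complex X (in_degree_0 F) x) n\<^esub>}"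
proof -
  let ?K = "stalk_complex X (in_degree_0 F) x"
  interpret group_complex ?K by (rule in_degree_0_complex[OF F x])
  interpret A: group_presheaf X "obj (in_degree_0 F) n" by (rule in_degree_0_presheaf[OF F])
  interpret G: comm_group "grp ?K n" by (rule comm)
  have t: "A.sec U = {\<one>\<^bsub>sections (obj (in_degree_0 F) n) U\<^esub>}" for U
    using n by (simp add: in_degree_0_def)
  have "z = \<one>\<^bsub>grp ?K n\<^esub>" if "z \<in> carrier (grp ?K n)" for z
  proof -
    obtain U s where "openin X U" "x \<in> U" "s \<in> A.sec U" "z = germ X (obj (in_degree_0 F) n) x U s"
      using A.stalk_obtain[of z x] \<open>z \<in> carrier (grp ?K n)\<close> by (auto simp: stalk_complex_def)
    then show ?thesis using A.stalk_one[of U x] t[of U] by (simp add: stalk_complex_def)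
  qed
  then show c: "carrier (grp ?K n) = {\<one>\<^bsub>grp ?K n\<^esub>}" by auto
  have "cocycles ?K n = {\<one>\<^bsub>grp ?K n\<^esub>}"
    using subgroup.one_closed[OF cocycles_subgroup, of n] c by (auto simp: cocycles_def)
  then show "carrier (cohomology ?K n) = {cohomology_class ?K n \<one>\<^bsub>grp ?K n\<^esub>}"
    by (simp add: cohomology_carrier)
qed

text \<open>The empty set is the germ of a family that is not a section near \<open>x\<close>.  It cannot be a value of the
  augmentation, because its class is not a class of the complex.\<close>

lemma quasi_iso_degree_0D:
  assumes F: "group_presheaf X F" and L: "\<And>n. group_presheaf X (obj L n)" and x: "x \<in> topspace X"
    and q: "quasi_iso X (in_degree_0 F) L (from_degree_0 L \<epsilon>)"
    and \<psi>: "\<And>z. z \<in> carrier (stalk X F x) \<Longrightarrow>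
      stalk_map X (obj L 0) x \<epsilon> z \<in> carrier (stalk X (obj L 0) x) \<or> stalk_map X (obj L 0) x \<epsilon> z = {}"
  shows "bij_betw (stalk_map X (obj L 0) x \<epsilon>) (carrier (stalk X F x)) (cocycles (stalk_complex X L x) 0)"
    and "stalk_map X (obj L 0) x \<epsilon> \<in> hom (stalk X F x) (stalk X (obj L 0) x)"
proof -
  let ?\<psi> = "stalk_map X (obj L 0) x \<epsilon>" and ?Lx = "stalk_complex X L x"
  let ?K = "stalk_complex X (in_degree_0 F) x"
  have f0: "from_degree_0 L \<epsilon> 0 = \<epsilon>" by (intro ext) (simp add: from_degree_0_def)
  have g: "grp ?Lx 0 = stalk X (obj L 0) x" by (simp add: stalk_complex_def)
  have gK: "grp ?K 0 = stalk X F x" by (simp add: stalk_complex_def in_degree_0_def)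
  have cL: "comm_group (grp ?Lx 0)" using group_presheaf.stalk_comm_group[OF L x] g by simp
  have iso: "cohomology_map ?Lx 0 ?\<psi> \<in> iso (cohomology ?K 0) (cohomology ?Lx 0)"
    using q[unfolded quasi_iso_def, rule_format, OF x, of 0] unfolding f0 .
  have cK: "carrier (cohomology ?K 0) = (\<lambda>z. {z}) ` carrier (stalk X F x)"
    by (rule in_degree_0_cohomology_0[OF F x])
  have coc: "cocycles ?Lx 0 \<subseteq> carrier (grp ?Lx 0)" by (auto simp: cocycles_def)
  have cLc: "carrier (cohomology ?Lx 0) = (\<lambda>z. {z}) ` cocycles ?Lx 0"
    unfolding cohomology_carrier' using class0[OF cL] coc by (intro image_cong) auto
  have homc: "cohomology_map ?Lx 0 ?\<psi> A \<in> carrier (cohomology ?Lx 0)" if "A \<in> carrier (cohomology ?K 0)" for A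
    using iso that by (simp add: iso_def hom_def Pi_iff)
  have homm: "cohomology_map ?Lx 0 ?\<psi> (A \<otimes>\<^bsub>cohomology ?K 0\<^esub> B) =
      cohomology_map ?Lx 0 ?\<psi> A \<otimes>\<^bsub>cohomology ?Lx 0\<^esub> cohomology_map ?Lx 0 ?\<psi> B"
    if "A \<in> carrier (cohomology ?K 0)" "B \<in> carrier (cohomology ?K 0)" for A B
    using iso that by (simp add: iso_def hom_def)
  have m: "cohomology_map ?Lx 0 ?\<psi> {z} = cohomology_class ?Lx 0 (?\<psi> z)" for z
    by (simp add: cohomology_map_def)
  have inL: "?\<psi> z \<in> carrier (grp ?Lx 0)" if z: "z \<in> carrier (stalk X F x)" for z
  proof (rule ccontr)
    have one1: "\<one>\<^bsub>stalk X (obj L 0) x\<^esub> \<in> carrier (stalk X (obj L 0) x)"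
      using monoid.one_closed[OF group.is_monoid[OF comm_group.axioms(2)[OF cL[unfolded g]]]] .
    have cb0: "coboundaries ?Lx 0 = {\<one>\<^bsub>stalk X (obj L 0) x\<^esub>}"
      using one1 by (auto simp: coboundaries_def g)
    assume "?\<psi> z \<notin> carrier (grp ?Lx 0)"
    then have "?\<psi> z = {}" using \<psi>[OF z] unfolding g by blast
    moreover have "cohomology_class ?Lx 0 (?\<psi> z) \<in> (\<lambda>z. {z}) ` cocycles ?Lx 0"
      using homc[of "{z}"] z m[of z] unfolding cK cLc by simp
    ultimately obtain w where w: "w \<in> carrier (stalk X (obj L 0) x)" "cohomology_class ?Lx 0 {} = {w}"
      unfolding g[symmetric] using coc by auto
    have "w = \<one>\<^bsub>stalk X (obj L 0) x\<^esub> \<otimes>\<^bsub>stalk X (obj L 0) x\<^esub> {}"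
      using w(2) one1 by (simp add: cohomology_class_def r_coset_def cb0 g)
    then have "w = {}" by (simp add: stalk_def split_def)
    with w(1) have "{} \<in> carrier (stalk X (obj L 0) x)" by simp
    then obtain U s where "openin X U" "x \<in> U" "s \<in> carrier (sections (obj L 0) U)"
      "{} = germ X (obj L 0) x U s" by (rule group_presheaf.stalk_obtain[OF L])
    then show False using group_presheaf.germ_self[OF L, of U x s 0] by simp
  qed
  have m': "cohomology_map ?Lx 0 ?\<psi> {z} = {?\<psi> z}" if "z \<in> carrier (stalk X F x)" for z
    using m class0[OF cL inL[OF that]] by simp
  have bij: "bij_betw (cohomology_map ?Lx 0 ?\<psi>) ((\<lambda>z. {z}) ` carrier (stalk X F x)) ((\<lambda>z. {z}) ` cocycles ?Lx 0)"
    using iso by (simp add: iso_def cK cLc)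
  show "bij_betw ?\<psi> (carrier (stalk X F x)) (cocycles ?Lx 0)"
    unfolding bij_betw_def
  proof
    show "inj_on ?\<psi> (carrier (stalk X F x))"
    proof (rule inj_onI)
      fix z w assume zw: "z \<in> carrier (stalk X F x)" "w \<in> carrier (stalk X F x)" "?\<psi> z = ?\<psi> w"
      then have "cohomology_map ?Lx 0 ?\<psi> {z} = cohomology_map ?Lx 0 ?\<psi> {w}" using m' by simp
      then have "{z} = {w}" using bij zw(1,2) unfolding bij_betw_def inj_on_def by blast
      then show "z = w" by simp
    qed
    have "(\<lambda>z. {z}) ` (?\<psi> ` carrier (stalk X F x)) = (\<lambda>z. {z}) ` cocycles ?Lx 0"
      using bij m' unfolding bij_betw_def by (simp add: image_image)
    then show "?\<psi> ` carrier (stalk X F x) = cocycles ?Lx 0"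
      by (rule iffD1[OF inj_image_eq_iff, rotated]) (simp add: inj_on_def)
  qed
  show "?\<psi> \<in> hom (stalk X F x) (stalk X (obj L 0) x)"
  proof (rule homI)
    fix z w assume z: "z \<in> carrier (stalk X F x)" and w: "w \<in> carrier (stalk X F x)"
    interpret S: comm_group "stalk X F x" using group_presheaf.stalk_comm_group[OF F x] .
    have "cohomology_map ?Lx 0 ?\<psi> ({z} \<otimes>\<^bsub>cohomology ?K 0\<^esub> {w}) =
      cohomology_map ?Lx 0 ?\<psi> {z} \<otimes>\<^bsub>cohomology ?Lx 0\<^esub> cohomology_map ?Lx 0 ?\<psi> {w}"
      using homm[of "{z}" "{w}"] z w unfolding cK by simp
    then show "?\<psi> (z \<otimes>\<^bsub>stalk X F x\<^esub> w) = ?\<psi> z \<otimes>\<^bsub>stalk X (obj L 0) x\<^esub> ?\<psi> w"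
      using z w by (simp add: m' cohomology_mult g gK)
  qed (use inL g in auto)
qed

text \<open>The cohomology of the target in degree \<open>n\<close> has one element, and the class of \<open>z\<close> contains \<open>z\<close> and equals the class
  of the neutral element, which is the set of coboundaries.\<close>

lemma quasi_iso_exactD:
  assumes F: "group_presheaf X F" and L: "\<And>n. group_presheaf X (obj L n)" and x: "x \<in> topspace X"
    and q: "quasi_iso X (in_degree_0 F) L (from_degree_0 L \<epsilon>)" and n: "n > 0"
    and one: "\<And>n. cobd (stalk_complex X L x) n \<one>\<^bsub>stalk X (obj L n) x\<^esub> = \<one>\<^bsub>stalk X (obj L (Suc n)) x\<^esub>"
  shows "cocycles (stalk_complex X L x) n \<subseteq> coboundaries (stalk_complex X L x) n"
proof
  let ?Lx = "stalk_complex X L x"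
  let ?K = "stalk_complex X (in_degree_0 F) x"
  have g: "grp ?Lx n = stalk X (obj L n) x" for n by (simp add: stalk_complex_def)
  interpret G: comm_group "grp ?Lx n" using group_presheaf.stalk_comm_group[OF L x] g by simp
  have one_in: "\<one>\<^bsub>grp ?Lx m\<^esub> \<in> carrier (grp ?Lx m)" for m
  proof -
    interpret M: comm_group "grp ?Lx m" using group_presheaf.stalk_comm_group[OF L x] g by simp
    show ?thesis by simp
  qed
  fix z assume z: "z \<in> cocycles ?Lx n"
  obtain h where "h \<in> iso (cohomology ?K n) (cohomology ?Lx n)" 
    using q[unfolded quasi_iso_def, rule_format, OF x, of n] by blast
  then have "bij_betw h (carrier (cohomology ?K n)) (carrier (cohomology ?Lx n))" by (simp add: iso_def)
  then have s: "\<exists>c. carrier (cohomology ?Lx n) = {c}"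
    using in_degree_0_cohomology_pos(1)[OF F x n] by (auto simp: bij_betw_def)
  have "\<one>\<^bsub>grp ?Lx n\<^esub> \<in> cocycles ?Lx n" using one_in one[of n] g by (simp add: cocycles_def)
  then have e: "cohomology_class ?Lx n z = cohomology_class ?Lx n \<one>\<^bsub>grp ?Lx n\<^esub>"
    using s z unfolding cohomology_carrier' by blast
  obtain m where m: "n = Suc m" using n by (cases n) auto
  have "\<one>\<^bsub>grp ?Lx n\<^esub> \<in> coboundaries ?Lx n"
    using one_in one[of m] m g by (auto simp: coboundaries_def)
  moreover have zc: "z \<in> carrier (grp ?Lx n)" using z by (auto simp: cocycles_def)
  ultimately have "z \<in> cohomology_class ?Lx n z" unfolding cohomology_class_def r_coset_def
    by (auto intro!: bexI[where x = "\<one>\<^bsub>grp ?Lx n\<^esub>"])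
  then have "z \<in> cohomology_class ?Lx n \<one>\<^bsub>grp ?Lx n\<^esub>" using e by simp
  then obtain b where "b \<in> coboundaries ?Lx n" "z = b \<otimes>\<^bsub>grp ?Lx n\<^esub> \<one>\<^bsub>grp ?Lx n\<^esub>"
    unfolding cohomology_class_def r_coset_def by auto
  then show "z \<in> coboundaries ?Lx n" by (auto simp: coboundaries_def)
qed

text \<open>The differential of \<open>L\<close> need not map into the next group.  For the triviality of the cohomology it
  suffices that the coboundaries, which by definition lie in the group, form a subgroup that contains the
  cocycles: then both are equal.\<close>

lemma quasi_iso_degree_0I:
  assumes F: "group_presheaf X F" and L: "\<And>n. group_presheaf X (obj L n)"
    and bij: "\<And>x. x \<in> topspace X \<Longrightarrow> bij_betw (stalk_map X (obj L 0) x \<epsilon>) (carrier (stalk X F x))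
      (cocycles (stalk_complex X L x) 0)"
    and hom: "\<And>x. x \<in> topspace X \<Longrightarrow> stalk_map X (obj L 0) x \<epsilon> \<in> hom (stalk X F x) (stalk X (obj L 0) x)"
    and one: "\<And>x n. x \<in> topspace X \<Longrightarrow>
      cobd (stalk_complex X L x) n \<one>\<^bsub>stalk X (obj L n) x\<^esub> = \<one>\<^bsub>stalk X (obj L (Suc n)) x\<^esub>"
    and sub: "\<And>x n. x \<in> topspace X \<Longrightarrow> n > 0 \<Longrightarrow>
      subgroup (coboundaries (stalk_complex X L x) n) (stalk X (obj L n) x)"
    and exact: "\<And>x n. x \<in> topspace X \<Longrightarrow> n > 0 \<Longrightarrow>
      cocycles (stalk_complex X L x) n \<subseteq> coboundaries (stalk_complex X L x) n"
  shows "quasi_iso X (in_degree_0 F) L (from_degree_0 L \<epsilon>)"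
  unfolding quasi_iso_def
proof (intro ballI allI)
  fix x n assume x: "x \<in> topspace X"
  let ?Lx = "stalk_complex X L x"
  let ?K = "stalk_complex X (in_degree_0 F) x"
  have g: "grp ?Lx n = stalk X (obj L n) x" for n by (simp add: stalk_complex_def)
  have gK: "grp ?K 0 = stalk X F x" by (simp add: stalk_complex_def in_degree_0_def)
  have cL: "comm_group (grp ?Lx n)" for n using group_presheaf.stalk_comm_group[OF L x] g by simp
  show "cohomology_map ?Lx n (stalk_map X (obj L n) x (from_degree_0 L \<epsilon> n)) \<in> iso (cohomology ?K n) (cohomology ?Lx n)"
  proof (cases "n = 0")
    case True
    let ?\<psi> = "stalk_map X (obj L 0) x \<epsilon>"
    have f0: "from_degree_0 L \<epsilon> 0 = \<epsilon>" by (intro ext) (simp add: from_degree_0_def)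
    have cK: "carrier (cohomology ?K 0) = (\<lambda>z. {z}) ` carrier (stalk X F x)"
      by (rule in_degree_0_cohomology_0[OF F x])
    have coc: "cocycles ?Lx 0 \<subseteq> carrier (grp ?Lx 0)" by (auto simp: cocycles_def)
    have cLc: "carrier (cohomology ?Lx 0) = (\<lambda>z. {z}) ` cocycles ?Lx 0"
      unfolding cohomology_carrier' using class0[OF cL] coc by (intro image_cong) auto
    have inL: "?\<psi> z \<in> cocycles ?Lx 0" if z: "z \<in> carrier (stalk X F x)" for z
      using bij[OF x] z by (auto simp: bij_betw_def)
    have m': "cohomology_map ?Lx 0 ?\<psi> {z} = {?\<psi> z}" if "z \<in> carrier (stalk X F x)" for z
      using class0[OF cL, of "?\<psi> z"] inL[OF that] coc by (auto simp: cohomology_map_def)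
    interpret S: comm_group "stalk X F x" using group_presheaf.stalk_comm_group[OF F x] .
    have "cohomology_map ?Lx 0 ?\<psi> \<in> hom (cohomology ?K 0) (cohomology ?Lx 0)"
    proof (rule homI)
      fix A assume "A \<in> carrier (cohomology ?K 0)"
      then show "cohomology_map ?Lx 0 ?\<psi> A \<in> carrier (cohomology ?Lx 0)"
        using m' inL unfolding cK cLc by auto
    next
      fix A B assume "A \<in> carrier (cohomology ?K 0)" "B \<in> carrier (cohomology ?K 0)"
      then obtain z w where zw: "z \<in> carrier (stalk X F x)" "w \<in> carrier (stalk X F x)" "A = {z}" "B = {w}"
        unfolding cK by auto
      have "?\<psi> (z \<otimes>\<^bsub>stalk X F x\<^esub> w) = ?\<psi> z \<otimes>\<^bsub>stalk X (obj L 0) x\<^esub> ?\<psi> w"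
        using hom[OF x] zw by (auto simp: hom_def)
      then show "cohomology_map ?Lx 0 ?\<psi> (A \<otimes>\<^bsub>cohomology ?K 0\<^esub> B) =
        cohomology_map ?Lx 0 ?\<psi> A \<otimes>\<^bsub>cohomology ?Lx 0\<^esub> cohomology_map ?Lx 0 ?\<psi> B"
        using zw by (simp add: m' cohomology_mult g gK)
    qed
    moreover have "bij_betw (cohomology_map ?Lx 0 ?\<psi>) ((\<lambda>z. {z}) ` carrier (stalk X F x)) ((\<lambda>z. {z}) ` cocycles ?Lx 0)"
    proof (rule bij_betw_imageI)
      show "inj_on (cohomology_map ?Lx 0 ?\<psi>) ((\<lambda>z. {z}) ` carrier (stalk X F x))"
        using bij[OF x] m' by (auto simp: bij_betw_def inj_on_def)
      show "cohomology_map ?Lx 0 ?\<psi> ` (\<lambda>z. {z}) ` carrier (stalk X F x) = (\<lambda>z. {z}) ` cocycles ?Lx 0"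
      proof -
        have "cohomology_map ?Lx 0 ?\<psi> ` (\<lambda>z. {z}) ` carrier (stalk X F x) = (\<lambda>z. {z}) ` ?\<psi> ` carrier (stalk X F x)"
          using m' by (simp add: image_image)
        also have "?\<psi> ` carrier (stalk X F x) = cocycles ?Lx 0" using bij[OF x] by (simp add: bij_betw_def)
        finally show ?thesis .
      qed
    qed
    ultimately show ?thesis using True by (simp add: iso_def f0 cK cLc)
  next
    case False
    then have n: "n > 0" by simp
    interpret G: comm_group "grp ?Lx n" by (rule cL)
    interpret LP: group_presheaf X "obj L n" by (rule L)
    interpret KP: group_presheaf X "obj (in_degree_0 F) n" by (rule in_degree_0_presheaf[OF F])
    let ?cb = "coboundaries ?Lx n"
    let ?f = "from_degree_0 L \<epsilon> n"
    let ?\<psi> = "stalk_map X (obj L n) x ?f"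
    have sb: "subgroup ?cb (grp ?Lx n)" using sub[OF x n] g by simp
    have cls: "cohomology_class ?Lx n z = ?cb" if "z \<in> ?cb" for z
      unfolding cohomology_class_def by (rule subgroup_coset_self[OF cL sb that])
    have "\<one>\<^bsub>grp ?Lx n\<^esub> \<in> cocycles ?Lx n" using one[OF x, of n] g G.one_closed by (simp add: cocycles_def)
    then have cLc: "carrier (cohomology ?Lx n) = {?cb}"
      unfolding cohomology_carrier' using exact[OF x n] cls by auto
    let ?u = "\<one>\<^bsub>grp ?K n\<^esub>"
    have cK: "carrier (cohomology ?K n) = {cohomology_class ?K n ?u}"
      and cK1: "carrier (grp ?K n) = {?u}" by (rule in_degree_0_cohomology_pos[OF F x n])+
    interpret KC: group_complex ?K by (rule in_degree_0_complex[OF F x])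
    have "?u \<in> coboundaries ?K n" "coboundaries ?K n \<subseteq> {?u}"
      using subgroup.one_closed[OF KC.coboundaries_subgroup] cK1 by (auto simp: coboundaries_def)
    then have "coboundaries ?K n = {?u}" by auto
    interpret KG: comm_group "grp ?K n" by (rule KC.comm)
    have c1: "cohomology_class ?K n ?u = {?u}"
      using \<open>coboundaries ?K n = {?u}\<close> by (simp add: cohomology_class_def r_coset_def)
    have "?\<psi> ?u = \<one>\<^bsub>grp ?Lx n\<^esub>"
    proof -
      have "?u = germ X (obj (in_degree_0 F) n) x (topspace X) \<one>\<^bsub>sections (obj (in_degree_0 F) n) (topspace X)\<^esub>"
        using KP.stalk_one[OF openin_topspace x] by (simp add: stalk_complex_def)
      also have "?\<psi> \<dots> = germ X (obj L n) x (topspace X) (?f (topspace X) \<one>\<^bsub>sections (obj (in_degree_0 F) n) (topspace X)\<^esub>)"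
      proof (rule stalk_map_germ[OF in_degree_0_presheaf[OF F] openin_topspace x])
        fix U W s assume a: "openin X U" "openin X W" "x \<in> W" "W \<subseteq> U" "s \<in> KP.sec U"
        then have "x \<in> U" by auto
        then show "germ X (obj L n) x U (?f U s) = germ X (obj L n) x W (?f W (restr (obj (in_degree_0 F) n) U W s))"
          using n a LP.stalk_one[of U x] LP.stalk_one[of W x] by (simp add: from_degree_0_def)
      qed (use KP.one_sec in auto)
      also have "\<dots> = \<one>\<^bsub>grp ?Lx n\<^esub>" using LP.stalk_one[OF openin_topspace x] n g by (simp add: from_degree_0_def)
      finally show ?thesis .
    qed
    then have map1: "cohomology_map ?Lx n ?\<psi> {?u} = ?cb"
      using cls[OF subgroup.one_closed[OF sb]] by (simp add: cohomology_map_def)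
    have mm: "?cb \<otimes>\<^bsub>cohomology ?Lx n\<^esub> ?cb = ?cb"
    proof -
      have "?cb <#>\<^bsub>grp ?Lx n\<^esub> ?cb = ?cb"
        by (rule G.subgroup_mult_id[OF sb])
      then show ?thesis by (simp add: cohomology_mult set_mult_def)
    qed
    have "{?u} \<otimes>\<^bsub>cohomology ?K n\<^esub> {?u} = {?u}" by (simp add: cohomology_mult)
    then show ?thesis
      unfolding iso_def hom_def cK cLc c1 using map1 mm by (auto simp: bij_betw_def)
  qed
qed

(* The closure in a setoid has the same syntax as the topological closure. *)
no_notation eq_closure_of (\<open>closure'_of\<index>\<close>)

section \<open>Noetherian sober spaces\<close>

text \<open>The points of a closed subset \<open>W\<close> are the specializations of the generic points of its finitely
  many irreducible components.  Noetherianity and sobriety enter in this form.\<close>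

locale noetherian_sober =
  fixes X :: "'x topology"
  assumes closed_generic: "closedin X W \<Longrightarrow> \<exists>S. finite S \<and> S \<subseteq> topspace X \<and> W = X closure_of S"
    and T0: "x \<in> topspace X \<Longrightarrow> y \<in> topspace X \<Longrightarrow> X closure_of {x} = X closure_of {y} \<Longrightarrow> x = y"

lemma closure_of_finite:
  assumes "finite S"
  shows "X closure_of S = (\<Union>s\<in>S. X closure_of {s})"
proof -
  have "X closure_of (\<Union>((\<lambda>s. {s}) ` S)) = (\<Union>A\<in>(\<lambda>s. {s}) ` S. X closure_of A)"
    using assms by (intro closure_of_Union) auto
  then show ?thesis by simp
qed

subsection \<open>Spectra\<close>

lemma topspace_spec: "topspace (spec_topology R) = spec_points R"
proof -
  have "spec_open R (spec_points R)" unfolding spec_open_def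
  proof (intro exI[of _ "{x. x \<in> carrier R}"] conjI)
    show "spec_points R = {P \<in> spec_points R. \<not> {x. x \<in> carrier R} \<subseteq> P}"
    proof -
      have "\<not> carrier R \<subseteq> P" if "primeideal P R" for P
        using that primeideal.I_notcarr[OF that] ideal.Icarr[OF primeideal.axioms(1)[OF that]] by blast
      then show ?thesis by (auto simp: spec_points_def)
    qed
  qed auto
  moreover have "\<And>U. spec_open R U \<Longrightarrow> U \<subseteq> spec_points R" by (auto simp: spec_open_def)
  ultimately show ?thesis unfolding topspace_def openin_spec_topology by blast
qed

lemma closedin_spec: "closedin (spec_topology R) W \<longleftrightarrow> (\<exists>E \<subseteq> carrier R. W = {P \<in> spec_points R. E \<subseteq> P})"
proof
  assume "closedin (spec_topology R) W"
  then obtain E where "E \<subseteq> carrier R" "spec_points R - W = {P \<in> spec_points R. \<not> E \<subseteq> P}" "W \<subseteq> spec_points R"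
    by (auto simp: closedin_def topspace_spec openin_spec_topology spec_open_def)
  then have "W = {P \<in> spec_points R. E \<subseteq> P}" by blast
  then show "\<exists>E \<subseteq> carrier R. W = {P \<in> spec_points R. E \<subseteq> P}" using \<open>E \<subseteq> carrier R\<close> by blast
next
  assume "\<exists>E \<subseteq> carrier R. W = {P \<in> spec_points R. E \<subseteq> P}"
  then obtain E where E: "E \<subseteq> carrier R" "W = {P \<in> spec_points R. E \<subseteq> P}" by blast
  then have "spec_points R - W = {P \<in> spec_points R. \<not> E \<subseteq> P}" by blast
  then show "closedin (spec_topology R) W"
    using E by (auto simp: closedin_def topspace_spec openin_spec_topology spec_open_def)
qed

lemma closure_spec:
  assumes "P \<in> spec_points R"
  shows "spec_topology R closure_of {P} = {Q \<in> spec_points R. P \<subseteq> Q}"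
proof (rule closure_of_unique)
  have "P \<subseteq> carrier R" using assms ideal.Icarr[OF primeideal.axioms(1)] by (auto simp: spec_points_def)
  then show "closedin (spec_topology R) {Q \<in> spec_points R. P \<subseteq> Q}" by (auto simp: closedin_spec)
  show "{P} \<subseteq> {Q \<in> spec_points R. P \<subseteq> Q}" using assms by simp
  fix T assume T: "{P} \<subseteq> T" "closedin (spec_topology R) T"
  then obtain E where "T = {P \<in> spec_points R. E \<subseteq> P}" by (auto simp: closedin_spec)
  then show "{Q \<in> spec_points R. P \<subseteq> Q} \<subseteq> T" using T by auto
qed

text \<open>Noetherian induction on ideals.  An ideal \<open>M\<close> that is maximal among those whose zero locus is not the
  closure of finitely many points is not prime.  So it contains a product \<open>a b\<close> with \<open>a\<close> and \<open>b\<close> outside \<open>M\<close>,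
  and its zero locus is the union of those of \<open>M + (a)\<close> and \<open>M + (b)\<close>, a contradiction.\<close>

lemma noetherian_sober_spec:
  assumes "cring R" "noetherian_ring R"
  shows "noetherian_sober (spec_topology R)"
proof
  interpret cring R by fact
  interpret noetherian_ring R by fact
  define V where "V J = {P \<in> spec_points R. J \<subseteq> P}" for J
  define good where "good J \<longleftrightarrow> (\<exists>S. finite S \<and> S \<subseteq> spec_points R \<and> V J = spec_topology R closure_of S)" for J
  have good: "good J" if J: "ideal J R" for J
  proof (rule ccontr)
    assume "\<not> good J"
    define A where "A = {J. ideal J R \<and> \<not> good J}"
    have "A \<noteq> {}" using J \<open>\<not> good J\<close> by (auto simp: A_def)
    moreover have "\<Union>C \<in> A" if "C \<noteq> {}" "subset.chain A C" for C
    proof -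
      have "subset.chain {I. ideal I R} C" using that(2) unfolding A_def subset.chain_def by blast
      then have "\<Union>C \<in> C" using ideal_chain_is_trivial that(1) by blast
      then show ?thesis using that(2) unfolding subset.chain_def by blast
    qed
    ultimately obtain M where M: "M \<in> A" "\<And>I. I \<in> A \<Longrightarrow> M \<subseteq> I \<Longrightarrow> I = M"
      using subset_Zorn_nonempty[of A] by blast
    have MI: "ideal M R" and Mb: "\<not> good M" using M(1) by (auto simp: A_def)
    have "V M \<noteq> {}"
    proof
      assume "V M = {}"
      then have "good M" unfolding good_def by (intro exI[of _ "{}"]) simp
      then show False using Mb by simp
    qed
    then obtain P0 where P0: "primeideal P0 R" "M \<subseteq> P0" by (auto simp: V_def spec_points_def)
    have "P0 \<subseteq> carrier R" using ideal.Icarr[OF primeideal.axioms(1)[OF P0(1)]] by auto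
    then have "M \<noteq> carrier R" using P0(2) primeideal.I_notcarr[OF P0(1)] by auto
    have "\<not> primeideal M R"
    proof
      assume "primeideal M R"
      then have "M \<in> spec_points R" by (simp add: spec_points_def)
      then have "V M = spec_topology R closure_of {M}" by (simp add: closure_spec V_def)
      then have "good M" unfolding good_def using \<open>M \<in> spec_points R\<close> by (intro exI[of _ "{M}"]) auto
      then show False using Mb by simp
    qed
    then obtain a b where ab: "a \<in> carrier R" "b \<in> carrier R" "a \<otimes>\<^bsub>R\<^esub> b \<in> M" "a \<notin> M" "b \<notin> M"
      using primeidealI[OF MI is_cring] \<open>M \<noteq> carrier R\<close> by blast
    have Mc: "M \<subseteq> carrier R" using ideal.Icarr[OF MI] by blast
    have big: "good (genideal R (insert c M))" if c: "c \<in> carrier R" "c \<notin> M" for c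
    proof (rule ccontr)
      assume "\<not> good (genideal R (insert c M))"
      moreover have "ideal (genideal R (insert c M)) R" using c Mc by (intro genideal_ideal) auto
      ultimately have "genideal R (insert c M) \<in> A" by (simp add: A_def)
      moreover have "insert c M \<subseteq> genideal R (insert c M)" using c Mc by (intro genideal_self) auto
      ultimately show False using M(2) c by blast
    qed
    have Vg: "V (genideal R (insert c M)) = {P \<in> V M. c \<in> P}" if c: "c \<in> carrier R" for c
    proof -
      have "insert c M \<subseteq> genideal R (insert c M)" using c Mc by (intro genideal_self) auto
      moreover have "genideal R (insert c M) \<subseteq> P" if "P \<in> spec_points R" "insert c M \<subseteq> P" for P
        using that primeideal.axioms(1) by (intro genideal_minimal) (auto simp: spec_points_def)
      ultimately show ?thesis unfolding V_def by blast
    qed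
    obtain S where S: "finite S" "S \<subseteq> spec_points R" "V (genideal R (insert a M)) = spec_topology R closure_of S"
      using big[OF ab(1,4)] by (auto simp: good_def)
    obtain T where T: "finite T" "T \<subseteq> spec_points R" "V (genideal R (insert b M)) = spec_topology R closure_of T"
      using big[OF ab(2,5)] by (auto simp: good_def)
    have "V M = V (genideal R (insert a M)) \<union> V (genideal R (insert b M))"
      unfolding Vg[OF ab(1)] Vg[OF ab(2)]
      using primeideal.I_prime[OF _ ab(1,2)] ab(3) by (auto simp: V_def spec_points_def)
    then have "V M = spec_topology R closure_of (S \<union> T)" using S T by simp
    then have "good M" unfolding good_def using S T by (intro exI[of _ "S \<union> T"]) auto
    then show False using Mb by simp
  qed
  fix W assume "closedin (spec_topology R) W"
  then obtain E where E: "E \<subseteq> carrier R" "W = V E" by (auto simp: closedin_spec V_def)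
  have "V E = V (genideal R E)"
    using genideal_self[OF E(1)] genideal_minimal[OF primeideal.axioms(1)] by (auto simp: V_def spec_points_def)
  then show "\<exists>S. finite S \<and> S \<subseteq> topspace (spec_topology R) \<and> W = spec_topology R closure_of S"
    using good[OF genideal_ideal[OF E(1)]] E(2) by (simp add: good_def topspace_spec)
next
  fix P Q assume "P \<in> topspace (spec_topology R)" "Q \<in> topspace (spec_topology R)"
    "spec_topology R closure_of {P} = spec_topology R closure_of {Q}"
  then show "P = Q" by (auto simp: topspace_spec closure_spec)
qed

lemma noetherian_sober_homeomorphic:
  assumes h: "homeomorphic_map X Y h" and Y: "noetherian_sober Y"
  shows "noetherian_sober X"
proof
  interpret Y: noetherian_sober Y by fact
  have bij: "bij_betw h (topspace X) (topspace Y)"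
    using homeomorphic_imp_surjective_map[OF h] homeomorphic_imp_injective_map[OF h]
    by (auto simp: bij_betw_def)
  have cl: "h ` (X closure_of S) = Y closure_of (h ` S)" if "S \<subseteq> topspace X" for S
    by (rule homeomorphic_map_closure_of[OF h that, symmetric])
  fix W assume W: "closedin X W"
  then have "closedin Y (h ` W)" using homeomorphic_imp_closed_map[OF h] unfolding closed_map_def by simp
  from Y.closed_generic[OF this] obtain S where S: "finite S" "S \<subseteq> topspace Y" "h ` W = Y closure_of S"
    by (elim exE conjE)
  then obtain T where T: "T \<subseteq> topspace X" "finite T" "S = h ` T"
    using finite_subset_image[OF S(1), of h "topspace X"] bij unfolding bij_betw_def by blast
  then have "h ` W = h ` (X closure_of T)" using S cl by simp
  then have "W = X closure_of T"
    using inj_on_image_eq_iff[OF homeomorphic_imp_injective_map[OF h] closedin_subset[OF W] closure_of_subset_topspace] by simp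
  then show "\<exists>S. finite S \<and> S \<subseteq> topspace X \<and> W = X closure_of S" using T by blast
next
  interpret Y: noetherian_sober Y by fact
  fix x y assume a: "x \<in> topspace X" "y \<in> topspace X" "X closure_of {x} = X closure_of {y}"
  then have "Y closure_of {h x} = Y closure_of {h y}"
    using homeomorphic_map_closure_of[OF h, of "{x}"] homeomorphic_map_closure_of[OF h, of "{y}"] by simp
  moreover have "h x \<in> topspace Y" "h y \<in> topspace Y" using a homeomorphic_imp_surjective_map[OF h] by auto
  ultimately have "h x = h y" using Y.T0 by blast
  then show "x = y" using a homeomorphic_imp_injective_map[OF h] by (auto dest: inj_onD)
qed

theorem noetherian_scheme_sober:
  assumes "noetherian_scheme X OX"
  shows "noetherian_sober X"
proof -
  have "\<exists>\<U>. finite \<U> \<and> \<Union>\<U> = topspace X \<and> (\<forall>U\<in>\<U>. \<exists>R. affine_open X OX U R \<and> noetherian_ring R)"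
    using assms by (simp add: noetherian_scheme_def)
  then obtain \<U> where \<U>: "finite \<U>" "\<Union>\<U> = topspace X"
    and aff': "\<forall>U\<in>\<U>. \<exists>R. affine_open X OX U R \<and> noetherian_ring R"
    by (elim exE conjE)
  note aff = bspec[OF aff']
  have op: "openin X U" if "U \<in> \<U>" for U using aff[OF that] by (auto simp: affine_open_def)
  have sob: "noetherian_sober (subtopology X U)" if U: "U \<in> \<U>" for U
  proof -
    from aff[OF U] obtain R where "affine_open X OX U R" and nR: "noetherian_ring R"
      by (elim exE conjE)
    then have R: "cring R" "noetherian_ring R" "iso_to_spec (subtopology X U) OX R"
      by (simp_all only: affine_open_def)
    then obtain h where "homeomorphic_map (subtopology X U) (spec_topology R) h"
      by (auto simp: iso_to_spec_def)
    then show ?thesis by (rule noetherian_sober_homeomorphic[OF _ noetherian_sober_spec[OF R(1,2)]])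
  qed
  show ?thesis
  proof
    fix W assume W: "closedin X W"
    have "\<exists>S. finite S \<and> S \<subseteq> W \<and> W \<inter> U \<subseteq> X closure_of S" if U: "U \<in> \<U>" for U
    proof -
      interpret noetherian_sober "subtopology X U" by (rule sob[OF U])
      have "closedin (subtopology X U) (W \<inter> U)" using W by (auto simp: closedin_subtopology)
      then obtain S where S: "finite S" "S \<subseteq> topspace (subtopology X U)" "W \<inter> U = subtopology X U closure_of S"
        using closed_generic by blast
      have "S \<subseteq> W \<inter> U" using S(3) closure_of_subset[OF S(2)] by blast
      moreover have "W \<inter> U \<subseteq> X closure_of S" unfolding S(3)
        by (auto simp: closure_of_subtopology intro: subsetD[OF closure_of_mono])
      ultimately show ?thesis using S(1) by blast
    qed
    then obtain S where S: "\<And>U. U \<in> \<U> \<Longrightarrow> finite (S U) \<and> S U \<subseteq> W \<and> W \<inter> U \<subseteq> X closure_of (S U)" by metis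
    let ?S = "\<Union>(S ` \<U>)"
    have "?S \<subseteq> W" using S by blast
    have "W \<subseteq> X closure_of ?S"
    proof
      fix x assume x: "x \<in> W"
      then obtain U where U: "U \<in> \<U>" "x \<in> U" using \<U>(2) closedin_subset[OF W] by blast
      then have "x \<in> X closure_of (S U)" using S x by blast
      moreover have "S U \<subseteq> ?S" using U by blast
      ultimately show "x \<in> X closure_of ?S" using closure_of_mono by blast
    qed
    moreover have "X closure_of ?S \<subseteq> W" using \<open>?S \<subseteq> W\<close> W by (rule closure_of_minimal)
    moreover have "finite ?S" using \<U> S by blast
    ultimately show "\<exists>S. finite S \<and> S \<subseteq> topspace X \<and> W = X closure_of S"
      using \<open>?S \<subseteq> W\<close> closedin_subset[OF W] by (intro exI[of _ ?S]) auto
  next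
    fix x y assume a: "x \<in> topspace X" "y \<in> topspace X" "X closure_of {x} = X closure_of {y}"
    obtain U where U: "U \<in> \<U>" "x \<in> U" using a \<U>(2) by blast
    have "x \<in> X closure_of {y}" using a closure_of_subset[of "{x}" X] by auto
    then have y: "y \<in> U" using closure_of_nbhd op U by metis
    interpret noetherian_sober "subtopology X U" by (rule sob[OF U(1)])
    have "subtopology X U closure_of {x} = subtopology X U closure_of {y}"
      using a U y by (simp add: closure_of_subtopology)
    then show "x = y" using T0 U y a by auto
  qed
qed

subsection \<open>Codimension\<close>

lemma irreducible_closure:
  assumes "x \<in> topspace X"
  shows "irreducible_closed X (X closure_of {x})"
proof -
  have "x \<in> X closure_of {x}" using assms closure_of_subset[of "{x}" X] by auto
  moreover have min: "X closure_of {x} \<subseteq> A" if "closedin X A" "x \<in> A" for A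
    by (rule closure_of_minimal) (use that in auto)
  moreover have "X closure_of {x} \<subseteq> A \<or> X closure_of {x} \<subseteq> B"
    if "closedin X A" "closedin X B" "X closure_of {x} \<subseteq> A \<union> B" for A B
    using min[OF that(1)] min[OF that(2)] that(3) calculation(1) by fastforce
  ultimately show ?thesis unfolding irreducible_closed_def by auto
qed

lemma closure_trans:
  assumes "y \<in> X closure_of {x}" "z \<in> X closure_of {y}"
  shows "z \<in> X closure_of {x}"
  using assms closure_of_minimal[of "{y}" "X closure_of {x}" X] by auto

lemma point_in_closure: "x \<in> topspace X \<Longrightarrow> x \<in> X closure_of {x}"
  using closure_of_subset[of "{x}" X] by auto

lemma closure_topspace: "y \<in> X closure_of {x} \<Longrightarrow> x \<in> topspace X \<and> y \<in> topspace X"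
  by (metis closure_of_nbhd in_closure_of openin_topspace)

lemma codim_strict:
  assumes "irreducible_closed X Z" "irreducible_closed X Z'" "Z \<subset> Z'"
  shows "eSuc (codim X Z') \<le> codim X Z"
proof (cases "codim X Z")
  case infinity then show ?thesis by simp
next
  case (enat q)
  have *: "enat (length Zs) \<le> enat q" if Zs: "irr_chain X Zs" "hd Zs = Z'" for Zs
  proof -
    obtain Ys where Y: "Zs = Z' # Ys" using Zs by (cases Zs) (auto simp: irr_chain_def)
    have "irr_chain X (Z # Zs)" using Zs(1) assms unfolding irr_chain_def Y by auto
    then have "enat (length Zs) \<le> codim X Z"
      unfolding codim_def by (intro Sup_upper) (auto intro!: exI[of _ "Z # Zs"])
    then show ?thesis using enat by simp
  qed
  have "irr_chain X [Z']" using assms by (auto simp: irr_chain_def)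
  then have q: "q \<ge> 1" using *[of "[Z']"] by auto
  have "codim X Z' \<le> enat (q - 1)" unfolding codim_def
    by (rule Sup_least) (use * in force)
  then have "eSuc (codim X Z') \<le> eSuc (enat (q - 1))" by simp
  then show ?thesis using q enat by (simp add: eSuc_enat)
qed

context noetherian_sober
begin

abbreviation cl :: "'x \<Rightarrow> 'x set" where "cl x \<equiv> X closure_of {x}"
abbreviation P :: "nat \<Rightarrow> 'x set" where "P \<equiv> points_codim X"

lemma P_topspace: "x \<in> P p \<Longrightarrow> x \<in> topspace X" by (simp add: points_codim_def)

lemma P_self: "x \<in> P p \<Longrightarrow> x \<in> cl x" by (simp add: P_topspace point_in_closure)

lemma P_unique: "x \<in> P p \<Longrightarrow> x \<in> P q \<Longrightarrow> p = q" by (simp add: points_codim_def)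

lemma closure_antisym:
  assumes "x \<in> cl y" "y \<in> cl x"
  shows "x = y"
proof -
  have "cl x \<subseteq> cl y" "cl y \<subseteq> cl x"
    using assms closure_of_minimal[of "{x}" "cl y" X] closure_of_minimal[of "{y}" "cl x" X]
    by auto
  then show ?thesis using T0 closure_topspace[OF assms(1)] by blast
qed

lemma codim_generization:
  assumes "x \<in> P q" "x \<in> cl y" "x \<noteq> y"
  obtains p where "y \<in> P p" "p < q"
proof -
  have "cl x \<subseteq> cl y"
    using assms closure_of_minimal[of "{x}" "cl y" X] by auto
  moreover have "cl x \<noteq> cl y"
    using T0 closure_topspace[OF assms(2)] assms(3) by blast
  ultimately have "eSuc (codim X (cl y)) \<le> enat q"
    using codim_strict[OF irreducible_closure irreducible_closure, of x X y] closure_topspace[OF assms(2)] assms(1)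
    by (auto simp: points_codim_def)
  then obtain p where "codim X (cl y) = enat p" "p < q"
    by (cases "codim X (cl y)") (auto simp: eSuc_enat)
  then show thesis using that closure_topspace[OF assms(2)] by (auto simp: points_codim_def)
qed

lemma codim_mono: "x \<in> P q \<Longrightarrow> y \<in> P p \<Longrightarrow> x \<in> cl y \<Longrightarrow> p \<le> q"
  by (metis codim_generization P_unique less_imp_le order_refl)

lemma codim_eq: "x \<in> P q \<Longrightarrow> y \<in> P q \<Longrightarrow> x \<in> cl y \<Longrightarrow> x = y"
  by (metis codim_generization P_unique less_irrefl)

lemma codim_between:
  assumes "x \<in> P (Suc (Suc p))" "x \<in> cl y" "y \<in> cl z" "z \<in> P p" "y \<noteq> x" "y \<noteq> z"
  shows "y \<in> P (Suc p)"
proof -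
  obtain r where r: "y \<in> P r" "r < Suc (Suc p)" using codim_generization[OF assms(1,2)] assms(5) by blast
  obtain s where "z \<in> P s" "s < r" using codim_generization[OF r(1) assms(3)] assms(6) by blast
  then show ?thesis using r P_unique[OF assms(4)] by (metis less_antisym not_less_eq)
qed

text \<open>Among finitely many points whose closures cover \<open>W\<close> are all the generic points of \<open>W\<close>.\<close>

lemma finite_generic:
  assumes "closedin X W"
  shows "finite {x \<in> W. \<forall>y\<in>W. x \<in> cl y \<longrightarrow> y = x}"
proof -
  obtain S where S: "finite S" "S \<subseteq> topspace X" "W = X closure_of S" using closed_generic[OF assms] by blast
  have "x \<in> S" if "x \<in> W" "\<forall>y\<in>W. x \<in> cl y \<longrightarrow> y = x" for x
  proof -
    have "x \<in> (\<Union>s\<in>S. cl s)" using that(1) S(3) closure_of_finite[OF S(1), of X] by simp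
    then obtain s where "s \<in> S" "x \<in> cl s" by blast
    moreover have "s \<in> W" using \<open>s \<in> S\<close> S closure_of_subset by blast
    ultimately show ?thesis using that(2) by blast
  qed
  then show ?thesis using S(1) by (auto intro: finite_subset)
qed

lemma finite_P0: "finite (P 0)"
proof (rule finite_subset[OF _ finite_generic[OF closedin_topspace]])
  show "P 0 \<subseteq> {x \<in> topspace X. \<forall>y\<in>topspace X. x \<in> cl y \<longrightarrow> y = x}"
  proof (intro subsetI CollectI conjI ballI impI)
    fix x y assume x: "x \<in> P 0" "x \<in> cl y"
    show "y = x"
    proof (rule ccontr)
      assume "y \<noteq> x"
      then obtain p where "p < (0::nat)" using codim_generization[OF x] by blast
      then show False by simp
    qed
  qed (rule P_topspace)
qed

text \<open>A closed set through \<open>z\<close> that contains no proper generization of \<open>z\<close> is near \<open>z\<close> contained in the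
  closure of \<open>z\<close>.\<close>

lemma local_closed:
  assumes W: "closedin X W" and z: "z \<in> topspace X"
    and gen: "\<And>y. y \<in> W \<Longrightarrow> z \<in> cl y \<Longrightarrow> y = z"
  obtains V where "openin X V" "z \<in> V" "W \<inter> V \<subseteq> cl z"
proof -
  obtain S where S: "finite S" "S \<subseteq> topspace X" "W = X closure_of S" using closed_generic[OF W] by blast
  let ?T = "{s \<in> S. z \<notin> cl s}"
  let ?V = "topspace X - X closure_of ?T"
  have fT: "finite ?T" using S by simp
  show thesis
  proof
    show "openin X ?V" by (simp add: openin_diff)
    show "z \<in> ?V" using z by (simp add: closure_of_finite[OF fT])
    show "W \<inter> ?V \<subseteq> cl z"
    proof
      fix y assume y: "y \<in> W \<inter> ?V"
      have "y \<in> (\<Union>s\<in>S. cl s)" using y S(3) closure_of_finite[OF S(1), of X] by simp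
      then obtain s where s: "s \<in> S" "y \<in> cl s" by blast
      then have "z \<in> cl s" using y unfolding closure_of_finite[OF fT] by blast
      moreover have "s \<in> W" using s S closure_of_subset by blast
      ultimately show "y \<in> cl z" using gen s by blast
    qed
  qed
qed

text \<open>Finitely many points that do not specialize to \<open>x\<close> are absent from some neighbourhood of \<open>x\<close>.\<close>

lemma avoid_finite:
  assumes "finite S" "x \<in> U" "openin X U" "\<And>s. s \<in> S \<Longrightarrow> s \<in> topspace X \<Longrightarrow> x \<notin> cl s"
  obtains V where "openin X V" "x \<in> V" "V \<subseteq> U" "V \<inter> S = {}"
proof -
  let ?V = "U - X closure_of (S \<inter> topspace X)"
  have f: "finite (S \<inter> topspace X)" using assms by simp
  have "x \<notin> (\<Union>s\<in>S \<inter> topspace X. cl s)" using assms(4) by blast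
  then have "x \<in> ?V" using assms(2) closure_of_finite[OF f, of X] by simp
  moreover have "openin X ?V" using assms(3) by (simp add: openin_diff)
  moreover have "?V \<inter> S = {}"
    using openin_subset[OF assms(3)] closure_of_subset[of "S \<inter> topspace X" X] by blast
  ultimately show thesis using that[of ?V] by blast
qed

lemma irreducible_subset_generic:
  assumes "irreducible_closed X W" "finite S" "W \<subseteq> (\<Union>s\<in>S. cl s)"
  shows "\<exists>s\<in>S. W \<subseteq> cl s"
  using assms(2,3)
proof (induction S)
  case empty then show ?case using assms(1) by (auto simp: irreducible_closed_def)
next
  case (insert a S)
  have "closedin X (\<Union>s\<in>S. cl s)" using insert by (intro closedin_Union) auto
  then have "W \<subseteq> cl a \<or> W \<subseteq> (\<Union>s\<in>S. cl s)"
    using assms(1) insert.prems unfolding irreducible_closed_def by simp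
  then show ?case using insert.IH by blast
qed

lemma component_above:
  assumes W: "irreducible_closed X W"
  obtains Z where "Z \<in> irreducible_components X" "W \<subseteq> Z"
proof -
  obtain S where S: "finite S" "S \<subseteq> topspace X" "topspace X = X closure_of S"
    using closed_generic[OF closedin_topspace] by blast
  have sub: "\<exists>s\<in>S. Y \<subseteq> cl s" if "irreducible_closed X Y" for Y
  proof (rule irreducible_subset_generic[OF that S(1)])
    have "Y \<subseteq> topspace X" using that closedin_subset by (auto simp: irreducible_closed_def)
    then show "Y \<subseteq> (\<Union>s\<in>S. cl s)" using S(3) closure_of_finite[OF S(1), of X] by simp
  qed
  define A where "A = (\<lambda>s. cl s) ` {s \<in> S. W \<subseteq> cl s}"
  have fA: "finite A" using S(1) by (simp add: A_def)
  obtain s0 where s0: "s0 \<in> S" "W \<subseteq> X closure_of {s0}" using sub[OF W] by (elim bexE)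
  then have "A \<noteq> {}" by (auto simp: A_def)
  from finite_has_maximal[OF fA this] obtain Z where Z: "Z \<in> A" "\<forall>Y\<in>A. Z \<subseteq> Y \<longrightarrow> Z = Y"
    by (elim bexE)
  then have WZ: "W \<subseteq> Z" by (auto simp: A_def)
  have "Y = Z" if Y: "irreducible_closed X Y" "Z \<subseteq> Y" for Y
  proof -
    obtain s where s: "s \<in> S" "Y \<subseteq> cl s" using sub[OF Y(1)] by (elim bexE)
    then have "cl s \<in> A" using WZ Y(2) by (auto simp: A_def)
    then have "Z = cl s" using Z(2) s(2) Y(2) order_trans[OF Y(2) s(2)] by simp
    then show ?thesis using s Y by simp
  qed
  moreover have "irreducible_closed X Z" using Z(1) S(2) by (auto simp: A_def intro!: irreducible_closure)
  ultimately show thesis using that[of Z] WZ by (simp add: irreducible_components_def)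
qed

text \<open>A chain of irreducible closed sets lies in the component that contains its largest member.\<close>

lemma codim_le_dim:
  assumes d: "\<forall>Z\<in>irreducible_components X. krull_dim (subtopology X Z) = enat d" and x: "x \<in> P p"
  shows "p \<le> d"
proof -
  have "enat (length Zs - 1) \<le> enat d" if Zs: "irr_chain X Zs" for Zs
  proof -
    have "irreducible_closed X (last Zs)" using Zs by (auto simp: irr_chain_def)
    then obtain Z where Z: "Z \<in> irreducible_components X" "last Zs \<subseteq> Z" using component_above by blast
    have cZ: "closedin X Z" using Z(1) by (auto simp: irreducible_components_def irreducible_closed_def)
    have sub: "Y \<subseteq> Z" if "Y \<in> set Zs" for Y
    proof -
      have "Zs = butlast Zs @ [last Zs]" using Zs by (simp add: irr_chain_def)
      moreover have "sorted_wrt (\<subset>) Zs" using Zs by (simp add: irr_chain_def)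
      ultimately have "\<forall>Y\<in>set (butlast Zs). Y \<subset> last Zs" and "set Zs = insert (last Zs) (set (butlast Zs))"
        by (metis sorted_wrt_append list.set_intros(1), metis set_append list.simps(15) empty_set Un_insert_right Un_empty_right)
      then have "Y \<subseteq> last Zs" using that by auto
      then show ?thesis using Z by blast
    qed
    have "irreducible_closed (subtopology X Z) Y" if Y: "Y \<in> set Zs" for Y
    proof -
      have i: "irreducible_closed X Y" using Zs Y by (auto simp: irr_chain_def)
      then have "closedin (subtopology X Z) Y" using sub[OF Y] by (auto simp: irreducible_closed_def closedin_subset_topspace)
      moreover have "closedin X A" if "closedin (subtopology X Z) A" for A
        using that cZ closedin_closed_subtopology by blast
      ultimately show ?thesis using i unfolding irreducible_closed_def by blast
    qed
    then have "irr_chain (subtopology X Z) Zs" using Zs by (auto simp: irr_chain_def)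
    then have "enat (length Zs - 1) \<le> krull_dim (subtopology X Z)"
      unfolding krull_dim_def by (intro Sup_upper) auto
    then show ?thesis using d Z by simp
  qed
  then have "codim X (cl x) \<le> enat d" unfolding codim_def by (intro Sup_least) auto
  then show ?thesis using x by (simp add: points_codim_def)
qed

end

section \<open>Injective sheaves are flasque\<close>

lemma gluingD:
  assumes "gluing X J" "\<forall>U\<in>\<U>. openin X U \<and> s U \<in> carrier (sections J U)"
    "\<forall>U\<in>\<U>. \<forall>V\<in>\<U>. restr J U (U \<inter> V) (s U) = restr J V (U \<inter> V) (s V)"
  shows "\<exists>!t. t \<in> carrier (sections J (\<Union>\<U>)) \<and> (\<forall>U\<in>\<U>. restr J (\<Union>\<U>) U t = s U)"
  using spec[OF spec[OF assms(1)[unfolded gluing_def], of \<U>], of s] assms(2,3) by (rule mp[OF mp])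

lemma sheaf_eqI:
  assumes J: "ab_sheaf X J" and W: "openin X W" and st: "s \<in> carrier (sections J W)" "t \<in> carrier (sections J W)"
    and loc: "\<And>y. y \<in> W \<Longrightarrow> \<exists>N. openin X N \<and> y \<in> N \<and> N \<subseteq> W \<and> restr J W N s = restr J W N t"
  shows "s = t"
proof -
  interpret group_presheaf X J using J by (rule group_presheaf_of_ab_sheaf)
  let ?U = "{N. openin X N \<and> N \<subseteq> W \<and> restr J W N s = restr J W N t}"
  have un: "\<Union>?U = W" using loc by blast
  have "\<exists>!u. u \<in> sec (\<Union>?U) \<and> (\<forall>U\<in>?U. restr J (\<Union>?U) U u = restr J W U s)"
  proof -
    have 1: "\<forall>U\<in>?U. openin X U \<and> restr J W U s \<in> sec U" using W st restr_carrier by auto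
    have 2: "\<forall>U\<in>?U. \<forall>V\<in>?U. restr J U (U \<inter> V) (restr J W U s) = restr J V (U \<inter> V) (restr J W V s)"
      using W st by (auto simp: restr_comp openin_Int)
    have "gluing X J" using J by (simp add: ab_sheaf_def)
    from gluingD[OF this 1 2] show ?thesis .
  qed
  then have ex1: "\<exists>!u. u \<in> sec W \<and> (\<forall>U\<in>?U. restr J W U u = restr J W U s)" unfolding un .
  have "s \<in> sec W \<and> (\<forall>U\<in>?U. restr J W U s = restr J W U s)" using st by simp
  moreover have "t \<in> sec W \<and> (\<forall>U\<in>?U. restr J W U t = restr J W U s)" using st by simp
  ultimately show ?thesis using ex1 by blast
qed

lemma sheaf_glue:
  assumes J: "ab_sheaf X J" and U: "\<And>i. i \<in> I \<Longrightarrow> openin X (U i)" "\<And>i. i \<in> I \<Longrightarrow> s i \<in> carrier (sections J (U i))"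
    and comp: "\<And>i j. i \<in> I \<Longrightarrow> j \<in> I \<Longrightarrow> restr J (U i) (U i \<inter> U j) (s i) = restr J (U j) (U i \<inter> U j) (s j)"
  obtains t where "t \<in> carrier (sections J (\<Union>i\<in>I. U i))" "\<forall>i\<in>I. restr J (\<Union>i\<in>I. U i) (U i) t = s i"
proof -
  interpret group_presheaf X J using J by (rule group_presheaf_of_ab_sheaf)
  define c where "c V = (SOME i. i \<in> I \<and> U i = V)" for V
  have c: "c (U i) \<in> I" "U (c (U i)) = U i" if "i \<in> I" for i
    using someI[of "\<lambda>k. k \<in> I \<and> U k = U i" i] that by (auto simp: c_def)
  have same: "s (c (U i)) = s i" if i: "i \<in> I" for i
  proof -
    have "restr J (U i) (U i \<inter> U i) (s (c (U i))) = restr J (U i) (U i \<inter> U i) (s i)"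
      using comp[OF c(1)[OF i] i] c(2)[OF i] by simp
    then show ?thesis using restr_id U i c[OF i] by (metis Int_absorb)
  qed
  have 1: "\<forall>V\<in>U ` I. openin X V \<and> s (c V) \<in> sec V" using U same by auto
  have 2: "\<forall>V\<in>U ` I. \<forall>V'\<in>U ` I. restr J V (V \<inter> V') (s (c V)) = restr J V' (V \<inter> V') (s (c V'))"
    using comp same by auto
  have "gluing X J" using J by (simp add: ab_sheaf_def)
  from ex1_implies_ex[OF gluingD[OF this 1 2]]
  obtain t where "t \<in> sec (\<Union>(U ` I))" "\<forall>V\<in>U ` I. restr J (\<Union>(U ` I)) V t = s (c V)" by (elim exE conjE)
  then show thesis using that same by auto
qed

lemma sheaf_empty:
  assumes J: "ab_sheaf X J" and "s \<in> carrier (sections J {})" "t \<in> carrier (sections J {})"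
  shows "s = t"
  by (rule sheaf_eqI[OF J _ assms(2,3)]) auto

text \<open>The extension by zero of the constant sheaf \<open>\<int>\<close> on the open set \<open>V\<close>.  Its sections are the locally
  constant functions that vanish outside \<open>V\<close>.\<close>

definition int_sheaf :: "'x topology \<Rightarrow> 'x set \<Rightarrow> ('x, 'x \<Rightarrow> int) ab_presheaf" where
  "int_sheaf X V = \<lparr>sections = (\<lambda>U. \<lparr>carrier = {f. (\<forall>y. y \<notin> U \<inter> V \<longrightarrow> f y = 0) \<and>
       (\<forall>y\<in>U. \<exists>N. openin X N \<and> y \<in> N \<and> N \<subseteq> U \<and> (\<forall>z\<in>N. f z = f y))},
       mult = (\<lambda>f g y. f y + g y), one = (\<lambda>y. 0)\<rparr>),
     restr = (\<lambda>U W f y. if y \<in> W then f y else 0)\<rparr>"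

lemma int_sheaf_carrier: "f \<in> carrier (sections (int_sheaf X V) U) \<longleftrightarrow> (\<forall>y. y \<notin> U \<inter> V \<longrightarrow> f y = 0) \<and>
       (\<forall>y\<in>U. \<exists>N. openin X N \<and> y \<in> N \<and> N \<subseteq> U \<and> (\<forall>z\<in>N. f z = f y))"
  by (simp add: int_sheaf_def)

lemma int_sheaf_const:
  assumes "f \<in> carrier (sections (int_sheaf X V) U)" "y \<in> U"
  obtains N a where "openin X N" "y \<in> N" "N \<subseteq> U" "\<forall>z\<in>N. f z = a"
proof -
  have "\<exists>N. openin X N \<and> y \<in> N \<and> N \<subseteq> U \<and> (\<forall>z\<in>N. f z = f y)"
    using assms by (simp add: int_sheaf_carrier)
  then obtain N where "openin X N" "y \<in> N" "N \<subseteq> U" "\<forall>z\<in>N. f z = f y" by (elim exE conjE)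
  then show thesis by (rule that[of N "f y"])
qed

lemma int_sheaf_const2:
  assumes "f \<in> carrier (sections (int_sheaf X V) U)" "g \<in> carrier (sections (int_sheaf X V) U)" "y \<in> U"
  obtains N a c where "openin X N" "y \<in> N" "N \<subseteq> U" "\<forall>z\<in>N. f z = a" "\<forall>z\<in>N. g z = c"
proof -
  obtain N a where N: "openin X N" "y \<in> N" "N \<subseteq> U" "\<forall>z\<in>N. f z = a"
    by (rule int_sheaf_const[OF assms(1,3)])
  obtain N' c where N': "openin X N'" "y \<in> N'" "N' \<subseteq> U" "\<forall>z\<in>N'. g z = c"
    by (rule int_sheaf_const[OF assms(2,3)])
  show thesis by (rule that[of "N \<inter> N'" a c]) (use N N' in auto)
qed

lemma int_sheaf_restr:
  assumes "openin X W" "W \<subseteq> U" "f \<in> carrier (sections (int_sheaf X V) U)"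
  shows "(\<lambda>y. if y \<in> W then f y else 0) \<in> carrier (sections (int_sheaf X V) W)"
  unfolding int_sheaf_carrier
proof (intro conjI allI ballI impI)
  fix y assume "y \<in> W"
  then have "y \<in> U" using assms(2) by blast
  then obtain N a where N: "openin X N" "y \<in> N" "N \<subseteq> U" "\<forall>z\<in>N. f z = a"
    by (rule int_sheaf_const[OF assms(3)])
  then show "\<exists>N. openin X N \<and> y \<in> N \<and> N \<subseteq> W \<and> (\<forall>z\<in>N. (if z \<in> W then f z else 0) = (if y \<in> W then f y else 0))"
    using \<open>y \<in> W\<close> assms(1) by (intro exI[of _ "N \<inter> W"]) auto
next
  fix y assume "y \<notin> W \<inter> V"
  then show "(if y \<in> W then f y else 0) = 0" using assms(3) by (simp add: int_sheaf_carrier)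
qed

lemma int_sheaf_comm_group:
  assumes U: "openin X U"
  shows "comm_group (sections (int_sheaf X V) U)"
proof (rule comm_groupI)
  let ?S = "sections (int_sheaf X V) U"
  have m: "f \<otimes>\<^bsub>?S\<^esub> g = (\<lambda>y. f y + g y)" "\<one>\<^bsub>?S\<^esub> = (\<lambda>y. 0)" for f g by (simp_all add: int_sheaf_def)
  show "\<one>\<^bsub>?S\<^esub> \<in> carrier ?S" unfolding m using U by (auto simp: int_sheaf_carrier)
  fix f assume f: "f \<in> carrier ?S"
  show "\<one>\<^bsub>?S\<^esub> \<otimes>\<^bsub>?S\<^esub> f = f" by (simp add: m)
  show "\<exists>g\<in>carrier ?S. g \<otimes>\<^bsub>?S\<^esub> f = \<one>\<^bsub>?S\<^esub>"
  proof (rule bexI[of _ "\<lambda>y. - f y"])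
    show "(\<lambda>y. - f y) \<in> carrier ?S" using f by (simp add: int_sheaf_carrier)
  qed (simp add: m)
  fix g assume g: "g \<in> carrier ?S"
  show "f \<otimes>\<^bsub>?S\<^esub> g \<in> carrier ?S" unfolding m int_sheaf_carrier
  proof (intro conjI allI ballI impI)
    fix y assume "y \<in> U"
    obtain N a c where "openin X N" "y \<in> N" "N \<subseteq> U" "\<forall>z\<in>N. f z = a" "\<forall>z\<in>N. g z = c"
      by (rule int_sheaf_const2[OF f g \<open>y \<in> U\<close>])
    then show "\<exists>N. openin X N \<and> y \<in> N \<and> N \<subseteq> U \<and> (\<forall>z\<in>N. f z + g z = f y + g y)"
      by (intro exI[of _ N]) auto
  next
    fix y assume "y \<notin> U \<inter> V" then show "f y + g y = 0" using f g by (simp add: int_sheaf_carrier)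
  qed
qed (simp_all add: int_sheaf_def add.commute add.left_commute)

lemma int_sheaf_ab_sheaf: "ab_sheaf X (int_sheaf X V)"
  unfolding ab_sheaf_def
proof (intro conjI allI impI)
  let ?Z = "int_sheaf X V"
  have r: "restr ?Z U W f = (\<lambda>y. if y \<in> W then f y else 0)" for U W f by (simp add: int_sheaf_def)
  have rc: "restr ?Z U W f \<in> carrier (sections ?Z W)"
    if "openin X W" "W \<subseteq> U" "f \<in> carrier (sections ?Z U)" for U W f
    unfolding r by (rule int_sheaf_restr[OF that])
  have ri: "restr ?Z U U f = f" if "f \<in> carrier (sections ?Z U)" for U f
    using that by (auto simp: r int_sheaf_carrier)
  have rr: "restr ?Z V W (restr ?Z U V f) = restr ?Z U W f" if "W \<subseteq> V" for U V W f
    using that by (auto simp: r fun_eq_iff)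
  show "is_presheaf X ?Z"
    unfolding is_presheaf_def by (simp add: rc ri rr Pi_iff)
  show "restr ?Z U W \<in> hom (sections ?Z U) (sections ?Z W)" if "openin X U" "openin X W" "W \<subseteq> U" for U W
  proof (rule homI)
    fix f assume "f \<in> carrier (sections ?Z U)"
    then show "restr ?Z U W f \<in> carrier (sections ?Z W)" using int_sheaf_restr that unfolding r by blast
  qed (auto simp: int_sheaf_def)
  show "gluing X ?Z" unfolding gluing_def
  proof (intro allI impI)
    fix \<U> s assume s: "\<forall>U\<in>\<U>. openin X U \<and> s U \<in> carrier (sections ?Z U)"
      and comp: "\<forall>U\<in>\<U>. \<forall>W\<in>\<U>. restr ?Z U (U \<inter> W) (s U) = restr ?Z W (U \<inter> W) (s W)"
    have comp': "s U y = s W y" if "U \<in> \<U>" "W \<in> \<U>" "y \<in> U" "y \<in> W" for U W y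
    proof -
      have "restr ?Z U (U \<inter> W) (s U) y = restr ?Z W (U \<inter> W) (s W) y"
        by (rule fun_cong[OF bspec[OF bspec[OF comp that(1)] that(2)]])
      then show ?thesis using that by (simp add: r)
    qed
    have zero: "s U y = 0" if "U \<in> \<U>" "y \<notin> U \<inter> V" for U y
      using s that unfolding int_sheaf_carrier by blast
    define t where "t y = (if \<exists>U\<in>\<U>. y \<in> U then s (SOME U. U \<in> \<U> \<and> y \<in> U) y else 0)" for y
    have t: "t y = s U y" if "U \<in> \<U>" "y \<in> U" for U y
    proof -
      define U' where "U' = (SOME U. U \<in> \<U> \<and> y \<in> U)"
      have U': "U' \<in> \<U>" "y \<in> U'"
        using someI[of "\<lambda>U. U \<in> \<U> \<and> y \<in> U" U] that by (simp_all add: U'_def)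
      have "t y = s U' y" using that unfolding t_def U'_def by (metis (no_types, lifting))
      also have "\<dots> = s U y" by (rule comp'[OF U'(1) that(1) U'(2) that(2)])
      finally show ?thesis .
    qed
    have t0: "t y = 0" if y: "y \<notin> \<Union>\<U> \<inter> V" for y
    proof (cases "y \<in> \<Union>\<U>")
      case True
      then obtain U where U: "U \<in> \<U>" "y \<in> U" by (rule UnionE)
      then have "t y = s U y" by (intro t)
      also have "\<dots> = 0" by (rule zero[OF U(1)]) (use y U in auto)
      finally show ?thesis .
    next
      case False
      then show ?thesis unfolding t_def by auto
    qed
    show "\<exists>!t. t \<in> carrier (sections ?Z (\<Union>\<U>)) \<and> (\<forall>U\<in>\<U>. restr ?Z (\<Union>\<U>) U t = s U)"
    proof (rule ex1I[of _ t])
      have "t \<in> carrier (sections ?Z (\<Union>\<U>))" unfolding int_sheaf_carrier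
      proof (intro conjI allI ballI impI)
        fix y assume "y \<in> \<Union>\<U>"
        then obtain U where U: "U \<in> \<U>" "y \<in> U" by blast
        have "s U \<in> carrier (sections ?Z U)" using s U by blast
        from int_sheaf_const[OF this U(2)]
        obtain N a where N: "openin X N" "y \<in> N" "N \<subseteq> U" "\<forall>z\<in>N. s U z = a" .
        have "t z = a" if "z \<in> N" for z using t[OF U(1), of z] N that by auto
        then have "\<forall>z\<in>N. t z = t y" using N(2) by simp
        then show "\<exists>N. openin X N \<and> y \<in> N \<and> N \<subseteq> \<Union>\<U> \<and> (\<forall>z\<in>N. t z = t y)" using N U by blast
      qed (rule t0)
      moreover have "restr ?Z (\<Union>\<U>) U t = s U" if "U \<in> \<U>" for U
        unfolding r using that t zero by (auto simp: fun_eq_iff)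
      ultimately show "t \<in> carrier (sections ?Z (\<Union>\<U>)) \<and> (\<forall>U\<in>\<U>. restr ?Z (\<Union>\<U>) U t = s U)" by blast
      fix u assume u: "u \<in> carrier (sections ?Z (\<Union>\<U>)) \<and> (\<forall>U\<in>\<U>. restr ?Z (\<Union>\<U>) U u = s U)"
      show "u = t"
      proof
        fix y show "u y = t y"
        proof (cases "y \<in> \<Union>\<U>")
          case True
          then obtain U where U: "U \<in> \<U>" "y \<in> U" by blast
          then have "restr ?Z (\<Union>\<U>) U u y = s U y" using u by simp
          then show ?thesis using U t unfolding r by simp
        next
          case False
          then show ?thesis using t0[of y] u by (simp add: int_sheaf_carrier)
        qed
      qed
    qed
  qed
qed (rule int_sheaf_comm_group)

context
  fixes X :: "'x topology" and J :: "('x, 'c) ab_presheaf" and V :: "'x set" and s :: 'c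
  assumes J: "ab_sheaf X J" and V: "openin X V" and s: "s \<in> carrier (sections J V)"
begin

interpretation group_presheaf X J using J by (rule group_presheaf_of_ab_sheaf)

text \<open>The homomorphism from \<open>\<int>\<^sub>V\<close> to \<open>J\<close> that sends the function \<open>1\<close> on \<open>V\<close> to \<open>s\<close>: where \<open>f\<close> takes the
  value \<open>n\<close>, its image is the \<open>n\<close>-th power of \<open>s\<close>.\<close>

definition spow :: "'x set \<Rightarrow> int \<Rightarrow> 'c" where
  "spow N n = (if n = 0 then \<one>\<^bsub>sections J N\<^esub> else restr J V N s [^]\<^bsub>sections J N\<^esub> n)"

definition int_hom :: "'x set \<Rightarrow> ('x \<Rightarrow> int) \<Rightarrow> 'c" where
  "int_hom W f = (SOME t. t \<in> sec W \<and>
     (\<forall>N n. openin X N \<longrightarrow> N \<subseteq> W \<longrightarrow> (\<forall>y\<in>N. f y = n) \<longrightarrow> (n \<noteq> 0 \<longrightarrow> N \<subseteq> V) \<longrightarrow> restr J W N t = spow N n))"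

lemma spow_carrier: "openin X N \<Longrightarrow> (n \<noteq> 0 \<Longrightarrow> N \<subseteq> V) \<Longrightarrow> spow N n \<in> sec N"
  using group.int_pow_closed[OF comm_group.axioms(2)[OF comm]] restr_carrier[OF V _ _ s] one_sec
  by (auto simp: spow_def)

lemma spow_restr:
  assumes "openin X N" "openin X M" "M \<subseteq> N" "n \<noteq> 0 \<Longrightarrow> N \<subseteq> V"
  shows "restr J N M (spow N n) = spow M n"
proof (cases "n = 0")
  case True then show ?thesis using assms by (simp add: spow_def restr_one)
next
  case False
  then have NV: "N \<subseteq> V" using assms by simp
  have "restr J N M (restr J V N s [^]\<^bsub>sections J N\<^esub> n) = restr J N M (restr J V N s) [^]\<^bsub>sections J M\<^esub> n"
    using hom_int_pow[OF restr_hom[OF assms(1,2,3)] restr_carrier[OF V assms(1) NV s]]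
      comm_group.axioms(2)[OF comm[OF assms(1)]] comm_group.axioms(2)[OF comm[OF assms(2)]] by simp
  then show ?thesis using False restr_comp[OF V assms(1,2) NV assms(3) s] by (simp add: spow_def)
qed

lemma spow_add:
  assumes "openin X N" "n \<noteq> 0 \<Longrightarrow> N \<subseteq> V" "m \<noteq> 0 \<Longrightarrow> N \<subseteq> V"
  shows "spow N (n + m) = spow N n \<otimes>\<^bsub>sections J N\<^esub> spow N m"
proof -
  interpret S: comm_group "sections J N" by (rule comm[OF assms(1)])
  show ?thesis
  proof (cases "N \<subseteq> V")
    case True
    then have r: "restr J V N s \<in> sec N" using restr_carrier[OF V assms(1) _ s] by simp
    then have "spow N k = restr J V N s [^]\<^bsub>sections J N\<^esub> k" for k by (simp add: spow_def)
    then show ?thesis using S.int_pow_mult[OF r] by simp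
  qed (use assms in \<open>auto simp: spow_def\<close>)
qed

lemma int_hom_ex:
  assumes W: "openin X W" and f: "f \<in> carrier (sections (int_sheaf X V) W)"
  shows "int_hom W f \<in> sec W"
    and "\<And>N n. openin X N \<Longrightarrow> N \<subseteq> W \<Longrightarrow> (\<And>y. y \<in> N \<Longrightarrow> f y = n) \<Longrightarrow> (n \<noteq> 0 \<Longrightarrow> N \<subseteq> V) \<Longrightarrow>
      restr J W N (int_hom W f) = spow N n"
proof -
  define L where "L n = {y \<in> W. f y = n}" for n
  have LV: "L n \<subseteq> V" if "n \<noteq> 0" for n using f that by (auto simp: L_def int_sheaf_carrier)
  have Lop: "openin X (L n)" for n
  proof (subst openin_subopen, intro ballI)
    fix y assume y: "y \<in> L n"
    then have "y \<in> W" by (simp add: L_def)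
    from int_sheaf_const[OF f this]
    obtain N a where N: "openin X N" "y \<in> N" "N \<subseteq> W" "\<forall>z\<in>N. f z = a" .
    have "a = n" using N(2,4) y by (auto simp: L_def)
    then show "\<exists>T. openin X T \<and> y \<in> T \<and> T \<subseteq> L n" using y N by (intro exI[of _ N]) (auto simp: L_def)
  qed
  have Lun: "(\<Union>n\<in>UNIV. L n) = W" by (auto simp: L_def)
  have comp: "restr J (L n) (L n \<inter> L m) (spow (L n) n) = restr J (L m) (L n \<inter> L m) (spow (L m) m)" for n m
  proof (cases "n = m")
    case False
    then have e: "L n \<inter> L m = {}" by (auto simp: L_def)
    have "restr J (L k) {} (spow (L k) k) \<in> sec {}" for k
      using spow_carrier[OF Lop] LV Lop by (intro restr_carrier) auto
    then show ?thesis unfolding e using sheaf_empty[OF J] by blast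
  qed simp
  obtain t where t: "t \<in> sec (\<Union>n\<in>UNIV. L n)" "\<forall>n\<in>UNIV. restr J (\<Union>n\<in>UNIV. L n) (L n) t = spow (L n) n"
    by (rule sheaf_glue[OF J, of UNIV L "\<lambda>n. spow (L n) n", OF Lop spow_carrier[OF Lop LV] comp])
  have "t \<in> sec W \<and>
     (\<forall>N n. openin X N \<longrightarrow> N \<subseteq> W \<longrightarrow> (\<forall>y\<in>N. f y = n) \<longrightarrow> (n \<noteq> 0 \<longrightarrow> N \<subseteq> V) \<longrightarrow> restr J W N t = spow N n)"
  proof (intro conjI allI impI)
    show tW: "t \<in> sec W" using t Lun by simp
    fix N n assume N: "openin X N" "N \<subseteq> W" "\<forall>y\<in>N. f y = n" "n \<noteq> 0 \<longrightarrow> N \<subseteq> V"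
    have NL: "N \<subseteq> L n" using N by (auto simp: L_def)
    have LW: "L n \<subseteq> W" by (auto simp: L_def)
    have "restr J W N t = restr J (L n) N (restr J W (L n) t)"
      using restr_comp[OF W Lop N(1) LW NL tW] by simp
    also have "\<dots> = restr J (L n) N (spow (L n) n)" using bspec[OF t(2) UNIV_I[of n]] unfolding Lun by simp
    also have "\<dots> = spow N n" by (rule spow_restr[OF Lop N(1) NL LV])
    finally show "restr J W N t = spow N n" .
  qed
  from someI[where P = "\<lambda>t. t \<in> sec W \<and>
     (\<forall>N n. openin X N \<longrightarrow> N \<subseteq> W \<longrightarrow> (\<forall>y\<in>N. f y = n) \<longrightarrow> (n \<noteq> 0 \<longrightarrow> N \<subseteq> V) \<longrightarrow> restr J W N t = spow N n)", OF this]
  have *: "int_hom W f \<in> sec W \<and>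
     (\<forall>N n. openin X N \<longrightarrow> N \<subseteq> W \<longrightarrow> (\<forall>y\<in>N. f y = n) \<longrightarrow> (n \<noteq> 0 \<longrightarrow> N \<subseteq> V) \<longrightarrow> restr J W N (int_hom W f) = spow N n)"
    unfolding int_hom_def .
  then show "int_hom W f \<in> sec W" by simp
  show "restr J W N (int_hom W f) = spow N n"
    if "openin X N" "N \<subseteq> W" "\<And>y. y \<in> N \<Longrightarrow> f y = n" "n \<noteq> 0 \<Longrightarrow> N \<subseteq> V" for N n
    using * that by simp
qed

lemma int_hom_hom: "sheaf_hom X (int_sheaf X V) J int_hom"
  unfolding sheaf_hom_def
proof (intro conjI allI impI ballI)
  let ?Z = "int_sheaf X V"
  have NV: "N \<subseteq> V" if "f \<in> carrier (sections ?Z W)" "\<And>z. z \<in> N \<Longrightarrow> f z = a" "a \<noteq> 0" for f W N a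
  proof
    fix z assume "z \<in> N"
    then have "f z \<noteq> 0" using that by simp
    then show "z \<in> V" using that(1) by (auto simp: int_sheaf_carrier)
  qed
  fix W assume W: "openin X W"
  show "int_hom W \<in> hom (sections ?Z W) (sections J W)"
  proof (rule homI)
    fix f g assume f: "f \<in> carrier (sections ?Z W)" and g: "g \<in> carrier (sections ?Z W)"
    let ?h = "f \<otimes>\<^bsub>sections ?Z W\<^esub> g"
    have h: "?h \<in> carrier (sections ?Z W)"
      using monoid.m_closed[OF group.is_monoid[OF comm_group.axioms(2)[OF int_sheaf_comm_group[OF W]]] f g] .
    have hv: "?h y = f y + g y" for y by (simp add: int_sheaf_def)
    show "int_hom W ?h = int_hom W f \<otimes>\<^bsub>sections J W\<^esub> int_hom W g"
    proof (rule sheaf_eqI[OF J W])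
      show "int_hom W ?h \<in> sec W" by (rule int_hom_ex(1)[OF W h])
      show "int_hom W f \<otimes>\<^bsub>sections J W\<^esub> int_hom W g \<in> sec W"
        by (rule mult_sec[OF W int_hom_ex(1)[OF W f] int_hom_ex(1)[OF W g]])
      fix y assume "y \<in> W"
      from int_sheaf_const2[OF f g this]
      obtain N a c where N: "openin X N" "y \<in> N" "N \<subseteq> W" "\<forall>z\<in>N. f z = a" "\<forall>z\<in>N. g z = c" .
      note N4 = bspec[OF N(4)] and N5 = bspec[OF N(5)]
      note fV = NV[OF f N4] and gV = NV[OF g N5]
      have hac: "?h z = a + c" if "z \<in> N" for z using N4[OF that] N5[OF that] by (simp add: hv)
      have "restr J W N (int_hom W ?h) = spow N (a + c)"
        by (rule int_hom_ex(2)[OF W h N(1,3) hac NV[OF h hac]])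
      also have "\<dots> = spow N a \<otimes>\<^bsub>sections J N\<^esub> spow N c" by (rule spow_add[OF N(1) fV gV])
      also have "spow N a = restr J W N (int_hom W f)" by (rule int_hom_ex(2)[OF W f N(1,3) N4 fV, symmetric])
      also have "spow N c = restr J W N (int_hom W g)" by (rule int_hom_ex(2)[OF W g N(1,3) N5 gV, symmetric])
      finally have "restr J W N (int_hom W ?h) = restr J W N (int_hom W f \<otimes>\<^bsub>sections J W\<^esub> int_hom W g)"
        using restr_mult[OF W N(1,3) int_hom_ex(1)[OF W f] int_hom_ex(1)[OF W g]] by simp
      then show "\<exists>N. openin X N \<and> y \<in> N \<and> N \<subseteq> W \<and>
        restr J W N (int_hom W ?h) = restr J W N (int_hom W f \<otimes>\<^bsub>sections J W\<^esub> int_hom W g)"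
        using N by blast
    qed
  qed (rule int_hom_ex(1)[OF W])
  fix W' f assume W': "openin X W'" "W' \<subseteq> W" and f: "f \<in> carrier (sections ?Z W)"
  let ?g = "restr ?Z W W' f"
  have g: "?g \<in> carrier (sections ?Z W')" using int_sheaf_restr[OF W' f] by (simp add: int_sheaf_def)
  have gv: "?g y = f y" if "y \<in> W'" for y using that by (simp add: int_sheaf_def)
  show "restr J W W' (int_hom W f) = int_hom W' ?g"
  proof (rule sheaf_eqI[OF J W'(1)])
    show "restr J W W' (int_hom W f) \<in> sec W'" using restr_carrier[OF W W' int_hom_ex(1)[OF W f]] .
    show "int_hom W' ?g \<in> sec W'" by (rule int_hom_ex(1)[OF W'(1) g])
    fix y assume y: "y \<in> W'"
    from int_sheaf_const[OF g y]
    obtain N a where N: "openin X N" "y \<in> N" "N \<subseteq> W'" "\<forall>z\<in>N. ?g z = a" .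
    note N4 = bspec[OF N(4)]
    note V' = NV[OF g N4]
    have NW: "N \<subseteq> W" using N W' by blast
    have fa: "f z = a" if "z \<in> N" for z using N4[OF that] gv[of z] N(3) that by auto
    have "restr J W N (int_hom W f) = spow N a"
      by (rule int_hom_ex(2)[OF W f N(1) NW fa V'])
    also have "\<dots> = restr J W' N (int_hom W' ?g)" by (rule int_hom_ex(2)[OF W'(1) g N(1,3) N4 V', symmetric])
    finally show "\<exists>N. openin X N \<and> y \<in> N \<and> N \<subseteq> W' \<and>
       restr J W' N (restr J W W' (int_hom W f)) = restr J W' N (int_hom W' ?g)"
      using N restr_comp[OF W W'(1) N(1) W'(2) N(3) int_hom_ex(1)[OF W f]] by auto
  qed
qed

end

text \<open>A section \<open>s\<close> over \<open>V\<close> is a homomorphism from \<open>\<int>\<^sub>V\<close> to \<open>J\<close>.  By injectivity it extends to \<open>\<int>\<^sub>X\<close>, and the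
  value of the extension at the function \<open>1\<close> is a global section that restricts to \<open>s\<close>.\<close>

theorem injective_flasque:
  assumes inj: "injective_sheaf X J" and V: "openin X V" and s: "s \<in> carrier (sections J V)"
  obtains t where "t \<in> carrier (sections J (topspace X))" "restr J (topspace X) V t = s"
proof -
  have J: "ab_sheaf X J" using inj by (simp add: injective_sheaf_def)
  interpret group_presheaf X J using J by (rule group_presheaf_of_ab_sheaf)
  let ?A = "int_sheaf X V" and ?B = "int_sheaf X (topspace X)" and ?f = "int_hom X J V s"
  have sub: "carrier (sections ?A U) \<subseteq> carrier (sections ?B U)" if "openin X U" for U
  proof
    fix f assume f: "f \<in> carrier (sections ?A U)"
    have "f y = 0" if "y \<notin> U \<inter> topspace X" for y
    proof -
      have "y \<notin> U \<inter> V" using that openin_subset[OF \<open>openin X U\<close>] by blast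
      then show ?thesis using f by (simp add: int_sheaf_carrier)
    qed
    then show "f \<in> carrier (sections ?B U)" using f by (simp add: int_sheaf_carrier)
  qed
  have i: "sheaf_hom X ?A ?B (\<lambda>U f. f)"
    using sub by (auto simp: sheaf_hom_def hom_def) (auto simp: int_sheaf_def)
  have ii: "\<forall>U. openin X U \<longrightarrow> inj_on ((\<lambda>U f. f) U) (carrier (sections ?A U))" by simp
  have f: "sheaf_hom X ?A J ?f" by (rule int_hom_hom[OF J V s])
  obtain g where g: "sheaf_hom X ?B J g"
    and gf': "\<forall>U. openin X U \<longrightarrow> (\<forall>t\<in>carrier (sections ?A U). g U t = ?f U t)"
    using mp[OF mp[OF mp[OF mp[OF mp[OF spec[OF spec[OF spec[OF spec[OF
      conjunct2[OF inj[unfolded injective_sheaf_def]], of ?A], of ?B], of "\<lambda>U f. f"], of ?f]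
      int_sheaf_ab_sheaf] int_sheaf_ab_sheaf] i] ii] f] by (elim exE conjE)
  have gf: "g U t = ?f U t" if "openin X U" "t \<in> carrier (sections ?A U)" for U t
    using gf' that by simp
  let ?one = "\<lambda>U y. if y \<in> U then 1 else (0::int)"
  have 1: "?one (topspace X) \<in> carrier (sections ?B (topspace X))"
    by (auto simp: int_sheaf_carrier)
  have 2: "?one V \<in> carrier (sections ?A V)" using V by (auto simp: int_sheaf_carrier)
  have VX: "V \<subseteq> topspace X" using openin_subset[OF V] .
  have "restr ?B (topspace X) V (?one (topspace X)) = ?one V" using VX by (auto simp: int_sheaf_def fun_eq_iff)
  moreover have "restr J (topspace X) V (g (topspace X) (?one (topspace X))) =
    g V (restr ?B (topspace X) V (?one (topspace X)))"
    using g[unfolded sheaf_hom_def] V VX 1 by simp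
  ultimately have "restr J (topspace X) V (g (topspace X) (?one (topspace X))) = g V (?one V)"
    by simp
  also have "\<dots> = ?f V (?one V)" by (rule gf[OF V 2])
  also have "\<dots> = restr J V V (?f V (?one V))"
    using restr_id[OF V int_hom_ex(1)[OF J V s V 2]] by simp
  also have "\<dots> = spow J V s V 1" by (rule int_hom_ex(2)[OF J V s V 2 V]) auto
  also have "\<dots> = s"
    using group.int_pow_1[OF comm_group.axioms(2)[OF comm[OF V]] s] s V by (simp add: spow_def[OF J V s] restr_id)
  finally have "restr J (topspace X) V (g (topspace X) (?one (topspace X))) = s" .
  moreover have "g (topspace X) (?one (topspace X)) \<in> sec (topspace X)"
    using g 1 by (auto simp: sheaf_hom_def hom_def)
  ultimately show thesis using that by blast
qed

section \<open>Local cohomology in terms of global sections\<close>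

locale injective_complex = noetherian_sober X for X :: "'x topology" +
  fixes I :: "('x, 'c) sheaf_complex"
  assumes inj: "injective_sheaf X (obj I n)"
    and diff_hom: "sheaf_hom X (obj I n) (obj I (Suc n)) (diff I n)"
    and diff_diff: "openin X U \<Longrightarrow> s \<in> carrier (sections (obj I n) U) \<Longrightarrow>
        diff I (Suc n) U (diff I n U s) = \<one>\<^bsub>sections (obj I (Suc (Suc n))) U\<^esub>"
begin

abbreviation T :: "'x set" where "T \<equiv> topspace X"
abbreviation J :: "nat \<Rightarrow> ('x, 'c) ab_presheaf" where "J n \<equiv> obj I n"
abbreviation Gs :: "nat \<Rightarrow> 'c monoid" where "Gs n \<equiv> sections (J n) T"
abbreviation dg :: "nat \<Rightarrow> 'c \<Rightarrow> 'c" where "dg n s \<equiv> diff I n T s"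
abbreviation gm :: "nat \<Rightarrow> 'x \<Rightarrow> 'c \<Rightarrow> ('x set \<times> 'c) set" where "gm n x s \<equiv> germ X (J n) x T s"

lemma J_sheaf: "ab_sheaf X (J n)" using inj by (simp add: injective_sheaf_def)

lemma J_presheaf: "group_presheaf X (J n)" by (rule group_presheaf_of_ab_sheaf[OF J_sheaf])

sublocale Jp: group_presheaf X "J n" for n by (rule J_presheaf)

lemma G_comm: "comm_group (Gs n)" by (rule Jp.comm[OF openin_topspace])

sublocale Gc: comm_group "Gs n" for n by (rule G_comm)

lemma dg_hom: "dg n \<in> hom (Gs n) (Gs (Suc n))"
  using diff_hom[of n] by (simp add: sheaf_hom_def)

lemma dg_carrier: "s \<in> carrier (Gs n) \<Longrightarrow> dg n s \<in> carrier (Gs (Suc n))"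
  using dg_hom by (auto simp: hom_def)

lemma dg_mult: "s \<in> carrier (Gs n) \<Longrightarrow> t \<in> carrier (Gs n) \<Longrightarrow>
    dg n (s \<otimes>\<^bsub>Gs n\<^esub> t) = dg n s \<otimes>\<^bsub>Gs (Suc n)\<^esub> dg n t"
  using dg_hom by (auto simp: hom_def)

lemma dg_one: "dg n \<one>\<^bsub>Gs n\<^esub> = \<one>\<^bsub>Gs (Suc n)\<^esub>"
  by (rule hom_one_comm[OF G_comm G_comm dg_hom])

lemma dg_inv: "s \<in> carrier (Gs n) \<Longrightarrow> dg n (inv\<^bsub>Gs n\<^esub> s) = inv\<^bsub>Gs (Suc n)\<^esub> dg n s"
  by (rule hom_inv_comm[OF G_comm G_comm dg_hom])

lemma dg_dg: "s \<in> carrier (Gs n) \<Longrightarrow> dg (Suc n) (dg n s) = \<one>\<^bsub>Gs (Suc (Suc n))\<^esub>"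
  by (rule diff_diff[OF openin_topspace])

lemma gm_eq_iff:
  assumes "x \<in> T" "s \<in> carrier (Gs n)" "t \<in> carrier (Gs n)"
  shows "gm n x s = gm n x t \<longleftrightarrow> (\<exists>W. openin X W \<and> x \<in> W \<and> restr (J n) T W s = restr (J n) T W t)"
  using Jp.germ_eq_iff[OF openin_topspace openin_topspace assms] openin_subset by (metis Int_absorb)

lemma gm_eqE:
  assumes "x \<in> T" "s \<in> carrier (Gs n)" "t \<in> carrier (Gs n)" "gm n x s = gm n x t"
  obtains W where "openin X W" "x \<in> W" "restr (J n) T W s = restr (J n) T W t"
  using iffD1[OF gm_eq_iff[OF assms(1-3)] assms(4)] by (elim exE conjE)

lemma gm_eqI:
  assumes "s \<in> carrier (Gs n)" "t \<in> carrier (Gs n)" "openin X W" "x \<in> W" "restr (J n) T W s = restr (J n) T W t"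
  shows "gm n x s = gm n x t"
proof -
  have "x \<in> T" using openin_subset[OF assms(3)] assms(4) by (rule subsetD)
  then show ?thesis by (rule iffD2[OF gm_eq_iff[OF _ assms(1,2)]]) (intro exI[of _ W] conjI assms(3-5))
qed

lemma gm_mult: "x \<in> T \<Longrightarrow> s \<in> carrier (Gs n) \<Longrightarrow> t \<in> carrier (Gs n) \<Longrightarrow>
    gm n x (s \<otimes>\<^bsub>Gs n\<^esub> t) = gm n x s \<otimes>\<^bsub>stalk X (J n) x\<^esub> gm n x t"
  by (rule Jp.stalk_mult_germ[OF openin_topspace, symmetric])

lemma gm_one: "x \<in> T \<Longrightarrow> gm n x \<one>\<^bsub>Gs n\<^esub> = \<one>\<^bsub>stalk X (J n) x\<^esub>"
  by (rule Jp.stalk_one[OF openin_topspace, symmetric])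

lemma gm_inv: "x \<in> T \<Longrightarrow> s \<in> carrier (Gs n) \<Longrightarrow>
    gm n x (inv\<^bsub>Gs n\<^esub> s) = inv\<^bsub>stalk X (J n) x\<^esub> gm n x s"
  by (rule Jp.stalk_inv_germ[OF openin_topspace, symmetric])

lemma gm_carrier: "x \<in> T \<Longrightarrow> s \<in> carrier (Gs n) \<Longrightarrow> gm n x s \<in> carrier (stalk X (J n) x)"
  by (rule Jp.germ_carrier[OF openin_topspace])

lemma stalk_J_comm: "x \<in> T \<Longrightarrow> comm_group (stalk X (J n) x)"
  by (rule Jp.stalk_comm_group)

lemma gm_hom: "x \<in> T \<Longrightarrow> gm n x \<in> hom (Gs n) (stalk X (J n) x)"
  by (rule homI) (simp_all add: gm_mult gm_carrier)

lemma gm_dg: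
  assumes "x \<in> T" "s \<in> carrier (Gs n)" "t \<in> carrier (Gs n)" "gm n x s = gm n x t"
  shows "gm (Suc n) x (dg n s) = gm (Suc n) x (dg n t)"
proof -
  obtain W where W: "openin X W" "x \<in> W" "restr (J n) T W s = restr (J n) T W t"
    by (rule gm_eqE[OF assms])
  have nat: "restr (J (Suc n)) T W (dg n u) = diff I n W (restr (J n) T W u)" if "u \<in> carrier (Gs n)" for u
    using diff_hom[of n] W(1) openin_subset[OF W(1)] that unfolding sheaf_hom_def by simp
  show ?thesis
    by (rule gm_eqI[OF dg_carrier[OF assms(2)] dg_carrier[OF assms(3)] W(1,2)])
      (simp only: nat[OF assms(2)] nat[OF assms(3)] W(3))
qed

text \<open>\<open>Gam Z n\<close> is the group of global sections of the \<open>n\<close>-th sheaf with support in \<open>Z\<close>.\<close>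

definition supp :: "nat \<Rightarrow> 'c \<Rightarrow> 'x set" where
  "supp n s = {x \<in> T. gm n x s \<noteq> gm n x \<one>\<^bsub>Gs n\<^esub>}"

definition Gam :: "'x set \<Rightarrow> nat \<Rightarrow> 'c set" where
  "Gam Z n = {s \<in> carrier (Gs n). supp n s \<subseteq> Z}"

lemma supp_closed: "s \<in> carrier (Gs n) \<Longrightarrow> closedin X (supp n s)"
proof -
  assume s: "s \<in> carrier (Gs n)"
  have "openin X (T - supp n s)"
  proof (subst openin_subopen, intro ballI)
    fix x assume x: "x \<in> T - supp n s"
    then have "gm n x s = gm n x \<one>\<^bsub>Gs n\<^esub>" by (simp add: supp_def)
    then obtain W where W: "openin X W" "x \<in> W" "restr (J n) T W s = restr (J n) T W \<one>\<^bsub>Gs n\<^esub>"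
      using x by (elim gm_eqE[OF _ s Gc.one_closed, rotated]) (auto simp: supp_def)
    have "W \<subseteq> T - supp n s"
      using gm_eqI[OF s Gc.one_closed W(1) _ W(3)] openin_subset[OF W(1)] by (auto simp: supp_def)
    then show "\<exists>V. openin X V \<and> x \<in> V \<and> V \<subseteq> T - supp n s" using W(1,2) by (intro exI[of _ W]) simp
  qed
  then show ?thesis by (auto simp: closedin_def supp_def)
qed

lemma GamI: "s \<in> carrier (Gs n) \<Longrightarrow> (\<And>x. x \<in> T \<Longrightarrow> x \<notin> Z \<Longrightarrow> gm n x s = gm n x \<one>\<^bsub>Gs n\<^esub>) \<Longrightarrow> s \<in> Gam Z n"
  by (auto simp: Gam_def supp_def)

lemma GamD: "s \<in> Gam Z n \<Longrightarrow> s \<in> carrier (Gs n)"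
  "s \<in> Gam Z n \<Longrightarrow> x \<in> T \<Longrightarrow> x \<notin> Z \<Longrightarrow> gm n x s = gm n x \<one>\<^bsub>Gs n\<^esub>"
  by (auto simp: Gam_def supp_def)

lemma Gam_mono: "Z \<subseteq> Z' \<Longrightarrow> Gam Z n \<subseteq> Gam Z' n" by (auto simp: Gam_def)

lemma Gam_subgroup: "subgroup (Gam Z n) (Gs n)"
proof (rule subgroup_commI[OF G_comm])
  show "Gam Z n \<subseteq> carrier (Gs n)" by (auto simp: Gam_def)
  show "\<one>\<^bsub>Gs n\<^esub> \<in> Gam Z n" by (rule GamI) auto
  fix s assume s: "s \<in> Gam Z n"
  have one: "\<one>\<^bsub>stalk X (J n) x\<^esub> \<otimes>\<^bsub>stalk X (J n) x\<^esub> \<one>\<^bsub>stalk X (J n) x\<^esub> = \<one>\<^bsub>stalk X (J n) x\<^esub>"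
    "inv\<^bsub>stalk X (J n) x\<^esub> \<one>\<^bsub>stalk X (J n) x\<^esub> = \<one>\<^bsub>stalk X (J n) x\<^esub>" if "x \<in> T" for x
  proof -
    interpret comm_group "stalk X (J n) x" by (rule stalk_J_comm[OF that])
    show "\<one>\<^bsub>stalk X (J n) x\<^esub> \<otimes>\<^bsub>stalk X (J n) x\<^esub> \<one>\<^bsub>stalk X (J n) x\<^esub> = \<one>\<^bsub>stalk X (J n) x\<^esub>"
      "inv\<^bsub>stalk X (J n) x\<^esub> \<one>\<^bsub>stalk X (J n) x\<^esub> = \<one>\<^bsub>stalk X (J n) x\<^esub>" by simp_all
  qed
  show "inv\<^bsub>Gs n\<^esub> s \<in> Gam Z n"
    by (rule GamI) (use GamD[OF s] one in \<open>simp_all add: gm_inv gm_one\<close>)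
  fix t assume t: "t \<in> Gam Z n"
  show "s \<otimes>\<^bsub>Gs n\<^esub> t \<in> Gam Z n"
    by (rule GamI) (use GamD[OF s] GamD[OF t] one in \<open>simp_all add: gm_mult gm_one\<close>)
qed

lemma Gam_mult: "s \<in> Gam Z n \<Longrightarrow> t \<in> Gam Z n \<Longrightarrow> s \<otimes>\<^bsub>Gs n\<^esub> t \<in> Gam Z n"
  by (rule subgroup.m_closed[OF Gam_subgroup])
lemma Gam_inv: "s \<in> Gam Z n \<Longrightarrow> inv\<^bsub>Gs n\<^esub> s \<in> Gam Z n"
  by (rule subgroup.m_inv_closed[OF Gam_subgroup])
lemma Gam_one: "\<one>\<^bsub>Gs n\<^esub> \<in> Gam Z n"
  by (rule subgroup.one_closed[OF Gam_subgroup])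

lemma Gam_dg:
  assumes "s \<in> Gam Z n"
  shows "dg n s \<in> Gam Z (Suc n)"
proof (rule GamI)
  fix x assume x: "x \<in> T" "x \<notin> Z"
  have "gm (Suc n) x (dg n s) = gm (Suc n) x (dg n \<one>\<^bsub>Gs n\<^esub>)"
    by (rule gm_dg[OF x(1) GamD(1)[OF assms] Gc.one_closed GamD(2)[OF assms x]])
  then show "gm (Suc n) x (dg n s) = gm (Suc n) x \<one>\<^bsub>Gs (Suc n)\<^esub>" by (simp add: dg_one)
qed (use GamD(1)[OF assms] dg_carrier in auto)

abbreviation JZ :: "'x set \<Rightarrow> nat \<Rightarrow> ('x, 'c) ab_presheaf" where "JZ Z n \<equiv> with_support Z (J n)"

lemma JZ_simps:
  "carrier (sections (JZ Z n) U) = {s \<in> carrier (sections (J n) U). restr (J n) U (U - Z) s = \<one>\<^bsub>sections (J n) (U - Z)\<^esub>}"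
  "mult (sections (JZ Z n) U) = mult (sections (J n) U)" "\<one>\<^bsub>sections (JZ Z n) U\<^esub> = \<one>\<^bsub>sections (J n) U\<^esub>"
  "restr (JZ Z n) = restr (J n)"
  by (simp_all add: with_support_def)

lemma JZ_restr:
  assumes Z: "closedin X Z" and U: "openin X U" "openin X V" "V \<subseteq> U" and s: "s \<in> carrier (sections (JZ Z n) U)"
  shows "restr (J n) U V s \<in> carrier (sections (JZ Z n) V)"
proof -
  have o: "openin X (U - Z)" "openin X (V - Z)" using Z U openin_diff by auto
  have sU: "s \<in> Jp.sec n U" and s1: "restr (J n) U (U - Z) s = \<one>\<^bsub>sections (J n) (U - Z)\<^esub>" using s by (auto simp: JZ_simps)
  have VZ: "V - Z \<subseteq> V" "V - Z \<subseteq> U - Z" "U - Z \<subseteq> U" using U by auto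
  have "restr (J n) V (V - Z) (restr (J n) U V s) = restr (J n) U (V - Z) s"
    by (rule Jp.restr_comp[OF U(1,2) o(2) U(3) VZ(1) sU])
  also have "\<dots> = restr (J n) (U - Z) (V - Z) (restr (J n) U (U - Z) s)"
    by (rule Jp.restr_comp[OF U(1) o VZ(3,2) sU, symmetric])
  also have "\<dots> = \<one>\<^bsub>sections (J n) (V - Z)\<^esub>" unfolding s1 by (rule Jp.restr_one[OF o VZ(2)])
  finally show ?thesis using Jp.restr_carrier[OF U sU] by (simp add: JZ_simps)
qed

lemma JZ_subgroup:
  assumes Z: "closedin X Z" and U: "openin X U"
  shows "subgroup (carrier (sections (JZ Z n) U)) (sections (J n) U)"
proof -
  have o: "openin X (U - Z)" using Z U by (rule openin_diff[rotated])
  interpret A: comm_group "sections (J n) (U - Z)" by (rule Jp.comm[OF o])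
  interpret B: comm_group "sections (J n) U" by (rule Jp.comm[OF U])
  show ?thesis
    by (rule subgroup_commI[OF Jp.comm[OF U]])
      (auto simp: JZ_simps Jp.restr_one[OF U o] Jp.restr_mult[OF U o] Jp.restr_inv[OF U o])
qed

lemma JZ_presheaf:
  assumes Z: "closedin X Z"
  shows "group_presheaf X (JZ Z n)"
proof (rule group_presheaf.intro)
  have sub: "s \<in> carrier (sections (JZ Z n) U) \<Longrightarrow> s \<in> Jp.sec n U" for s U by (simp add: JZ_simps)
  fix U assume U: "openin X U"
  show "comm_group (sections (JZ Z n) U)"
    using comm_subgroup[OF Jp.comm[OF U] JZ_subgroup[OF Z U]] by (simp add: with_support_def)
  show "restr (JZ Z n) U U s = s" if "s \<in> carrier (sections (JZ Z n) U)" for s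
    using Jp.restr_id[OF U sub[OF that]] by (simp add: JZ_simps)
  fix V assume V: "openin X V"
  show "restr (JZ Z n) U V \<in> hom (sections (JZ Z n) U) (sections (JZ Z n) V)" if VU: "V \<subseteq> U"
    by (rule homI) (use JZ_restr[OF Z U V VU] Jp.restr_mult[OF U V VU] sub in \<open>simp_all only: JZ_simps(2,4)\<close>)
  fix W assume W: "openin X W"
  show "restr (JZ Z n) V W (restr (JZ Z n) U V s) = restr (JZ Z n) U W s"
    if "V \<subseteq> U" "W \<subseteq> V" "s \<in> carrier (sections (JZ Z n) U)" for s
    using Jp.restr_comp[OF U V W that(1,2) sub[OF that(3)]] by (simp add: JZ_simps)
qed

lemma JZ_global:
  assumes Z: "closedin X Z"
  shows "carrier (sections (JZ Z n) T) = Gam Z n"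
proof -
  have o: "openin X (T - Z)" using Z by (simp add: openin_diff)
  have "restr (J n) T (T - Z) s = \<one>\<^bsub>sections (J n) (T - Z)\<^esub> \<longleftrightarrow> (\<forall>x\<in>T - Z. gm n x s = gm n x \<one>\<^bsub>Gs n\<^esub>)"
    if s: "s \<in> carrier (Gs n)" for s
  proof
    assume a: "restr (J n) T (T - Z) s = \<one>\<^bsub>sections (J n) (T - Z)\<^esub>"
    then show "\<forall>x\<in>T - Z. gm n x s = gm n x \<one>\<^bsub>Gs n\<^esub>"
      using gm_eqI[OF s Gc.one_closed o] Jp.restr_one[OF openin_topspace o] by simp
  next
    assume a: "\<forall>x\<in>T - Z. gm n x s = gm n x \<one>\<^bsub>Gs n\<^esub>"
    show "restr (J n) T (T - Z) s = \<one>\<^bsub>sections (J n) (T - Z)\<^esub>"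
    proof (rule sheaf_eqI[OF J_sheaf o])
      show "restr (J n) T (T - Z) s \<in> Jp.sec n (T - Z)" by (rule Jp.restr_carrier[OF _ o _ s]) auto
      show "\<one>\<^bsub>sections (J n) (T - Z)\<^esub> \<in> Jp.sec n (T - Z)" by (rule Jp.one_sec[OF o])
      fix x assume x: "x \<in> T - Z"
      obtain W where W: "openin X W" "x \<in> W" "restr (J n) T W s = restr (J n) T W \<one>\<^bsub>Gs n\<^esub>"
        by (rule gm_eqE[OF _ s Gc.one_closed bspec[OF a x]]) (use x in simp_all)
      let ?N = "W \<inter> (T - Z)"
      have N: "openin X ?N" "?N \<subseteq> W" "?N \<subseteq> T - Z" "W \<subseteq> T" using W(1) o openin_subset[OF W(1)] by auto
      have "restr (J n) (T - Z) ?N (restr (J n) T (T - Z) s) = restr (J n) T ?N s"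
        by (rule Jp.restr_comp[OF openin_topspace o N(1) _ N(3) s]) auto
      also have "\<dots> = restr (J n) W ?N (restr (J n) T W s)"
        by (rule Jp.restr_comp[OF openin_topspace W(1) N(1) N(4,2) s, symmetric])
      also have "\<dots> = \<one>\<^bsub>sections (J n) ?N\<^esub>"
        unfolding W(3) Jp.restr_one[OF openin_topspace W(1) N(4)] by (rule Jp.restr_one[OF W(1) N(1,2)])
      also have "\<dots> = restr (J n) (T - Z) ?N \<one>\<^bsub>sections (J n) (T - Z)\<^esub>"
        by (rule Jp.restr_one[OF o N(1,3), symmetric])
      finally show "\<exists>N. openin X N \<and> x \<in> N \<and> N \<subseteq> T - Z \<and>
        restr (J n) (T - Z) N (restr (J n) T (T - Z) s) = restr (J n) (T - Z) N \<one>\<^bsub>sections (J n) (T - Z)\<^esub>"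
        using N(1,3) x W(2) by (intro exI[of _ ?N] conjI) simp_all
    qed
  qed
  then show ?thesis by (auto simp: JZ_simps Gam_def supp_def)
qed

text \<open>A section of an injective sheaf with support in \<open>Z\<close> extends to a global section with support in
  \<open>Z\<close>: glue it with the trivial section outside \<open>Z\<close> before extending.\<close>

lemma JZ_extend:
  assumes Z: "closedin X Z" and U: "openin X U" and s: "s \<in> carrier (sections (JZ Z n) U)"
  obtains t where "t \<in> Gam Z n" "restr (J n) T U t = s"
proof -
  have sU: "s \<in> Jp.sec n U" and s1: "restr (J n) U (U - Z) s = \<one>\<^bsub>sections (J n) (U - Z)\<^esub>" using s by (auto simp: JZ_simps)
  let ?O = "T - Z"
  have o: "openin X ?O" using Z by (simp add: openin_diff)
  have oU: "openin X (U - Z)" using Z U by (rule openin_diff[rotated])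
  have UT: "U \<subseteq> T" by (rule openin_subset[OF U])
  have UZ: "U \<inter> ?O = U - Z" "?O \<inter> U = U - Z" using UT by auto
  define c where "c b = (if b then U else ?O)" for b
  define s' where "s' b = (if b then s else \<one>\<^bsub>sections (J n) ?O\<^esub>)" for b
  have "restr (J n) ?O (U - Z) \<one>\<^bsub>sections (J n) ?O\<^esub> = \<one>\<^bsub>sections (J n) (U - Z)\<^esub>"
    using UT by (intro Jp.restr_one[OF o oU]) auto
  then have comp: "restr (J n) (c i) (c i \<inter> c j) (s' i) = restr (J n) (c j) (c i \<inter> c j) (s' j)" for i j
    using s1 by (auto simp: c_def s'_def UZ)
  have co: "openin X (c b)" "s' b \<in> Jp.sec n (c b)" for b
    using U o sU Jp.one_sec[OF o] by (simp_all add: c_def s'_def)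
  obtain u where u: "u \<in> Jp.sec n (\<Union>b\<in>UNIV. c b)" "\<forall>b\<in>UNIV. restr (J n) (\<Union>b\<in>UNIV. c b) (c b) u = s' b"
    by (rule sheaf_glue[OF J_sheaf, of UNIV c s', OF co comp])
  have cu: "(\<Union>b\<in>UNIV. c b) = U \<union> ?O" by (auto simp: c_def)
  have oo: "openin X (U \<union> ?O)" using U o by blast
  obtain t where t: "t \<in> carrier (Gs n)" "restr (J n) T (U \<union> ?O) t = u"
    using injective_flasque[OF inj oo] u(1) unfolding cu by blast
  have UO: "U \<union> ?O \<subseteq> T" using UT by auto
  have r: "restr (J n) T V t = restr (J n) (U \<union> ?O) V u" if "openin X V" "V \<subseteq> U \<union> ?O" for V
    using Jp.restr_comp[OF openin_topspace oo that(1) UO that(2) t(1)] t(2) by simp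
  have "restr (J n) T U t = s" using r[OF U] bspec[OF u(2) UNIV_I[of True]] unfolding cu by (simp add: c_def s'_def)
  moreover have "restr (J n) T ?O t = \<one>\<^bsub>sections (J n) ?O\<^esub>"
    using r[OF o] bspec[OF u(2) UNIV_I[of False]] unfolding cu by (simp add: c_def s'_def)
  then have "t \<in> Gam Z n" using t(1) JZ_global[OF Z, of n] by (auto simp: JZ_simps)
  ultimately show thesis using that by blast
qed

text \<open>The restriction of \<open>s\<close> to \<open>V\<close> has support in \<open>Z\<close>, so it extends to a global section with support in \<open>Z\<close>.\<close>

lemma truncate:
  assumes Z: "closedin X Z" and s: "s \<in> carrier (Gs n)" and V: "openin X V" "x \<in> V" "supp n s \<inter> V \<subseteq> Z"
  obtains t where "t \<in> Gam Z n" "gm n x t = gm n x s"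
proof -
  have VT: "V \<subseteq> T" by (rule openin_subset[OF V(1)])
  have o: "openin X (V - Z)" using Z V by (intro openin_diff)
  have "restr (J n) T (V - Z) s = \<one>\<^bsub>sections (J n) (V - Z)\<^esub>"
  proof -
    have "s \<in> Gam (Z \<union> (T - V)) n"
      using V(3) by (intro GamI[OF s]) (auto simp: supp_def)
    moreover have cc: "closedin X (Z \<union> (T - V))" using Z V by auto
    ultimately have 1: "restr (J n) T (T - (Z \<union> (T - V))) s = \<one>\<^bsub>sections (J n) (T - (Z \<union> (T - V)))\<^esub>"
      using JZ_global[OF cc, of n] by (auto simp: JZ_simps)
    have "T - (Z \<union> (T - V)) = V - Z" using VT by auto
    then show ?thesis using 1 by simp
  qed
  then have "restr (J n) V (V - Z) (restr (J n) T V s) = \<one>\<^bsub>sections (J n) (V - Z)\<^esub>"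
    using Jp.restr_comp[OF openin_topspace V(1) o VT _ s] by auto
  then have "restr (J n) T V s \<in> carrier (sections (JZ Z n) V)"
    using Jp.restr_carrier[OF openin_topspace V(1) VT s] by (simp add: JZ_simps)
  then obtain t where t: "t \<in> Gam Z n" "restr (J n) T V t = restr (J n) T V s"
    using JZ_extend[OF Z V(1)] by blast
  moreover have "gm n x t = gm n x s"
    by (rule gm_eqI[OF GamD(1)[OF t(1)] s V(1,2) t(2)])
  ultimately show thesis using that by blast
qed

abbreviation S :: "'x set \<Rightarrow> 'x \<Rightarrow> ('x set \<times> 'c) set cochain_complex" where
  "S Z x \<equiv> stalk_complex X (supp_complex Z I) x"

abbreviation zg :: "'x set \<Rightarrow> nat \<Rightarrow> 'x \<Rightarrow> 'c \<Rightarrow> ('x set \<times> 'c) set" where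
  "zg Z n x s \<equiv> germ X (JZ Z n) x T s"

lemma S_grp: "grp (S Z x) n = stalk X (JZ Z n) x"
  and S_cobd: "cobd (S Z x) n = stalk_map X (JZ Z (Suc n)) x (diff I n)"
  by (simp_all add: stalk_complex_def supp_complex_def)

lemma zg_surj:
  assumes Z: "closedin X Z" and x: "x \<in> T" and A: "A \<in> carrier (stalk X (JZ Z n) x)"
  obtains t where "t \<in> Gam Z n" "A = zg Z n x t"
proof -
  interpret P: group_presheaf X "JZ Z n" by (rule JZ_presheaf[OF Z])
  obtain U s where U: "openin X U" "x \<in> U" "s \<in> P.sec U" "A = germ X (JZ Z n) x U s"
    using A by (rule P.stalk_obtain)
  obtain t where t: "t \<in> Gam Z n" "restr (J n) T U t = s" using JZ_extend[OF Z U(1,3)] .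
  have "zg Z n x t = A"
    using P.germ_restr[OF openin_topspace U(1,2) openin_subset[OF U(1)], of t] t U(4) JZ_global[OF Z]
    by (simp only: JZ_simps(4))
  then show thesis using that t by blast
qed

lemma zg_eq_iff:
  assumes Z: "closedin X Z" and x: "x \<in> T" and st: "s \<in> Gam Z n" "t \<in> Gam Z n"
  shows "zg Z n x s = zg Z n x t \<longleftrightarrow> gm n x s = gm n x t"
proof -
  interpret P: group_presheaf X "JZ Z n" by (rule JZ_presheaf[OF Z])
  show ?thesis
    using P.germ_eq_iff[OF openin_topspace openin_topspace x, of s t]
      Jp.germ_eq_iff[OF openin_topspace openin_topspace x GamD(1)[OF st(1)] GamD(1)[OF st(2)]]
      st JZ_global[OF Z] by (simp add: JZ_simps(4))
qed

lemma zg_carrier: "closedin X Z \<Longrightarrow> x \<in> T \<Longrightarrow> s \<in> Gam Z n \<Longrightarrow> zg Z n x s \<in> carrier (stalk X (JZ Z n) x)"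
  using group_presheaf.germ_carrier[OF JZ_presheaf openin_topspace] JZ_global by metis

lemma zg_mult: "closedin X Z \<Longrightarrow> x \<in> T \<Longrightarrow> s \<in> Gam Z n \<Longrightarrow> t \<in> Gam Z n \<Longrightarrow>
   zg Z n x s \<otimes>\<^bsub>stalk X (JZ Z n) x\<^esub> zg Z n x t = zg Z n x (s \<otimes>\<^bsub>Gs n\<^esub> t)"
  using group_presheaf.stalk_mult_germ[OF JZ_presheaf openin_topspace, of Z x s n t] JZ_global[of Z n]
  by (simp add: JZ_simps(2))

lemma zg_one: "closedin X Z \<Longrightarrow> x \<in> T \<Longrightarrow> \<one>\<^bsub>stalk X (JZ Z n) x\<^esub> = zg Z n x \<one>\<^bsub>Gs n\<^esub>"
  using group_presheaf.stalk_one[OF JZ_presheaf openin_topspace, of Z x n] by (simp add: JZ_simps(3))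

lemma JZ_diff_hom:
  assumes Z: "closedin X Z"
  shows "sheaf_hom X (JZ Z n) (JZ Z (Suc n)) (diff I n)"
  unfolding sheaf_hom_def
proof (intro conjI allI impI ballI)
  fix U assume U: "openin X U"
  have o: "openin X (U - Z)" using Z U by (rule openin_diff[rotated])
  have h: "diff I n U \<in> hom (sections (J n) U) (sections (J (Suc n)) U)" 
    if "openin X U" for U using diff_hom[of n] that by (simp add: sheaf_hom_def)
  have nat: "restr (J (Suc n)) U V (diff I n U s) = diff I n V (restr (J n) U V s)"
    if "openin X V" "V \<subseteq> U" "s \<in> Jp.sec n U" for V s
    using diff_hom[of n] that U by (simp add: sheaf_hom_def)
  show "diff I n U \<in> hom (sections (JZ Z n) U) (sections (JZ Z (Suc n)) U)"
  proof (rule homI)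
    fix s assume s: "s \<in> carrier (sections (JZ Z n) U)"
    then have sU: "s \<in> Jp.sec n U" and s1: "restr (J n) U (U - Z) s = \<one>\<^bsub>sections (J n) (U - Z)\<^esub>" by (auto simp: JZ_simps)
    have "restr (J (Suc n)) U (U - Z) (diff I n U s) = \<one>\<^bsub>sections (J (Suc n)) (U - Z)\<^esub>"
      using nat[OF o _ sU] s1 hom_one_comm[OF Jp.comm[OF o] Jp.comm[OF o] h[OF o]] by auto
    then show "diff I n U s \<in> carrier (sections (JZ Z (Suc n)) U)"
      using h[OF U] sU by (auto simp: JZ_simps hom_def)
    fix t assume "t \<in> carrier (sections (JZ Z n) U)"
    then show "diff I n U (s \<otimes>\<^bsub>sections (JZ Z n) U\<^esub> t) = diff I n U s \<otimes>\<^bsub>sections (JZ Z (Suc n)) U\<^esub> diff I n U t"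
      using h[OF U] sU by (simp add: JZ_simps hom_def)
  qed
  fix V s assume "openin X V" "V \<subseteq> U" "s \<in> carrier (sections (JZ Z n) U)"
  then show "restr (JZ Z (Suc n)) U V (diff I n U s) = diff I n V (restr (JZ Z n) U V s)"
    using nat[of V s] by (simp add: JZ_simps)
qed

lemma S_cobd_zg:
  assumes Z: "closedin X Z" and x: "x \<in> T" and s: "s \<in> Gam Z n"
  shows "cobd (S Z x) n (zg Z n x s) = zg Z (Suc n) x (dg n s)"
  unfolding S_cobd
  by (rule stalk_map_germ_hom[OF JZ_presheaf[OF Z] JZ_presheaf[OF Z] JZ_diff_hom[OF Z] openin_topspace x])
    (use s JZ_global[OF Z] in auto)

lemma S_complex:
  assumes Z: "closedin X Z" and x: "x \<in> T"
  shows "group_complex (S Z x)"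
proof (rule group_complex.intro)
  show "comm_group (grp (S Z x) n)" for n
    unfolding S_grp by (rule group_presheaf.stalk_comm_group[OF JZ_presheaf[OF Z] x])
  show "cobd (S Z x) n \<in> hom (grp (S Z x) n) (grp (S Z x) (Suc n))" for n
    unfolding S_grp S_cobd by (rule stalk_map_hom[OF JZ_presheaf[OF Z] JZ_presheaf[OF Z] JZ_diff_hom[OF Z]])
  fix n z assume "z \<in> carrier (grp (S Z x) n)"
  then obtain s where "s \<in> Gam Z n" "z = zg Z n x s" unfolding S_grp by (rule zg_surj[OF Z x])
  then show "cobd (S Z x) (Suc n) (cobd (S Z x) n z) = \<one>\<^bsub>grp (S Z x) (Suc (Suc n))\<^esub>"
    using dg_dg[OF GamD(1)] by (simp add: S_cobd_zg[OF Z x] Gam_dg S_grp zg_one[OF Z x])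
qed

abbreviation H :: "nat \<Rightarrow> 'x \<Rightarrow> ('x set \<times> 'c) set set monoid" where "H p \<eta> \<equiv> local_cohomology X I p \<eta>"

lemma cl_closed: "closedin X (cl x)" by simp

lemma H_comm_group: "\<eta> \<in> T \<Longrightarrow> comm_group (H p \<eta>)"
  unfolding local_cohomology_def by (rule group_complex.cohomology_comm_group[OF S_complex[OF cl_closed]])

text \<open>As germs of sections with support extend to global ones, a class in \<open>H\<^sup>p\<close> at \<open>\<eta>\<close> comes from a global
  section with support in the closure of \<open>\<eta>\<close> whose differential vanishes at \<open>\<eta>\<close>, and a coboundary from the
  differential of a global section with support there.\<close>

definition Rep :: "nat \<Rightarrow> 'x \<Rightarrow> 'c set" where
  "Rep p \<eta> = {s \<in> Gam (cl \<eta>) p. gm (Suc p) \<eta> (dg p s) = gm (Suc p) \<eta> \<one>\<^bsub>Gs (Suc p)\<^esub>}"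

definition Bd :: "nat \<Rightarrow> 'x \<Rightarrow> 'c set" where
  "Bd p \<eta> = (case p of 0 \<Rightarrow> {\<one>\<^bsub>Gs 0\<^esub>} | Suc q \<Rightarrow> dg q ` Gam (cl \<eta>) q)"

definition cls :: "nat \<Rightarrow> 'x \<Rightarrow> 'c \<Rightarrow> ('x set \<times> 'c) set set" where
  "cls p \<eta> s = cohomology_class (S (cl \<eta>) \<eta>) p (zg (cl \<eta>) p \<eta> s)"

lemma Bd_D: "D \<in> Bd p \<eta> \<Longrightarrow> D \<in> Gam (cl \<eta>) p \<and> dg p D = \<one>\<^bsub>Gs (Suc p)\<^esub>"
  by (cases p) (auto simp: Bd_def dg_one Gam_one Gam_dg intro!: dg_dg GamD(1))

lemma cocycle_zg_iff:
  assumes "\<eta> \<in> T" "s \<in> Gam (cl \<eta>) p"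
  shows "zg (cl \<eta>) p \<eta> s \<in> cocycles (S (cl \<eta>) \<eta>) p \<longleftrightarrow> s \<in> Rep p \<eta>"
  using assms zg_eq_iff[OF cl_closed assms(1) Gam_dg[OF assms(2)] Gam_one]
  by (simp add: cocycles_def S_cobd_zg S_grp zg_carrier zg_one Rep_def)

lemma coboundary_zg_iff:
  assumes \<eta>: "\<eta> \<in> T" and s: "s \<in> Gam (cl \<eta>) p"
  shows "zg (cl \<eta>) p \<eta> s \<in> coboundaries (S (cl \<eta>) \<eta>) p \<longleftrightarrow> (\<exists>D\<in>Bd p \<eta>. gm p \<eta> s = gm p \<eta> D)"
proof (cases p)
  case 0
  then show ?thesis using zg_eq_iff[OF cl_closed \<eta> s Gam_one] zg_carrier[OF cl_closed \<eta> s]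
    by (simp add: coboundaries_def S_grp zg_one \<eta> Bd_def)
next
  case (Suc q)
  have "zg (cl \<eta>) p \<eta> s \<in> coboundaries (S (cl \<eta>) \<eta>) p \<longleftrightarrow>
    (\<exists>y\<in>carrier (stalk X (JZ (cl \<eta>) q) \<eta>). cobd (S (cl \<eta>) \<eta>) q y = zg (cl \<eta>) p \<eta> s)"
    using zg_carrier[OF cl_closed \<eta> s] Suc by (simp add: coboundaries_def S_grp)
  also have "\<dots> \<longleftrightarrow> (\<exists>r\<in>Gam (cl \<eta>) q. zg (cl \<eta>) p \<eta> (dg q r) = zg (cl \<eta>) p \<eta> s)"
  proof
    assume "\<exists>y\<in>carrier (stalk X (JZ (cl \<eta>) q) \<eta>). cobd (S (cl \<eta>) \<eta>) q y = zg (cl \<eta>) p \<eta> s"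
    then obtain y where y: "y \<in> carrier (stalk X (JZ (cl \<eta>) q) \<eta>)" "cobd (S (cl \<eta>) \<eta>) q y = zg (cl \<eta>) p \<eta> s" by blast
    obtain r where "r \<in> Gam (cl \<eta>) q" "y = zg (cl \<eta>) q \<eta> r" using zg_surj[OF cl_closed \<eta> y(1)] .
    then show "\<exists>r\<in>Gam (cl \<eta>) q. zg (cl \<eta>) p \<eta> (dg q r) = zg (cl \<eta>) p \<eta> s"
      using y(2) S_cobd_zg[OF cl_closed \<eta>] Suc by auto
  next
    assume "\<exists>r\<in>Gam (cl \<eta>) q. zg (cl \<eta>) p \<eta> (dg q r) = zg (cl \<eta>) p \<eta> s"
    then obtain r where r: "r \<in> Gam (cl \<eta>) q" "zg (cl \<eta>) p \<eta> (dg q r) = zg (cl \<eta>) p \<eta> s" by blast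
    show "\<exists>y\<in>carrier (stalk X (JZ (cl \<eta>) q) \<eta>). cobd (S (cl \<eta>) \<eta>) q y = zg (cl \<eta>) p \<eta> s"
      by (rule bexI[OF _ zg_carrier[OF cl_closed \<eta> r(1)]])
        (use S_cobd_zg[OF cl_closed \<eta> r(1)] r(2) Suc in simp)
  qed
  also have "\<dots> \<longleftrightarrow> (\<exists>r\<in>Gam (cl \<eta>) q. gm p \<eta> s = gm p \<eta> (dg q r))"
  proof (rule bex_cong[OF refl])
    fix r assume "r \<in> Gam (cl \<eta>) q"
    then have "dg q r \<in> Gam (cl \<eta>) p" unfolding Suc by (rule Gam_dg)
    then show "zg (cl \<eta>) p \<eta> (dg q r) = zg (cl \<eta>) p \<eta> s \<longleftrightarrow> gm p \<eta> s = gm p \<eta> (dg q r)"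
      using zg_eq_iff[OF cl_closed \<eta> _ s] by (auto simp: eq_commute[of "gm p \<eta> s"])
  qed
  finally show ?thesis using Suc by (simp add: Bd_def)
qed

lemma Rep_D: "s \<in> Rep p \<eta> \<Longrightarrow> s \<in> Gam (cl \<eta>) p" "s \<in> Rep p \<eta> \<Longrightarrow> s \<in> carrier (Gs p)"
  "s \<in> Rep p \<eta> \<Longrightarrow> gm (Suc p) \<eta> (dg p s) = gm (Suc p) \<eta> \<one>\<^bsub>Gs (Suc p)\<^esub>"
  by (auto simp: Rep_def intro: GamD(1))

lemma Rep_subgroup:
  assumes \<eta>: "\<eta> \<in> T"
  shows "subgroup (Rep p \<eta>) (Gs p)"
proof (rule subgroup_commI[OF G_comm])
  interpret A: comm_group "stalk X (J (Suc p)) \<eta>" by (rule stalk_J_comm[OF \<eta>])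
  show "Rep p \<eta> \<subseteq> carrier (Gs p)" using Rep_D by blast
  show "\<one>\<^bsub>Gs p\<^esub> \<in> Rep p \<eta>" by (simp add: Rep_def Gam_one dg_one)
  fix s assume s: "s \<in> Rep p \<eta>"
  show "inv\<^bsub>Gs p\<^esub> s \<in> Rep p \<eta>"
    using Rep_D[OF s] by (simp add: Rep_def Gam_inv dg_inv gm_inv \<eta> dg_carrier gm_one)
  fix t assume t: "t \<in> Rep p \<eta>"
  show "s \<otimes>\<^bsub>Gs p\<^esub> t \<in> Rep p \<eta>"
    using Rep_D[OF s] Rep_D[OF t] by (simp add: Rep_def Gam_mult dg_mult gm_mult \<eta> dg_carrier gm_one)
qed

lemma cls_surj:
  assumes "\<eta> \<in> T" "c \<in> carrier (H p \<eta>)"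
  obtains s where "s \<in> Rep p \<eta>" "c = cls p \<eta> s"
proof -
  obtain z where z: "z \<in> cocycles (S (cl \<eta>) \<eta>) p" "c = cohomology_class (S (cl \<eta>) \<eta>) p z"
    using assms group_complex.cohomology_carrier[OF S_complex[OF cl_closed assms(1)]]
    by (auto simp: local_cohomology_def)
  then have "z \<in> carrier (stalk X (JZ (cl \<eta>) p) \<eta>)" by (simp add: cocycles_def S_grp)
  then obtain s where "s \<in> Gam (cl \<eta>) p" "z = zg (cl \<eta>) p \<eta> s" using zg_surj[OF cl_closed assms(1)] by blast
  then show thesis using that z cocycle_zg_iff[OF assms(1)] by (auto simp: cls_def)
qed

lemma cls_carrier:
  assumes "\<eta> \<in> T" "s \<in> Rep p \<eta>"
  shows "cls p \<eta> s \<in> carrier (H p \<eta>)"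
  using group_complex.cohomology_carrier[OF S_complex[OF cl_closed assms(1)]] cocycle_zg_iff[OF assms(1) Rep_D(1)[OF assms(2)]] assms(2)
  by (simp add: local_cohomology_def cls_def)

lemma cls_mult:
  assumes \<eta>: "\<eta> \<in> T" and s: "s \<in> Rep p \<eta>" and t: "t \<in> Rep p \<eta>"
  shows "cls p \<eta> (s \<otimes>\<^bsub>Gs p\<^esub> t) = cls p \<eta> s \<otimes>\<^bsub>H p \<eta>\<^esub> cls p \<eta> t"
proof -
  have "cls p \<eta> s \<otimes>\<^bsub>H p \<eta>\<^esub> cls p \<eta> t = cohomology_class (S (cl \<eta>) \<eta>) p (zg (cl \<eta>) p \<eta> s \<otimes>\<^bsub>grp (S (cl \<eta>) \<eta>) p\<^esub> zg (cl \<eta>) p \<eta> t)"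
    using group_complex.class_mult[OF S_complex[OF cl_closed \<eta>], where n = p and z = "zg (cl \<eta>) p \<eta> s" and w = "zg (cl \<eta>) p \<eta> t"]
      cocycle_zg_iff[OF \<eta> Rep_D(1)[OF s]] cocycle_zg_iff[OF \<eta> Rep_D(1)[OF t]] s t
    by (simp add: cls_def local_cohomology_def)
  then show ?thesis using zg_mult[OF cl_closed \<eta> Rep_D(1)[OF s] Rep_D(1)[OF t]] by (simp add: cls_def S_grp)
qed

lemma cls_one: "\<eta> \<in> T \<Longrightarrow> cls p \<eta> \<one>\<^bsub>Gs p\<^esub> = \<one>\<^bsub>H p \<eta>\<^esub>"
  using group_complex.class_one[OF S_complex[OF cl_closed]] by (simp add: cls_def local_cohomology_def S_grp zg_one)

lemma zg_inv:
  assumes "\<eta> \<in> T" "t \<in> Gam (cl \<eta>) p"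
  shows "inv\<^bsub>stalk X (JZ (cl \<eta>) p) \<eta>\<^esub> zg (cl \<eta>) p \<eta> t = zg (cl \<eta>) p \<eta> (inv\<^bsub>Gs p\<^esub> t)"
proof -
  interpret A: comm_group "stalk X (JZ (cl \<eta>) p) \<eta>"
    by (rule group_presheaf.stalk_comm_group[OF JZ_presheaf[OF cl_closed] assms(1)])
  show ?thesis
    by (rule A.inv_equality) (use assms GamD(1)[OF assms(2)] in \<open>simp_all add: zg_mult Gam_inv zg_one zg_carrier\<close>)
qed

lemma cls_eq_iff:
  assumes \<eta>: "\<eta> \<in> T" and s: "s \<in> Rep p \<eta>" and t: "t \<in> Rep p \<eta>"
  shows "cls p \<eta> s = cls p \<eta> t \<longleftrightarrow> (\<exists>D\<in>Bd p \<eta>. gm p \<eta> s = gm p \<eta> (D \<otimes>\<^bsub>Gs p\<^esub> t))"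
proof -
  interpret A: comm_group "stalk X (J p) \<eta>" by (rule stalk_J_comm[OF \<eta>])
  note sG = Rep_D(1)[OF s] and tG = Rep_D(1)[OF t] and sc = Rep_D(2)[OF s] and tc = Rep_D(2)[OF t]
  have "cls p \<eta> s = cls p \<eta> t \<longleftrightarrow> zg (cl \<eta>) p \<eta> (s \<otimes>\<^bsub>Gs p\<^esub> inv\<^bsub>Gs p\<^esub> t) \<in> coboundaries (S (cl \<eta>) \<eta>) p"
    unfolding cls_def
    using group_complex.class_eq_iff[OF S_complex[OF cl_closed \<eta>], where n = p and z = "zg (cl \<eta>) p \<eta> s" and w = "zg (cl \<eta>) p \<eta> t"]
      cocycle_zg_iff[OF \<eta> sG] cocycle_zg_iff[OF \<eta> tG] s t sG tG
    by (simp add: S_grp zg_inv[OF \<eta>] zg_mult[OF cl_closed \<eta>] Gam_inv)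
  also have "\<dots> \<longleftrightarrow> (\<exists>D\<in>Bd p \<eta>. gm p \<eta> (s \<otimes>\<^bsub>Gs p\<^esub> inv\<^bsub>Gs p\<^esub> t) = gm p \<eta> D)"
    by (rule coboundary_zg_iff[OF \<eta> Gam_mult[OF sG Gam_inv[OF tG]]])
  also have "\<dots> \<longleftrightarrow> (\<exists>D\<in>Bd p \<eta>. gm p \<eta> s = gm p \<eta> (D \<otimes>\<^bsub>Gs p\<^esub> t))"
  proof (intro bex_cong refl)
    fix D assume "D \<in> Bd p \<eta>"
    then have D: "D \<in> carrier (Gs p)" using Bd_D GamD(1) by blast
    have c: "gm p \<eta> s \<in> carrier (stalk X (J p) \<eta>)" "gm p \<eta> t \<in> carrier (stalk X (J p) \<eta>)" "gm p \<eta> D \<in> carrier (stalk X (J p) \<eta>)"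
      using gm_carrier[OF \<eta>] sc tc D by auto
    show "gm p \<eta> (s \<otimes>\<^bsub>Gs p\<^esub> inv\<^bsub>Gs p\<^esub> t) = gm p \<eta> D \<longleftrightarrow> gm p \<eta> s = gm p \<eta> (D \<otimes>\<^bsub>Gs p\<^esub> t)"
      unfolding gm_mult[OF \<eta> sc Gc.inv_closed[OF tc]] gm_inv[OF \<eta> tc] gm_mult[OF \<eta> D tc]
        A.inv_solve_right[OF c(3,1,2), symmetric] by (rule eq_commute)
  qed
  finally show ?thesis .
qed

lemma cls_finprod:
  assumes \<eta>: "\<eta> \<in> T" and f: "\<And>x. x \<in> A \<Longrightarrow> f x \<in> Rep p \<eta>"
  shows "finprod (Gs p) f A \<in> Rep p \<eta>" "cls p \<eta> (finprod (Gs p) f A) = finprod (H p \<eta>) (\<lambda>x. cls p \<eta> (f x)) A"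
proof -
  interpret Hc: comm_group "H p \<eta>" by (rule H_comm_group[OF \<eta>])
  have "finprod (Gs p) f A \<in> Rep p \<eta> \<and> cls p \<eta> (finprod (Gs p) f A) = finprod (H p \<eta>) (\<lambda>x. cls p \<eta> (f x)) A"
    using f
  proof (induction A rule: infinite_finite_induct)
    case (insert a A)
    have "f \<in> A \<rightarrow> carrier (Gs p)" "f a \<in> carrier (Gs p)" using insert.prems Rep_D(2) by auto
    then show ?case using insert cls_mult[OF \<eta>] subgroup.m_closed[OF Rep_subgroup[OF \<eta>]] cls_carrier[OF \<eta>]
      by (simp add: Pi_iff)
  qed (simp_all add: cls_one[OF \<eta>] subgroup.one_closed[OF Rep_subgroup[OF \<eta>]])
  then show "finprod (Gs p) f A \<in> Rep p \<eta>" "cls p \<eta> (finprod (Gs p) f A) = finprod (H p \<eta>) (\<lambda>x. cls p \<eta> (f x)) A" by auto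
qed

section \<open>The connecting maps\<close>

text \<open>A section with support in the closure of \<open>\<eta>\<close> that vanishes at \<open>\<eta>\<close> has near \<open>\<xi>\<close> support in the
  closure of \<open>\<xi>\<close>, because no point lies strictly between \<open>\<eta>\<close> and \<open>\<xi>\<close>.\<close>

lemma truncate_codim1:
  assumes \<eta>: "\<eta> \<in> P p" and \<xi>: "\<xi> \<in> P (Suc p)" "\<xi> \<in> cl \<eta>" and e: "e \<in> Gam (cl \<eta>) n"
    and v: "gm n \<eta> e = gm n \<eta> \<one>\<^bsub>Gs n\<^esub>"
  obtains e' where "e' \<in> Gam (cl \<xi>) n" "gm n \<xi> e' = gm n \<xi> e"
proof -
  note ec = GamD(1)[OF e]
  have "y = \<xi>" if y: "y \<in> supp n e" "\<xi> \<in> cl y" for y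
  proof (rule ccontr)
    assume ne: "y \<noteq> \<xi>"
    obtain r where r: "y \<in> P r" "r < Suc p" by (rule codim_generization[OF \<xi>(1) y(2) ne[symmetric]])
    have "y \<in> cl \<eta>" "y \<noteq> \<eta>" using y e v by (auto simp: Gam_def supp_def)
    then obtain q where "\<eta> \<in> P q" "q < r" by (rule codim_generization[OF r(1)])
    then show False using P_unique[OF \<eta>] r by auto
  qed
  then obtain V where "openin X V" "\<xi> \<in> V" "supp n e \<inter> V \<subseteq> cl \<xi>"
    by (rule local_closed[OF supp_closed[OF ec] P_topspace[OF \<xi>(1)]])
  then show thesis by (rule truncate[OF cl_closed ec]) (rule that)
qed

lemma cl_mono:
  assumes "\<xi> \<in> cl \<eta>"
  shows "cl \<xi> \<subseteq> cl \<eta>"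
  by (intro subsetI closure_trans[OF assms])

lemma nu_rep:
  assumes \<eta>: "\<eta> \<in> P p" and \<xi>: "\<xi> \<in> P (Suc p)" "\<xi> \<in> cl \<eta>" and s: "s \<in> Rep p \<eta>"
  obtains a where "a \<in> Rep (Suc p) \<xi>" "gm (Suc p) \<xi> a = gm (Suc p) \<xi> (dg p s)"
proof -
  obtain a where a: "a \<in> Gam (cl \<xi>) (Suc p)" "gm (Suc p) \<xi> a = gm (Suc p) \<xi> (dg p s)"
    by (rule truncate_codim1[OF \<eta> \<xi> Gam_dg[OF Rep_D(1)[OF s]] Rep_D(3)[OF s]])
  have "gm (Suc (Suc p)) \<xi> (dg (Suc p) a) = gm (Suc (Suc p)) \<xi> (dg (Suc p) (dg p s))"
    using gm_dg[OF P_topspace[OF \<xi>(1)] GamD(1)[OF a(1)] dg_carrier[OF Rep_D(2)[OF s]] a(2)] .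
  then have "a \<in> Rep (Suc p) \<xi>" using a dg_dg[OF Rep_D(2)[OF s]] by (simp add: Rep_def)
  then show thesis using that a by blast
qed

text \<open>The differential of \<open>s\<close> vanishes at \<open>\<eta>\<close>, so near \<open>\<xi>\<close> it has support in the closure of \<open>\<xi>\<close> and defines a class there.
  It does not depend on the lift: a second lift \<open>s'\<close> of the class of \<open>s\<close> differs from \<open>s\<close>, up to a coboundary, by a
  section \<open>e\<close> that vanishes at \<open>\<eta>\<close> and hence has near \<open>\<xi>\<close> support in the closure of \<open>\<xi>\<close>; its differential is a
  coboundary at \<open>\<xi>\<close>.\<close>

lemma nu_cls:
  assumes \<eta>: "\<eta> \<in> P p" and \<xi>: "\<xi> \<in> P (Suc p)" "\<xi> \<in> cl \<eta>" and s: "s \<in> Rep p \<eta>"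
    and a: "a \<in> Rep (Suc p) \<xi>" "gm (Suc p) \<xi> a = gm (Suc p) \<xi> (dg p s)"
  shows "nu X I p \<eta> \<xi> (cls p \<eta> s) = cls (Suc p) \<xi> a"
proof -
  have \<eta>T: "\<eta> \<in> T" and \<xi>T: "\<xi> \<in> T" using \<eta> \<xi> P_topspace by auto
  let ?i = "\<lambda>n. stalk_map X (JZ (cl \<eta>) n) \<xi> (\<lambda>U s. s)"
  let ?q = "\<lambda>n. stalk_map X (JZ (cl \<eta>) n) \<eta> (\<lambda>U s. s)"
  have i: "?i n (zg (cl \<xi>) n \<xi> t) = zg (cl \<eta>) n \<xi> t" if t: "t \<in> Gam (cl \<xi>) n" for t n
  proof (rule stalk_map_germ_hom[OF JZ_presheaf[OF cl_closed] JZ_presheaf[OF cl_closed] _ openin_topspace \<xi>T])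
    show "sheaf_hom X (JZ (cl \<xi>) n) (JZ (cl \<eta>) n) (\<lambda>U s. s)" unfolding sheaf_hom_def
    proof (intro conjI allI impI ballI)
      fix U assume U: "openin X U"
      have o: "openin X (U - cl \<xi>)" "openin X (U - cl \<eta>)" using U by (simp_all add: openin_diff)
      have sub: "U - cl \<eta> \<subseteq> U - cl \<xi>" using cl_mono[OF \<xi>(2)] by auto
      have "t \<in> carrier (sections (JZ (cl \<eta>) n) U)" if "t \<in> carrier (sections (JZ (cl \<xi>) n) U)" for t
      proof -
        have t: "t \<in> Jp.sec n U" "restr (J n) U (U - cl \<xi>) t = \<one>\<^bsub>sections (J n) (U - cl \<xi>)\<^esub>"
          using that by (auto simp: JZ_simps)
        have "restr (J n) U (U - cl \<eta>) t = restr (J n) (U - cl \<xi>) (U - cl \<eta>) (restr (J n) U (U - cl \<xi>) t)"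
          using Jp.restr_comp[OF U o(1,2) _ sub t(1)] by auto
        then show ?thesis using t Jp.restr_one[OF o sub] by (simp add: JZ_simps)
      qed
      then show "(\<lambda>s. s) \<in> hom (sections (JZ (cl \<xi>) n) U) (sections (JZ (cl \<eta>) n) U)"
        by (auto simp: hom_def JZ_simps(2))
    qed (simp add: JZ_simps)
    show "t \<in> carrier (sections (JZ (cl \<xi>) n) T)" using t JZ_global[OF cl_closed] by simp
  qed
  have q: "?q n (zg (cl \<eta>) n \<xi> t) = zg (cl \<eta>) n \<eta> t" if t: "t \<in> Gam (cl \<eta>) n" for t n
  proof (rule stalk_map_germ_hom[OF JZ_presheaf[OF cl_closed] JZ_presheaf[OF cl_closed] sheaf_hom_id[OF JZ_presheaf[OF cl_closed]] openin_topspace \<xi>T])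
    show "t \<in> carrier (sections (JZ (cl \<eta>) n) T)" using t JZ_global[OF cl_closed] by simp
  qed (rule closure_of_nbhd[OF \<xi>(2)])
  let ?Q = "\<lambda>h. \<exists>b\<in>carrier (grp (S (cl \<eta>) \<xi>) p). \<exists>a'\<in>carrier (grp (S (cl \<xi>) \<xi>) (Suc p)).
     ?q p b \<in> cls p \<eta> s \<and> ?i (Suc p) a' = cobd (S (cl \<eta>) \<xi>) p b \<and> h = cohomology_class (S (cl \<xi>) \<xi>) (Suc p) a'"
  have "(THE h. ?Q h) = cls (Suc p) \<xi> a"
  proof (rule the_equality)
    show "?Q (cls (Suc p) \<xi> a)"
    proof (intro bexI conjI)
      show "zg (cl \<eta>) p \<xi> s \<in> carrier (grp (S (cl \<eta>) \<xi>) p)"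
        using zg_carrier[OF cl_closed \<xi>T Rep_D(1)[OF s]] by (simp add: S_grp)
      show "zg (cl \<xi>) (Suc p) \<xi> a \<in> carrier (grp (S (cl \<xi>) \<xi>) (Suc p))"
        using zg_carrier[OF cl_closed \<xi>T Rep_D(1)[OF a(1)]] by (simp add: S_grp)
      have "zg (cl \<eta>) p \<eta> s \<in> cls p \<eta> s"
      proof -
        interpret C: group_complex "S (cl \<eta>) \<eta>" by (rule S_complex[OF cl_closed \<eta>T])
        interpret A: comm_group "grp (S (cl \<eta>) \<eta>) p" by (rule C.comm)
        show ?thesis unfolding cls_def cohomology_class_def
          by (rule A.rcos_self[OF _ C.coboundaries_subgroup]) (use zg_carrier[OF cl_closed \<eta>T Rep_D(1)[OF s]] in \<open>simp add: S_grp\<close>)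
      qed
      then show "?q p (zg (cl \<eta>) p \<xi> s) \<in> cls p \<eta> s" using q[OF Rep_D(1)[OF s]] by simp
      have "a \<in> Gam (cl \<eta>) (Suc p)" using Rep_D(1)[OF a(1)] Gam_mono[OF cl_mono[OF \<xi>(2)]] by blast
      then have "zg (cl \<eta>) (Suc p) \<xi> a = zg (cl \<eta>) (Suc p) \<xi> (dg p s)"
        using zg_eq_iff[OF cl_closed \<xi>T _ Gam_dg[OF Rep_D(1)[OF s]]] a(2) by blast
      then show "?i (Suc p) (zg (cl \<xi>) (Suc p) \<xi> a) = cobd (S (cl \<eta>) \<xi>) p (zg (cl \<eta>) p \<xi> s)"
        using i[OF Rep_D(1)[OF a(1)]] S_cobd_zg[OF cl_closed \<xi>T Rep_D(1)[OF s]] by simp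
    qed (simp add: cls_def)
  next
    fix h assume "?Q h"
    then obtain b a' where b: "b \<in> carrier (stalk X (JZ (cl \<eta>) p) \<xi>)" and a': "a' \<in> carrier (stalk X (JZ (cl \<xi>) (Suc p)) \<xi>)"
      and Q: "?q p b \<in> cls p \<eta> s" "?i (Suc p) a' = cobd (S (cl \<eta>) \<xi>) p b" "h = cohomology_class (S (cl \<xi>) \<xi>) (Suc p) a'"
      by (auto simp: S_grp)
    obtain s' where s': "s' \<in> Gam (cl \<eta>) p" "b = zg (cl \<eta>) p \<xi> s'" using zg_surj[OF cl_closed \<xi>T b] .
    obtain t' where t': "t' \<in> Gam (cl \<xi>) (Suc p)" "a' = zg (cl \<xi>) (Suc p) \<xi> t'" using zg_surj[OF cl_closed \<xi>T a'] .
    have s'c: "s' \<in> carrier (Gs p)" using GamD(1)[OF s'(1)] .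
    have t'c: "t' \<in> carrier (Gs (Suc p))" using GamD(1)[OF t'(1)] .
    have sc: "s \<in> carrier (Gs p)" using Rep_D(2)[OF s] .
    have ac: "a \<in> carrier (Gs (Suc p))" using Rep_D(2)[OF a(1)] .
    have "zg (cl \<eta>) p \<eta> s' \<in> cls p \<eta> s" using Q(1) q[OF s'(1)] s' by simp
    then obtain c where c: "c \<in> coboundaries (S (cl \<eta>) \<eta>) p"
      "zg (cl \<eta>) p \<eta> s' = c \<otimes>\<^bsub>stalk X (JZ (cl \<eta>) p) \<eta>\<^esub> zg (cl \<eta>) p \<eta> s"
      by (auto simp: cls_def cohomology_class_def r_coset_def S_grp)
    then have "c \<in> carrier (stalk X (JZ (cl \<eta>) p) \<eta>)" by (simp add: coboundaries_def S_grp)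
    then obtain D0 where D0: "D0 \<in> Gam (cl \<eta>) p" "c = zg (cl \<eta>) p \<eta> D0" using zg_surj[OF cl_closed \<eta>T] by blast
    obtain D where D: "D \<in> Bd p \<eta>" "gm p \<eta> D0 = gm p \<eta> D" using coboundary_zg_iff[OF \<eta>T D0(1)] c(1) D0(2) by blast
    have DG: "D \<in> Gam (cl \<eta>) p" and dD: "dg p D = \<one>\<^bsub>Gs (Suc p)\<^esub>" using Bd_D[OF D(1)] by auto
    have Dc: "D \<in> carrier (Gs p)" using GamD(1)[OF DG] .
    have DsG: "D \<otimes>\<^bsub>Gs p\<^esub> s \<in> Gam (cl \<eta>) p" by (rule Gam_mult[OF DG Rep_D(1)[OF s]])
    have "gm p \<eta> s' = gm p \<eta> (D0 \<otimes>\<^bsub>Gs p\<^esub> s)"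
      using c(2) D0 zg_mult[OF cl_closed \<eta>T D0(1) Rep_D(1)[OF s]]
        zg_eq_iff[OF cl_closed \<eta>T s'(1) Gam_mult[OF D0(1) Rep_D(1)[OF s]]] by simp
    then have s'D: "gm p \<eta> s' = gm p \<eta> (D \<otimes>\<^bsub>Gs p\<^esub> s)"
      using D(2) GamD(1)[OF D0(1)] Dc sc by (simp add: gm_mult[OF \<eta>T])
    define e where "e = s' \<otimes>\<^bsub>Gs p\<^esub> inv\<^bsub>Gs p\<^esub> (D \<otimes>\<^bsub>Gs p\<^esub> s)"
    have eG: "e \<in> Gam (cl \<eta>) p" unfolding e_def by (rule Gam_mult[OF s'(1) Gam_inv[OF DsG]])
    have ec: "e \<in> carrier (Gs p)" using GamD(1)[OF eG] .
    have Dsc: "D \<otimes>\<^bsub>Gs p\<^esub> s \<in> carrier (Gs p)" using Dc sc by simp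
    have "gm p \<eta> e = gm p \<eta> \<one>\<^bsub>Gs p\<^esub>"
    proof -
      interpret A: comm_group "stalk X (J p) \<eta>" by (rule stalk_J_comm[OF \<eta>T])
      show ?thesis unfolding e_def gm_mult[OF \<eta>T s'c Gc.inv_closed[OF Dsc]] gm_inv[OF \<eta>T Dsc] s'D gm_one[OF \<eta>T]
        using gm_carrier[OF \<eta>T Dsc] by simp
    qed
    then obtain e' where e': "e' \<in> Gam (cl \<xi>) p" "gm p \<xi> e' = gm p \<xi> e"
      by (rule truncate_codim1[OF \<eta> \<xi> eG])
    have e'c: "e' \<in> carrier (Gs p)" using GamD(1)[OF e'(1)] .
    have "s' = e \<otimes>\<^bsub>Gs p\<^esub> (D \<otimes>\<^bsub>Gs p\<^esub> s)" unfolding e_def using s'c Dsc by (simp add: Gc.m_assoc)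
    then have ds': "dg p s' = dg p e \<otimes>\<^bsub>Gs (Suc p)\<^esub> dg p s"
      using ec Dc sc dD by (simp add: dg_mult dg_carrier)
    have "zg (cl \<eta>) (Suc p) \<xi> t' = zg (cl \<eta>) (Suc p) \<xi> (dg p s')"
      using Q(2) i[OF t'(1)] t' s' S_cobd_zg[OF cl_closed \<xi>T s'(1)] by simp
    then have "gm (Suc p) \<xi> t' = gm (Suc p) \<xi> (dg p s')"
      using zg_eq_iff[OF cl_closed \<xi>T _ Gam_dg[OF s'(1)]] t'(1) Gam_mono[OF cl_mono[OF \<xi>(2)]] by blast
    also have "\<dots> = gm (Suc p) \<xi> (dg p e) \<otimes>\<^bsub>stalk X (J (Suc p)) \<xi>\<^esub> gm (Suc p) \<xi> (dg p s)"
      unfolding ds' by (rule gm_mult[OF \<xi>T dg_carrier[OF ec] dg_carrier[OF sc]])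
    also have "\<dots> = gm (Suc p) \<xi> (dg p e') \<otimes>\<^bsub>stalk X (J (Suc p)) \<xi>\<^esub> gm (Suc p) \<xi> a"
      using gm_dg[OF \<xi>T e'c ec e'(2)] a(2) by simp
    also have "\<dots> = gm (Suc p) \<xi> (dg p e' \<otimes>\<^bsub>Gs (Suc p)\<^esub> a)"
      by (rule gm_mult[OF \<xi>T dg_carrier[OF e'c] ac, symmetric])
    finally have t'a: "gm (Suc p) \<xi> t' = gm (Suc p) \<xi> (dg p e' \<otimes>\<^bsub>Gs (Suc p)\<^esub> a)" .
    have de': "dg p e' \<in> Bd (Suc p) \<xi>" using e' by (simp add: Bd_def)
    have "dg (Suc p) (dg p e' \<otimes>\<^bsub>Gs (Suc p)\<^esub> a) = dg (Suc p) a"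
      using e'c ac by (simp add: dg_mult dg_carrier dg_dg)
    then have "t' \<in> Rep (Suc p) \<xi>"
      using t'(1) gm_dg[OF \<xi>T t'c _ t'a] Rep_D(3)[OF a(1)] ac dg_carrier[OF e'c] by (simp add: Rep_def)
    then have "cls (Suc p) \<xi> t' = cls (Suc p) \<xi> a"
      using cls_eq_iff[OF \<xi>T _ a(1)] t'a de' by blast
    then show "h = cls (Suc p) \<xi> a" using Q(3) t' by (simp add: cls_def)
  qed
  then show ?thesis by (simp add: nu_def connecting_hom_def)
qed

lemma nu_hom:
  assumes \<eta>: "\<eta> \<in> P p" and \<xi>: "\<xi> \<in> P (Suc p)" "\<xi> \<in> cl \<eta>"
  shows "nu X I p \<eta> \<xi> \<in> hom (H p \<eta>) (H (Suc p) \<xi>)"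
proof -
  have \<eta>T: "\<eta> \<in> T" and \<xi>T: "\<xi> \<in> T" using \<eta> \<xi> P_topspace by auto
  show ?thesis
  proof (rule homI)
    fix c assume "c \<in> carrier (H p \<eta>)"
    then obtain s where s: "s \<in> Rep p \<eta>" "c = cls p \<eta> s" by (rule cls_surj[OF \<eta>T])
    obtain a where a: "a \<in> Rep (Suc p) \<xi>" "gm (Suc p) \<xi> a = gm (Suc p) \<xi> (dg p s)" using nu_rep[OF \<eta> \<xi> s(1)] .
    show "nu X I p \<eta> \<xi> c \<in> carrier (H (Suc p) \<xi>)"
      unfolding s(2) nu_cls[OF \<eta> \<xi> s(1) a] by (rule cls_carrier[OF \<xi>T a(1)])
    fix c' assume "c' \<in> carrier (H p \<eta>)"
    then obtain s' where s': "s' \<in> Rep p \<eta>" "c' = cls p \<eta> s'" by (rule cls_surj[OF \<eta>T])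
    obtain a' where a': "a' \<in> Rep (Suc p) \<xi>" "gm (Suc p) \<xi> a' = gm (Suc p) \<xi> (dg p s')" using nu_rep[OF \<eta> \<xi> s'(1)] .
    have ss: "s \<otimes>\<^bsub>Gs p\<^esub> s' \<in> Rep p \<eta>" by (rule subgroup.m_closed[OF Rep_subgroup[OF \<eta>T] s(1) s'(1)])
    have aa: "a \<otimes>\<^bsub>Gs (Suc p)\<^esub> a' \<in> Rep (Suc p) \<xi>" by (rule subgroup.m_closed[OF Rep_subgroup[OF \<xi>T] a(1) a'(1)])
    have g: "gm (Suc p) \<xi> (a \<otimes>\<^bsub>Gs (Suc p)\<^esub> a') = gm (Suc p) \<xi> (dg p (s \<otimes>\<^bsub>Gs p\<^esub> s'))"
      using a a' Rep_D(2)[OF s(1)] Rep_D(2)[OF s'(1)] Rep_D(2)[OF a(1)] Rep_D(2)[OF a'(1)]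
      by (simp add: dg_mult gm_mult[OF \<xi>T] dg_carrier)
    show "nu X I p \<eta> \<xi> (c \<otimes>\<^bsub>H p \<eta>\<^esub> c') = nu X I p \<eta> \<xi> c \<otimes>\<^bsub>H (Suc p) \<xi>\<^esub> nu X I p \<eta> \<xi> c'"
      unfolding s(2) s'(2) cls_mult[OF \<eta>T s(1) s'(1), symmetric] nu_cls[OF \<eta> \<xi> ss aa g]
        nu_cls[OF \<eta> \<xi> s(1) a] nu_cls[OF \<eta> \<xi> s'(1) a'] by (rule cls_mult[OF \<xi>T a(1) a'(1)])
  qed
qed

text \<open>A point \<open>\<xi>\<close> at which \<open>ds\<close> does not vanish is a generic point of the support of \<open>ds\<close>: a proper
  generization of \<open>\<xi>\<close> in the support would lie strictly between \<open>\<eta>\<close> and \<open>\<xi>\<close>.\<close>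

lemma nu_support:
  assumes \<eta>: "\<eta> \<in> P p" and s: "s \<in> Rep p \<eta>"
  shows "finite {\<xi> \<in> P (Suc p). \<xi> \<in> cl \<eta> \<and> gm (Suc p) \<xi> (dg p s) \<noteq> gm (Suc p) \<xi> \<one>\<^bsub>Gs (Suc p)\<^esub>}"
    and "\<And>\<xi>. \<xi> \<in> P (Suc p) \<Longrightarrow> \<xi> \<in> cl \<eta> \<Longrightarrow> gm (Suc p) \<xi> (dg p s) = gm (Suc p) \<xi> \<one>\<^bsub>Gs (Suc p)\<^esub> \<Longrightarrow>
      nu X I p \<eta> \<xi> (cls p \<eta> s) = \<one>\<^bsub>H (Suc p) \<xi>\<^esub>"
proof -
  let ?W = "supp (Suc p) (dg p s)"
  have dG: "dg p s \<in> Gam (cl \<eta>) (Suc p)" by (rule Gam_dg[OF Rep_D(1)[OF s]])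
  have "finite {x \<in> ?W. \<forall>y\<in>?W. x \<in> cl y \<longrightarrow> y = x}" by (rule finite_generic[OF supp_closed[OF GamD(1)[OF dG]]])
  moreover have "{\<xi> \<in> P (Suc p). \<xi> \<in> cl \<eta> \<and> gm (Suc p) \<xi> (dg p s) \<noteq> gm (Suc p) \<xi> \<one>\<^bsub>Gs (Suc p)\<^esub>}
     \<subseteq> {x \<in> ?W. \<forall>y\<in>?W. x \<in> cl y \<longrightarrow> y = x}"
  proof (intro subsetI CollectI conjI ballI impI)
    fix x y assume x: "x \<in> {\<xi> \<in> P (Suc p). \<xi> \<in> cl \<eta> \<and> gm (Suc p) \<xi> (dg p s) \<noteq> gm (Suc p) \<xi> \<one>\<^bsub>Gs (Suc p)\<^esub>}"
      and y: "y \<in> ?W" "x \<in> cl y"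
    have "y \<in> cl \<eta>" "y \<noteq> \<eta>" using y dG Rep_D(3)[OF s] by (auto simp: Gam_def supp_def)
    show "y = x"
    proof (rule ccontr)
      assume "y \<noteq> x"
      have xP: "x \<in> P (Suc p)" using x by simp
      obtain r where r: "y \<in> P r" "r < Suc p" by (rule codim_generization[OF xP y(2) \<open>y \<noteq> x\<close>[symmetric]])
      obtain q where "\<eta> \<in> P q" "q < r" by (rule codim_generization[OF r(1) \<open>y \<in> cl \<eta>\<close> \<open>y \<noteq> \<eta>\<close>])
      then show False using P_unique[OF \<eta>] r by auto
    qed
  qed (auto simp: supp_def P_topspace)
  ultimately show "finite {\<xi> \<in> P (Suc p). \<xi> \<in> cl \<eta> \<and> gm (Suc p) \<xi> (dg p s) \<noteq> gm (Suc p) \<xi> \<one>\<^bsub>Gs (Suc p)\<^esub>}"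
    by (rule finite_subset[rotated])
  fix \<xi> assume \<xi>: "\<xi> \<in> P (Suc p)" "\<xi> \<in> cl \<eta>" and v: "gm (Suc p) \<xi> (dg p s) = gm (Suc p) \<xi> \<one>\<^bsub>Gs (Suc p)\<^esub>"
  have \<xi>T: "\<xi> \<in> T" using \<xi> P_topspace by auto
  show "nu X I p \<eta> \<xi> (cls p \<eta> s) = \<one>\<^bsub>H (Suc p) \<xi>\<^esub>"
    using nu_cls[OF \<eta> \<xi> s subgroup.one_closed[OF Rep_subgroup[OF \<xi>T]]] v cls_one[OF \<xi>T] by simp
qed

lemma nu_finite:
  assumes \<eta>: "\<eta> \<in> P p" and c: "c \<in> carrier (H p \<eta>)"
  shows "finite {\<xi> \<in> P (Suc p). \<xi> \<in> cl \<eta> \<and> nu X I p \<eta> \<xi> c \<noteq> \<one>\<^bsub>H (Suc p) \<xi>\<^esub>}"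
proof -
  obtain s where s: "s \<in> Rep p \<eta>" "c = cls p \<eta> s" using cls_surj[OF P_topspace[OF \<eta>] c] .
  show ?thesis unfolding s(2)
    by (rule finite_subset[OF _ nu_support(1)[OF \<eta> s(1)]]) (use nu_support(2)[OF \<eta> s(1)] in auto)
qed

text \<open>The section \<open>ds\<close> is decomposed near \<open>\<zeta>\<close> into sections \<open>a \<xi>\<close> with support in the closures of the points \<open>\<xi>\<close> between \<open>\<eta>\<close>
  and \<open>\<zeta>\<close>, up to a section \<open>e\<close> with support in the closure of \<open>\<zeta>\<close>.  As \<open>d(ds)\<close> is trivial, the product of
  the \<open>d(a \<xi>)\<close> is the inverse of \<open>de\<close>, a coboundary.\<close>

lemma nu_nu:
  assumes \<eta>: "\<eta> \<in> P p" and \<zeta>: "\<zeta> \<in> P (Suc (Suc p))" "\<zeta> \<in> cl \<eta>" and c: "c \<in> carrier (H p \<eta>)"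
  shows "finprod (H (Suc (Suc p)) \<zeta>) (\<lambda>\<xi>. nu X I (Suc p) \<xi> \<zeta> (nu X I p \<eta> \<xi> c))
     {\<xi> \<in> P (Suc p). \<xi> \<in> cl \<eta> \<and> \<zeta> \<in> cl \<xi> \<and> nu X I p \<eta> \<xi> c \<noteq> \<one>\<^bsub>H (Suc p) \<xi>\<^esub>} = \<one>\<^bsub>H (Suc (Suc p)) \<zeta>\<^esub>"
proof -
  have \<eta>T: "\<eta> \<in> T" and \<zeta>T: "\<zeta> \<in> T" using \<eta> \<zeta> P_topspace by auto
  interpret Hc: comm_group "H (Suc (Suc p)) \<zeta>" by (rule H_comm_group[OF \<zeta>T])
  obtain s where s: "s \<in> Rep p \<eta>" "c = cls p \<eta> s" using cls_surj[OF \<eta>T c] .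
  note sc = Rep_D(2)[OF s(1)]
  let ?L = "{\<xi> \<in> P (Suc p). \<xi> \<in> cl \<eta> \<and> \<zeta> \<in> cl \<xi> \<and> gm (Suc p) \<xi> (dg p s) \<noteq> gm (Suc p) \<xi> \<one>\<^bsub>Gs (Suc p)\<^esub>}"
  let ?F = "{\<xi> \<in> P (Suc p). \<xi> \<in> cl \<eta> \<and> \<zeta> \<in> cl \<xi> \<and> nu X I p \<eta> \<xi> c \<noteq> \<one>\<^bsub>H (Suc p) \<xi>\<^esub>}"
  have L: "finite ?L" by (rule finite_subset[OF _ nu_support(1)[OF \<eta> s(1)]]) auto
  have FL: "?F \<subseteq> ?L" using nu_support(2)[OF \<eta> s(1)] s(2) by auto
  have "\<forall>\<xi>\<in>?L. \<exists>a. a \<in> Rep (Suc p) \<xi> \<and> gm (Suc p) \<xi> a = gm (Suc p) \<xi> (dg p s)"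
  proof
    fix \<xi> assume "\<xi> \<in> ?L"
    then have "\<xi> \<in> P (Suc p)" "\<xi> \<in> cl \<eta>" by auto
    then obtain a where "a \<in> Rep (Suc p) \<xi>" "gm (Suc p) \<xi> a = gm (Suc p) \<xi> (dg p s)" by (rule nu_rep[OF \<eta> _ _ s(1)])
    then show "\<exists>a. a \<in> Rep (Suc p) \<xi> \<and> gm (Suc p) \<xi> a = gm (Suc p) \<xi> (dg p s)" by (intro exI conjI)
  qed
  from bchoice[OF this] obtain a where a_all: "\<forall>\<xi>\<in>?L. a \<xi> \<in> Rep (Suc p) \<xi> \<and> gm (Suc p) \<xi> (a \<xi>) = gm (Suc p) \<xi> (dg p s)" ..
  have a: "a \<xi> \<in> Rep (Suc p) \<xi>" "gm (Suc p) \<xi> (a \<xi>) = gm (Suc p) \<xi> (dg p s)" if "\<xi> \<in> ?L" for \<xi>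
    using bspec[OF a_all that] by simp_all
  have nuc: "nu X I p \<eta> \<xi> c = cls (Suc p) \<xi> (a \<xi>)" if "\<xi> \<in> ?L" for \<xi>
    unfolding s(2) by (rule nu_cls[OF \<eta> _ _ s(1) a(1)[OF that] a(2)[OF that]]) (use that in auto)
  have "\<forall>\<xi>\<in>?L. \<exists>b. b \<in> Rep (Suc (Suc p)) \<zeta> \<and> gm (Suc (Suc p)) \<zeta> b = gm (Suc (Suc p)) \<zeta> (dg (Suc p) (a \<xi>))"
  proof
    fix \<xi> assume x: "\<xi> \<in> ?L"
    then have "\<xi> \<in> P (Suc p)" "\<zeta> \<in> cl \<xi>" by auto
    then obtain b where "b \<in> Rep (Suc (Suc p)) \<zeta>" "gm (Suc (Suc p)) \<zeta> b = gm (Suc (Suc p)) \<zeta> (dg (Suc p) (a \<xi>))"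
      by (rule nu_rep[OF _ \<zeta>(1) _ a(1)[OF x]])
    then show "\<exists>b. b \<in> Rep (Suc (Suc p)) \<zeta> \<and> gm (Suc (Suc p)) \<zeta> b = gm (Suc (Suc p)) \<zeta> (dg (Suc p) (a \<xi>))" by (intro exI conjI)
  qed
  from bchoice[OF this] obtain b where b_all: "\<forall>\<xi>\<in>?L. b \<xi> \<in> Rep (Suc (Suc p)) \<zeta> \<and> gm (Suc (Suc p)) \<zeta> (b \<xi>) = gm (Suc (Suc p)) \<zeta> (dg (Suc p) (a \<xi>))" ..
  have b: "b \<xi> \<in> Rep (Suc (Suc p)) \<zeta>" "gm (Suc (Suc p)) \<zeta> (b \<xi>) = gm (Suc (Suc p)) \<zeta> (dg (Suc p) (a \<xi>))" if "\<xi> \<in> ?L" for \<xi>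
    using bspec[OF b_all that] by simp_all
  have nub: "nu X I (Suc p) \<xi> \<zeta> (nu X I p \<eta> \<xi> c) = cls (Suc (Suc p)) \<zeta> (b \<xi>)" if "\<xi> \<in> ?L" for \<xi>
    unfolding nuc[OF that] by (rule nu_cls[OF _ \<zeta>(1) _ a(1)[OF that] b(1)[OF that] b(2)[OF that]]) (use that in auto)
  have ac: "a \<xi> \<in> carrier (Gs (Suc p))" if "\<xi> \<in> ?L" for \<xi> using Rep_D(2)[OF a(1)[OF that]] .
  have bc: "b \<xi> \<in> carrier (Gs (Suc (Suc p)))" if "\<xi> \<in> ?L" for \<xi> using Rep_D(2)[OF b(1)[OF that]] .
  define A where "A = finprod (Gs (Suc p)) a ?L"
  have Ac: "A \<in> carrier (Gs (Suc p))" unfolding A_def using ac by (intro Gc.finprod_closed) auto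
  have gA: "gm (Suc p) x A = finprod (stalk X (J (Suc p)) x) (\<lambda>\<xi>. gm (Suc p) x (a \<xi>)) ?L" if "x \<in> T" for x
    unfolding A_def by (rule hom_finprod_comm[OF G_comm stalk_J_comm[OF that] gm_hom[OF that]]) (use ac in auto)
  define e where "e = dg p s \<otimes>\<^bsub>Gs (Suc p)\<^esub> inv\<^bsub>Gs (Suc p)\<^esub> A"
  have ec: "e \<in> carrier (Gs (Suc p))" unfolding e_def using Ac dg_carrier[OF sc] by simp
  have e1: "gm (Suc p) x e = gm (Suc p) x \<one>\<^bsub>Gs (Suc p)\<^esub>" if x: "x \<in> T" and eq: "gm (Suc p) x (dg p s) = gm (Suc p) x A" for x
  proof -
    interpret B: comm_group "stalk X (J (Suc p)) x" by (rule stalk_J_comm[OF x])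
    show ?thesis unfolding e_def using Ac dg_carrier[OF sc] gm_carrier[OF x Ac]
      by (simp add: gm_mult[OF x] gm_inv[OF x] eq gm_one[OF x])
  qed
  have van: "gm (Suc p) x (a \<xi>) = gm (Suc p) x \<one>\<^bsub>Gs (Suc p)\<^esub>" if "\<xi> \<in> ?L" "x \<in> T" "x \<notin> cl \<xi>" for x \<xi>
    by (rule GamD(2)[OF Rep_D(1)[OF a(1)[OF that(1)]] that(2,3)])
  have A_at: "gm (Suc p) x A = gm (Suc p) x (dg p s)"
    if x: "x \<in> T" and out: "\<And>\<xi>. \<xi> \<in> ?L \<Longrightarrow> x \<in> cl \<xi> \<Longrightarrow> \<xi> = x"
      and nL: "x \<notin> ?L \<Longrightarrow> gm (Suc p) x (dg p s) = gm (Suc p) x \<one>\<^bsub>Gs (Suc p)\<^esub>" for x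
  proof -
    interpret B: comm_group "stalk X (J (Suc p)) x" by (rule stalk_J_comm[OF x])
    have v: "gm (Suc p) x (a \<xi>) = \<one>\<^bsub>stalk X (J (Suc p)) x\<^esub>" if "\<xi> \<in> ?L" "\<xi> \<noteq> x" for \<xi>
      unfolding gm_one[OF x, symmetric] by (rule van[OF that(1) x]) (use out that in blast)
    show ?thesis
    proof (cases "x \<in> ?L")
      case False
      then have "finprod (stalk X (J (Suc p)) x) (\<lambda>\<xi>. gm (Suc p) x (a \<xi>)) ?L = \<one>\<^bsub>stalk X (J (Suc p)) x\<^esub>"
        by (intro B.finprod_one_eqI v) auto
      then show ?thesis using nL[OF False] gA[OF x] gm_one[OF x] by simp
    next
      case True
      have "finprod (stalk X (J (Suc p)) x) (\<lambda>\<xi>. gm (Suc p) x (a \<xi>)) ?L = 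
        finprod (stalk X (J (Suc p)) x) (\<lambda>\<xi>. gm (Suc p) x (a \<xi>)) {x}"
        using L True v gm_carrier[OF x ac] by (intro B.finprod_mono_neutral_cong_right) (auto simp: Pi_iff)
      also have "\<dots> = gm (Suc p) x (a x)" using gm_carrier[OF x ac[OF True]] by simp
      finally show ?thesis using gA[OF x] a(2)[OF True] by simp
    qed
  qed
  have "y = \<zeta>" if y: "y \<in> supp (Suc p) e" "\<zeta> \<in> cl y" for y
  proof (rule ccontr)
    assume ne: "y \<noteq> \<zeta>"
    have yT: "y \<in> T" using y by (simp add: supp_def)
    have y\<eta>: "y \<in> cl \<eta>"
    proof (rule ccontr)
      assume n: "y \<notin> cl \<eta>"
      have "gm (Suc p) y (dg p s) = gm (Suc p) y \<one>\<^bsub>Gs (Suc p)\<^esub>"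
        by (rule GamD(2)[OF Gam_dg[OF Rep_D(1)[OF s(1)]] yT n])
      moreover have "\<xi> = y" if "\<xi> \<in> ?L" "y \<in> cl \<xi>" for \<xi>
        using n closure_trans[of \<xi> X \<eta> y] that by simp
      ultimately have "gm (Suc p) y A = gm (Suc p) y (dg p s)" by (intro A_at[OF yT])
      then show False using e1[OF yT] y by (simp add: supp_def)
    qed
    show False
    proof (cases "y = \<eta>")
      case True
      have "\<xi> = y" if "\<xi> \<in> ?L" "y \<in> cl \<xi>" for \<xi>
        using that True closure_antisym[of \<xi> y] by simp
      moreover have "gm (Suc p) y (dg p s) = gm (Suc p) y \<one>\<^bsub>Gs (Suc p)\<^esub>" using Rep_D(3)[OF s(1)] True by simp
      ultimately have "gm (Suc p) y A = gm (Suc p) y (dg p s)" by (intro A_at[OF yT])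
      then show False using e1[OF yT] y by (simp add: supp_def)
    next
      case False
      have yP: "y \<in> P (Suc p)" by (rule codim_between[OF \<zeta>(1) y(2) y\<eta> \<eta> ne False])
      have "\<xi> = y" if "\<xi> \<in> ?L" "y \<in> cl \<xi>" for \<xi> using codim_eq[OF yP _ that(2)] that(1) by simp
      moreover have "gm (Suc p) y (dg p s) = gm (Suc p) y \<one>\<^bsub>Gs (Suc p)\<^esub>" if "y \<notin> ?L" using that yP y\<eta> y by blast
      ultimately have "gm (Suc p) y A = gm (Suc p) y (dg p s)" by (intro A_at[OF yT])
      then show False using e1[OF yT] y by (simp add: supp_def)
    qed
  qed
  then obtain V where "openin X V" "\<zeta> \<in> V" "supp (Suc p) e \<inter> V \<subseteq> cl \<zeta>"
    by (rule local_closed[OF supp_closed[OF ec] \<zeta>T])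
  then obtain e' where e': "e' \<in> Gam (cl \<zeta>) (Suc p)" "gm (Suc p) \<zeta> e' = gm (Suc p) \<zeta> e"
    by (rule truncate[OF cl_closed ec])
  note e'c = GamD(1)[OF e'(1)]
  define B where "B = finprod (Gs (Suc (Suc p))) b ?L"
  have BR: "B \<in> Rep (Suc (Suc p)) \<zeta>" unfolding B_def by (rule cls_finprod(1)[OF \<zeta>T]) (rule b(1))
  have clB: "cls (Suc (Suc p)) \<zeta> B = finprod (H (Suc (Suc p)) \<zeta>) (\<lambda>\<xi>. cls (Suc (Suc p)) \<zeta> (b \<xi>)) ?L"
    unfolding B_def by (rule cls_finprod(2)[OF \<zeta>T]) (rule b(1))
  interpret Z: comm_group "stalk X (J (Suc (Suc p))) \<zeta>" by (rule stalk_J_comm[OF \<zeta>T])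
  have "gm (Suc (Suc p)) \<zeta> B = finprod (stalk X (J (Suc (Suc p))) \<zeta>) (\<lambda>\<xi>. gm (Suc (Suc p)) \<zeta> (b \<xi>)) ?L"
    unfolding B_def by (rule hom_finprod_comm[OF G_comm stalk_J_comm[OF \<zeta>T] gm_hom[OF \<zeta>T]]) (use bc in auto)
  also have "\<dots> = finprod (stalk X (J (Suc (Suc p))) \<zeta>) (\<lambda>\<xi>. gm (Suc (Suc p)) \<zeta> (dg (Suc p) (a \<xi>))) ?L"
    using b(2) gm_carrier[OF \<zeta>T dg_carrier[OF ac]] by (intro Z.finprod_cong') auto
  also have "\<dots> = gm (Suc (Suc p)) \<zeta> (finprod (Gs (Suc (Suc p))) (\<lambda>\<xi>. dg (Suc p) (a \<xi>)) ?L)"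
    by (rule hom_finprod_comm[OF G_comm stalk_J_comm[OF \<zeta>T] gm_hom[OF \<zeta>T], symmetric]) (use dg_carrier[OF ac] in auto)
  also have "finprod (Gs (Suc (Suc p))) (\<lambda>\<xi>. dg (Suc p) (a \<xi>)) ?L = dg (Suc p) A"
    unfolding A_def by (rule hom_finprod_comm[OF G_comm G_comm dg_hom, symmetric]) (use ac in auto)
  also have "gm (Suc (Suc p)) \<zeta> (dg (Suc p) A) = gm (Suc (Suc p)) \<zeta> (dg (Suc p) (inv\<^bsub>Gs (Suc p)\<^esub> e'))"
  proof -
    have "A = inv\<^bsub>Gs (Suc p)\<^esub> e \<otimes>\<^bsub>Gs (Suc p)\<^esub> dg p s"
      unfolding e_def using Ac dg_carrier[OF sc] by (simp add: Gc.inv_mult Gc.m_assoc Gc.m_comm[of "inv\<^bsub>Gs (Suc p)\<^esub> dg p s"])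
    then have "dg (Suc p) A = dg (Suc p) (inv\<^bsub>Gs (Suc p)\<^esub> e)"
      using ec dg_carrier[OF sc] by (simp add: dg_mult dg_dg[OF sc] dg_carrier)
    moreover have "gm (Suc p) \<zeta> (inv\<^bsub>Gs (Suc p)\<^esub> e) = gm (Suc p) \<zeta> (inv\<^bsub>Gs (Suc p)\<^esub> e')"
      using e'(2) ec e'c by (simp add: gm_inv[OF \<zeta>T])
    ultimately show ?thesis using gm_dg[OF \<zeta>T] ec e'c by simp
  qed
  finally have gB: "gm (Suc (Suc p)) \<zeta> B = gm (Suc (Suc p)) \<zeta> (dg (Suc p) (inv\<^bsub>Gs (Suc p)\<^esub> e') \<otimes>\<^bsub>Gs (Suc (Suc p))\<^esub> \<one>\<^bsub>Gs (Suc (Suc p))\<^esub>)"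
    using e'c by (simp add: dg_carrier)
  have "dg (Suc p) (inv\<^bsub>Gs (Suc p)\<^esub> e') \<in> Bd (Suc (Suc p)) \<zeta>" using Gam_inv[OF e'(1)] by (simp add: Bd_def)
  then have "\<exists>D\<in>Bd (Suc (Suc p)) \<zeta>. gm (Suc (Suc p)) \<zeta> B = gm (Suc (Suc p)) \<zeta> (D \<otimes>\<^bsub>Gs (Suc (Suc p))\<^esub> \<one>\<^bsub>Gs (Suc (Suc p))\<^esub>)"
    by (rule bexI[rotated]) (rule gB)
  then have "cls (Suc (Suc p)) \<zeta> B = \<one>\<^bsub>H (Suc (Suc p)) \<zeta>\<^esub>"
    unfolding cls_one[OF \<zeta>T, symmetric]
    by (rule iffD2[OF cls_eq_iff[OF \<zeta>T BR subgroup.one_closed[OF Rep_subgroup[OF \<zeta>T]]]])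
  moreover have "finprod (H (Suc (Suc p)) \<zeta>) (\<lambda>\<xi>. nu X I (Suc p) \<xi> \<zeta> (nu X I p \<eta> \<xi> c)) ?F =
    finprod (H (Suc (Suc p)) \<zeta>) (\<lambda>\<xi>. cls (Suc (Suc p)) \<zeta> (b \<xi>)) ?L"
  proof (rule Hc.finprod_mono_neutral_cong_left[OF L FL])
    show "cls (Suc (Suc p)) \<zeta> (b \<xi>) = \<one>\<^bsub>H (Suc (Suc p)) \<zeta>\<^esub>" if "\<xi> \<in> ?L - ?F" for \<xi>
    proof -
      have x: "\<xi> \<in> ?L" "\<xi> \<in> P (Suc p)" "\<zeta> \<in> cl \<xi>" "nu X I p \<eta> \<xi> c = \<one>\<^bsub>H (Suc p) \<xi>\<^esub>" using that by auto
      have "nu X I (Suc p) \<xi> \<zeta> \<one>\<^bsub>H (Suc p) \<xi>\<^esub> = \<one>\<^bsub>H (Suc (Suc p)) \<zeta>\<^esub>"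
        by (rule hom_one_comm[OF H_comm_group[OF P_topspace[OF x(2)]] H_comm_group[OF \<zeta>T] nu_hom[OF x(2) \<zeta>(1) x(3)]])
      then show ?thesis using nub[OF x(1)] x(4) by simp
    qed
    show "nu X I (Suc p) \<xi> \<zeta> (nu X I p \<eta> \<xi> c) = cls (Suc (Suc p)) \<zeta> (b \<xi>)" if "\<xi> \<in> ?F" for \<xi>
      using nub FL that by blast
    show "(\<lambda>\<xi>. cls (Suc (Suc p)) \<zeta> (b \<xi>)) \<in> ?L \<rightarrow> carrier (H (Suc (Suc p)) \<zeta>)"
      using cls_carrier[OF \<zeta>T b(1)] by auto
  qed
  ultimately show ?thesis using clB by simp
qed

end

section \<open>Alternating sums over the faces of a flag\<close>

fun faces :: "'x list \<Rightarrow> 'x list list" where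
  "faces [] = []"
| "faces (a # xs) = xs # map ((#) a) (faces xs)"

text \<open>The alternating sum of the values of \<open>h\<close> on the faces of a flag.  Recursion on the first point of the flag
  suits inductive proofs better than a sum over indices.\<close>

fun alt :: "('h, 'z) monoid_scheme \<Rightarrow> ('x list \<Rightarrow> 'h) \<Rightarrow> 'x list \<Rightarrow> 'h" where
  "alt G h [] = \<one>\<^bsub>G\<^esub>"
| "alt G h (a # xs) = h xs \<otimes>\<^bsub>G\<^esub> inv\<^bsub>G\<^esub> alt G (\<lambda>ys. h (a # ys)) xs"

lemma faces_length: "ys \<in> set (faces xs) \<Longrightarrow> Suc (length ys) = length xs"
  by (induction xs arbitrary: ys) auto

lemma alt_cong: "(\<And>ys. ys \<in> set (faces xs) \<Longrightarrow> h ys = h' ys) \<Longrightarrow> alt G h xs = alt G h' xs"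
proof (induction xs arbitrary: h h')
  case (Cons a xs)
  have "alt G (\<lambda>ys. h (a # ys)) xs = alt G (\<lambda>ys. h' (a # ys)) xs" by (rule Cons.IH) (simp add: Cons.prems)
  then show ?case by (simp add: Cons.prems)
qed simp

lemma alt_closed:
  assumes "comm_group G"
  shows "(\<And>ys. ys \<in> set (faces xs) \<Longrightarrow> h ys \<in> carrier G) \<Longrightarrow> alt G h xs \<in> carrier G"
proof (induction xs arbitrary: h)
  case Nil
  interpret comm_group G by fact
  show ?case by simp
next
  case (Cons a xs)
  interpret comm_group G by fact
  have "alt G (\<lambda>ys. h (a # ys)) xs \<in> carrier G" by (rule Cons.IH) (simp add: Cons.prems)
  then show ?case using Cons.prems[of xs] by simp
qed

lemma alt_hom:
  assumes G: "comm_group G" and H: "comm_group H" and \<phi>: "\<phi> \<in> hom G H"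
  shows "(\<And>ys. ys \<in> set (faces xs) \<Longrightarrow> h ys \<in> carrier G) \<Longrightarrow> \<phi> (alt G h xs) = alt H (\<lambda>ys. \<phi> (h ys)) xs"
proof (induction xs arbitrary: h)
  case Nil
  then show ?case by (simp add: hom_one_comm[OF G H \<phi>])
next
  case (Cons a xs)
  interpret comm_group G by fact
  have c: "alt G (\<lambda>ys. h (a # ys)) xs \<in> carrier G" by (rule alt_closed[OF G]) (simp add: Cons.prems)
  have "\<phi> (alt G (\<lambda>ys. h (a # ys)) xs) = alt H (\<lambda>ys. \<phi> (h (a # ys))) xs"
    by (rule Cons.IH) (simp add: Cons.prems)
  then show ?case using Cons.prems[of xs] c
    by (simp add: hom_mult[OF \<phi>] hom_inv_comm[OF G H \<phi>])
qed

lemma alt_mult: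
  assumes G: "comm_group G"
  shows "(\<And>ys. ys \<in> set (faces xs) \<Longrightarrow> h ys \<in> carrier G) \<Longrightarrow> (\<And>ys. ys \<in> set (faces xs) \<Longrightarrow> h' ys \<in> carrier G) \<Longrightarrow>
    alt G (\<lambda>ys. h ys \<otimes>\<^bsub>G\<^esub> h' ys) xs = alt G h xs \<otimes>\<^bsub>G\<^esub> alt G h' xs"
proof (induction xs arbitrary: h h')
  case Nil
  interpret comm_group G by fact
  show ?case by simp
next
  case (Cons a xs)
  interpret comm_group G by fact
  have c: "alt G (\<lambda>ys. h (a # ys)) xs \<in> carrier G" "alt G (\<lambda>ys. h' (a # ys)) xs \<in> carrier G"
    by (rule alt_closed[OF G]; simp add: Cons.prems)+
  have "alt G (\<lambda>ys. h (a # ys) \<otimes>\<^bsub>G\<^esub> h' (a # ys)) xs = alt G (\<lambda>ys. h (a # ys)) xs \<otimes>\<^bsub>G\<^esub> alt G (\<lambda>ys. h' (a # ys)) xs"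
    by (rule Cons.IH) (simp_all add: Cons.prems)
  then show ?case using Cons.prems(1)[of xs] Cons.prems(2)[of xs] c by (simp add: inv_mult m_ac)
qed

lemma alt_inv:
  assumes G: "comm_group G" and h: "\<And>ys. ys \<in> set (faces xs) \<Longrightarrow> h ys \<in> carrier G"
  shows "alt G (\<lambda>ys. inv\<^bsub>G\<^esub> h ys) xs = inv\<^bsub>G\<^esub> alt G h xs"
proof -
  interpret comm_group G by fact
  have "m_inv G \<in> hom G G" by (rule homI) (simp_all add: inv_mult)
  from alt_hom[OF G G this, of xs h] h show ?thesis by simp
qed

text \<open>Of the terms for \<open>a # xs\<close>, those without \<open>a\<close> appear twice with opposite signs, and the others form the
  same sum for \<open>xs\<close>.\<close>

lemma alt_alt:
  assumes G: "comm_group G"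
  shows "(\<And>ys zs. ys \<in> set (faces xs) \<Longrightarrow> zs \<in> set (faces ys) \<Longrightarrow> h zs \<in> carrier G) \<Longrightarrow> alt G (alt G h) xs = \<one>\<^bsub>G\<^esub>"
proof (induction xs arbitrary: h)
  case Nil then show ?case by simp
next
  case (Cons a xs)
  interpret comm_group G by fact
  have hxs: "h zs \<in> carrier G" if "zs \<in> set (faces xs)" for zs using Cons.prems[of xs zs] that by simp
  have ha: "h (a # zs) \<in> carrier G" if "ys \<in> set (faces xs)" "zs \<in> set (faces ys)" for ys zs
    by (rule Cons.prems[of "a # ys"]) (use that in auto)
  have c: "alt G h xs \<in> carrier G" by (rule alt_closed[OF G hxs])
  have c': "alt G (\<lambda>zs. h (a # zs)) ys \<in> carrier G" if "ys \<in> set (faces xs)" for ys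
    by (rule alt_closed[OF G ha[OF that]])
  have "alt G (\<lambda>ys. alt G h (a # ys)) xs = alt G (\<lambda>ys. h ys \<otimes>\<^bsub>G\<^esub> inv\<^bsub>G\<^esub> alt G (\<lambda>zs. h (a # zs)) ys) xs" by simp
  also have "\<dots> = alt G h xs \<otimes>\<^bsub>G\<^esub> alt G (\<lambda>ys. inv\<^bsub>G\<^esub> alt G (\<lambda>zs. h (a # zs)) ys) xs"
    by (rule alt_mult[OF G hxs]) (simp_all add: c')
  also have "alt G (\<lambda>ys. inv\<^bsub>G\<^esub> alt G (\<lambda>zs. h (a # zs)) ys) xs = inv\<^bsub>G\<^esub> alt G (alt G (\<lambda>zs. h (a # zs))) xs"
    by (rule alt_inv[OF G c'])
  also have "alt G (alt G (\<lambda>zs. h (a # zs))) xs = \<one>\<^bsub>G\<^esub>" by (rule Cons.IH[OF ha])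
  finally show ?case using c by simp
qed

section \<open>Abstract Cousin complexes\<close>

fun ncomp :: "(nat \<Rightarrow> 'x \<Rightarrow> 'x \<Rightarrow> 'h \<Rightarrow> 'h) \<Rightarrow> nat \<Rightarrow> 'x list \<Rightarrow> 'h \<Rightarrow> 'h" where
  "ncomp N p (\<eta> # \<xi> # \<eta>s) h = ncomp N (Suc p) (\<xi> # \<eta>s) (N p \<eta> \<xi> h)"
| "ncomp N p \<eta>s h = h"

text \<open>The properties of the groups \<open>H\<^sup>p\<close> at points and of the maps \<open>\<nu>\<close> on which the construction for flags rests.\<close>

locale cousin_data = noetherian_sober X for X :: "'x topology" +
  fixes H :: "nat \<Rightarrow> 'x \<Rightarrow> 'h monoid" and N :: "nat \<Rightarrow> 'x \<Rightarrow> 'x \<Rightarrow> 'h \<Rightarrow> 'h"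
  assumes H_comm: "\<eta> \<in> P p \<Longrightarrow> comm_group (H p \<eta>)"
    and N_hom: "\<eta> \<in> P p \<Longrightarrow> \<xi> \<in> P (Suc p) \<Longrightarrow> \<xi> \<in> cl \<eta> \<Longrightarrow> N p \<eta> \<xi> \<in> hom (H p \<eta>) (H (Suc p) \<xi>)"
    and N_finite: "\<eta> \<in> P p \<Longrightarrow> c \<in> carrier (H p \<eta>) \<Longrightarrow>
      finite {\<xi> \<in> P (Suc p). \<xi> \<in> cl \<eta> \<and> N p \<eta> \<xi> c \<noteq> \<one>\<^bsub>H (Suc p) \<xi>\<^esub>}"
    and N_N: "\<eta> \<in> P p \<Longrightarrow> \<zeta> \<in> P (Suc (Suc p)) \<Longrightarrow> \<zeta> \<in> cl \<eta> \<Longrightarrow> c \<in> carrier (H p \<eta>) \<Longrightarrow>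
      finprod (H (Suc (Suc p)) \<zeta>) (\<lambda>\<xi>. N (Suc p) \<xi> \<zeta> (N p \<eta> \<xi> c))
        {\<xi> \<in> P (Suc p). \<xi> \<in> cl \<eta> \<and> \<zeta> \<in> cl \<xi> \<and> N p \<eta> \<xi> c \<noteq> \<one>\<^bsub>H (Suc p) \<xi>\<^esub>} = \<one>\<^bsub>H (Suc (Suc p)) \<zeta>\<^esub>"
begin

abbreviation oneH :: "nat \<Rightarrow> 'x \<Rightarrow> 'h" where "oneH k \<eta> \<equiv> \<one>\<^bsub>H k \<eta>\<^esub>"

definition Gen :: "nat \<Rightarrow> 'x \<Rightarrow> 'x set" where
  "Gen k \<xi> = {\<eta> \<in> P k. \<xi> \<in> cl \<eta>}"

text \<open>Elements of the direct sum of the groups \<open>H k \<eta>\<close> for \<open>\<eta>\<close> in \<open>A\<close>.\<close>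

definition fam :: "nat \<Rightarrow> 'x set \<Rightarrow> ('x \<Rightarrow> 'h) \<Rightarrow> bool" where
  "fam k A h \<longleftrightarrow> (\<forall>\<eta>\<in>A. h \<eta> \<in> carrier (H k \<eta>)) \<and> finite {\<eta>\<in>A. h \<eta> \<noteq> oneH k \<eta>}"

text \<open>The component at \<open>\<xi>\<close> of the Cousin differential.  The product is restricted to nontrivial components in order to be
  finite.\<close>

definition D :: "nat \<Rightarrow> 'x \<Rightarrow> ('x \<Rightarrow> 'h) \<Rightarrow> 'h" where
  "D k \<xi> h = finprod (H (Suc k) \<xi>) (\<lambda>\<eta>. N k \<eta> \<xi> (h \<eta>)) {\<eta>\<in>Gen k \<xi>. h \<eta> \<noteq> oneH k \<eta>}"

lemma Gen_D: "\<eta> \<in> Gen k \<xi> \<Longrightarrow> \<eta> \<in> P k \<and> \<xi> \<in> cl \<eta>" by (simp add: Gen_def)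

lemma Gen_trans: "\<xi> \<in> Gen l \<zeta> \<Longrightarrow> Gen k \<xi> \<subseteq> Gen k \<zeta>"
  using closure_trans by (fastforce simp: Gen_def)

lemma Gen_self: "\<xi> \<in> P k \<Longrightarrow> Gen k \<xi> = {\<xi>}"
  using codim_eq P_self by (auto simp: Gen_def)

lemma Gen_empty: "\<xi> \<in> P k \<Longrightarrow> k < l \<Longrightarrow> Gen l \<xi> = {}"
  using codim_mono by (fastforce simp: Gen_def)

lemma fam_mono: "fam k A h \<Longrightarrow> B \<subseteq> A \<Longrightarrow> fam k B h"
  unfolding fam_def by (auto elim: finite_subset[rotated])

lemma fam_cong: "(\<And>\<eta>. \<eta> \<in> A \<Longrightarrow> h \<eta> = h' \<eta>) \<Longrightarrow> fam k A h = fam k A h'"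
  unfolding fam_def by (intro arg_cong2[where f = "(\<and>)"] arg_cong[where f = finite]) auto

lemma fam_carrier: "fam k A h \<Longrightarrow> \<eta> \<in> A \<Longrightarrow> h \<eta> \<in> carrier (H k \<eta>)"
  by (simp add: fam_def)

lemma fam_one: "A \<subseteq> P k \<Longrightarrow> fam k A (\<lambda>\<eta>. oneH k \<eta>)"
proof -
  assume A: "A \<subseteq> P k"
  have "oneH k \<eta> \<in> carrier (H k \<eta>)" if "\<eta> \<in> A" for \<eta>
  proof -
    interpret comm_group "H k \<eta>" using A that by (intro H_comm) auto
    show ?thesis by simp
  qed
  then show ?thesis by (simp add: fam_def)
qed

lemma fam_mult:
  assumes A: "A \<subseteq> P k" and h: "fam k A h" and h': "fam k A h'"
  shows "fam k A (\<lambda>\<eta>. h \<eta> \<otimes>\<^bsub>H k \<eta>\<^esub> h' \<eta>)"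
proof -
  have c: "h \<eta> \<otimes>\<^bsub>H k \<eta>\<^esub> h' \<eta> \<in> carrier (H k \<eta>)"
    and o: "h \<eta> = oneH k \<eta> \<Longrightarrow> h' \<eta> = oneH k \<eta> \<Longrightarrow> h \<eta> \<otimes>\<^bsub>H k \<eta>\<^esub> h' \<eta> = oneH k \<eta>" if "\<eta> \<in> A" for \<eta>
  proof -
    interpret comm_group "H k \<eta>" using A that by (intro H_comm) auto
    show "h \<eta> \<otimes>\<^bsub>H k \<eta>\<^esub> h' \<eta> \<in> carrier (H k \<eta>)" using fam_carrier[OF h that] fam_carrier[OF h' that] by simp
    show "h \<eta> = oneH k \<eta> \<Longrightarrow> h' \<eta> = oneH k \<eta> \<Longrightarrow> h \<eta> \<otimes>\<^bsub>H k \<eta>\<^esub> h' \<eta> = oneH k \<eta>" by simp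
  qed
  have "{\<eta>\<in>A. h \<eta> \<otimes>\<^bsub>H k \<eta>\<^esub> h' \<eta> \<noteq> oneH k \<eta>} \<subseteq> {\<eta>\<in>A. h \<eta> \<noteq> oneH k \<eta>} \<union> {\<eta>\<in>A. h' \<eta> \<noteq> oneH k \<eta>}"
    using o by blast
  then show ?thesis using c h h' unfolding fam_def by (auto elim: finite_subset)
qed

lemma fam_inv:
  assumes A: "A \<subseteq> P k" and h: "fam k A h"
  shows "fam k A (\<lambda>\<eta>. inv\<^bsub>H k \<eta>\<^esub> h \<eta>)"
proof -
  have c: "inv\<^bsub>H k \<eta>\<^esub> h \<eta> \<in> carrier (H k \<eta>)"
    and o: "h \<eta> = oneH k \<eta> \<Longrightarrow> inv\<^bsub>H k \<eta>\<^esub> h \<eta> = oneH k \<eta>" if "\<eta> \<in> A" for \<eta>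
  proof -
    interpret comm_group "H k \<eta>" using A that by (intro H_comm) auto
    show "inv\<^bsub>H k \<eta>\<^esub> h \<eta> \<in> carrier (H k \<eta>)" using fam_carrier[OF h that] by simp
    show "h \<eta> = oneH k \<eta> \<Longrightarrow> inv\<^bsub>H k \<eta>\<^esub> h \<eta> = oneH k \<eta>" by simp
  qed
  have "{\<eta>\<in>A. inv\<^bsub>H k \<eta>\<^esub> h \<eta> \<noteq> oneH k \<eta>} \<subseteq> {\<eta>\<in>A. h \<eta> \<noteq> oneH k \<eta>}" using o by blast
  then show ?thesis using c h unfolding fam_def by (auto elim: finite_subset)
qed

lemma Gen_P: "Gen k \<xi> \<subseteq> P k" by (auto simp: Gen_def)

lemma N_one: "\<eta> \<in> P k \<Longrightarrow> \<xi> \<in> P (Suc k) \<Longrightarrow> \<xi> \<in> cl \<eta> \<Longrightarrow> N k \<eta> \<xi> (oneH k \<eta>) = oneH (Suc k) \<xi>"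
  by (rule hom_one_comm[OF H_comm H_comm N_hom])

lemma N_carrier: "\<eta> \<in> Gen k \<xi> \<Longrightarrow> \<xi> \<in> P (Suc k) \<Longrightarrow> c \<in> carrier (H k \<eta>) \<Longrightarrow> N k \<eta> \<xi> c \<in> carrier (H (Suc k) \<xi>)"
  using N_hom[of \<eta> k \<xi>] by (auto simp: Gen_def hom_def)

lemma D_eq:
  assumes \<xi>: "\<xi> \<in> P (Suc k)" and h: "fam k (Gen k \<xi>) h" and A: "finite A" "A \<subseteq> Gen k \<xi>"
    "\<And>\<eta>. \<eta> \<in> Gen k \<xi> \<Longrightarrow> \<eta> \<notin> A \<Longrightarrow> h \<eta> = oneH k \<eta>"
  shows "D k \<xi> h = finprod (H (Suc k) \<xi>) (\<lambda>\<eta>. N k \<eta> \<xi> (h \<eta>)) A"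
proof -
  interpret comm_group "H (Suc k) \<xi>" by (rule H_comm[OF \<xi>])
  show ?thesis unfolding D_def
  proof (rule finprod_mono_neutral_cong_left[OF A(1)])
    show "{\<eta> \<in> Gen k \<xi>. h \<eta> \<noteq> oneH k \<eta>} \<subseteq> A" using A(3) by blast
    show "N k \<eta> \<xi> (h \<eta>) = oneH (Suc k) \<xi>" if "\<eta> \<in> A - {\<eta> \<in> Gen k \<xi>. h \<eta> \<noteq> oneH k \<eta>}" for \<eta>
    proof -
      have "\<eta> \<in> Gen k \<xi>" "h \<eta> = oneH k \<eta>" using that A(2) by auto
      then show ?thesis using N_one[of \<eta> k \<xi>] \<xi> by (simp add: Gen_def)
    qed
    show "(\<lambda>\<eta>. N k \<eta> \<xi> (h \<eta>)) \<in> A \<rightarrow> carrier (H (Suc k) \<xi>)"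
      using A(2) N_carrier[OF _ \<xi>] fam_carrier[OF h] by auto
  qed simp
qed

lemma D_closed:
  assumes \<xi>: "\<xi> \<in> P (Suc k)" and h: "fam k (Gen k \<xi>) h"
  shows "D k \<xi> h \<in> carrier (H (Suc k) \<xi>)"
proof -
  interpret comm_group "H (Suc k) \<xi>" by (rule H_comm[OF \<xi>])
  show ?thesis unfolding D_def using N_carrier[OF _ \<xi>] fam_carrier[OF h] by (intro finprod_closed) auto
qed

lemma D_cong:
  assumes \<xi>: "\<xi> \<in> P (Suc k)" and h: "fam k (Gen k \<xi>) h" and e: "\<And>\<eta>. \<eta> \<in> Gen k \<xi> \<Longrightarrow> h \<eta> = h' \<eta>"
  shows "D k \<xi> h = D k \<xi> h'"
proof -
  interpret comm_group "H (Suc k) \<xi>" by (rule H_comm[OF \<xi>])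
  have s: "{\<eta> \<in> Gen k \<xi>. h \<eta> \<noteq> oneH k \<eta>} = {\<eta> \<in> Gen k \<xi>. h' \<eta> \<noteq> oneH k \<eta>}" using e by auto
  show ?thesis unfolding D_def s
    using N_carrier[OF _ \<xi>] fam_carrier[OF h] e by (intro finprod_cong') auto
qed

lemma D_one:
  assumes "\<xi> \<in> P (Suc k)" "\<And>\<eta>. \<eta> \<in> Gen k \<xi> \<Longrightarrow> h \<eta> = oneH k \<eta>"
  shows "D k \<xi> h = oneH (Suc k) \<xi>"
proof -
  interpret comm_group "H (Suc k) \<xi>" by (rule H_comm[OF assms(1)])
  have s: "{\<eta> \<in> Gen k \<xi>. h \<eta> \<noteq> oneH k \<eta>} = {}" using assms(2) by auto
  show ?thesis unfolding D_def s by simp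
qed

lemma D_mult:
  assumes \<xi>: "\<xi> \<in> P (Suc k)" and h: "fam k (Gen k \<xi>) h" and h': "fam k (Gen k \<xi>) h'"
  shows "D k \<xi> (\<lambda>\<eta>. h \<eta> \<otimes>\<^bsub>H k \<eta>\<^esub> h' \<eta>) = D k \<xi> h \<otimes>\<^bsub>H (Suc k) \<xi>\<^esub> D k \<xi> h'"
proof -
  interpret G: comm_group "H (Suc k) \<xi>" by (rule H_comm[OF \<xi>])
  let ?A = "{\<eta> \<in> Gen k \<xi>. h \<eta> \<noteq> oneH k \<eta>} \<union> {\<eta> \<in> Gen k \<xi>. h' \<eta> \<noteq> oneH k \<eta>}"
  have A: "finite ?A" "?A \<subseteq> Gen k \<xi>" using h h' by (auto simp: fam_def)
  have o: "h \<eta> \<otimes>\<^bsub>H k \<eta>\<^esub> h' \<eta> = oneH k \<eta>" if "\<eta> \<in> Gen k \<xi>" "\<eta> \<notin> ?A" for \<eta>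
  proof -
    interpret comm_group "H k \<eta>" using that Gen_P by (intro H_comm) auto
    show ?thesis using that by auto
  qed
  have "D k \<xi> (\<lambda>\<eta>. h \<eta> \<otimes>\<^bsub>H k \<eta>\<^esub> h' \<eta>) = finprod (H (Suc k) \<xi>) (\<lambda>\<eta>. N k \<eta> \<xi> (h \<eta> \<otimes>\<^bsub>H k \<eta>\<^esub> h' \<eta>)) ?A"
    by (rule D_eq[OF \<xi> fam_mult[OF Gen_P h h'] A o])
  also have "\<dots> = finprod (H (Suc k) \<xi>) (\<lambda>\<eta>. N k \<eta> \<xi> (h \<eta>) \<otimes>\<^bsub>H (Suc k) \<xi>\<^esub> N k \<eta> \<xi> (h' \<eta>)) ?A"
  proof (rule G.finprod_cong')
    show "N k \<eta> \<xi> (h \<eta> \<otimes>\<^bsub>H k \<eta>\<^esub> h' \<eta>) = N k \<eta> \<xi> (h \<eta>) \<otimes>\<^bsub>H (Suc k) \<xi>\<^esub> N k \<eta> \<xi> (h' \<eta>)" if "\<eta> \<in> ?A" for \<eta>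
    proof (rule hom_mult[OF N_hom[OF _ \<xi>]])
      show "\<eta> \<in> P k" "\<xi> \<in> cl \<eta>" "h \<eta> \<in> carrier (H k \<eta>)" "h' \<eta> \<in> carrier (H k \<eta>)"
        using that A(2) fam_carrier[OF h] fam_carrier[OF h'] Gen_D by blast+
    qed
    show "(\<lambda>\<eta>. N k \<eta> \<xi> (h \<eta>) \<otimes>\<^bsub>H (Suc k) \<xi>\<^esub> N k \<eta> \<xi> (h' \<eta>)) \<in> ?A \<rightarrow> carrier (H (Suc k) \<xi>)"
      using A(2) N_carrier[OF _ \<xi>] fam_carrier[OF h] fam_carrier[OF h'] by (intro Pi_I G.m_closed) auto
  qed simp
  also have "\<dots> = finprod (H (Suc k) \<xi>) (\<lambda>\<eta>. N k \<eta> \<xi> (h \<eta>)) ?A \<otimes>\<^bsub>H (Suc k) \<xi>\<^esub> finprod (H (Suc k) \<xi>) (\<lambda>\<eta>. N k \<eta> \<xi> (h' \<eta>)) ?A"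
    using A(2) N_carrier[OF _ \<xi>] fam_carrier[OF h] fam_carrier[OF h'] by (intro G.finprod_multf) auto
  also have "finprod (H (Suc k) \<xi>) (\<lambda>\<eta>. N k \<eta> \<xi> (h \<eta>)) ?A = D k \<xi> h" by (rule D_eq[OF \<xi> h A, symmetric]) auto
  also have "finprod (H (Suc k) \<xi>) (\<lambda>\<eta>. N k \<eta> \<xi> (h' \<eta>)) ?A = D k \<xi> h'" by (rule D_eq[OF \<xi> h' A, symmetric]) auto
  finally show ?thesis .
qed

lemma D_inv:
  assumes \<xi>: "\<xi> \<in> P (Suc k)" and h: "fam k (Gen k \<xi>) h"
  shows "D k \<xi> (\<lambda>\<eta>. inv\<^bsub>H k \<eta>\<^esub> h \<eta>) = inv\<^bsub>H (Suc k) \<xi>\<^esub> D k \<xi> h"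
proof -
  interpret G: comm_group "H (Suc k) \<xi>" by (rule H_comm[OF \<xi>])
  note i = fam_inv[OF Gen_P h]
  have "D k \<xi> (\<lambda>\<eta>. inv\<^bsub>H k \<eta>\<^esub> h \<eta>) \<otimes>\<^bsub>H (Suc k) \<xi>\<^esub> D k \<xi> h = D k \<xi> (\<lambda>\<eta>. inv\<^bsub>H k \<eta>\<^esub> h \<eta> \<otimes>\<^bsub>H k \<eta>\<^esub> h \<eta>)"
    by (rule D_mult[OF \<xi> i h, symmetric])
  also have "\<dots> = oneH (Suc k) \<xi>"
  proof (rule D_one[OF \<xi>])
    fix \<eta> assume e: "\<eta> \<in> Gen k \<xi>"
    interpret comm_group "H k \<eta>" using e Gen_P by (intro H_comm) auto
    show "inv\<^bsub>H k \<eta>\<^esub> h \<eta> \<otimes>\<^bsub>H k \<eta>\<^esub> h \<eta> = oneH k \<eta>" using fam_carrier[OF h e] by simp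
  qed
  finally show ?thesis using D_closed[OF \<xi> i] D_closed[OF \<xi> h] by (metis G.inv_equality)
qed

lemma D_single:
  assumes \<xi>: "\<xi> \<in> P (Suc k)" and \<eta>: "\<eta> \<in> P k" and c: "c \<in> carrier (H k \<eta>)"
  shows "D k \<xi> (\<lambda>\<eta>'. if \<eta>' = \<eta> then c else oneH k \<eta>') = (if \<xi> \<in> cl \<eta> then N k \<eta> \<xi> c else oneH (Suc k) \<xi>)"
proof -
  interpret G: comm_group "H (Suc k) \<xi>" by (rule H_comm[OF \<xi>])
  show ?thesis
  proof (cases "\<xi> \<in> cl \<eta>")
    case False
    then have "D k \<xi> (\<lambda>\<eta>'. if \<eta>' = \<eta> then c else oneH k \<eta>') = oneH (Suc k) \<xi>"
      by (intro D_one[OF \<xi>]) (auto simp: Gen_def)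
    then show ?thesis using False by simp
  next
    case True
    then have G: "\<eta> \<in> Gen k \<xi>" using \<eta> by (simp add: Gen_def)
    have "\<eta>' \<in> Gen k \<xi> \<Longrightarrow> (oneH k \<eta>') \<in> carrier (H k \<eta>')" for \<eta>'
      using fam_one[OF Gen_P, of k \<xi>] by (simp add: fam_def)
    then have f: "fam k (Gen k \<xi>) (\<lambda>\<eta>'. if \<eta>' = \<eta> then c else oneH k \<eta>')"
      using c by (auto simp: fam_def intro: finite_subset[of _ "{\<eta>}"])
    have "D k \<xi> (\<lambda>\<eta>'. if \<eta>' = \<eta> then c else oneH k \<eta>') =
      finprod (H (Suc k) \<xi>) (\<lambda>\<eta>'. N k \<eta>' \<xi> (if \<eta>' = \<eta> then c else oneH k \<eta>')) {\<eta>}"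
      by (rule D_eq[OF \<xi> f]) (use G in auto)
    also have "\<dots> = N k \<eta> \<xi> c" using N_carrier[OF G \<xi> c] by simp
    finally show ?thesis using True by simp
  qed
qed

lemma D_finite:
  assumes h: "fam k (P k) h"
  shows "finite {\<xi> \<in> P (Suc k). D k \<xi> h \<noteq> oneH (Suc k) \<xi>}"
proof (rule finite_subset)
  let ?E = "{\<eta> \<in> P k. h \<eta> \<noteq> oneH k \<eta>}"
  let ?B = "\<Union>\<eta>\<in>?E. {\<xi> \<in> P (Suc k). \<xi> \<in> cl \<eta> \<and> N k \<eta> \<xi> (h \<eta>) \<noteq> oneH (Suc k) \<xi>}"
  show "finite ?B" using h N_finite fam_carrier[OF h] by (intro finite_UN_I) (auto simp: fam_def)
  show "{\<xi> \<in> P (Suc k). D k \<xi> h \<noteq> oneH (Suc k) \<xi>} \<subseteq> ?B"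
  proof (rule ccontr)
    assume "\<not> ?thesis"
    then obtain \<xi> where \<xi>: "\<xi> \<in> P (Suc k)" "D k \<xi> h \<noteq> oneH (Suc k) \<xi>" "\<xi> \<notin> ?B" by blast
    interpret comm_group "H (Suc k) \<xi>" by (rule H_comm[OF \<xi>(1)])
    have "D k \<xi> h = oneH (Suc k) \<xi>" unfolding D_def
      by (rule finprod_one_eqI) (use \<xi> in \<open>auto simp: Gen_def\<close>)
    then show False using \<xi>(2) by simp
  qed
qed

lemma fam_extend:
  assumes "A \<subseteq> P k" "fam k A h"
  shows "fam k (P k) (\<lambda>\<eta>. if \<eta> \<in> A then h \<eta> else oneH k \<eta>)"
proof -
  have one: "\<eta> \<in> P k \<Longrightarrow> (oneH k \<eta>) \<in> carrier (H k \<eta>)" for \<eta>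
    using fam_one[of "P k" k] by (simp add: fam_def)
  have "{\<eta> \<in> P k. (if \<eta> \<in> A then h \<eta> else oneH k \<eta>) \<noteq> oneH k \<eta>} \<subseteq> {\<eta> \<in> A. h \<eta> \<noteq> oneH k \<eta>}" by auto
  moreover have "finite {\<eta> \<in> A. h \<eta> \<noteq> oneH k \<eta>}" using assms(2) by (simp add: fam_def)
  ultimately have "finite {\<eta> \<in> P k. (if \<eta> \<in> A then h \<eta> else oneH k \<eta>) \<noteq> oneH k \<eta>}"
    by (rule finite_subset)
  then show ?thesis using assms(2) one by (simp add: fam_def)
qed

lemma fam_D:
  assumes h: "fam k (Gen k \<zeta>) h"
  shows "fam (Suc k) (Gen (Suc k) \<zeta>) (\<lambda>\<xi>. D k \<xi> h)"
proof -
  let ?h = "\<lambda>\<eta>. if \<eta> \<in> Gen k \<zeta> then h \<eta> else oneH k \<eta>"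
  have f: "fam k (P k) ?h" by (rule fam_extend[OF Gen_P h])
  have e: "D k \<xi> h = D k \<xi> ?h" if "\<xi> \<in> Gen (Suc k) \<zeta>" for \<xi>
    using Gen_trans[OF that] Gen_D[OF that] by (intro D_cong fam_mono[OF h]) auto
  have "{\<xi> \<in> Gen (Suc k) \<zeta>. D k \<xi> h \<noteq> oneH (Suc k) \<xi>} \<subseteq> {\<xi> \<in> P (Suc k). D k \<xi> ?h \<noteq> oneH (Suc k) \<xi>}"
    using e Gen_P by auto
  then have "finite {\<xi> \<in> Gen (Suc k) \<zeta>. D k \<xi> h \<noteq> oneH (Suc k) \<xi>}"
    by (rule finite_subset[OF _ D_finite[OF f]])
  moreover have "D k \<xi> h \<in> carrier (H (Suc k) \<xi>)" if "\<xi> \<in> Gen (Suc k) \<zeta>" for \<xi>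
    using Gen_trans[OF that] Gen_D[OF that] by (intro D_closed fam_mono[OF h]) auto
  ultimately show ?thesis by (simp add: fam_def)
qed

text \<open>By additivity it suffices to consider families that are supported at a single point.\<close>

lemma D_D:
  assumes \<zeta>: "\<zeta> \<in> P (Suc (Suc k))" and h: "fam k (Gen k \<zeta>) h"
  shows "D (Suc k) \<zeta> (\<lambda>\<xi>. D k \<xi> h) = oneH (Suc (Suc k)) \<zeta>"
proof -
  interpret Z: comm_group "H (Suc (Suc k)) \<zeta>" by (rule H_comm[OF \<zeta>])
  have one: "\<eta> \<in> P k \<Longrightarrow> (oneH k \<eta>) \<in> carrier (H k \<eta>)" for \<eta> using fam_one[of "P k" k] by (simp add: fam_def)
  have single: "D (Suc k) \<zeta> (\<lambda>\<xi>. D k \<xi> (\<lambda>\<eta>'. if \<eta>' = \<eta> then c else oneH k \<eta>')) = oneH (Suc (Suc k)) \<zeta>"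
    if \<eta>: "\<eta> \<in> Gen k \<zeta>" and c: "c \<in> carrier (H k \<eta>)" for \<eta> c
  proof -
    let ?s = "\<lambda>\<eta>'. if \<eta>' = \<eta> then c else oneH k \<eta>'"
    have \<eta>P: "\<eta> \<in> P k" and \<zeta>\<eta>: "\<zeta> \<in> cl \<eta>" using Gen_D[OF \<eta>] by auto
    have fs: "fam k (Gen k \<zeta>) ?s" using c one Gen_P by (auto simp: fam_def intro: finite_subset[of _ "{\<eta>}"])
    have ds: "D k \<xi> ?s = (if \<xi> \<in> cl \<eta> then N k \<eta> \<xi> c else oneH (Suc k) \<xi>)" if "\<xi> \<in> P (Suc k)" for \<xi>
      by (rule D_single[OF that \<eta>P c])
    have set: "{\<xi> \<in> Gen (Suc k) \<zeta>. D k \<xi> ?s \<noteq> oneH (Suc k) \<xi>} =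
       {\<xi> \<in> P (Suc k). \<xi> \<in> cl \<eta> \<and> \<zeta> \<in> cl \<xi> \<and> N k \<eta> \<xi> c \<noteq> oneH (Suc k) \<xi>}"
      using ds by (auto simp: Gen_def split: if_splits)
    have "D (Suc k) \<zeta> (\<lambda>\<xi>. D k \<xi> ?s) = finprod (H (Suc (Suc k)) \<zeta>) (\<lambda>\<xi>. N (Suc k) \<xi> \<zeta> (N k \<eta> \<xi> c))
       {\<xi> \<in> P (Suc k). \<xi> \<in> cl \<eta> \<and> \<zeta> \<in> cl \<xi> \<and> N k \<eta> \<xi> c \<noteq> oneH (Suc k) \<xi>}"
      unfolding D_def[of "Suc k"] set
      using ds N_carrier[OF _ \<zeta>] N_carrier[OF _ _ c] \<eta>P
      by (intro Z.finprod_cong') (auto simp: Gen_def)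
    then show ?thesis using N_N[OF \<eta>P \<zeta> \<zeta>\<eta> c] by simp
  qed
  have "\<forall>h. fam k (Gen k \<zeta>) h \<longrightarrow> {\<eta>\<in>Gen k \<zeta>. h \<eta> \<noteq> oneH k \<eta>} \<subseteq> E \<longrightarrow> D (Suc k) \<zeta> (\<lambda>\<xi>. D k \<xi> h) = oneH (Suc (Suc k)) \<zeta>"
    if "finite E" for E using that
  proof (induction E)
    case empty
    have "D (Suc k) \<zeta> (\<lambda>\<xi>. D k \<xi> h) = oneH (Suc (Suc k)) \<zeta>" if e: "{\<eta>\<in>Gen k \<zeta>. h \<eta> \<noteq> oneH k \<eta>} \<subseteq> {}" for h
    proof (intro D_one \<zeta>)
      fix \<xi> \<eta> assume "\<xi> \<in> Gen (Suc k) \<zeta>"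
      then show "\<xi> \<in> P (Suc k)" "\<eta> \<in> Gen k \<xi> \<Longrightarrow> h \<eta> = oneH k \<eta>"
        using e Gen_trans[of \<xi> "Suc k" \<zeta> k] Gen_P[of "Suc k" \<zeta>] by auto
    qed
    then show ?case by blast
  next
    case (insert a E)
    show ?case
    proof (intro allI impI)
      fix h assume h: "fam k (Gen k \<zeta>) h" and sub: "{\<eta>\<in>Gen k \<zeta>. h \<eta> \<noteq> oneH k \<eta>} \<subseteq> insert a E"
      show "D (Suc k) \<zeta> (\<lambda>\<xi>. D k \<xi> h) = oneH (Suc (Suc k)) \<zeta>"
      proof (cases "a \<in> Gen k \<zeta>")
        case False
        then show ?thesis using insert.IH h sub by auto
      next
        case True
        let ?s = "\<lambda>\<eta>'. if \<eta>' = a then h a else oneH k \<eta>'" and ?r = "\<lambda>\<eta>. if \<eta> = a then (oneH k \<eta>) else h \<eta>"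
        have c: "h a \<in> carrier (H k a)" by (rule fam_carrier[OF h True])
        have fs: "fam k (Gen k \<zeta>) ?s" using c one Gen_P by (auto simp: fam_def intro: finite_subset[of _ "{a}"])
        have "{\<eta>\<in>Gen k \<zeta>. ?r \<eta> \<noteq> oneH k \<eta>} \<subseteq> {\<eta>\<in>Gen k \<zeta>. h \<eta> \<noteq> oneH k \<eta>}" by auto
        then have "finite {\<eta>\<in>Gen k \<zeta>. ?r \<eta> \<noteq> oneH k \<eta>}"
          by (rule finite_subset) (use h in \<open>simp add: fam_def\<close>)
        moreover have "?r \<eta> \<in> carrier (H k \<eta>)" if "\<eta> \<in> Gen k \<zeta>" for \<eta>
          using fam_carrier[OF h that] one[of \<eta>] that Gen_D[OF that] by (cases "\<eta> = a") simp_all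
        ultimately have fr: "fam k (Gen k \<zeta>) ?r" unfolding fam_def by blast
        have eq: "h \<eta> = ?s \<eta> \<otimes>\<^bsub>H k \<eta>\<^esub> ?r \<eta>" if "\<eta> \<in> Gen k \<zeta>" for \<eta>
        proof -
          interpret comm_group "H k \<eta>" using that Gen_P by (intro H_comm) auto
          show ?thesis
          proof (cases "\<eta> = a")
            case eq: True
            have "h \<eta> = h \<eta> \<otimes>\<^bsub>H k \<eta>\<^esub> (oneH k \<eta>)" using fam_carrier[OF h that] by simp
            then show ?thesis unfolding eq by simp
          qed (use fam_carrier[OF h that] in simp)
        qed
        have D1: "D k \<xi> h = D k \<xi> ?s \<otimes>\<^bsub>H (Suc k) \<xi>\<^esub> D k \<xi> ?r" if \<xi>: "\<xi> \<in> Gen (Suc k) \<zeta>" for \<xi>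
        proof -
          have \<xi>P: "\<xi> \<in> P (Suc k)" and sb: "Gen k \<xi> \<subseteq> Gen k \<zeta>" using Gen_D[OF \<xi>] Gen_trans[OF \<xi>] by auto
          have "D k \<xi> h = D k \<xi> (\<lambda>\<eta>. ?s \<eta> \<otimes>\<^bsub>H k \<eta>\<^esub> ?r \<eta>)"
            by (rule D_cong[OF \<xi>P fam_mono[OF h sb]]) (use eq sb in blast)
          also have "\<dots> = D k \<xi> ?s \<otimes>\<^bsub>H (Suc k) \<xi>\<^esub> D k \<xi> ?r"
            by (rule D_mult[OF \<xi>P fam_mono[OF fs sb] fam_mono[OF fr sb]])
          finally show ?thesis .
        qed
        have "D (Suc k) \<zeta> (\<lambda>\<xi>. D k \<xi> h) = D (Suc k) \<zeta> (\<lambda>\<xi>. D k \<xi> ?s \<otimes>\<^bsub>H (Suc k) \<xi>\<^esub> D k \<xi> ?r)"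
          by (rule D_cong[OF \<zeta> fam_D[OF h] D1])
        also have "\<dots> = D (Suc k) \<zeta> (\<lambda>\<xi>. D k \<xi> ?s) \<otimes>\<^bsub>H (Suc (Suc k)) \<zeta>\<^esub> D (Suc k) \<zeta> (\<lambda>\<xi>. D k \<xi> ?r)"
          by (rule D_mult[OF \<zeta> fam_D[OF fs] fam_D[OF fr]])
        also have "D (Suc k) \<zeta> (\<lambda>\<xi>. D k \<xi> ?s) = oneH (Suc (Suc k)) \<zeta>" by (rule single[OF True c])
        also have "D (Suc k) \<zeta> (\<lambda>\<xi>. D k \<xi> ?r) = oneH (Suc (Suc k)) \<zeta>"
          by (rule mp[OF mp[OF spec[OF insert.IH] fr]]) (use sub in auto)
        finally show ?thesis by simp
      qed
    qed
  qed
  moreover have "finite {\<eta>\<in>Gen k \<zeta>. h \<eta> \<noteq> oneH k \<eta>}" using h by (simp add: fam_def)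
  ultimately show ?thesis using h by simp
qed

lemma fam_alt:
  assumes A: "A \<subseteq> P k"
  shows "(\<And>ys. ys \<in> set (faces xs) \<Longrightarrow> fam k A (\<lambda>\<eta>. u \<eta> ys)) \<Longrightarrow> fam k A (\<lambda>\<eta>. alt (H k \<eta>) (u \<eta>) xs)"
proof (induction xs arbitrary: u)
  case Nil
  then show ?case using fam_one[OF A] by simp
next
  case (Cons a xs)
  have "fam k A (\<lambda>\<eta>. alt (H k \<eta>) (\<lambda>ys. u \<eta> (a # ys)) xs)"
    by (rule Cons.IH[of "\<lambda>\<eta> ys. u \<eta> (a # ys)"]) (use Cons.prems in auto)
  moreover have "fam k A (\<lambda>\<eta>. u \<eta> xs)" using Cons.prems by simp
  ultimately show ?case using fam_mult[OF A _ fam_inv[OF A]] by simp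
qed

lemma D_alt:
  assumes \<xi>: "\<xi> \<in> P (Suc k)"
  shows "(\<And>ys. ys \<in> set (faces xs) \<Longrightarrow> fam k (Gen k \<xi>) (\<lambda>\<eta>. u \<eta> ys)) \<Longrightarrow>
    D k \<xi> (\<lambda>\<eta>. alt (H k \<eta>) (u \<eta>) xs) = alt (H (Suc k) \<xi>) (\<lambda>ys. D k \<xi> (\<lambda>\<eta>. u \<eta> ys)) xs"
proof (induction xs arbitrary: u)
  case Nil
  then show ?case using D_one[OF \<xi>] by simp
next
  case (Cons a xs)
  have fa: "fam k (Gen k \<xi>) (\<lambda>\<eta>. alt (H k \<eta>) (\<lambda>ys. u \<eta> (a # ys)) xs)"
    by (rule fam_alt[OF Gen_P]) (use Cons.prems in auto)
  have ft: "fam k (Gen k \<xi>) (\<lambda>\<eta>. u \<eta> xs)" using Cons.prems by simp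
  have "D k \<xi> (\<lambda>\<eta>. alt (H k \<eta>) (\<lambda>ys. u \<eta> (a # ys)) xs) = alt (H (Suc k) \<xi>) (\<lambda>ys. D k \<xi> (\<lambda>\<eta>. u \<eta> (a # ys))) xs"
    by (rule Cons.IH[of "\<lambda>\<eta> ys. u \<eta> (a # ys)"]) (use Cons.prems in auto)
  then show ?case using D_mult[OF \<xi> ft fam_inv[OF Gen_P fa]] D_inv[OF \<xi> fa] by simp
qed

end

section \<open>Flags and the main construction\<close>

context cousin_data
begin

text \<open>A flag in \<open>U\<close> whose points have codimension at least \<open>k\<close>.  Its type is determined by its points and
  therefore not recorded.\<close>

fun flag :: "'x set \<Rightarrow> nat \<Rightarrow> 'x list \<Rightarrow> bool" where
  "flag U k [] \<longleftrightarrow> True"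
| "flag U k (a # xs) \<longleftrightarrow> a \<in> U \<and> (\<exists>c\<ge>k. a \<in> P c \<and> flag U (Suc c) xs) \<and> (xs \<noteq> [] \<longrightarrow> hd xs \<in> cl a)"

text \<open>The points of codimension \<open>k\<close> that can be put in front of the flag.\<close>

definition above :: "'x set \<Rightarrow> nat \<Rightarrow> 'x list \<Rightarrow> 'x set" where
  "above U k xs = {\<eta> \<in> P k. \<eta> \<in> U \<and> (xs \<noteq> [] \<longrightarrow> hd xs \<in> cl \<eta>)}"

lemma above_P: "above U k xs \<subseteq> P k" by (auto simp: above_def)

lemma flag_mono: "flag U k xs \<Longrightarrow> l \<le> k \<Longrightarrow> flag U l xs"
  by (cases xs) (auto intro: order_trans)

lemma flag_subset: "flag V k xs \<Longrightarrow> V \<subseteq> U \<Longrightarrow> flag U k xs"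
  by (induction xs arbitrary: k) auto

lemma flag_Cons: "\<eta> \<in> above U k xs \<Longrightarrow> flag U (Suc k) xs \<Longrightarrow> flag U k (\<eta> # xs)"
  by (auto simp: above_def)

lemma flag_ConsD: "flag U k (\<eta> # xs) \<Longrightarrow> \<eta> \<in> P k \<Longrightarrow> flag U (Suc k) xs \<and> \<eta> \<in> above U k xs"
  using P_unique by (auto simp: above_def)

lemma flag_tl: "flag U k (a # xs) \<Longrightarrow> flag U (Suc k) xs"
  using flag_mono by fastforce

lemma flag_Suc:
  assumes fl: "flag U k xs" and nh: "\<not> (xs \<noteq> [] \<and> hd xs \<in> P k)"
  shows "flag U (Suc k) xs"
proof (cases xs)
  case (Cons a zs)
  then obtain c where c: "c \<ge> k" "a \<in> P c" "flag U (Suc c) zs" using fl unfolding Cons by auto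
  moreover have "c \<noteq> k" using nh Cons c(2) by auto
  ultimately have "Suc k \<le> c" by simp
  then show ?thesis using c(2,3) fl unfolding Cons by auto
qed simp

lemma above_subset: "V \<subseteq> U \<Longrightarrow> above V k xs \<subseteq> above U k xs" by (auto simp: above_def)

lemma above_hd: "hd xs \<in> P l \<Longrightarrow> xs \<noteq> [] \<Longrightarrow> above U l xs \<subseteq> {hd xs}"
  using codim_eq by (auto simp: above_def)

lemma above_Gen_hd:
  assumes "openin X U" "xs \<noteq> []" "hd xs \<in> U"
  shows "above U k xs = Gen k (hd xs)"
  using assms closure_of_nbhd by (fastforce simp: above_def Gen_def)

lemma Gen_above:
  assumes "openin X U" "\<xi> \<in> above U l xs"
  shows "Gen k \<xi> \<subseteq> above U k xs"
proof
  fix \<eta> assume "\<eta> \<in> Gen k \<xi>"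
  then have \<eta>: "\<eta> \<in> P k" "\<xi> \<in> cl \<eta>" using Gen_D by auto
  have \<xi>: "\<xi> \<in> U" "xs \<noteq> [] \<longrightarrow> hd xs \<in> cl \<xi>" using assms(2) by (simp_all add: above_def)
  have "\<eta> \<in> U" by (rule closure_of_nbhd[OF \<eta>(2) assms(1) \<xi>(1)])
  moreover have "xs \<noteq> [] \<longrightarrow> hd xs \<in> cl \<eta>" using \<xi>(2) closure_trans[OF \<eta>(2)] by simp
  ultimately show "\<eta> \<in> above U k xs" using \<eta>(1) by (simp add: above_def)
qed

lemma face_flag:
  assumes "flag U k xs" "ys \<in> set (faces xs)"
  shows "flag U k ys" "above U l xs \<subseteq> above U l ys"
proof -
  have "flag U k ys \<and> (\<forall>\<xi>\<in>topspace X. (hd xs \<in> cl \<xi>) \<longrightarrow> (ys \<noteq> [] \<longrightarrow> hd ys \<in> cl \<xi>))" using assms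
  proof (induction xs arbitrary: ys k)
    case Nil then show ?case by simp
  next
    case (Cons a xs)
    show ?case
    proof (cases "ys = xs")
      case True
      then show ?thesis using flag_mono[OF flag_tl[OF Cons.prems(1)], of k] Cons.prems(1) closure_trans by auto
    next
      case False
      then obtain zs where zs: "zs \<in> set (faces xs)" "ys = a # zs" using Cons.prems by auto
      obtain c where c: "c \<ge> k" "a \<in> P c" "flag U (Suc c) xs" using Cons.prems by auto
      have ne: "xs \<noteq> []" using zs by auto
      have "flag U (Suc c) zs" "zs \<noteq> [] \<longrightarrow> hd zs \<in> cl a"
        using Cons.IH[OF c(3) zs(1)] Cons.prems(1) ne P_topspace[OF c(2)] by auto
      then have "flag U k ys" using zs c Cons.prems(1) by auto
      then show ?thesis using zs by simp
    qed
  qed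
  then show "flag U k ys" "above U l xs \<subseteq> above U l ys"
    using assms(2) P_topspace by (cases xs; auto simp: above_def)+
qed

text \<open>The points have the codimensions \<open>k, \<dots>, m\<close>.\<close>

definition seg :: "nat \<Rightarrow> nat \<Rightarrow> 'x list \<Rightarrow> bool" where
  "seg k m ys \<longleftrightarrow> length ys = Suc m - k \<and> (\<forall>j<length ys. ys ! j \<in> P (k + j))"

lemma seg_Cons: "k \<le> m \<Longrightarrow> seg k m (\<eta> # ys) \<longleftrightarrow> \<eta> \<in> P k \<and> seg (Suc k) m ys"
  by (auto simp: seg_def nth_Cons split: nat.splits)

lemma seg_nonempty: "k \<le> m \<Longrightarrow> seg k m ys \<Longrightarrow> ys \<noteq> []" by (auto simp: seg_def)

lemma seg_self: "seg k k ys \<longleftrightarrow> (\<exists>\<eta>\<in>P k. ys = [\<eta>])"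
  by (auto simp: seg_def length_Suc_conv)

lemma seg_last:
  assumes "k \<le> m" "seg k m ys"
  shows "last ys \<in> P m"
proof -
  have s: "length ys = Suc m - k" "\<forall>j<length ys. ys ! j \<in> P (k + j)" using assms(2) by (simp_all add: seg_def)
  have "m - k < length ys" using s(1) assms(1) by simp
  then have "ys ! (m - k) \<in> P (k + (m - k))" using s(2) by blast
  then show ?thesis using assms seg_nonempty[OF assms] by (simp add: seg_def last_conv_nth)
qed

lemma ncomp_hom:
  assumes "k \<le> m" "seg k m ys" "flag U k (ys @ xs)"
  shows "ncomp N k ys \<in> hom (H k (hd ys)) (H m (last ys))"
  using assms
proof (induction "m - k" arbitrary: k ys)
  case 0
  then have "m = k" by simp
  then obtain \<eta> where \<eta>: "\<eta> \<in> P k" "ys = [\<eta>]" using 0 by (auto simp: seg_self)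
  have "ncomp N k ys = (\<lambda>h. h)" using \<eta> by auto
  then show ?case using \<eta> \<open>m = k\<close> by (auto simp: hom_def)
next
  case (Suc n)
  obtain \<eta> ys' where s: "ys = \<eta> # ys'" using seg_nonempty[OF Suc.prems(1,2)] by (cases ys) auto
  have \<eta>: "\<eta> \<in> P k" and s': "seg (Suc k) m ys'" using Suc.prems s seg_Cons by auto
  have km: "Suc k \<le> m" using Suc.hyps by simp
  obtain \<xi> zs where r: "ys' = \<xi> # zs" using seg_nonempty[OF km s'] by (cases ys') auto
  have \<xi>: "\<xi> \<in> P (Suc k)" using s' r seg_Cons[OF km] by auto
  have "\<xi> \<in> cl \<eta>" using Suc.prems(3) s r by simp
  then have 1: "N k \<eta> \<xi> \<in> hom (H k \<eta>) (H (Suc k) \<xi>)" by (rule N_hom[OF \<eta> \<xi>])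
  have "flag U (Suc k) (ys' @ xs)" using flag_ConsD[of U k \<eta> "ys' @ xs"] Suc.prems(3) s \<eta> by simp
  then have 2: "ncomp N (Suc k) ys' \<in> hom (H (Suc k) \<xi>) (H m (last ys'))"
    using Suc.hyps(1)[of "Suc k" ys'] Suc.hyps(2) km s' r by simp
  have "ncomp N k ys = ncomp N (Suc k) ys' \<circ> N k \<eta> \<xi>" using s r by auto
  then show ?case using hom_compose[OF 1 2] s r by simp
qed

end

text \<open>At each point the complex of stalks of a Cousin complex is exact in positive degrees.\<close>

locale cousin_exact = cousin_data X H N for X :: "'x topology" and H :: "nat \<Rightarrow> 'x \<Rightarrow> 'h monoid" and N +
  assumes exact: "y \<in> topspace X \<Longrightarrow> fam (Suc k) (Gen (Suc k) y) h \<Longrightarrow>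
      (\<And>\<zeta>. \<zeta> \<in> Gen (Suc (Suc k)) y \<Longrightarrow> D (Suc k) \<zeta> h = oneH (Suc (Suc k)) \<zeta>) \<Longrightarrow>
      \<exists>g. fam k (Gen k y) g \<and> (\<forall>\<xi>\<in>Gen (Suc k) y. D k \<xi> g = h \<xi>)"
begin

text \<open>Exactness on a neighbourhood: both the family and its preimage are finitely supported, so the
  points at which they fail to agree and that do not specialize to \<open>x\<close> can be removed.\<close>

lemma exact_nbhd:
  assumes x: "x \<in> U" and U: "openin X U" and h: "fam (Suc k) (above U (Suc k) []) h"
    and z: "\<And>\<zeta>. \<zeta> \<in> above U (Suc (Suc k)) [] \<Longrightarrow> D (Suc k) \<zeta> h = oneH (Suc (Suc k)) \<zeta>"
  obtains V g where "openin X V" "x \<in> V" "V \<subseteq> U" "fam k (above V k []) g"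
    "\<forall>\<xi>\<in>above V (Suc k) []. D k \<xi> g = h \<xi>"
proof -
  have xT: "x \<in> topspace X" using x openin_subset[OF U] by auto
  have sub: "Gen l x \<subseteq> above U l []" for l
    using closure_of_nbhd[OF _ U x] by (auto simp: Gen_def above_def)
  have "\<exists>g. fam k (Gen k x) g \<and> (\<forall>\<xi>\<in>Gen (Suc k) x. D k \<xi> g = h \<xi>)"
    by (rule exact[OF xT fam_mono[OF h sub] z]) (rule subsetD[OF sub])
  then obtain g0 where g0: "fam k (Gen k x) g0" "\<forall>\<xi>\<in>Gen (Suc k) x. D k \<xi> g0 = h \<xi>" by (elim exE conjE)
  define g where "g \<eta> = (if \<eta> \<in> Gen k x then g0 \<eta> else oneH k \<eta>)" for \<eta>
  have g: "fam k (P k) g" unfolding g_def by (rule fam_extend[OF Gen_P g0(1)])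
  define B where "B = {\<xi> \<in> P (Suc k). D k \<xi> g \<noteq> oneH (Suc k) \<xi>} \<union> {\<xi> \<in> above U (Suc k) []. h \<xi> \<noteq> oneH (Suc k) \<xi>}"
  have B: "finite B" using D_finite[OF g] h by (auto simp: B_def fam_def)
  have fB: "finite (B - Gen (Suc k) x)" using B by simp
  have nB: "x \<notin> cl s" if "s \<in> B - Gen (Suc k) x" for s
    using that by (auto simp: B_def Gen_def above_def)
  obtain V where V: "openin X V" "x \<in> V" "V \<subseteq> U" "V \<inter> (B - Gen (Suc k) x) = {}"
    by (rule avoid_finite[OF fB x U nB])
  have "D k \<xi> g = h \<xi>" if \<xi>: "\<xi> \<in> above V (Suc k) []" for \<xi>
  proof (cases "\<xi> \<in> Gen (Suc k) x")
    case True
    have "D k \<xi> g0 = D k \<xi> g"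
      by (rule D_cong) (use True Gen_trans[OF True, of k] Gen_D[OF True] fam_mono[OF g0(1)] in \<open>auto simp: g_def\<close>)
    then show ?thesis using g0(2) True by simp
  next
    case False
    then have "\<xi> \<notin> B" using V(4) \<xi> by (auto simp: above_def)
    then show ?thesis using \<xi> V(3) by (auto simp: B_def above_def)
  qed
  then show thesis by (intro that[OF V(1-3) fam_mono[OF g above_P]] ballI)
qed

text \<open>A datum of level \<open>k\<close> assigns to a flag that consists of a point \<open>\<eta>\<close> of codimension \<open>k\<close> and a flag \<open>xs\<close> of points of
  larger codimension an element of \<open>H k \<eta>\<close>.  It is what remains of an adelic cocycle of degree \<open>n\<close> after \<open>k\<close> steps
  of taking residues; the alternating sums of its values are in the kernel of the Cousin differential.\<close>

definition datum :: "nat \<Rightarrow> 'x set \<Rightarrow> nat \<Rightarrow> ('x list \<Rightarrow> 'h) \<Rightarrow> bool" where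
  "datum n U k u \<longleftrightarrow>
     (\<forall>\<eta> xs. \<eta> \<in> P k \<longrightarrow> flag U k (\<eta> # xs) \<longrightarrow> length xs = n - k \<longrightarrow> u (\<eta> # xs) \<in> carrier (H k \<eta>)) \<and>
     (\<forall>m xs. k \<le> m \<longrightarrow> flag U (Suc m) xs \<longrightarrow>
        finite {ys. seg k m ys \<and> flag U k (ys @ xs) \<and> length (ys @ xs) = Suc n - k \<and>
          ncomp N k ys (u (ys @ xs)) \<noteq> oneH m (last ys)}) \<and>
     (\<forall>xs. flag U (Suc k) xs \<longrightarrow> length xs = Suc n - k \<longrightarrow> (\<forall>\<xi>\<in>above U (Suc k) xs.
        D k \<xi> (\<lambda>\<eta>. alt (H k \<eta>) (\<lambda>ys. u (\<eta> # ys)) xs) = oneH (Suc k) \<xi>))"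

text \<open>A family of degree \<open>n - 1\<close>.  The sums in the last condition are the candidates for the values of a
  coboundary on the flag \<open>xs\<close>: they have to be in the kernel of the Cousin differential.\<close>

definition solution :: "nat \<Rightarrow> 'x set \<Rightarrow> nat \<Rightarrow> ('x list \<Rightarrow> 'h) \<Rightarrow> ('x list \<Rightarrow> 'h) \<Rightarrow> bool" where
  "solution n V k u v \<longleftrightarrow>
     (\<forall>\<eta> xs. \<eta> \<in> P k \<longrightarrow> flag V k (\<eta> # xs) \<longrightarrow> Suc (length xs) = n - k \<longrightarrow> v (\<eta> # xs) \<in> carrier (H k \<eta>)) \<and>
     (\<forall>m xs. k \<le> m \<longrightarrow> flag V (Suc m) xs \<longrightarrow>
        finite {ys. seg k m ys \<and> flag V k (ys @ xs) \<and> length (ys @ xs) = n - k \<and>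
          v (ys @ xs) \<noteq> oneH k (hd ys)}) \<and>
     (\<forall>xs. flag V (Suc k) xs \<longrightarrow> length xs = n - k \<longrightarrow> (\<forall>\<xi>\<in>above V (Suc k) xs.
        D k \<xi> (\<lambda>\<eta>. u (\<eta> # xs) \<otimes>\<^bsub>H k \<eta>\<^esub> alt (H k \<eta>) (\<lambda>ys. v (\<eta> # ys)) xs) = oneH (Suc k) \<xi>))"

lemma datum_carrier: "datum n U k u \<Longrightarrow> \<eta> \<in> P k \<Longrightarrow> flag U k (\<eta> # xs) \<Longrightarrow> length xs = n - k \<Longrightarrow> u (\<eta> # xs) \<in> carrier (H k \<eta>)"
  by (simp add: datum_def)

lemma datum_finite: "datum n U k u \<Longrightarrow> k \<le> m \<Longrightarrow> flag U (Suc m) xs \<Longrightarrow>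
    finite {ys. seg k m ys \<and> flag U k (ys @ xs) \<and> length (ys @ xs) = Suc n - k \<and> ncomp N k ys (u (ys @ xs)) \<noteq> oneH m (last ys)}"
  unfolding datum_def by blast

lemma datum_cocycle: "datum n U k u \<Longrightarrow> flag U (Suc k) xs \<Longrightarrow> length xs = Suc n - k \<Longrightarrow> \<xi> \<in> above U (Suc k) xs \<Longrightarrow>
    D k \<xi> (\<lambda>\<eta>. alt (H k \<eta>) (\<lambda>ys. u (\<eta> # ys)) xs) = oneH (Suc k) \<xi>"
  unfolding datum_def by blast

lemma solution_carrier: "solution n V k u v \<Longrightarrow> \<eta> \<in> P k \<Longrightarrow> flag V k (\<eta> # xs) \<Longrightarrow> Suc (length xs) = n - k \<Longrightarrow>
    v (\<eta> # xs) \<in> carrier (H k \<eta>)"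
  by (simp add: solution_def)

lemma solution_finite: "solution n V k u v \<Longrightarrow> k \<le> m \<Longrightarrow> flag V (Suc m) xs \<Longrightarrow>
    finite {ys. seg k m ys \<and> flag V k (ys @ xs) \<and> length (ys @ xs) = n - k \<and> v (ys @ xs) \<noteq> oneH k (hd ys)}"
  unfolding solution_def by blast

lemma solution_eq: "solution n V k u v \<Longrightarrow> flag V (Suc k) xs \<Longrightarrow> length xs = n - k \<Longrightarrow> \<xi> \<in> above V (Suc k) xs \<Longrightarrow>
    D k \<xi> (\<lambda>\<eta>. u (\<eta> # xs) \<otimes>\<^bsub>H k \<eta>\<^esub> alt (H k \<eta>) (\<lambda>ys. v (\<eta> # ys)) xs) = oneH (Suc k) \<xi>"
  unfolding solution_def by blast

lemma datum_fam:
  assumes u: "datum n U k u" and k: "k \<le> n" and xs: "flag U (Suc k) xs" "length xs = n - k"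
  shows "fam k (above U k xs) (\<lambda>\<eta>. u (\<eta> # xs))"
proof -
  let ?A = "{ys. seg k k ys \<and> flag U k (ys @ xs) \<and> length (ys @ xs) = Suc n - k \<and> ncomp N k ys (u (ys @ xs)) \<noteq> oneH k (last ys)}"
  have "finite ?A" by (rule datum_finite[OF u order_refl xs(1)])
  moreover have "{\<eta> \<in> above U k xs. u (\<eta> # xs) \<noteq> oneH k \<eta>} \<subseteq> hd ` ?A"
  proof
    fix \<eta> assume \<eta>: "\<eta> \<in> {\<eta> \<in> above U k xs. u (\<eta> # xs) \<noteq> oneH k \<eta>}"
    then have "[\<eta>] \<in> ?A" using xs k flag_Cons[of \<eta> U k xs] above_P[of U k xs] by (auto simp: seg_self)
    then show "\<eta> \<in> hd ` ?A" by (rule image_eqI[rotated]) simp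
  qed
  ultimately have "finite {\<eta> \<in> above U k xs. u (\<eta> # xs) \<noteq> oneH k \<eta>}" by (rule finite_surj)
  moreover have "u (\<eta> # xs) \<in> carrier (H k \<eta>)" if "\<eta> \<in> above U k xs" for \<eta>
    by (rule datum_carrier[OF u subsetD[OF above_P that] flag_Cons[OF that xs(1)] xs(2)])
  ultimately show ?thesis by (simp add: fam_def)
qed

lemma solution_fam:
  assumes v: "solution n V k u v" and xs: "flag V (Suc k) xs" "Suc (length xs) = n - k"
  shows "fam k (above V k xs) (\<lambda>\<eta>. v (\<eta> # xs))"
proof -
  let ?A = "{ys. seg k k ys \<and> flag V k (ys @ xs) \<and> length (ys @ xs) = n - k \<and> v (ys @ xs) \<noteq> oneH k (hd ys)}"
  have "finite ?A" by (rule solution_finite[OF v order_refl xs(1)])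
  moreover have "{\<eta> \<in> above V k xs. v (\<eta> # xs) \<noteq> oneH k \<eta>} \<subseteq> hd ` ?A"
  proof
    fix \<eta> assume \<eta>: "\<eta> \<in> {\<eta> \<in> above V k xs. v (\<eta> # xs) \<noteq> oneH k \<eta>}"
    then have "[\<eta>] \<in> ?A" using xs flag_Cons[of \<eta> V k xs] above_P[of V k xs] by (auto simp: seg_self)
    then show "\<eta> \<in> hd ` ?A" by (rule image_eqI[rotated]) simp
  qed
  ultimately have "finite {\<eta> \<in> above V k xs. v (\<eta> # xs) \<noteq> oneH k \<eta>}" by (rule finite_surj)
  moreover have "v (\<eta> # xs) \<in> carrier (H k \<eta>)" if "\<eta> \<in> above V k xs" for \<eta>
    by (rule solution_carrier[OF v subsetD[OF above_P that] flag_Cons[OF that xs(1)] xs(2)])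
  ultimately show ?thesis by (simp add: fam_def)
qed

lemma face_fam_datum:
  assumes u: "datum n U k u" and k: "k \<le> n" and xs: "flag U (Suc k) xs" "length xs = Suc n - k" and ys: "ys \<in> set (faces xs)"
  shows "fam k (above U k xs) (\<lambda>\<eta>. u (\<eta> # ys))"
  using fam_mono[OF datum_fam[OF u k face_flag(1)[OF xs(1) ys]] face_flag(2)[OF xs(1) ys]]
    faces_length[OF ys] xs(2) k by (simp add: Suc_diff_le)

lemma face_fam_solution:
  assumes v: "solution n V k u v" and xs: "flag V (Suc k) xs" "length xs = n - k" and ys: "ys \<in> set (faces xs)"
  shows "fam k (above V k xs) (\<lambda>\<eta>. v (\<eta> # ys))"
  using fam_mono[OF solution_fam[OF v face_flag(1)[OF xs(1) ys]] face_flag(2)[OF xs(1) ys]]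
    faces_length[OF ys] xs(2) by simp

text \<open>The residue of a datum, with the sign that the next level requires.\<close>

definition res :: "nat \<Rightarrow> ('x list \<Rightarrow> 'h) \<Rightarrow> 'x list \<Rightarrow> 'h" where
  "res k u zs = inv\<^bsub>H (Suc k) (hd zs)\<^esub> D k (hd zs) (\<lambda>\<eta>. u (\<eta> # zs))"

text \<open>The cocycle condition for the flag \<open>\<xi> # xs\<close> expresses the differential of the family for its first face \<open>xs\<close>
  by those for the other faces, which are residues.\<close>

lemma res_alt:
  assumes U: "openin X U" and u: "datum n U k u" and k: "k < n"
    and xs: "flag U (Suc (Suc k)) xs" "length xs = n - k" and \<xi>: "\<xi> \<in> above U (Suc k) xs"
  shows "alt (H (Suc k) \<xi>) (\<lambda>ys. res k u (\<xi> # ys)) xs = inv\<^bsub>H (Suc k) \<xi>\<^esub> D k \<xi> (\<lambda>\<eta>. u (\<eta> # xs))"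
    and "\<And>ys. ys \<in> set (faces xs) \<Longrightarrow> res k u (\<xi> # ys) \<in> carrier (H (Suc k) \<xi>)"
proof -
  have \<xi>P: "\<xi> \<in> P (Suc k)" using \<xi> above_P by blast
  interpret comm_group "H (Suc k) \<xi>" by (rule H_comm[OF \<xi>P])
  have kn: "k \<le> n" using k by simp
  have fl: "flag U (Suc k) (\<xi> # xs)" by (rule flag_Cons[OF \<xi> xs(1)])
  have len: "length (\<xi> # xs) = Suc n - k" using xs(2) k by simp
  have \<xi>U: "\<xi> \<in> U" using \<xi> by (simp add: above_def)
  have ab: "above U k (\<xi> # xs) = Gen k \<xi>" using above_Gen_hd[OF U, of "\<xi> # xs" k] \<xi>U by simp
  have fys: "fam k (Gen k \<xi>) (\<lambda>\<eta>. u (\<eta> # \<xi> # ys))" if "ys \<in> set (faces xs)" for ys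
    using face_fam_datum[OF u kn fl len, of "\<xi> # ys"] that ab by simp
  have fxs: "fam k (Gen k \<xi>) (\<lambda>\<eta>. u (\<eta> # xs))"
    using face_fam_datum[OF u kn fl len, of xs] ab by simp
  have Dc: "D k \<xi> (\<lambda>\<eta>. u (\<eta> # \<xi> # ys)) \<in> carrier (H (Suc k) \<xi>)" if "ys \<in> set (faces xs)" for ys
    by (rule D_closed[OF \<xi>P fys[OF that]])
  show "res k u (\<xi> # ys) \<in> carrier (H (Suc k) \<xi>)" if "ys \<in> set (faces xs)" for ys
    using Dc[OF that] by (simp add: res_def)
  let ?a = "\<lambda>\<eta>. alt (H k \<eta>) (\<lambda>ys. u (\<eta> # \<xi> # ys)) xs"
  have fa: "fam k (Gen k \<xi>) ?a" by (rule fam_alt[OF Gen_P, where u = "\<lambda>\<eta> ys. u (\<eta> # \<xi> # ys)", OF fys])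
  have "oneH (Suc k) \<xi> = D k \<xi> (\<lambda>\<eta>. alt (H k \<eta>) (\<lambda>ys. u (\<eta> # ys)) (\<xi> # xs))"
    by (rule datum_cocycle[OF u fl len, symmetric]) (use \<xi>P \<xi>U P_self in \<open>auto simp: above_def\<close>)
  also have "\<dots> = D k \<xi> (\<lambda>\<eta>. u (\<eta> # xs) \<otimes>\<^bsub>H k \<eta>\<^esub> inv\<^bsub>H k \<eta>\<^esub> ?a \<eta>)" by simp
  also have "\<dots> = D k \<xi> (\<lambda>\<eta>. u (\<eta> # xs)) \<otimes>\<^bsub>H (Suc k) \<xi>\<^esub> inv\<^bsub>H (Suc k) \<xi>\<^esub> D k \<xi> ?a"
    using D_mult[OF \<xi>P fxs fam_inv[OF Gen_P fa]] D_inv[OF \<xi>P fa] by simp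
  finally have "D k \<xi> (\<lambda>\<eta>. u (\<eta> # xs)) = D k \<xi> ?a"
    using div_one_iff[OF comm_group_axioms D_closed[OF \<xi>P fxs] D_closed[OF \<xi>P fa]] by simp
  also have "\<dots> = alt (H (Suc k) \<xi>) (\<lambda>ys. D k \<xi> (\<lambda>\<eta>. u (\<eta> # \<xi> # ys))) xs"
    by (rule D_alt[OF \<xi>P, of xs "\<lambda>\<eta> ys. u (\<eta> # \<xi> # ys)", OF fys])
  finally show "alt (H (Suc k) \<xi>) (\<lambda>ys. res k u (\<xi> # ys)) xs = inv\<^bsub>H (Suc k) \<xi>\<^esub> D k \<xi> (\<lambda>\<eta>. u (\<eta> # xs))"
    using alt_inv[OF comm_group_axioms Dc] by (simp add: res_def)
qed

text \<open>The cocycle condition for the residues follows from \<open>res_alt\<close> and the triviality of \<open>D \<circ> D\<close>.  If the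
  composite of the maps \<open>N\<close> along \<open>ys\<close> does not vanish on a residue, then the composite along \<open>\<eta> # ys\<close> does not
  vanish on the value of \<open>u\<close> for some \<open>\<eta>\<close>, which bounds the number of such \<open>ys\<close>.\<close>

lemma datum_res:
  assumes U: "openin X U" and u: "datum n U k u" and k: "k < n"
  shows "datum n U (Suc k) (res k u)"
  unfolding datum_def
proof (intro conjI allI impI ballI)
  have kn: "k \<le> n" using k by simp
  have fam_u: "fam k (Gen k \<xi>) (\<lambda>\<eta>. u (\<eta> # \<xi> # xs))" if "\<xi> \<in> P (Suc k)" "flag U (Suc k) (\<xi> # xs)" "length xs = n - Suc k" for \<xi> xs
    using datum_fam[OF u kn that(2)] above_Gen_hd[OF U, of "\<xi> # xs" k] that k by simp
  show "res k u (\<xi> # xs) \<in> carrier (H (Suc k) \<xi>)"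
    if "\<xi> \<in> P (Suc k)" "flag U (Suc k) (\<xi> # xs)" "length xs = n - Suc k" for \<xi> xs
  proof -
    interpret comm_group "H (Suc k) \<xi>" by (rule H_comm[OF that(1)])
    show ?thesis using D_closed[OF that(1) fam_u[OF that]] by (simp add: res_def)
  qed
  show "finite {ys. seg (Suc k) m ys \<and> flag U (Suc k) (ys @ xs) \<and> length (ys @ xs) = Suc n - Suc k \<and>
          ncomp N (Suc k) ys (res k u (ys @ xs)) \<noteq> oneH m (last ys)}" (is "finite ?B")
    if m: "Suc k \<le> m" and xs: "flag U (Suc m) xs" for m xs
  proof -
    let ?A = "{ys. seg k m ys \<and> flag U k (ys @ xs) \<and> length (ys @ xs) = Suc n - k \<and>
          ncomp N k ys (u (ys @ xs)) \<noteq> oneH m (last ys)}"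
    have km: "k \<le> m" using m by simp
    have "finite ?A" by (rule datum_finite[OF u km xs])
    moreover have "?B \<subseteq> tl ` ?A"
    proof
      fix ys assume ys: "ys \<in> ?B"
      then obtain \<xi> zs where r: "ys = \<xi> # zs" using seg_nonempty[OF m] by (cases ys) auto
      have \<xi>: "\<xi> \<in> P (Suc k)" using ys r seg_Cons[OF m] by auto
      have fl: "flag U (Suc k) (\<xi> # (zs @ xs))" and ln: "length (zs @ xs) = n - Suc k" using ys r k by auto
      note f = fam_u[OF \<xi> fl ln]
      have hom: "ncomp N (Suc k) ys \<in> hom (H (Suc k) \<xi>) (H m (last ys))"
        using ncomp_hom[OF m, of ys U xs] ys r by simp
      have lm: "last ys \<in> P m" using seg_last[OF m] ys by blast
      interpret A: comm_group "H (Suc k) \<xi>" by (rule H_comm[OF \<xi>])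
      interpret B: comm_group "H m (last ys)" by (rule H_comm[OF lm])
      let ?D = "D k \<xi> (\<lambda>\<eta>. u (\<eta> # \<xi> # (zs @ xs)))"
      have Dc: "?D \<in> carrier (H (Suc k) \<xi>)" by (rule D_closed[OF \<xi> f])
      have "ncomp N (Suc k) ys (inv\<^bsub>H (Suc k) \<xi>\<^esub> ?D) \<noteq> oneH m (last ys)" using ys r by (simp add: res_def)
      then have ne: "ncomp N (Suc k) ys ?D \<noteq> oneH m (last ys)"
        using hom_inv_comm[OF A.comm_group_axioms B.comm_group_axioms hom Dc] by auto
      let ?S = "{\<eta> \<in> Gen k \<xi>. u (\<eta> # \<xi> # (zs @ xs)) \<noteq> oneH k \<eta>}"
      have "ncomp N (Suc k) ys ?D = finprod (H m (last ys)) (\<lambda>\<eta>. ncomp N (Suc k) ys (N k \<eta> \<xi> (u (\<eta> # \<xi> # (zs @ xs))))) ?S"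
        unfolding D_def
        by (rule hom_finprod_comm[OF A.comm_group_axioms B.comm_group_axioms hom]) (use N_carrier[OF _ \<xi>] fam_carrier[OF f] in auto)
      then have "\<not> (\<forall>\<eta>\<in>?S. ncomp N (Suc k) ys (N k \<eta> \<xi> (u (\<eta> # \<xi> # (zs @ xs)))) = oneH m (last ys))"
      proof (rule contrapos_pn)
        assume a: "\<forall>\<eta>\<in>?S. ncomp N (Suc k) ys (N k \<eta> \<xi> (u (\<eta> # \<xi> # (zs @ xs)))) = oneH m (last ys)"
        show "ncomp N (Suc k) ys ?D \<noteq> finprod (H m (last ys)) (\<lambda>\<eta>. ncomp N (Suc k) ys (N k \<eta> \<xi> (u (\<eta> # \<xi> # (zs @ xs))))) ?S"
        proof
          assume "ncomp N (Suc k) ys ?D = finprod (H m (last ys)) (\<lambda>\<eta>. ncomp N (Suc k) ys (N k \<eta> \<xi> (u (\<eta> # \<xi> # (zs @ xs))))) ?S"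
          also have "\<dots> = oneH m (last ys)" by (rule B.finprod_one_eqI) (rule bspec[OF a])
          finally show False using ne by simp
        qed
      qed
      then obtain \<eta> where \<eta>: "\<eta> \<in> ?S" "ncomp N (Suc k) ys (N k \<eta> \<xi> (u (\<eta> # \<xi> # (zs @ xs)))) \<noteq> oneH m (last ys)"
        by blast
      have \<eta>P: "\<eta> \<in> P k" "\<xi> \<in> cl \<eta>" using \<eta> Gen_D by auto
      have \<eta>U: "\<eta> \<in> U" using closure_of_nbhd[OF \<eta>P(2) U] fl by simp
      have mem: "\<eta> # ys \<in> ?A"
      proof (intro CollectI conjI)
        show "seg k m (\<eta> # ys)" using seg_Cons[OF km] \<eta>P ys by blast
        show "flag U k ((\<eta> # ys) @ xs)" using \<eta>P \<eta>U fl r by auto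
        show "length ((\<eta> # ys) @ xs) = Suc n - k" using ln r k by simp
        show "ncomp N k (\<eta> # ys) (u ((\<eta> # ys) @ xs)) \<noteq> oneH m (last (\<eta> # ys))" using \<eta>(2) r by simp
      qed
      show "ys \<in> tl ` ?A" by (rule image_eqI[OF _ mem]) simp
    qed
    ultimately show ?thesis by (rule finite_surj)
  qed
  fix xs \<zeta> assume xs: "flag U (Suc (Suc k)) xs" "length xs = Suc n - Suc k" and \<zeta>: "\<zeta> \<in> above U (Suc (Suc k)) xs"
  have \<zeta>P: "\<zeta> \<in> P (Suc (Suc k))" and \<zeta>U: "\<zeta> \<in> U" using \<zeta> by (auto simp: above_def)
  have ln: "length xs = n - k" using xs(2) by simp
  have sub: "Gen l \<zeta> \<subseteq> above U l xs" for l by (rule Gen_above[OF U \<zeta>])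
  have fu: "fam k (Gen k \<zeta>) (\<lambda>\<eta>. u (\<eta> # xs))"
    by (rule fam_mono[OF datum_fam[OF u kn flag_mono[OF xs(1)] ln] sub]) simp
  note fD = fam_D[OF fu]
  have "D (Suc k) \<zeta> (\<lambda>\<xi>. alt (H (Suc k) \<xi>) (\<lambda>ys. res k u (\<xi> # ys)) xs) = D (Suc k) \<zeta> (\<lambda>\<xi>. inv\<^bsub>H (Suc k) \<xi>\<^esub> D k \<xi> (\<lambda>\<eta>. u (\<eta> # xs)))"
    by (rule D_cong[OF \<zeta>P fam_inv[OF Gen_P fD], symmetric]) (rule res_alt(1)[OF U u k xs(1) ln subsetD[OF sub], symmetric])
  also have "\<dots> = inv\<^bsub>H (Suc (Suc k)) \<zeta>\<^esub> D (Suc k) \<zeta> (\<lambda>\<xi>. D k \<xi> (\<lambda>\<eta>. u (\<eta> # xs)))"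
    by (rule D_inv[OF \<zeta>P fD])
  also have "\<dots> = oneH (Suc (Suc k)) \<zeta>"
  proof -
    interpret comm_group "H (Suc (Suc k)) \<zeta>" by (rule H_comm[OF \<zeta>P])
    show ?thesis using D_D[OF \<zeta>P fu] by simp
  qed
  finally show "D (Suc k) \<zeta> (\<lambda>\<xi>. alt (H (Suc k) \<xi>) (\<lambda>ys. res k u (\<xi> # ys)) xs) = oneH (Suc (Suc k)) \<zeta>" .
qed

lemma exact_above:
  assumes y: "y \<in> P (Suc k)" and c: "c \<in> carrier (H (Suc k) y)"
  obtains g where "fam k (Gen k y) g" "D k y g = c" "c = oneH (Suc k) y \<longrightarrow> (\<forall>\<eta>\<in>Gen k y. g \<eta> = oneH k \<eta>)"
proof (cases "c = oneH (Suc k) y")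
  case True
  then show thesis using that[OF fam_one[OF Gen_P]] D_one[OF y] by simp
next
  case False
  have "fam (Suc k) (Gen (Suc k) y) (\<lambda>_. c)" using c Gen_self[OF y] by (simp add: fam_def)
  then obtain g where "fam k (Gen k y) g" "\<forall>\<xi>\<in>Gen (Suc k) y. D k \<xi> g = c"
    using exact[OF P_topspace[OF y], of k "\<lambda>_. c"] Gen_empty[OF y, of "Suc (Suc k)"] by auto
  then show thesis using that[of g] False Gen_self[OF y] by simp
qed

text \<open>The induction step.  A solution \<open>v'\<close> for the residues is lifted separately over each flag \<open>xs\<close>: if
  the first point of \<open>xs\<close> has codimension \<open>k + 1\<close>, to a preimage of \<open>v' xs\<close>, and otherwise to a preimage
  of the family that \<open>v'\<close> prescribes.  In the first case the trivial element is lifted trivially, which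
  preserves finiteness.  With these choices the terms in the alternating sum of the images cancel up to the residue
  of the datum.  Only for the empty \<open>xs\<close> is the neighbourhood shrunk.\<close>

lemma lift_solution:
  assumes x: "x \<in> V" and V: "openin X V" and u: "datum n V k u" and k: "k < n"
    and v': "solution n V (Suc k) (res k u) v'"
  obtains W v where "openin X W" "x \<in> W" "W \<subseteq> V" "solution n W k u v"
proof -
  define rhs where "rhs xs \<xi> = (if xs \<noteq> [] \<and> hd xs \<in> P (Suc k) then v' xs
      else res k u (\<xi> # xs) \<otimes>\<^bsub>H (Suc k) \<xi>\<^esub> alt (H (Suc k) \<xi>) (\<lambda>ys. v' (\<xi> # ys)) xs)" for xs \<xi>
  define good where "good W xs w \<longleftrightarrow> fam k (above W k xs) w \<and> (\<forall>\<xi>\<in>above W (Suc k) xs. D k \<xi> w = rhs xs \<xi>) \<and>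
     (xs \<noteq> [] \<longrightarrow> hd xs \<in> P (Suc k) \<longrightarrow> v' xs = oneH (Suc k) (hd xs) \<longrightarrow> (\<forall>\<eta>\<in>above W k xs. w \<eta> = oneH k \<eta>))" for W xs w
  note dres = datum_res[OF V u k]
  have kn: "k \<le> n" "Suc k \<le> n" using k by auto
  have low: "\<not> (xs \<noteq> [] \<and> hd xs \<in> P (Suc k))" if "flag W (Suc (Suc k)) xs" for W xs
    using that P_unique by (cases xs) fastforce+
  have rhs_high: "rhs xs \<xi> = res k u (\<xi> # xs) \<otimes>\<^bsub>H (Suc k) \<xi>\<^esub> alt (H (Suc k) \<xi>) (\<lambda>ys. v' (\<xi> # ys)) xs"
    if "flag W (Suc (Suc k)) xs" for W xs \<xi> using low[OF that] unfolding rhs_def by (rule if_not_P)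
  have fam_rhs: "fam (Suc k) (above V (Suc k) xs) (rhs xs)"
    if xs: "flag V (Suc (Suc k)) xs" "length xs = n - Suc k" for xs
    unfolding rhs_high[OF xs(1), abs_def]
    by (rule fam_mult[OF above_P datum_fam[OF dres kn(2) xs] fam_alt[OF above_P, where u = "\<lambda>\<xi> ys. v' (\<xi> # ys)", OF face_fam_solution[OF v' xs]]])
  have D_rhs: "D (Suc k) \<zeta> (rhs xs) = oneH (Suc (Suc k)) \<zeta>"
    if xs: "flag V (Suc (Suc k)) xs" "length xs = n - Suc k" and \<zeta>: "\<zeta> \<in> above V (Suc (Suc k)) xs" for xs \<zeta>
    unfolding rhs_high[OF xs(1), abs_def] by (rule solution_eq[OF v' xs \<zeta>])
  have ex: "\<exists>w. good W xs w"
    if W: "openin X W" "W \<subseteq> V" and xs: "xs \<noteq> []" "flag W (Suc k) xs" "Suc (length xs) = n - k" for W xs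
  proof -
    have hW: "hd xs \<in> W" using xs by (cases xs) auto
    then have hV: "hd xs \<in> V" using W by auto
    have ab: "above W l xs = Gen l (hd xs)" "above V l xs = Gen l (hd xs)" for l
      by (rule above_Gen_hd[OF W(1) xs(1) hW], rule above_Gen_hd[OF V xs(1) hV])
    have xsV: "flag V (Suc k) xs" by (rule flag_subset[OF xs(2) W(2)])
    show ?thesis
    proof (cases "hd xs \<in> P (Suc k)")
      case True
      have "v' (hd xs # tl xs) \<in> carrier (H (Suc k) (hd xs))"
        by (rule solution_carrier[OF v' True]) (use xsV xs in auto)
      then have c: "v' xs \<in> carrier (H (Suc k) (hd xs))" using xs(1) by simp
      obtain g where "fam k (Gen k (hd xs)) g" "D k (hd xs) g = v' xs"
        "v' xs = oneH (Suc k) (hd xs) \<longrightarrow> (\<forall>\<eta>\<in>Gen k (hd xs). g \<eta> = oneH k \<eta>)"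
        by (rule exact_above[OF True c])
      then have "good W xs g" using True xs(1) by (simp add: good_def ab rhs_def Gen_self[OF True])
      then show ?thesis by blast
    next
      case False
      then have xsh: "flag V (Suc (Suc k)) xs" using flag_Suc[OF xsV] by simp
      have ln: "length xs = n - Suc k" using xs(3) by simp
      have hT: "hd xs \<in> topspace X" using hV openin_subset[OF V] by auto
      have "\<exists>g. fam k (Gen k (hd xs)) g \<and> (\<forall>\<xi>\<in>Gen (Suc k) (hd xs). D k \<xi> g = rhs xs \<xi>)"
        by (rule exact[OF hT fam_rhs[OF xsh ln, unfolded ab] D_rhs[OF xsh ln, unfolded ab]])
      then obtain g where "fam k (Gen k (hd xs)) g" "\<forall>\<xi>\<in>Gen (Suc k) (hd xs). D k \<xi> g = rhs xs \<xi>" by (elim exE conjE)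
      then have "good W xs g" using False by (simp add: good_def ab)
      then show ?thesis by blast
    qed
  qed
  obtain W where W: "openin X W" "x \<in> W" "W \<subseteq> V"
    and exW: "\<forall>xs. flag W (Suc k) xs \<longrightarrow> Suc (length xs) = n - k \<longrightarrow> (\<exists>w. good W xs w)"
  proof (cases "n = Suc k")
    case False
    have "\<exists>w. good V xs w" if "flag V (Suc k) xs" "Suc (length xs) = n - k" for xs
      by (rule ex[OF V order_refl _ that]) (use that False in auto)
    then show thesis by (intro that[OF V x order_refl] allI impI)
  next
    case True
    have 0: "flag V (Suc (Suc k)) []" "length [] = n - Suc k" using True by auto
    obtain W g where W: "openin X W" "x \<in> W" "W \<subseteq> V" "fam k (above W k []) g"
      "\<forall>\<xi>\<in>above W (Suc k) []. D k \<xi> g = rhs [] \<xi>"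
      by (rule exact_nbhd[OF x V fam_rhs[OF 0] D_rhs[OF 0]])
    have g: "good W [] g" using W(4,5) by (simp add: good_def)
    have "xs = []" if "Suc (length xs) = n - k" for xs :: "'x list" using that True by simp
    with g show thesis by (intro that[OF W(1-3)] allI impI) blast
  qed
  define w where "w xs = (SOME w. good W xs w)" for xs
  have w: "good W xs (w xs)" if "flag W (Suc k) xs" "Suc (length xs) = n - k" for xs
    unfolding w_def using someI_ex[OF mp[OF mp[OF spec[OF exW] that(1)] that(2)]] .
  define v where "v zs = w (tl zs) (hd zs)" for zs
  have v: "v (\<eta> # xs) = w xs \<eta>" for \<eta> xs by (simp add: v_def)
  have v_fam: "fam k (above W k xs) (\<lambda>\<eta>. v (\<eta> # xs))" if "flag W (Suc k) xs" "Suc (length xs) = n - k" for xs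
    using w[OF that] by (simp add: good_def v)
  have v_D: "D k \<xi> (\<lambda>\<eta>. v (\<eta> # xs)) = rhs xs \<xi>" if "flag W (Suc k) xs" "Suc (length xs) = n - k" "\<xi> \<in> above W (Suc k) xs" for xs \<xi>
    using w[OF that(1,2)] that(3) by (simp add: good_def v)
  have v_one: "v (\<eta> # \<xi> # xs) = oneH k \<eta>"
    if "flag W (Suc k) (\<xi> # xs)" "Suc (length (\<xi> # xs)) = n - k" "\<xi> \<in> P (Suc k)" "v' (\<xi> # xs) = oneH (Suc k) \<xi>" "\<eta> \<in> above W k (\<xi> # xs)" for \<eta> \<xi> xs
    using w[OF that(1,2)] that(3-5) by (simp add: good_def v)
  have "solution n W k u v"
    unfolding solution_def
  proof (intro conjI allI impI ballI)
    show "v (\<eta> # xs) \<in> carrier (H k \<eta>)" if "\<eta> \<in> P k" "flag W k (\<eta> # xs)" "Suc (length xs) = n - k" for \<eta> xs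
      using fam_carrier[OF v_fam[of xs]] flag_ConsD[OF that(2,1)] that(3) by blast
    show "finite {ys. seg k m ys \<and> flag W k (ys @ xs) \<and> length (ys @ xs) = n - k \<and> v (ys @ xs) \<noteq> oneH k (hd ys)}" (is "finite ?B")
      if m: "k \<le> m" and xs: "flag W (Suc m) xs" for m xs
    proof (cases "m = k")
      case True
      have sub: "?B \<subseteq> (\<lambda>\<eta>. [\<eta>]) ` {\<eta> \<in> above W k xs. v (\<eta> # xs) \<noteq> oneH k \<eta>}"
      proof
        fix ys assume ys: "ys \<in> ?B"
        then obtain \<eta> where \<eta>: "\<eta> \<in> P k" "ys = [\<eta>]" using True by (auto simp: seg_self)
        then show "ys \<in> (\<lambda>\<eta>. [\<eta>]) ` {\<eta> \<in> above W k xs. v (\<eta> # xs) \<noteq> oneH k \<eta>}"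
          using ys flag_ConsD[of W k \<eta> xs] by auto
      qed
      have fin: "finite {\<eta> \<in> above W k xs. v (\<eta> # xs) \<noteq> oneH k \<eta>}" if "Suc (length xs) = n - k"
        using v_fam[of xs] xs True that by (simp add: fam_def)
      have emp: "?B = {}" if "Suc (length xs) \<noteq> n - k"
      proof (rule equals0I)
        fix ys assume "ys \<in> ?B"
        then have "length ys = Suc 0" "length (ys @ xs) = n - k" using True by (simp_all add: seg_def)
        then show False using that by simp
      qed
      show ?thesis
      proof (cases "Suc (length xs) = n - k")
        case eq: True
        show ?thesis by (rule finite_subset[OF sub finite_imageI[OF fin[OF eq]]])
      next
        case False
        show ?thesis unfolding emp[OF False] by (rule finite.emptyI)
      qed
    next
      case False
      then have m': "Suc k \<le> m" using m by simp
      let ?A = "{ys. seg (Suc k) m ys \<and> flag V (Suc k) (ys @ xs) \<and> length (ys @ xs) = n - Suc k \<and> v' (ys @ xs) \<noteq> oneH (Suc k) (hd ys)}"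
      let ?A' = "{ys \<in> ?A. flag W (Suc k) (ys @ xs)}"
      have A: "finite ?A'" by (rule finite_subset[OF _ solution_finite[OF v' m' flag_subset[OF xs W(3)]]]) auto
      let ?E = "\<lambda>ys. {\<eta> \<in> above W k (ys @ xs). v (\<eta> # ys @ xs) \<noteq> oneH k \<eta>}"
      have E: "finite (?E ys)" if "ys \<in> ?A'" for ys
        using v_fam[of "ys @ xs"] that k by (simp add: fam_def)
      have "?B \<subseteq> (\<Union>ys\<in>?A'. (\<lambda>\<eta>. \<eta> # ys) ` ?E ys)"
      proof
        fix zs assume zs: "zs \<in> ?B"
        then obtain \<eta> ys where s: "zs = \<eta> # ys" using seg_nonempty[OF m] by (cases zs) auto
        then have \<eta>: "\<eta> \<in> P k" and sg: "seg (Suc k) m ys" using zs seg_Cons[OF m] by auto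
        have fl: "flag W (Suc k) (ys @ xs)" "\<eta> \<in> above W k (ys @ xs)"
          using flag_ConsD[of W k \<eta> "ys @ xs"] zs s \<eta> by auto
        have ln: "length (ys @ xs) = n - Suc k" using zs s by auto
        have vn: "v (\<eta> # ys @ xs) \<noteq> oneH k \<eta>" using zs s by simp
        obtain \<xi> ys' where r: "ys = \<xi> # ys'" using seg_nonempty[OF m' sg] by (cases ys) auto
        have \<xi>: "\<xi> \<in> P (Suc k)" using sg r seg_Cons[OF m'] by auto
        have "v' (ys @ xs) \<noteq> oneH (Suc k) \<xi>"
        proof
          assume a: "v' (ys @ xs) = oneH (Suc k) \<xi>"
          have "Suc (length (\<xi> # (ys' @ xs))) = n - k" using ln r k by simp
          then have "v (\<eta> # \<xi> # (ys' @ xs)) = oneH k \<eta>"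
            using fl a unfolding r append_Cons by (intro v_one \<xi>)
          then show False using vn r by simp
        qed
        then have "ys \<in> ?A'" using sg fl flag_subset[OF fl(1) W(3)] ln r by simp
        moreover have "\<eta> \<in> ?E ys" using fl vn by simp
        ultimately show "zs \<in> (\<Union>ys\<in>?A'. (\<lambda>\<eta>. \<eta> # ys) ` ?E ys)" using s by blast
      qed
      moreover have "finite (\<Union>ys\<in>?A'. (\<lambda>\<eta>. \<eta> # ys) ` ?E ys)" by (intro finite_UN_I[OF A] finite_imageI E)
      ultimately show ?thesis by (rule finite_subset)
    qed
    fix xs \<xi> assume xs: "flag W (Suc k) xs" "length xs = n - k" and \<xi>: "\<xi> \<in> above W (Suc k) xs"
    have \<xi>P: "\<xi> \<in> P (Suc k)" and \<xi>W: "\<xi> \<in> W" using \<xi> by (auto simp: above_def)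
    interpret Z: comm_group "H (Suc k) \<xi>" by (rule H_comm[OF \<xi>P])
    have xsV: "flag V (Suc k) xs" by (rule flag_subset[OF xs(1) W(3)])
    have sub: "Gen k \<xi> \<subseteq> above W k xs" "Gen k \<xi> \<subseteq> above V k xs"
      using Gen_above[OF W(1) \<xi>] above_subset[OF W(3)] by blast+
    have fu: "fam k (Gen k \<xi>) (\<lambda>\<eta>. u (\<eta> # xs))" by (rule fam_mono[OF datum_fam[OF u kn(1) xsV xs(2)] sub(2)])
    have fv: "fam k (Gen k \<xi>) (\<lambda>\<eta>. v (\<eta> # ys))" if s: "ys \<in> set (faces xs)" for ys
    proof -
      have "above W k xs \<subseteq> above W k ys" by (rule face_flag(2)[OF xs(1) s])
      then show ?thesis using fam_mono[OF v_fam[OF face_flag(1)[OF xs(1) s]]] faces_length[OF s] xs(2) sub(1) by auto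
    qed
    have fa: "fam k (Gen k \<xi>) (\<lambda>\<eta>. alt (H k \<eta>) (\<lambda>ys. v (\<eta> # ys)) xs)"
      by (rule fam_alt[OF Gen_P, where u = "\<lambda>\<eta> ys. v (\<eta> # ys)", OF fv])
    have Dsum: "D k \<xi> (\<lambda>\<eta>. u (\<eta> # xs) \<otimes>\<^bsub>H k \<eta>\<^esub> alt (H k \<eta>) (\<lambda>ys. v (\<eta> # ys)) xs) =
      D k \<xi> (\<lambda>\<eta>. u (\<eta> # xs)) \<otimes>\<^bsub>H (Suc k) \<xi>\<^esub> alt (H (Suc k) \<xi>) (\<lambda>ys. D k \<xi> (\<lambda>\<eta>. v (\<eta> # ys))) xs"
      using D_mult[OF \<xi>P fu fa] D_alt[OF \<xi>P, of xs "\<lambda>\<eta> ys. v (\<eta> # ys)", OF fv] by simp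
    have Dv: "D k \<xi> (\<lambda>\<eta>. v (\<eta> # ys)) = rhs ys \<xi>" if s: "ys \<in> set (faces xs)" for ys
      by (rule v_D[OF face_flag(1)[OF xs(1) s]]) (use faces_length[OF s] xs(2) face_flag(2)[OF xs(1) s] \<xi> in auto)
    have Duc: "D k \<xi> (\<lambda>\<eta>. u (\<eta> # xs)) \<in> carrier (H (Suc k) \<xi>)" by (rule D_closed[OF \<xi>P fu])
    have "D k \<xi> (\<lambda>\<eta>. u (\<eta> # xs)) \<otimes>\<^bsub>H (Suc k) \<xi>\<^esub> alt (H (Suc k) \<xi>) (\<lambda>ys. rhs ys \<xi>) xs = oneH (Suc k) \<xi>"
    proof (cases "xs \<noteq> [] \<and> hd xs \<in> P (Suc k)")
      case True
      then have "\<xi> = hd xs" using above_hd[of xs "Suc k" W] \<xi> by auto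
      then obtain xs' where t: "xs = \<xi> # xs'" using True by (cases xs) auto
      have xs': "flag V (Suc (Suc k)) xs'" "\<xi> \<in> above V (Suc k) xs'" using flag_ConsD[of V "Suc k" \<xi> xs'] xsV t \<xi>P by auto
      have ln: "length xs' = n - Suc k" using xs(2) t by simp
      have ac: "alt (H (Suc k) \<xi>) (\<lambda>ys. v' (\<xi> # ys)) xs' \<in> carrier (H (Suc k) \<xi>)"
        by (rule alt_closed[OF Z.comm_group_axioms]) (use fam_carrier[OF face_fam_solution[OF v' xs'(1) ln] xs'(2)] in auto)
      have "rhs (\<xi> # ys) \<xi> = v' (\<xi> # ys)" for ys using \<xi>P by (simp add: rhs_def)
      then have "alt (H (Suc k) \<xi>) (\<lambda>ys. rhs ys \<xi>) xs = rhs xs' \<xi> \<otimes>\<^bsub>H (Suc k) \<xi>\<^esub> inv\<^bsub>H (Suc k) \<xi>\<^esub> alt (H (Suc k) \<xi>) (\<lambda>ys. v' (\<xi> # ys)) xs'"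
        by (simp add: t)
      also have "\<dots> = res k u (\<xi> # xs')"
        using rhs_high[OF xs'(1), of \<xi>] ac fam_carrier[OF datum_fam[OF dres kn(2) xs'(1) ln] xs'(2)]
        by (simp add: Z.m_assoc)
      also have "\<dots> = inv\<^bsub>H (Suc k) \<xi>\<^esub> D k \<xi> (\<lambda>\<eta>. u (\<eta> # xs))" by (simp add: res_def t)
      finally show ?thesis using Duc by simp
    next
      case False
      note xsh = flag_Suc[OF xsV False]
      have \<xi>V: "\<xi> \<in> above V (Suc k) xs" using \<xi> above_subset[OF W(3)] by blast
      note ra = res_alt[OF V u k xsh xs(2) \<xi>V]
      have vc: "v' (\<xi> # zs) \<in> carrier (H (Suc k) \<xi>)" if s: "ys \<in> set (faces xs)" and r: "zs \<in> set (faces ys)" for ys zs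
      proof (rule fam_carrier[OF face_fam_solution[OF v' face_flag(1)[OF xsh s] _ r]])
        show "length ys = n - Suc k" using faces_length[OF s] xs(2) by simp
        show "\<xi> \<in> above V (Suc k) ys" using face_flag(2)[OF xsh s] \<xi>V by blast
      qed
      have avc: "alt (H (Suc k) \<xi>) (\<lambda>zs. v' (\<xi> # zs)) ys \<in> carrier (H (Suc k) \<xi>)" if "ys \<in> set (faces xs)" for ys
        by (rule alt_closed[OF Z.comm_group_axioms vc[OF that]])
      have "alt (H (Suc k) \<xi>) (\<lambda>ys. rhs ys \<xi>) xs =
        alt (H (Suc k) \<xi>) (\<lambda>ys. res k u (\<xi> # ys) \<otimes>\<^bsub>H (Suc k) \<xi>\<^esub> alt (H (Suc k) \<xi>) (\<lambda>zs. v' (\<xi> # zs)) ys) xs"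
        by (rule alt_cong) (rule rhs_high[OF face_flag(1)[OF xsh]])
      also have "\<dots> = alt (H (Suc k) \<xi>) (\<lambda>ys. res k u (\<xi> # ys)) xs \<otimes>\<^bsub>H (Suc k) \<xi>\<^esub> alt (H (Suc k) \<xi>) (alt (H (Suc k) \<xi>) (\<lambda>zs. v' (\<xi> # zs))) xs"
        by (rule alt_mult[OF Z.comm_group_axioms ra(2) avc])
      also have "\<dots> = inv\<^bsub>H (Suc k) \<xi>\<^esub> D k \<xi> (\<lambda>\<eta>. u (\<eta> # xs))"
      proof -
        have "alt (H (Suc k) \<xi>) (alt (H (Suc k) \<xi>) (\<lambda>zs. v' (\<xi> # zs))) xs = oneH (Suc k) \<xi>"
          by (rule alt_alt[OF Z.comm_group_axioms vc])
        then show ?thesis using ra(1) Duc by simp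
      qed
      finally show ?thesis using Duc by simp
    qed
    then show "D k \<xi> (\<lambda>\<eta>. u (\<eta> # xs) \<otimes>\<^bsub>H k \<eta>\<^esub> alt (H k \<eta>) (\<lambda>ys. v (\<eta> # ys)) xs) = oneH (Suc k) \<xi>"
      unfolding Dsum using alt_cong[of xs "\<lambda>ys. D k \<xi> (\<lambda>\<eta>. v (\<eta> # ys))" "\<lambda>ys. rhs ys \<xi>" "H (Suc k) \<xi>"] Dv by simp
  qed
  then show thesis by (rule that[OF W])
qed

lemma datum_restrict:
  assumes u: "datum n U k u" and V: "V \<subseteq> U"
  shows "datum n V k u"
  unfolding datum_def
proof (intro conjI allI impI ballI)
  note fs = flag_subset[OF _ V]
  show "u (\<eta> # xs) \<in> carrier (H k \<eta>)" if "\<eta> \<in> P k" "flag V k (\<eta> # xs)" "length xs = n - k" for \<eta> xs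
    by (rule datum_carrier[OF u that(1) fs[OF that(2)] that(3)])
  show "finite {ys. seg k m ys \<and> flag V k (ys @ xs) \<and> length (ys @ xs) = Suc n - k \<and> ncomp N k ys (u (ys @ xs)) \<noteq> oneH m (last ys)}"
    if "k \<le> m" "flag V (Suc m) xs" for m xs
    by (rule finite_subset[OF _ datum_finite[OF u that(1) fs[OF that(2)]]]) (use fs in blast)
  show "D k \<xi> (\<lambda>\<eta>. alt (H k \<eta>) (\<lambda>ys. u (\<eta> # ys)) xs) = oneH (Suc k) \<xi>"
    if "flag V (Suc k) xs" "length xs = Suc n - k" "\<xi> \<in> above V (Suc k) xs" for xs \<xi>
    by (rule datum_cocycle[OF u fs[OF that(1)] that(2)]) (use that(3) above_subset[OF V] in blast)
qed

text \<open>For \<open>k = n\<close> the condition on a solution does not involve the solution, and it is the cocycle condition of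
  the datum for flags with one point.\<close>

theorem solution_exists:
  assumes "k \<le> n" "x \<in> U" "openin X U" "datum n U k u"
  shows "\<exists>V v. openin X V \<and> x \<in> V \<and> V \<subseteq> U \<and> solution n V k u v"
  using assms
proof (induction k arbitrary: U u rule: inc_induct)
  case base
  have "D n \<xi> (\<lambda>\<eta>. u [\<eta>] \<otimes>\<^bsub>H n \<eta>\<^esub> (oneH n \<eta>)) = oneH (Suc n) \<xi>" if \<xi>: "\<xi> \<in> above U (Suc n) []" for \<xi>
  proof -
    have \<xi>P: "\<xi> \<in> P (Suc n)" and \<xi>U: "\<xi> \<in> U" using \<xi> by (auto simp: above_def)
    have fl: "flag U (Suc n) [\<xi>]" using flag_Cons[OF \<xi>] by simp
    have "D n \<xi> (\<lambda>\<eta>. alt (H n \<eta>) (\<lambda>ys. u (\<eta> # ys)) [\<xi>]) = oneH (Suc n) \<xi>"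
      by (rule datum_cocycle[OF base(3) fl]) (use \<xi>P \<xi>U P_self in \<open>auto simp: above_def\<close>)
    moreover have "D n \<xi> (\<lambda>\<eta>. u [\<eta>] \<otimes>\<^bsub>H n \<eta>\<^esub> (oneH n \<eta>)) = D n \<xi> (\<lambda>\<eta>. alt (H n \<eta>) (\<lambda>ys. u (\<eta> # ys)) [\<xi>])"
    proof (rule D_cong[OF \<xi>P])
      have "fam n (Gen n \<xi>) (\<lambda>\<eta>. u [\<eta>])"
        by (rule fam_mono[OF datum_fam[OF base(3) order_refl, of "[]"] Gen_above[OF base(2) \<xi>]]) auto
      then show "fam n (Gen n \<xi>) (\<lambda>\<eta>. u [\<eta>] \<otimes>\<^bsub>H n \<eta>\<^esub> (oneH n \<eta>))" by (rule fam_mult[OF Gen_P _ fam_one[OF Gen_P]])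
      fix \<eta> assume "\<eta> \<in> Gen n \<xi>"
      then interpret comm_group "H n \<eta>" using Gen_P by (intro H_comm) auto
      show "u [\<eta>] \<otimes>\<^bsub>H n \<eta>\<^esub> (oneH n \<eta>) = alt (H n \<eta>) (\<lambda>ys. u (\<eta> # ys)) [\<xi>]" by simp
    qed
    ultimately show ?thesis by simp
  qed
  then have "solution n U n u v" for v by (auto simp: solution_def seg_def)
  then show ?case using base by (intro exI[of _ U] exI conjI) simp_all
next
  case (step k)
  have "datum n U (Suc k) (res k u)" by (rule datum_res[OF step.prems(2,3) step.hyps(2)])
  from step.IH[OF step.prems(1,2) this]
  obtain V v' where V: "openin X V" "x \<in> V" "V \<subseteq> U" "solution n V (Suc k) (res k u) v'" by (elim exE conjE)
  obtain W v where "openin X W" "x \<in> W" "W \<subseteq> V" "solution n W k u v"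
    by (rule lift_solution[OF V(2,1) datum_restrict[OF step.prems(3) V(3)] step.hyps(2) V(4)])
  then show ?case by (intro exI[of _ W] exI[of _ v] conjI subset_trans[OF _ V(3)])
qed

end

section \<open>Presheaves of families\<close>

text \<open>For presheaves whose restriction maps forget values, the restrictions are compatible for all
  families, sections or not, and the germ of any family is defined.\<close>

locale strict_presheaf = group_presheaf X G for X :: "'x topology" and G :: "('x, 'b) ab_presheaf" +
  assumes strict_comp: "V \<subseteq> U \<Longrightarrow> W \<subseteq> V \<Longrightarrow> restr G V W (restr G U V s) = restr G U W s"
begin

lemma germ_restr_any:
  assumes "openin X W" "x \<in> W" "W \<subseteq> U"
  shows "germ X G x W (restr G U W a) = germ X G x U a"
proof (intro equalityI subsetI)
  fix A assume "A \<in> germ X G x W (restr G U W a)"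
  then obtain V t W' where A: "A = (V, t)" "openin X V" "x \<in> V" "t \<in> sec V" "openin X W'" "x \<in> W'"
    "W' \<subseteq> W \<inter> V" "restr G W W' (restr G U W a) = restr G V W' t" unfolding germ_def by auto
  then have "restr G U W' a = restr G V W' t" using strict_comp[OF assms(3), of W'] by simp
  then show "A \<in> germ X G x U a" unfolding germ_def using A assms by auto
next
  fix A assume "A \<in> germ X G x U a"
  then obtain V t W' where A: "A = (V, t)" "openin X V" "x \<in> V" "t \<in> sec V" "openin X W'" "x \<in> W'"
    "W' \<subseteq> U \<inter> V" "restr G U W' a = restr G V W' t" unfolding germ_def by auto
  let ?W = "W \<inter> W'"
  have sub: "W' \<subseteq> U" "W' \<subseteq> V" using A by auto
  have "restr G W ?W (restr G U W a) = restr G U ?W a" using strict_comp[OF assms(3)] by simp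
  also have "\<dots> = restr G W' ?W (restr G U W' a)" using strict_comp[OF sub(1)] by simp
  also have "\<dots> = restr G V ?W t" unfolding A(8) using strict_comp[OF sub(2)] by simp
  finally have "restr G W ?W (restr G U W a) = restr G V ?W t" .
  moreover have "openin X ?W" using assms A by blast
  ultimately show "A \<in> germ X G x W (restr G U W a)" unfolding germ_def using A assms
    by (auto intro!: exI[of _ ?W])
qed

lemma germ_mem_any:
  assumes "(V, t) \<in> germ X G x U a"
  obtains W where "openin X V" "x \<in> V" "t \<in> sec V" "openin X W" "x \<in> W" "W \<subseteq> U \<inter> V"
    "restr G U W a = restr G V W t" "germ X G x U a = germ X G x V t"
proof -
  obtain W where W: "openin X V" "x \<in> V" "t \<in> sec V" "openin X W" "x \<in> W" "W \<subseteq> U \<inter> V"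
    "restr G U W a = restr G V W t" using assms unfolding germ_def by auto
  have "germ X G x U a = germ X G x W (restr G U W a)" using germ_restr_any[of W x U a] W by simp
  also have "\<dots> = germ X G x V t" unfolding W(7) using germ_restr_any[of W x V t] W by simp
  finally show thesis using that W by blast
qed

lemma germ_any_cases: "germ X G x U a \<in> carrier (stalk X G x) \<or> germ X G x U a = {}"
proof (cases "germ X G x U a = {}")
  case False
  then obtain V t where "(V, t) \<in> germ X G x U a" by auto
  then obtain W where "openin X V" "x \<in> V" "t \<in> sec V" "germ X G x U a = germ X G x V t"
    by (rule germ_mem_any)
  then show ?thesis using germ_carrier by simp
qed simp

end

section \<open>The Cousin complex on stalks\<close>

locale cousin_setup = injective_complex X I for X :: "'x topology" and I :: "('x, 'c) sheaf_complex"
begin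

sublocale cousin_data X H "nu X I"
proof (rule cousin_data.intro[OF noetherian_sober_axioms cousin_data_axioms.intro])
  show "comm_group (H p \<eta>)" if "\<eta> \<in> P p" for p \<eta> by (rule H_comm_group[OF P_topspace[OF that]])
  show "nu X I p \<eta> \<xi> \<in> hom (H p \<eta>) (H (Suc p) \<xi>)" if "\<eta> \<in> P p" "\<xi> \<in> P (Suc p)" "\<xi> \<in> cl \<eta>" for p \<eta> \<xi>
    by (rule nu_hom[OF that])
  show "finite {\<xi> \<in> P (Suc p). \<xi> \<in> cl \<eta> \<and> nu X I p \<eta> \<xi> c \<noteq> \<one>\<^bsub>H (Suc p) \<xi>\<^esub>}"
    if "\<eta> \<in> P p" "c \<in> carrier (H p \<eta>)" for p \<eta> c by (rule nu_finite[OF that])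
  show "finprod (H (Suc (Suc p)) \<zeta>) (\<lambda>\<xi>. nu X I (Suc p) \<xi> \<zeta> (nu X I p \<eta> \<xi> c))
     {\<xi> \<in> P (Suc p). \<xi> \<in> cl \<eta> \<and> \<zeta> \<in> cl \<xi> \<and> nu X I p \<eta> \<xi> c \<noteq> \<one>\<^bsub>H (Suc p) \<xi>\<^esub>} = \<one>\<^bsub>H (Suc (Suc p)) \<zeta>\<^esub>"
    if "\<eta> \<in> P p" "\<zeta> \<in> P (Suc (Suc p))" "\<zeta> \<in> cl \<eta>" "c \<in> carrier (H p \<eta>)" for p \<eta> \<zeta> c
    by (rule nu_nu[OF that])
qed

abbreviation K :: "('x, 'x \<Rightarrow> 'x \<Rightarrow> ('x set \<times> 'c) set set) sheaf_complex" where "K \<equiv> cousin_complex X I"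

text \<open>The section over \<open>U\<close> with constant value \<open>h \<eta>\<close> on the closure of \<open>\<eta>\<close>.\<close>

definition eU :: "nat \<Rightarrow> 'x set \<Rightarrow> ('x \<Rightarrow> ('x set \<times> 'c) set set) \<Rightarrow> 'x \<Rightarrow> 'x \<Rightarrow> ('x set \<times> 'c) set set" where
  "eU p U h = (\<lambda>\<eta>\<in>P p. \<lambda>y\<in>U \<inter> cl \<eta>. h \<eta>)"

lemma above_Nil: "above U k [] = P k \<inter> U" by (auto simp: above_def)

lemma in_nbhd: "openin X U \<Longrightarrow> y \<in> U \<inter> cl \<eta> \<Longrightarrow> \<eta> \<in> U" using closure_of_nbhd by fast

lemma eU_cong: "openin X U \<Longrightarrow> (\<And>\<eta>. \<eta> \<in> P p \<inter> U \<Longrightarrow> h \<eta> = h' \<eta>) \<Longrightarrow> eU p U h = eU p U h'"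
  unfolding eU_def using in_nbhd by (intro restrict_ext) auto

lemma eU_eqD: "eU p U h = eU p U h' \<Longrightarrow> \<eta> \<in> P p \<Longrightarrow> y \<in> U \<inter> cl \<eta> \<Longrightarrow> h \<eta> = h' \<eta>"
  unfolding eU_def by (drule fun_cong[of _ _ \<eta>], drule fun_cong[of _ _ y]) auto

text \<open>Each neighbourhood of a point of the closure of \<open>\<eta>\<close> contains \<open>\<eta>\<close>.\<close>

lemma locally_constant_closure:
  assumes U: "openin X U" and \<eta>: "\<eta> \<in> U"
    and c: "continuous_map (subtopology X (U \<inter> cl \<eta>)) (discrete_topology C) f" and y: "y \<in> U \<inter> cl \<eta>"
  shows "f y = f \<eta>"
proof -
  have ts: "topspace (subtopology X (U \<inter> cl \<eta>)) = U \<inter> cl \<eta>"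
    using openin_subset[OF U] by auto
  have "f y \<in> C" using c y ts continuous_map_image_subset_topspace[OF c] by auto
  then have "openin (discrete_topology C) {f y}" by simp
  from openin_continuous_map_preimage[OF c this]
  have "openin (subtopology X (U \<inter> cl \<eta>)) {z \<in> U \<inter> cl \<eta>. f z \<in> {f y}}" unfolding ts .
  then obtain W where W: "openin X W" "{z \<in> U \<inter> cl \<eta>. f z \<in> {f y}} = W \<inter> (U \<inter> cl \<eta>)"
    by (auto simp: openin_subtopology)
  then have "y \<in> W" using y by blast
  then have "\<eta> \<in> W" using closure_of_nbhd[OF _ W(1)] y by blast
  moreover have "\<eta> \<in> cl \<eta>" using \<eta> openin_subset[OF U] by (intro point_in_closure) auto
  ultimately have "\<eta> \<in> {z \<in> U \<inter> cl \<eta>. f z \<in> {f y}}" using W(2) \<eta> by blast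
  then show ?thesis by simp
qed

lemma cousin_carrier:
  assumes U: "openin X U"
  shows "f \<in> carrier (cousin_sections X I p U) \<longleftrightarrow> (\<exists>h. fam p (above U p []) h \<and> f = eU p U h)"
proof
  assume f: "f \<in> carrier (cousin_sections X I p U)"
  then have f1: "f \<in> (\<Pi>\<^sub>E \<eta>\<in>P p. \<Pi>\<^sub>E y\<in>U \<inter> cl \<eta>. carrier (H p \<eta>))"
    and f2: "\<And>\<eta>. \<eta> \<in> P p \<Longrightarrow> continuous_map (subtopology X (U \<inter> cl \<eta>)) (discrete_topology (carrier (H p \<eta>))) (f \<eta>)"
    and f3: "finite {\<eta>\<in>P p. \<exists>y\<in>U \<inter> cl \<eta>. f \<eta> y \<noteq> oneH p \<eta>}"
    by (simp_all add: cousin_sections_def)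
  define h where "h \<eta> = f \<eta> \<eta>" for \<eta>
  have hc: "h \<eta> \<in> carrier (H p \<eta>)" if "\<eta> \<in> above U p []" for \<eta>
    using f1 that P_self[of \<eta> p] unfolding h_def above_Nil by (fastforce simp: PiE_iff)
  have "{\<eta> \<in> above U p []. h \<eta> \<noteq> oneH p \<eta>} \<subseteq> {\<eta>\<in>P p. \<exists>y\<in>U \<inter> cl \<eta>. f \<eta> y \<noteq> oneH p \<eta>}"
    using P_self unfolding h_def above_Nil by blast
  then have "fam p (above U p []) h" using hc finite_subset[OF _ f3] by (simp add: fam_def)
  moreover have "f = eU p U h"
  proof (intro ext)
    fix \<eta> y show "f \<eta> y = eU p U h \<eta> y"
    proof (cases "\<eta> \<in> P p")
      case True
      show ?thesis
      proof (cases "y \<in> U \<inter> cl \<eta>")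
        case y: True
        then show ?thesis using locally_constant_closure[OF U in_nbhd[OF U y] f2[OF True] y] True
          by (simp add: eU_def h_def)
      next
        case False
        have "f \<eta> \<in> extensional (U \<inter> cl \<eta>)" using f1 True by (auto simp: PiE_iff)
        then show ?thesis using False True by (auto simp: eU_def extensional_def)
      qed
    next
      case False
      then show ?thesis using f1 by (auto simp: eU_def PiE_iff extensional_def)
    qed
  qed
  ultimately show "\<exists>h. fam p (above U p []) h \<and> f = eU p U h" by blast
next
  assume "\<exists>h. fam p (above U p []) h \<and> f = eU p U h"
  then obtain h where h: "fam p (above U p []) h" "f = eU p U h" by blast
  have hc: "h \<eta> \<in> carrier (H p \<eta>)" if "\<eta> \<in> P p" "y \<in> U \<inter> cl \<eta>" for \<eta> y
    using fam_carrier[OF h(1)] in_nbhd[OF U that(2)] that(1) by (auto simp: above_Nil)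
  have f: "f \<eta> = (\<lambda>y\<in>U \<inter> cl \<eta>. h \<eta>)" if "\<eta> \<in> P p" for \<eta> using that h by (simp add: eU_def)
  have "f \<in> (\<Pi>\<^sub>E \<eta>\<in>P p. \<Pi>\<^sub>E y\<in>U \<inter> cl \<eta>. carrier (H p \<eta>))"
    unfolding h(2) eU_def using hc by (auto simp: PiE_iff)
  moreover have "continuous_map (subtopology X (U \<inter> cl \<eta>)) (discrete_topology (carrier (H p \<eta>))) (f \<eta>)"
    if \<eta>: "\<eta> \<in> P p" for \<eta>
  proof (rule continuous_map_eq)
    show "continuous_map (subtopology X (U \<inter> cl \<eta>)) (discrete_topology (carrier (H p \<eta>))) (\<lambda>y. h \<eta>)"
      by (cases "U \<inter> cl \<eta> = {}") (use hc[OF \<eta>] in auto)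
    show "h \<eta> = f \<eta> y" if "y \<in> topspace (subtopology X (U \<inter> cl \<eta>))" for y
      using that f[OF \<eta>] by simp
  qed
  moreover have "{\<eta>\<in>P p. \<exists>y\<in>U \<inter> cl \<eta>. f \<eta> y \<noteq> oneH p \<eta>} \<subseteq> {\<eta> \<in> above U p []. h \<eta> \<noteq> oneH p \<eta>}"
    using f in_nbhd[OF U] by (auto simp: above_Nil)
  then have "finite {\<eta>\<in>P p. \<exists>y\<in>U \<inter> cl \<eta>. f \<eta> y \<noteq> oneH p \<eta>}"
    using h(1) finite_subset unfolding fam_def by blast
  ultimately show "f \<in> carrier (cousin_sections X I p U)" by (simp add: cousin_sections_def)
qed

lemma cousin_mult: "eU p U h \<otimes>\<^bsub>cousin_sections X I p U\<^esub> eU p U h' = eU p U (\<lambda>\<eta>. h \<eta> \<otimes>\<^bsub>H p \<eta>\<^esub> h' \<eta>)"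
  by (auto simp: cousin_sections_def eU_def fun_eq_iff)

lemma cousin_one: "\<one>\<^bsub>cousin_sections X I p U\<^esub> = eU p U (\<lambda>\<eta>. oneH p \<eta>)"
  by (simp add: cousin_sections_def eU_def)

lemma cousin_comm_group:
  assumes U: "openin X U"
  shows "comm_group (cousin_sections X I p U)"
proof (rule comm_groupI)
  let ?C = "cousin_sections X I p U"
  have Hc: "comm_group (H p \<eta>)" if "\<eta> \<in> P p \<inter> U" for \<eta> using that H_comm by blast
  show "\<one>\<^bsub>?C\<^esub> \<in> carrier ?C" unfolding cousin_carrier[OF U] cousin_one using fam_one[OF above_P] by blast
  fix f assume "f \<in> carrier ?C"
  then obtain h where h: "fam p (above U p []) h" "f = eU p U h" unfolding cousin_carrier[OF U] by blast
  have hc: "h \<eta> \<in> carrier (H p \<eta>)" if "\<eta> \<in> P p \<inter> U" for \<eta> using fam_carrier[OF h(1)] that by (simp add: above_Nil)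
  show "\<one>\<^bsub>?C\<^esub> \<otimes>\<^bsub>?C\<^esub> f = f" unfolding cousin_one h(2) cousin_mult
    by (rule eU_cong[OF U]) (simp add: hc monoid.l_one[OF group.is_monoid[OF comm_group.axioms(2)[OF Hc]]])
  show "\<exists>g\<in>carrier ?C. g \<otimes>\<^bsub>?C\<^esub> f = \<one>\<^bsub>?C\<^esub>"
  proof (rule bexI)
    show "eU p U (\<lambda>\<eta>. inv\<^bsub>H p \<eta>\<^esub> h \<eta>) \<in> carrier ?C"
      unfolding cousin_carrier[OF U] using fam_inv[OF above_P h(1)] by blast
    show "eU p U (\<lambda>\<eta>. inv\<^bsub>H p \<eta>\<^esub> h \<eta>) \<otimes>\<^bsub>?C\<^esub> f = \<one>\<^bsub>?C\<^esub>" unfolding cousin_one h(2) cousin_mult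
      by (rule eU_cong[OF U]) (simp add: hc group.l_inv[OF comm_group.axioms(2)[OF Hc]])
  qed
  fix g assume "g \<in> carrier ?C"
  then obtain k where k: "fam p (above U p []) k" "g = eU p U k" unfolding cousin_carrier[OF U] by blast
  have kc: "k \<eta> \<in> carrier (H p \<eta>)" if "\<eta> \<in> P p \<inter> U" for \<eta> using fam_carrier[OF k(1)] that by (simp add: above_Nil)
  show "f \<otimes>\<^bsub>?C\<^esub> g \<in> carrier ?C" unfolding h(2) k(2) cousin_mult cousin_carrier[OF U]
    using fam_mult[OF above_P h(1) k(1)] by blast
  show "f \<otimes>\<^bsub>?C\<^esub> g = g \<otimes>\<^bsub>?C\<^esub> f" unfolding h(2) k(2) cousin_mult
    by (rule eU_cong[OF U]) (simp add: hc kc comm_monoid.m_comm[OF comm_group.axioms(1)[OF Hc]])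
  fix e assume "e \<in> carrier ?C"
  then obtain l where l: "fam p (above U p []) l" "e = eU p U l" unfolding cousin_carrier[OF U] by blast
  have lc: "l \<eta> \<in> carrier (H p \<eta>)" if "\<eta> \<in> P p \<inter> U" for \<eta> using fam_carrier[OF l(1)] that by (simp add: above_Nil)
  show "f \<otimes>\<^bsub>?C\<^esub> g \<otimes>\<^bsub>?C\<^esub> e = f \<otimes>\<^bsub>?C\<^esub> (g \<otimes>\<^bsub>?C\<^esub> e)" unfolding h(2) k(2) l(2) cousin_mult
    by (rule eU_cong[OF U]) (simp add: hc kc lc monoid.m_assoc[OF group.is_monoid[OF comm_group.axioms(2)[OF Hc]]])
qed

lemma K_simps: "sections (obj K p) U = cousin_sections X I p U"
  "restr (obj K p) U V f = (\<lambda>\<eta>\<in>P p. restrict (f \<eta>) (V \<inter> cl \<eta>))"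
  by (simp_all add: cousin_complex_def)

lemma K_restr_eU: "V \<subseteq> U \<Longrightarrow> restr (obj K p) U V (eU p U h) = eU p V h"
  by (auto simp: K_simps eU_def fun_eq_iff)

lemma K_presheaf: "strict_presheaf X (obj K p)"
proof (rule strict_presheaf.intro[OF group_presheaf.intro strict_presheaf_axioms.intro])
  fix U assume U: "openin X U"
  show "comm_group (sections (obj K p) U)" unfolding K_simps by (rule cousin_comm_group[OF U])
  show "restr (obj K p) U U s = s" if s: "s \<in> carrier (sections (obj K p) U)" for s
    using that K_restr_eU[of U U p] unfolding K_simps(1) cousin_carrier[OF U] by auto
  fix V assume V: "openin X V" "V \<subseteq> U"
  show "restr (obj K p) U V \<in> hom (sections (obj K p) U) (sections (obj K p) V)"
    unfolding K_simps(1)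
  proof (rule homI)
    fix f assume "f \<in> carrier (cousin_sections X I p U)"
    then obtain h where h: "fam p (above U p []) h" "f = eU p U h" unfolding cousin_carrier[OF U] by blast
    show "restr (obj K p) U V f \<in> carrier (cousin_sections X I p V)"
      unfolding cousin_carrier[OF V(1)] h(2) K_restr_eU[OF V(2)] using fam_mono[OF h(1) above_subset[OF V(2)]] by blast
    fix g assume "g \<in> carrier (cousin_sections X I p U)"
    then obtain k where k: "g = eU p U k" unfolding cousin_carrier[OF U] by blast
    show "restr (obj K p) U V (f \<otimes>\<^bsub>cousin_sections X I p U\<^esub> g) =
      restr (obj K p) U V f \<otimes>\<^bsub>cousin_sections X I p V\<^esub> restr (obj K p) U V g"
      unfolding h(2) k cousin_mult K_restr_eU[OF V(2)] ..
  qed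
next
  have st: "restr (obj K p) V W (restr (obj K p) U V s) = restr (obj K p) U W s" if "V \<subseteq> U" "W \<subseteq> V" for U V W s
    using that by (auto simp: K_simps fun_eq_iff restrict_def)
  then show "restr (obj K p) V W (restr (obj K p) U V s) = restr (obj K p) U W s" if "V \<subseteq> U" "W \<subseteq> V" for U V W s
    using that by blast
  show "restr (obj K p) V W (restr (obj K p) U V s) = restr (obj K p) U W s" if "V \<subseteq> U" "W \<subseteq> V" for U V W s
    using st that by blast
qed

lemma K_group_presheaf: "group_presheaf X (obj K p)"
  by (rule strict_presheaf.axioms(1)[OF K_presheaf])

abbreviation kg :: "nat \<Rightarrow> 'x \<Rightarrow> 'x set \<Rightarrow> ('x \<Rightarrow> ('x set \<times> 'c) set set) \<Rightarrow> ('x set \<times> ('x \<Rightarrow> 'x \<Rightarrow> ('x set \<times> 'c) set set)) set"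
  where "kg p x U h \<equiv> germ X (obj K p) x U (eU p U h)"

lemma Gen_sub_above: "openin X U \<Longrightarrow> x \<in> U \<Longrightarrow> Gen p x \<subseteq> above U p []"
  using closure_of_nbhd by (fastforce simp: Gen_def above_Nil)

text \<open>Both families are finitely supported, so the points at which they differ and that do not specialize to \<open>x\<close>
  are absent from a neighbourhood of \<open>x\<close>.\<close>

lemma kg_eq_iff:
  assumes U: "openin X U" "x \<in> U" and V: "openin X V" "x \<in> V"
    and h: "fam p (above U p []) h" and h': "fam p (above V p []) h'"
  shows "kg p x U h = kg p x V h' \<longleftrightarrow> (\<forall>\<eta>\<in>Gen p x. h \<eta> = h' \<eta>)"
proof -
  interpret Kp: group_presheaf X "obj K p" by (rule K_group_presheaf)
  have c: "eU p U h \<in> Kp.sec U" "eU p V h' \<in> Kp.sec V"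
    unfolding K_simps(1) cousin_carrier[OF U(1)] cousin_carrier[OF V(1)] using h h' by blast+
  have "kg p x U h = kg p x V h' \<longleftrightarrow>
    (\<exists>W. openin X W \<and> x \<in> W \<and> W \<subseteq> U \<inter> V \<and> restr (obj K p) U W (eU p U h) = restr (obj K p) V W (eU p V h'))"
    by (rule Kp.germ_eq_iff[OF U(1) V(1) U(2) c])
  also have "\<dots> \<longleftrightarrow> (\<exists>W. openin X W \<and> x \<in> W \<and> W \<subseteq> U \<inter> V \<and> eU p W h = eU p W h')"
    by (intro ex_cong1 conj_cong refl) (simp add: K_restr_eU)
  also have "\<dots> \<longleftrightarrow> (\<forall>\<eta>\<in>Gen p x. h \<eta> = h' \<eta>)"
  proof
    assume "\<exists>W. openin X W \<and> x \<in> W \<and> W \<subseteq> U \<inter> V \<and> eU p W h = eU p W h'"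
    then obtain W where "x \<in> W" "eU p W h = eU p W h'" by blast
    then show "\<forall>\<eta>\<in>Gen p x. h \<eta> = h' \<eta>" using eU_eqD[of p W h h' _ x] by (auto simp: Gen_def)
  next
    assume eq: "\<forall>\<eta>\<in>Gen p x. h \<eta> = h' \<eta>"
    let ?B = "({\<eta> \<in> above U p []. h \<eta> \<noteq> oneH p \<eta>} \<union> {\<eta> \<in> above V p []. h' \<eta> \<noteq> oneH p \<eta>}) - Gen p x"
    have B: "finite ?B" using h h' by (simp add: fam_def)
    have UV: "openin X (U \<inter> V)" "x \<in> U \<inter> V" using U V by auto
    have nB: "x \<notin> cl s" if "s \<in> ?B" for s using that by (auto simp: Gen_def above_Nil)
    obtain W where W: "openin X W" "x \<in> W" "W \<subseteq> U \<inter> V" "W \<inter> ?B = {}"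
      by (rule avoid_finite[OF B UV(2,1) nB])
    have "eU p W h = eU p W h'"
    proof (rule eU_cong[OF W(1)])
      fix \<eta> assume \<eta>: "\<eta> \<in> P p \<inter> W"
      show "h \<eta> = h' \<eta>"
      proof (cases "\<eta> \<in> Gen p x")
        case False
        then have "\<eta> \<notin> ?B" using W(4) \<eta> by blast
        then show ?thesis using False \<eta> W(3) by (auto simp: above_Nil)
      qed (use eq in blast)
    qed
    then show "\<exists>W. openin X W \<and> x \<in> W \<and> W \<subseteq> U \<inter> V \<and> eU p W h = eU p W h'" using W by blast
  qed
  finally show ?thesis .
qed

lemma kg_carrier: "openin X U \<Longrightarrow> x \<in> U \<Longrightarrow> fam p (above U p []) h \<Longrightarrow> kg p x U h \<in> carrier (stalk X (obj K p) x)"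
  using group_presheaf.germ_carrier[OF K_group_presheaf, of U x "eU p U h" p] cousin_carrier[of U "eU p U h" p]
  by (auto simp: K_simps(1))

lemma kg_surj:
  assumes "A \<in> carrier (stalk X (obj K p) x)"
  obtains U h where "openin X U" "x \<in> U" "fam p (above U p []) h" "A = kg p x U h"
proof -
  obtain U s where U: "openin X U" "x \<in> U" "s \<in> carrier (sections (obj K p) U)" "A = germ X (obj K p) x U s"
    using group_presheaf.stalk_obtain[OF K_group_presheaf assms] .
  then obtain h where "fam p (above U p []) h" "s = eU p U h" using cousin_carrier[OF U(1)] K_simps(1) by auto
  then show thesis using that U by blast
qed

lemma kg_one: "x \<in> T \<Longrightarrow> \<one>\<^bsub>stalk X (obj K p) x\<^esub> = kg p x T (\<lambda>\<eta>. oneH p \<eta>)"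
  using group_presheaf.stalk_one[OF K_group_presheaf openin_topspace] by (simp add: K_simps(1) cousin_one)

lemma fam_D_above:
  assumes U: "openin X U" and h: "fam p (above U p []) h"
  shows "fam (Suc p) (above U (Suc p) []) (\<lambda>\<xi>. D p \<xi> h)"
proof -
  let ?h = "\<lambda>\<eta>. if \<eta> \<in> above U p [] then h \<eta> else oneH p \<eta>"
  have f: "fam p (P p) ?h" by (rule fam_extend[OF above_P h])
  have s: "Gen p \<xi> \<subseteq> above U p []" "\<xi> \<in> P (Suc p)" if "\<xi> \<in> above U (Suc p) []" for \<xi>
    using Gen_sub_above[OF U, of \<xi>] that by (auto simp: above_Nil)
  have e: "D p \<xi> h = D p \<xi> ?h" if "\<xi> \<in> above U (Suc p) []" for \<xi>
    by (rule D_cong[OF s(2)[OF that] fam_mono[OF h s(1)[OF that]]]) (use s(1)[OF that] in auto)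
  have "{\<xi> \<in> above U (Suc p) []. D p \<xi> h \<noteq> oneH (Suc p) \<xi>} \<subseteq> {\<xi> \<in> P (Suc p). D p \<xi> ?h \<noteq> oneH (Suc p) \<xi>}"
    using e by (auto simp: above_Nil)
  then have "finite {\<xi> \<in> above U (Suc p) []. D p \<xi> h \<noteq> oneH (Suc p) \<xi>}"
    by (rule finite_subset[OF _ D_finite[OF f]])
  then show ?thesis using D_closed[OF s(2) fam_mono[OF h s(1)]] by (simp add: fam_def)
qed

lemma K_diff:
  assumes U: "openin X U" and h: "fam p (above U p []) h"
  shows "diff K p U (eU p U h) = eU (Suc p) U (\<lambda>\<xi>. D p \<xi> h)"
proof -
  have "finprod (H (Suc p) \<xi>) (\<lambda>\<eta>. nu X I p \<eta> \<xi> (eU p U h \<eta> y))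
      {\<eta>\<in>P p. \<xi> \<in> cl \<eta> \<and> eU p U h \<eta> y \<noteq> oneH p \<eta>} = D p \<xi> h"
    if \<xi>: "\<xi> \<in> P (Suc p)" and y: "y \<in> U \<inter> cl \<xi>" for \<xi> y
  proof -
    interpret comm_group "H (Suc p) \<xi>" by (rule H_comm[OF \<xi>])
    have \<xi>U: "\<xi> \<in> U" by (rule in_nbhd[OF U y])
    have fx: "fam p (Gen p \<xi>) h" by (rule fam_mono[OF h Gen_sub_above[OF U \<xi>U]])
    have e: "eU p U h \<eta> y = h \<eta>" if "\<eta> \<in> Gen p \<xi>" for \<eta>
      using that y closure_trans[of \<xi> X \<eta> y] unfolding eU_def Gen_def by auto
    have s: "{\<eta>\<in>P p. \<xi> \<in> cl \<eta> \<and> eU p U h \<eta> y \<noteq> oneH p \<eta>} = {\<eta>\<in>Gen p \<xi>. h \<eta> \<noteq> oneH p \<eta>}"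
      using e by (auto simp: Gen_def)
    show ?thesis unfolding s D_def
      by (rule finprod_cong') (use e N_carrier[OF _ \<xi>] fam_carrier[OF fx] in auto)
  qed
  then show ?thesis unfolding cousin_complex_def eU_def by (auto simp: fun_eq_iff)
qed

lemma K_cobd:
  assumes x: "x \<in> U" and U: "openin X U" and h: "fam p (above U p []) h"
  shows "cobd (stalk_complex X K x) p (kg p x U h) = kg (Suc p) x U (\<lambda>\<xi>. D p \<xi> h)"
proof -
  have sec: "eU p U h \<in> carrier (sections (obj K p) U)" unfolding K_simps(1) cousin_carrier[OF U] using h by blast
  have "stalk_map X (obj K (Suc p)) x (diff K p) (kg p x U h) = germ X (obj K (Suc p)) x U (diff K p U (eU p U h))"
  proof (rule stalk_map_germ[OF K_group_presheaf U x sec])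
    fix U W s assume a: "openin X U" "openin X W" "x \<in> W" "W \<subseteq> U" "s \<in> carrier (sections (obj K p) U)"
    then obtain h where h: "fam p (above U p []) h" "s = eU p U h" unfolding K_simps(1) cousin_carrier[OF a(1)] by blast
    have hW: "fam p (above W p []) h" by (rule fam_mono[OF h(1) above_subset[OF a(4)]])
    have xU: "x \<in> U" using a by auto
    show "germ X (obj K (Suc p)) x U (diff K p U s) = germ X (obj K (Suc p)) x W (diff K p W (restr (obj K p) U W s))"
      unfolding h(2) K_restr_eU[OF a(4)] K_diff[OF a(1) h(1)] K_diff[OF a(2) hW]
      by (rule iffD2[OF kg_eq_iff[OF a(1) xU a(2,3) fam_D_above[OF a(1) h(1)] fam_D_above[OF a(2) hW]]]) simp
  qed auto
  then show ?thesis unfolding K_diff[OF U h] by (simp add: stalk_complex_def)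
qed

lemma K_cobd_one_iff:
  assumes x: "x \<in> U" and U: "openin X U" and h: "fam p (above U p []) h"
  shows "kg p x U h \<in> cocycles (stalk_complex X K x) p \<longleftrightarrow> (\<forall>\<xi>\<in>Gen (Suc p) x. D p \<xi> h = oneH (Suc p) \<xi>)"
proof -
  have xT: "x \<in> T" using x openin_subset[OF U] by auto
  have g: "grp (stalk_complex X K x) q = stalk X (obj K q) x" for q by (simp add: stalk_complex_def)
  show ?thesis
    using kg_carrier[OF U x h] kg_eq_iff[OF U x openin_topspace xT fam_D_above[OF U h] fam_one[OF above_P]]
    by (simp add: cocycles_def K_cobd[OF x U h] g kg_one[OF xT])
qed

lemma K_cobd_one:
  assumes xT: "x \<in> T"
  shows "cobd (stalk_complex X K x) n \<one>\<^bsub>stalk X (obj K n) x\<^esub> = \<one>\<^bsub>stalk X (obj K (Suc n)) x\<^esub>"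
proof -
  have f1: "fam n (above T n []) (\<lambda>\<eta>. oneH n \<eta>)" by (rule fam_one[OF above_P])
  have "kg (Suc n) x T (\<lambda>\<xi>. D n \<xi> (\<lambda>\<eta>. oneH n \<eta>)) = kg (Suc n) x T (\<lambda>\<eta>. oneH (Suc n) \<eta>)"
    using kg_eq_iff[OF openin_topspace xT openin_topspace xT fam_D_above[OF openin_topspace f1] fam_one[OF above_P]]
      D_one Gen_D by simp
  then show ?thesis unfolding kg_one[OF xT] K_cobd[OF xT openin_topspace f1] .
qed

lemma fam_extend_T: "fam p (Gen p x) h \<Longrightarrow> fam p (above T p []) (\<lambda>\<eta>. if \<eta> \<in> Gen p x then h \<eta> else oneH p \<eta>)"
  by (rule fam_mono[OF fam_extend[OF Gen_P] above_P])

lemma D_extend: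
  assumes h: "fam p (Gen p x) h" and \<xi>: "\<xi> \<in> Gen (Suc p) x"
  shows "D p \<xi> (\<lambda>\<eta>. if \<eta> \<in> Gen p x then h \<eta> else oneH p \<eta>) = D p \<xi> h"
  by (rule D_cong[symmetric]) (use Gen_D[OF \<xi>] Gen_trans[OF \<xi>] fam_mono[OF h Gen_trans[OF \<xi>]] in auto)

end

section \<open>Cohen--Macaulay sheaves\<close>

locale cm_sheaf = cousin_setup X I for X :: "'x topology" and I :: "('x, 'c) sheaf_complex" +
  fixes F :: "('x, 'b) ab_presheaf" and \<epsilon> :: "'x set \<Rightarrow> 'b \<Rightarrow> 'c"
  assumes F_sheaf: "ab_sheaf X F" and CM: "cohen_macaulay X F I \<epsilon>"
begin

lemma F_presheaf: "group_presheaf X F" by (rule group_presheaf_of_ab_sheaf[OF F_sheaf])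

sublocale Fp: group_presheaf X F by (rule F_presheaf)

abbreviation Fx :: "'x \<Rightarrow> ('x set \<times> 'b) set monoid" where "Fx x \<equiv> stalk X F x"
abbreviation cosp :: "'x \<Rightarrow> ('x set \<times> 'b) set \<Rightarrow> ('x set \<times> 'b) set" where "cosp x \<equiv> stalk_map X F x (\<lambda>U s. s)"
abbreviation iota :: "'x \<Rightarrow> ('x set \<times> 'b) set \<Rightarrow> ('x set \<times> 'c) set set" where "iota \<eta> \<equiv> stalk_to_H0 X I \<epsilon> \<eta>"

lemma cosp_germ: "y \<in> cl x \<Longrightarrow> openin X U \<Longrightarrow> y \<in> U \<Longrightarrow> s \<in> Fp.sec U \<Longrightarrow> cosp x (germ X F y U s) = germ X F x U s"
  by (rule stalk_map_germ_hom[OF F_presheaf F_presheaf sheaf_hom_id[OF F_presheaf]]) (auto intro: closure_of_nbhd)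

lemma cosp_hom: "y \<in> cl x \<Longrightarrow> cosp x \<in> hom (Fx y) (Fx x)"
  by (rule stalk_map_hom[OF F_presheaf F_presheaf sheaf_hom_id[OF F_presheaf]]) (rule closure_of_nbhd)

lemma cosp_carrier: "y \<in> cl x \<Longrightarrow> z \<in> carrier (Fx y) \<Longrightarrow> cosp x z \<in> carrier (Fx x)"
  using cosp_hom by (auto simp: hom_def)

lemma cosp_trans:
  assumes "y \<in> cl x" "w \<in> cl y" "z \<in> carrier (Fx w)"
  shows "cosp x (cosp y z) = cosp x z"
proof -
  obtain U s where "openin X U" "w \<in> U" "s \<in> Fp.sec U" "z = germ X F w U s" using Fp.stalk_obtain[OF assms(3)] .
  then show ?thesis
    using cosp_germ[OF assms(2), of U s] cosp_germ[OF assms(1), of U s] cosp_germ[OF closure_trans[OF assms(1,2)], of U s]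
      closure_of_nbhd[OF assms(2), of U] by simp
qed

lemma cosp_self:
  assumes "x \<in> T" "z \<in> carrier (Fx x)"
  shows "cosp x z = z"
proof -
  obtain U s where "openin X U" "x \<in> U" "s \<in> Fp.sec U" "z = germ X F x U s" using Fp.stalk_obtain[OF assms(2)] .
  then show ?thesis using cosp_germ[OF point_in_closure[OF assms(1)]] by simp
qed

lemma quasi: "quasi_iso X (in_degree_0 F) K (from_degree_0 K (cousin_aug X F I \<epsilon>))"
  using CM by (simp add: cohen_macaulay_def)

text \<open>The cocycle given by \<open>h\<close> on the stalk at \<open>y\<close> is a coboundary, and germs of sections of the Cousin complex are
  families of elements at the generizations of \<open>y\<close>.\<close>

lemma exact_stalk:
  assumes y: "y \<in> T" and h: "fam (Suc k) (Gen (Suc k) y) h"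
    and z: "\<And>\<zeta>. \<zeta> \<in> Gen (Suc (Suc k)) y \<Longrightarrow> D (Suc k) \<zeta> h = oneH (Suc (Suc k)) \<zeta>"
  shows "\<exists>g. fam k (Gen k y) g \<and> (\<forall>\<xi>\<in>Gen (Suc k) y. D k \<xi> g = h \<xi>)"
proof -
  let ?h = "\<lambda>\<eta>. if \<eta> \<in> Gen (Suc k) y then h \<eta> else oneH (Suc k) \<eta>"
  have f: "fam (Suc k) (above T (Suc k) []) ?h" by (rule fam_extend_T[OF h])
  have "kg (Suc k) y T ?h \<in> cocycles (stalk_complex X K y) (Suc k)"
    using K_cobd_one_iff[OF y openin_topspace f] D_extend[OF h] z by simp
  then have "kg (Suc k) y T ?h \<in> coboundaries (stalk_complex X K y) (Suc k)"
    by (rule subsetD[OF quasi_iso_exactD[OF F_presheaf K_group_presheaf y quasi _ K_cobd_one[OF y]], rotated]) simp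
  then obtain A where A: "A \<in> carrier (stalk X (obj K k) y)" "cobd (stalk_complex X K y) k A = kg (Suc k) y T ?h"
    by (auto simp: coboundaries_def stalk_complex_def)
  obtain U g where U: "openin X U" "y \<in> U" "fam k (above U k []) g" "A = kg k y U g" using kg_surj[OF A(1)] .
  have "kg (Suc k) y U (\<lambda>\<xi>. D k \<xi> g) = kg (Suc k) y T ?h" using A(2) K_cobd[OF U(2,1,3)] U(4) by simp
  then have "\<forall>\<xi>\<in>Gen (Suc k) y. D k \<xi> g = ?h \<xi>"
    by (rule iffD1[OF kg_eq_iff[OF U(1,2) openin_topspace y fam_D_above[OF U(1,3)] f]])
  then show ?thesis using fam_mono[OF U(3) Gen_sub_above[OF U(1,2)]] by auto
qed

sublocale cousin_exact X H "nu X I"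
  by (rule cousin_exact.intro[OF cousin_data_axioms cousin_exact_axioms.intro]) (rule exact_stalk)

text \<open>The augmentation identifies the stalk of \<open>F\<close> with the kernel of the first Cousin differential.\<close>

lemma aug_germ:
  assumes U: "openin X U" "x \<in> U" and s: "s \<in> Fp.sec U"
  shows "stalk_map X (obj K 0) x (cousin_aug X F I \<epsilon>) (germ X F x U s) = germ X (obj K 0) x U (cousin_aug X F I \<epsilon> U s)"
proof (rule stalk_map_germ[OF F_presheaf U s])
  fix U W s assume a: "openin X U" "openin X W" "x \<in> W" "W \<subseteq> U" "s \<in> Fp.sec U"
  have "restr (obj K 0) U W (cousin_aug X F I \<epsilon> U s) = cousin_aug X F I \<epsilon> W (restr F U W s)"
  proof -
    have "germ X F \<eta> U s = germ X F \<eta> W (restr F U W s)" if "y \<in> W \<inter> cl \<eta>" for y \<eta>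
      using Fp.germ_restr[OF a(1,2) in_nbhd[OF a(2) that] a(4,5)] by simp
    then show ?thesis using a(4) by (auto simp: K_simps cousin_aug_def fun_eq_iff)
  qed
  then show "germ X (obj K 0) x U (cousin_aug X F I \<epsilon> U s) = germ X (obj K 0) x W (cousin_aug X F I \<epsilon> W (restr F U W s))"
    using strict_presheaf.germ_restr_any[OF K_presheaf a(2,3,4), of 0 "cousin_aug X F I \<epsilon> U s"] by simp
qed auto

abbreviation aug :: "'x \<Rightarrow> ('x set \<times> 'b) set \<Rightarrow> _" where
  "aug x \<equiv> stalk_map X (obj K 0) x (cousin_aug X F I \<epsilon>)"

lemma aug_facts:
  assumes x: "x \<in> T"
  shows "bij_betw (aug x) (carrier (Fx x)) (cocycles (stalk_complex X K x) 0)"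
    "aug x \<in> hom (Fx x) (stalk X (obj K 0) x)"
proof -
  have "aug x z \<in> carrier (stalk X (obj K 0) x) \<or> aug x z = {}" if z: "z \<in> carrier (Fx x)" for z
  proof -
    obtain U s where "openin X U" "x \<in> U" "s \<in> Fp.sec U" "z = germ X F x U s" using Fp.stalk_obtain[OF z] .
    then show ?thesis using aug_germ[of U x s] strict_presheaf.germ_any_cases[OF K_presheaf, of 0 x U "cousin_aug X F I \<epsilon> U s"] by simp
  qed
  from quasi_iso_degree_0D[OF F_presheaf K_group_presheaf x quasi this]
  show "bij_betw (aug x) (carrier (Fx x)) (cocycles (stalk_complex X K x) 0)"
    "aug x \<in> hom (Fx x) (stalk X (obj K 0) x)" by simp_all
qed

lemma aug_kg:
  assumes x: "x \<in> T" and z: "z \<in> carrier (Fx x)"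
  obtains V h where "openin X V" "x \<in> V" "fam 0 (above V 0 []) h" "aug x z = kg 0 x V h"
    "\<forall>\<eta>\<in>Gen 0 x. h \<eta> = iota \<eta> (cosp \<eta> z)" "\<forall>\<xi>\<in>Gen 1 x. D 0 \<xi> h = oneH 1 \<xi>"
proof -
  obtain U s where U: "openin X U" "x \<in> U" "s \<in> Fp.sec U" "z = germ X F x U s" using Fp.stalk_obtain[OF z] .
  have coc: "aug x z \<in> cocycles (stalk_complex X K x) 0" using aug_facts(1)[OF x] z by (auto simp: bij_betw_def)
  then have "aug x z \<in> carrier (stalk X (obj K 0) x)" by (simp add: cocycles_def stalk_complex_def)
  then obtain V h where V: "openin X V" "x \<in> V" "fam 0 (above V 0 []) h" "aug x z = kg 0 x V h" by (rule kg_surj)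
  have "eU 0 V h \<in> carrier (sections (obj K 0) V)" unfolding K_simps(1) cousin_carrier[OF V(1)] using V(3) by blast
  then have "(V, eU 0 V h) \<in> kg 0 x V h" by (rule group_presheaf.germ_self[OF K_group_presheaf V(1,2)])
  then have "(V, eU 0 V h) \<in> germ X (obj K 0) x U (cousin_aug X F I \<epsilon> U s)"
    unfolding V(4)[symmetric] U(4) aug_germ[OF U(1,2,3)] .
  then obtain W where W: "openin X W" "x \<in> W" "W \<subseteq> U \<inter> V"
    "restr (obj K 0) U W (cousin_aug X F I \<epsilon> U s) = restr (obj K 0) V W (eU 0 V h)"
    by (rule strict_presheaf.germ_mem_any[OF K_presheaf])
  have "h \<eta> = iota \<eta> (cosp \<eta> z)" if \<eta>: "\<eta> \<in> Gen 0 x" for \<eta>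
  proof -
    have e: "\<eta> \<in> P 0" "x \<in> cl \<eta>" using Gen_D[OF \<eta>] by auto
    have "restr (obj K 0) U W (cousin_aug X F I \<epsilon> U s) \<eta> x = iota \<eta> (germ X F \<eta> U s)"
      using e W(1-3) U(1,2) by (auto simp: K_simps cousin_aug_def)
    moreover have "restr (obj K 0) V W (eU 0 V h) \<eta> x = h \<eta>"
      using e W(1-3) by (auto simp: K_simps eU_def)
    ultimately show ?thesis using W(4) cosp_germ[OF e(2) U(1,2,3)] U(4) by simp
  qed
  moreover have "\<forall>\<xi>\<in>Gen 1 x. D 0 \<xi> h = oneH 1 \<xi>"
    using K_cobd_one_iff[OF V(2,1,3)] coc V(4) by simp
  ultimately show thesis by (intro that[OF V] ballI) simp_all
qed

lemma stalk_fam: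
  assumes x: "x \<in> T" and z: "z \<in> carrier (Fx x)"
  shows "fam 0 (Gen 0 x) (\<lambda>\<eta>. iota \<eta> (cosp \<eta> z))"
    and "\<And>\<xi>. \<xi> \<in> Gen 1 x \<Longrightarrow> D 0 \<xi> (\<lambda>\<eta>. iota \<eta> (cosp \<eta> z)) = oneH 1 \<xi>"
proof -
  obtain V h where V: "openin X V" "x \<in> V" "fam 0 (above V 0 []) h"
    and h: "\<forall>\<eta>\<in>Gen 0 x. h \<eta> = iota \<eta> (cosp \<eta> z)"
    and Dh: "\<forall>\<xi>\<in>Gen 1 x. D 0 \<xi> h = oneH 1 \<xi>" by (rule aug_kg[OF x z])
  have fh: "fam 0 (Gen 0 x) h" by (rule fam_mono[OF V(3) Gen_sub_above[OF V(1,2)]])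
  then show "fam 0 (Gen 0 x) (\<lambda>\<eta>. iota \<eta> (cosp \<eta> z))" using fam_cong[of "Gen 0 x" h "\<lambda>\<eta>. iota \<eta> (cosp \<eta> z)" 0] h by simp
  show "D 0 \<xi> (\<lambda>\<eta>. iota \<eta> (cosp \<eta> z)) = oneH 1 \<xi>" if \<xi>: "\<xi> \<in> Gen 1 x" for \<xi>
  proof -
    have \<xi>': "\<xi> \<in> P (Suc 0)" "Gen 0 \<xi> \<subseteq> Gen 0 x" using Gen_D[OF \<xi>] Gen_trans[OF \<xi>] by auto
    have "D 0 \<xi> h = D 0 \<xi> (\<lambda>\<eta>. iota \<eta> (cosp \<eta> z))"
      by (rule D_cong[OF \<xi>'(1) fam_mono[OF fh \<xi>'(2)]]) (use h \<xi>'(2) in blast)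
    then show ?thesis using bspec[OF Dh \<xi>] by simp
  qed
qed

lemma stalk_inj:
  assumes x: "x \<in> T" and z: "z \<in> carrier (Fx x)" "z' \<in> carrier (Fx x)"
    and eq: "\<And>\<eta>. \<eta> \<in> Gen 0 x \<Longrightarrow> iota \<eta> (cosp \<eta> z) = iota \<eta> (cosp \<eta> z')"
  shows "z = z'"
proof -
  obtain V h where V: "openin X V" "x \<in> V" "fam 0 (above V 0 []) h" "aug x z = kg 0 x V h"
    and h: "\<forall>\<eta>\<in>Gen 0 x. h \<eta> = iota \<eta> (cosp \<eta> z)" by (rule aug_kg[OF x z(1)])
  obtain V' h' where V': "openin X V'" "x \<in> V'" "fam 0 (above V' 0 []) h'" "aug x z' = kg 0 x V' h'"
    and h': "\<forall>\<eta>\<in>Gen 0 x. h' \<eta> = iota \<eta> (cosp \<eta> z')" by (rule aug_kg[OF x z(2)])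
  have "aug x z = aug x z'" unfolding V(4) V'(4)
  proof (rule iffD2[OF kg_eq_iff[OF V(1,2) V'(1,2) V(3) V'(3)]], rule ballI)
    fix \<eta> assume \<eta>: "\<eta> \<in> Gen 0 x"
    show "h \<eta> = h' \<eta>" unfolding bspec[OF h \<eta>] bspec[OF h' \<eta>] by (rule eq[OF \<eta>])
  qed
  then show ?thesis using aug_facts(1)[OF x] z by (auto simp: bij_betw_def dest: inj_onD)
qed

lemma stalk_surj:
  assumes x: "x \<in> T" and h: "fam 0 (Gen 0 x) h" and Dh: "\<And>\<xi>. \<xi> \<in> Gen 1 x \<Longrightarrow> D 0 \<xi> h = oneH 1 \<xi>"
  obtains z where "z \<in> carrier (Fx x)" "\<forall>\<eta>\<in>Gen 0 x. iota \<eta> (cosp \<eta> z) = h \<eta>"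
proof -
  let ?h = "\<lambda>\<eta>. if \<eta> \<in> Gen 0 x then h \<eta> else oneH 0 \<eta>"
  have f: "fam 0 (above T 0 []) ?h" by (rule fam_extend_T[OF h])
  have "kg 0 x T ?h \<in> cocycles (stalk_complex X K x) 0"
    using K_cobd_one_iff[OF x openin_topspace f] D_extend[OF h] Dh by simp
  then have "kg 0 x T ?h \<in> aug x ` carrier (Fx x)" using aug_facts(1)[OF x] by (simp add: bij_betw_def)
  then obtain z where z: "kg 0 x T ?h = aug x z" "z \<in> carrier (Fx x)" by (rule imageE)
  obtain V h' where V: "openin X V" "x \<in> V" "fam 0 (above V 0 []) h'" "aug x z = kg 0 x V h'"
    and h': "\<forall>\<eta>\<in>Gen 0 x. h' \<eta> = iota \<eta> (cosp \<eta> z)" by (rule aug_kg[OF x z(2)])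
  have "\<forall>\<eta>\<in>Gen 0 x. h' \<eta> = ?h \<eta>"
    using kg_eq_iff[OF V(1,2) openin_topspace x V(3) f] V(4) z(1) by simp
  then show thesis using that[OF z(2)] h' by simp
qed

text \<open>At a point of codimension \<open>0\<close> a family has a single component, so the stalk of \<open>F\<close> is the group of all
  families.\<close>

lemma iota_iso:
  assumes \<eta>: "\<eta> \<in> P 0"
  shows "iota \<eta> \<in> hom (Fx \<eta>) (H 0 \<eta>)" and "bij_betw (iota \<eta>) (carrier (Fx \<eta>)) (carrier (H 0 \<eta>))"
proof -
  have \<eta>T: "\<eta> \<in> T" by (rule P_topspace[OF \<eta>])
  have G: "Gen 0 \<eta> = {\<eta>}" "Gen 1 \<eta> = {}" using Gen_self[OF \<eta>] Gen_empty[OF \<eta>] by auto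
  interpret S: comm_group "Fx \<eta>" by (rule Fp.stalk_comm_group[OF \<eta>T])
  have c: "iota \<eta> z \<in> carrier (H 0 \<eta>)" if "z \<in> carrier (Fx \<eta>)" for z
    using fam_carrier[OF stalk_fam(1)[OF \<eta>T that], of \<eta>] G cosp_self[OF \<eta>T that] by simp
  show "iota \<eta> \<in> hom (Fx \<eta>) (H 0 \<eta>)"
  proof (rule homI[OF c])
    fix z w assume z: "z \<in> carrier (Fx \<eta>)" and w: "w \<in> carrier (Fx \<eta>)"
    let ?zw = "z \<otimes>\<^bsub>Fx \<eta>\<^esub> w"
    have zw: "?zw \<in> carrier (Fx \<eta>)" using z w by simp
    obtain V h where V: "openin X V" "\<eta> \<in> V" "fam 0 (above V 0 []) h" "aug \<eta> z = kg 0 \<eta> V h"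
      and h: "\<forall>\<eta>'\<in>Gen 0 \<eta>. h \<eta>' = iota \<eta>' (cosp \<eta>' z)" by (rule aug_kg[OF \<eta>T z])
    obtain V' h' where V': "openin X V'" "\<eta> \<in> V'" "fam 0 (above V' 0 []) h'" "aug \<eta> w = kg 0 \<eta> V' h'"
      and h': "\<forall>\<eta>'\<in>Gen 0 \<eta>. h' \<eta>' = iota \<eta>' (cosp \<eta>' w)" by (rule aug_kg[OF \<eta>T w])
    obtain V'' k where V'': "openin X V''" "\<eta> \<in> V''" "fam 0 (above V'' 0 []) k" "aug \<eta> ?zw = kg 0 \<eta> V'' k"
      and k: "\<forall>\<eta>'\<in>Gen 0 \<eta>. k \<eta>' = iota \<eta>' (cosp \<eta>' ?zw)" by (rule aug_kg[OF \<eta>T zw])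
    let ?W = "V \<inter> V'"
    have W: "openin X ?W" "\<eta> \<in> ?W" using V V' by auto
    have f: "fam 0 (above ?W 0 []) h" "fam 0 (above ?W 0 []) h'"
      using fam_mono[OF V(3)] fam_mono[OF V'(3)] above_subset[of ?W V] above_subset[of ?W V'] by auto
    have sec: "eU 0 ?W h \<in> carrier (sections (obj K 0) ?W)" "eU 0 ?W h' \<in> carrier (sections (obj K 0) ?W)"
      unfolding K_simps(1) cousin_carrier[OF W(1)] using f by blast+
    have "aug \<eta> ?zw = aug \<eta> z \<otimes>\<^bsub>stalk X (obj K 0) \<eta>\<^esub> aug \<eta> w"
      using aug_facts(2)[OF \<eta>T] z w by (simp add: hom_def)
    also have "aug \<eta> z = kg 0 \<eta> ?W h" unfolding V(4) using kg_eq_iff[OF V(1,2) W V(3) f(1)] by simp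
    also have "aug \<eta> w = kg 0 \<eta> ?W h'" unfolding V'(4) using kg_eq_iff[OF V'(1,2) W V'(3) f(2)] by simp
    also have "kg 0 \<eta> ?W h \<otimes>\<^bsub>stalk X (obj K 0) \<eta>\<^esub> kg 0 \<eta> ?W h' = kg 0 \<eta> ?W (\<lambda>\<eta>. h \<eta> \<otimes>\<^bsub>H 0 \<eta>\<^esub> h' \<eta>)"
      using group_presheaf.stalk_mult_germ[OF K_group_presheaf W sec] by (simp add: K_simps(1) cousin_mult)
    finally have "kg 0 \<eta> V'' k = kg 0 \<eta> ?W (\<lambda>\<eta>. h \<eta> \<otimes>\<^bsub>H 0 \<eta>\<^esub> h' \<eta>)" using V''(4) by simp
    then have "k \<eta> = h \<eta> \<otimes>\<^bsub>H 0 \<eta>\<^esub> h' \<eta>"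
      using kg_eq_iff[OF V''(1,2) W V''(3) fam_mult[OF above_P f]] G by simp
    then show "iota \<eta> ?zw = iota \<eta> z \<otimes>\<^bsub>H 0 \<eta>\<^esub> iota \<eta> w"
      using h h' k G cosp_self[OF \<eta>T] z w zw by simp
  qed
  show "bij_betw (iota \<eta>) (carrier (Fx \<eta>)) (carrier (H 0 \<eta>))"
  proof (rule bij_betw_imageI)
    show "inj_on (iota \<eta>) (carrier (Fx \<eta>))"
      using stalk_inj[OF \<eta>T] cosp_self[OF \<eta>T] G by (auto intro!: inj_onI)
    have "\<exists>z\<in>carrier (Fx \<eta>). iota \<eta> z = a" if a: "a \<in> carrier (H 0 \<eta>)" for a
    proof -
      have "fam 0 (Gen 0 \<eta>) (\<lambda>_. a)" using a G by (simp add: fam_def)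
      then obtain z where z: "z \<in> carrier (Fx \<eta>)" "\<forall>\<eta>'\<in>Gen 0 \<eta>. iota \<eta>' (cosp \<eta>' z) = a"
        by (rule stalk_surj[OF \<eta>T]) (use G in simp)
      then show ?thesis using cosp_self[OF \<eta>T z(1)] G by auto
    qed
    then show "iota \<eta> ` carrier (Fx \<eta>) = carrier (H 0 \<eta>)" using c by blast
  qed
qed

end

section \<open>Flags and their types\<close>

lemma flags_Nil: "flags X U [] = {[]}" by (auto simp: flags_def)

lemma flags_Cons: "zs \<in> flags X U (i # is) \<longleftrightarrow>
   (\<exists>a xs. zs = a # xs \<and> a \<in> U \<and> a \<in> points_codim X i \<and> xs \<in> flags X U is \<and> (xs \<noteq> [] \<longrightarrow> hd xs \<in> X closure_of {a}))"
proof (cases zs)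
  case Nil then show ?thesis by (simp add: flags_def)
next
  case (Cons a xs)
  have 1: "(\<forall>j<Suc (length is). (a # xs) ! j \<in> points_codim X ((i # is) ! j)) \<longleftrightarrow>
     a \<in> points_codim X i \<and> (\<forall>j<length is. xs ! j \<in> points_codim X (is ! j))"
    by (simp add: All_less_Suc2)
  have 2: "(\<forall>j. Suc j < Suc (length is) \<longrightarrow> (a # xs) ! Suc j \<in> X closure_of {(a # xs) ! j}) \<longleftrightarrow>
     (xs \<noteq> [] \<longrightarrow> hd xs \<in> X closure_of {a}) \<and> (\<forall>j. Suc j < length is \<longrightarrow> xs ! Suc j \<in> X closure_of {xs ! j})"
    if len: "length xs = length is"
  proof
    assume L: "\<forall>j. Suc j < Suc (length is) \<longrightarrow> (a # xs) ! Suc j \<in> X closure_of {(a # xs) ! j}"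
    have "hd xs \<in> X closure_of {a}" if "xs \<noteq> []"
      using L[rule_format, of 0] that len by (cases "is") (auto simp: hd_conv_nth)
    moreover have "xs ! Suc j \<in> X closure_of {xs ! j}" if "Suc j < length is" for j
      using L[rule_format, of "Suc j"] that by simp
    ultimately show "(xs \<noteq> [] \<longrightarrow> hd xs \<in> X closure_of {a}) \<and> (\<forall>j. Suc j < length is \<longrightarrow> xs ! Suc j \<in> X closure_of {xs ! j})"
      by simp
  next
    assume R: "(xs \<noteq> [] \<longrightarrow> hd xs \<in> X closure_of {a}) \<and> (\<forall>j. Suc j < length is \<longrightarrow> xs ! Suc j \<in> X closure_of {xs ! j})"
    show "\<forall>j. Suc j < Suc (length is) \<longrightarrow> (a # xs) ! Suc j \<in> X closure_of {(a # xs) ! j}"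
    proof (intro allI impI)
      fix j assume j: "Suc j < Suc (length is)"
      show "(a # xs) ! Suc j \<in> X closure_of {(a # xs) ! j}"
      proof (cases j)
        case 0 then show ?thesis using R j len by (cases xs) auto
      next
        case (Suc l) then show ?thesis using R j by simp
      qed
    qed
  qed
  show ?thesis unfolding flags_def using Cons 1 2 by auto
qed

lemma omit_0: "omit 0 (a # xs) = xs" by (simp add: omit_def)
lemma omit_Suc: "omit (Suc i) (a # xs) = a # omit i xs" by (simp add: omit_def)

lemma omit_faces: "i < length xs \<Longrightarrow> omit i xs \<in> set (faces xs)"
proof (induction xs arbitrary: i)
  case (Cons a xs) then show ?case by (cases i) (auto simp: omit_0 omit_Suc)
qed simp

lemma finprod_alt:
  assumes G: "comm_group G"
  shows "(\<And>ys. ys \<in> set (faces (a # xs)) \<Longrightarrow> h ys \<in> carrier G) \<Longrightarrow>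
    finprod G (\<lambda>i. if even i then h (omit i (a # xs)) else inv\<^bsub>G\<^esub> h (omit i (a # xs))) {..length xs} = alt G h (a # xs)"
proof (induction xs arbitrary: a h)
  case Nil
  interpret comm_group G by fact
  show ?case using Nil[of "[]"] by (simp add: omit_0)
next
  case (Cons b xs)
  interpret comm_group G by fact
  let ?h' = "\<lambda>ys. h (a # ys)"
  have hc: "?h' ys \<in> carrier G" if "ys \<in> set (faces (b # xs))" for ys using Cons.prems that by auto
  have oc: "h (omit i (a # b # xs)) \<in> carrier G" if "i \<le> Suc (length xs)" for i
    using Cons.prems[OF omit_faces, of i] that by simp
  have oc': "?h' (omit i (b # xs)) \<in> carrier G" if "i \<le> length xs" for i
    using hc[OF omit_faces, of i] that by simp
  let ?f = "\<lambda>i. if even i then h (omit i (a # b # xs)) else inv\<^bsub>G\<^esub> h (omit i (a # b # xs))"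
  let ?g = "\<lambda>i. if even i then ?h' (omit i (b # xs)) else inv\<^bsub>G\<^esub> ?h' (omit i (b # xs))"
  have gc: "?g \<in> {..length xs} \<rightarrow> carrier G" using oc' by auto
  have "finprod G ?f {..Suc (length xs)} = finprod G (\<lambda>i. ?f (Suc i)) {..length xs} \<otimes>\<^bsub>G\<^esub> ?f 0"
    using oc by (intro finprod_Suc2) auto
  also have "finprod G (\<lambda>i. ?f (Suc i)) {..length xs} = finprod G (\<lambda>i. inv\<^bsub>G\<^esub> ?g i) {..length xs}"
    using oc' by (intro finprod_cong') (auto simp: omit_Suc)
  also have "\<dots> = inv\<^bsub>G\<^esub> finprod G ?g {..length xs}"
  proof -
    have "m_inv G \<in> hom G G" by (rule homI) (simp_all add: inv_mult)
    from hom_finprod_comm[OF G G this gc] show ?thesis by simp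
  qed
  also have "finprod G ?g {..length xs} = alt G ?h' (b # xs)" by (rule Cons.IH[OF hc])
  finally have "finprod G ?f {..Suc (length xs)} = inv\<^bsub>G\<^esub> alt G ?h' (b # xs) \<otimes>\<^bsub>G\<^esub> h (b # xs)" by (simp add: omit_0)
  moreover have "alt G ?h' (b # xs) \<in> carrier G" by (rule alt_closed[OF G hc])
  moreover have "h (b # xs) \<in> carrier G" using Cons.prems by simp
  ultimately show ?case by (simp add: m_comm)
qed

lemma le_depth_iff:
  assumes "is \<noteq> []"
  shows "int m \<le> depth is \<longleftrightarrow> m < length is \<and> take (Suc m) is = [0..<Suc m]"
proof (cases "hd is = 0")
  case False
  have "take (Suc m) is \<noteq> [0..<Suc m]"
  proof
    assume e: "take (Suc m) is = [0..<Suc m]"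
    have "hd (take (Suc m) is) = hd is" using assms by (cases "is") auto
    then show False using e False by (simp add: hd_upt del: upt_Suc)
  qed
  then show ?thesis using False by (simp add: depth_def)
next
  case True
  let ?Q = "\<lambda>l. l < length is \<and> take (Suc l) is = [0..<Suc l]"
  define L where "L = (GREATEST l. ?Q l)"
  have Q0: "?Q 0" using True assms by (cases "is") auto
  have QL: "?Q L" unfolding L_def by (rule GreatestI_nat[of ?Q 0 "length is", OF Q0]) simp
  have "m \<le> L \<longleftrightarrow> ?Q m"
  proof
    assume "?Q m"
    then show "m \<le> L" unfolding L_def by (rule Greatest_le_nat[of ?Q m "length is"]) simp
  next
    assume m: "m \<le> L"
    have "take (Suc m) is = take (Suc m) (take (Suc L) is)" using m by (simp add: min_def)
    also have "\<dots> = take (Suc m) [0..<Suc L]" using QL by simp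
    also have "\<dots> = [0..<Suc m]" using m by (simp add: take_upt del: upt_Suc)
    finally show "?Q m" using m QL by simp
  qed
  then show ?thesis using True by (simp add: depth_def L_def)
qed

context cm_sheaf
begin

lemma flag_of_flags: "xs \<in> flags X U is \<Longrightarrow> sorted_wrt (<) is \<Longrightarrow> (is \<noteq> [] \<Longrightarrow> k \<le> hd is) \<Longrightarrow> flag U k xs"
proof (induction "is" arbitrary: xs k)
  case Nil then show ?case by (simp add: flags_Nil)
next
  case (Cons i "is")
  obtain a zs where r: "xs = a # zs" "a \<in> U" "a \<in> P i" "zs \<in> flags X U is" "zs \<noteq> [] \<longrightarrow> hd zs \<in> cl a"
    using Cons.prems(1) unfolding flags_Cons by auto
  have "flag U (Suc i) zs" by (rule Cons.IH[OF r(4)]) (use Cons.prems(2) in \<open>cases "is"; auto\<close>)+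
  then show ?case using r Cons.prems by auto
qed

lemma flags_append: "ys @ xs \<in> flags X U (is @ js) \<Longrightarrow> length ys = length is \<Longrightarrow> ys \<in> flags X U is \<and> xs \<in> flags X U js"
proof (induction "is" arbitrary: ys)
  case Nil then show ?case by (simp add: flags_Nil)
next
  case (Cons i "is")
  obtain a zs where s: "ys = a # zs" using Cons.prems(2) by (cases ys) auto
  have "a \<in> U" "a \<in> P i" "zs @ xs \<in> flags X U (is @ js)" "zs @ xs \<noteq> [] \<longrightarrow> hd (zs @ xs) \<in> cl a"
    using Cons.prems(1) unfolding s by (auto simp: flags_Cons)
  then show ?case using Cons.IH[of zs] Cons.prems(2) unfolding s flags_Cons by auto
qed

lemma flags_seg: "ys \<in> flags X U [0..<Suc m] \<Longrightarrow> seg 0 m ys"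
  by (auto simp: flags_def seg_def simp del: upt_Suc)

lemma seg_flags:
  assumes s: "seg 0 m ys" and fl: "flag U 0 (ys @ xs)" and xs: "xs \<in> flags X U js"
  shows "ys @ xs \<in> flags X U ([0..<Suc m] @ js)"
proof -
  have "ys @ xs \<in> flags X U ([k..<Suc m] @ js)" if "seg k m ys" "flag U k (ys @ xs)" "k \<le> Suc m" for k ys
    using that
  proof (induction ys arbitrary: k)
    case Nil
    then have "k = Suc m" by (simp add: seg_def)
    then show ?case using xs by simp
  next
    case (Cons a ys)
    then have km: "k \<le> m" by (auto simp: seg_def)
    have a: "a \<in> P k" "seg (Suc k) m ys" using Cons.prems(1) seg_Cons[OF km] by auto
    have "flag U (Suc k) (ys @ xs)" using flag_ConsD[of U k a "ys @ xs"] Cons.prems(2) a by simp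
    then have "ys @ xs \<in> flags X U ([Suc k..<Suc m] @ js)" using Cons.IH[of "Suc k"] a km by simp
    moreover have "[k..<Suc m] = k # [Suc k..<Suc m]" using km by (simp add: upt_conv_Cons del: upt_Suc)
    ultimately show ?case using Cons.prems(2) a by (auto simp: flags_Cons simp del: upt_Suc)
  qed
  from this[OF s fl] show ?thesis by simp
qed

lemma nu_comp_eq: "nu_comp X I p ys h = ncomp (nu X I) p ys h"
  by (induction "nu X I" p ys h rule: ncomp.induct) auto

end

section \<open>The adelic complex\<close>

locale adelic = cm_sheaf X I F \<epsilon> for X :: "'x topology" and I :: "('x, 'c) sheaf_complex"
    and F :: "('x, 'b) ab_presheaf" and \<epsilon> :: "'x set \<Rightarrow> 'b \<Rightarrow> 'c" +
  fixes d :: nat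
  assumes codim_le: "x \<in> P p \<Longrightarrow> p \<le> d"
begin

abbreviation AF :: "'x set \<Rightarrow> nat \<Rightarrow> 'x list set" where "AF U p \<equiv> all_flags X U d p"
abbreviation As :: "nat \<Rightarrow> 'x set \<Rightarrow> ('x list \<Rightarrow> ('x set \<times> 'b) set) monoid" where
  "As p U \<equiv> adele_sections X F I \<epsilon> d p U"

lemma flags_of_flag:
  "flag U k xs \<Longrightarrow> \<exists>is. xs \<in> flags X U is \<and> sorted_wrt (<) is \<and> set is \<subseteq> {k..d} \<and> length is = length xs"
proof (induction xs arbitrary: k)
  case Nil then show ?case by (intro exI[of _ "[]"]) (simp add: flags_Nil)
next
  case (Cons a xs)
  obtain c where c: "c \<ge> k" "a \<in> P c" "flag U (Suc c) xs" using Cons.prems by auto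
  then obtain "is" where i: "xs \<in> flags X U is" "sorted_wrt (<) is" "set is \<subseteq> {Suc c..d}" "length is = length xs"
    using Cons.IH by blast
  show ?case
  proof (intro exI conjI)
    show "a # xs \<in> flags X U (c # is)" unfolding flags_Cons using Cons.prems c i by auto
    show "sorted_wrt (<) (c # is)" using i by auto
    show "set (c # is) \<subseteq> {k..d}" using i(3) c codim_le[OF c(2)] by fastforce
    show "length (c # is) = length (a # xs)" using i by simp
  qed
qed

lemma AF_iff: "xs \<in> AF U p \<longleftrightarrow> flag U 0 xs \<and> length xs = Suc p"
proof
  assume "xs \<in> AF U p"
  then obtain "is" where "is \<in> flag_types d p" "xs \<in> flags X U is" by (auto simp: all_flags_def)
  then show "flag U 0 xs \<and> length xs = Suc p"
    using flag_of_flags[of xs U "is" 0] by (auto simp: flag_types_def flags_def)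
next
  assume a: "flag U 0 xs \<and> length xs = Suc p"
  then obtain "is" where i: "xs \<in> flags X U is" "sorted_wrt (<) is" "set is \<subseteq> {0..d}" "length is = length xs"
    using flags_of_flag[of U 0 xs] by auto
  then have "is \<in> flag_types d p" using a by (auto simp: flag_types_def)
  then show "xs \<in> AF U p" using i by (auto simp: all_flags_def)
qed

lemma AF_mono: "V \<subseteq> U \<Longrightarrow> AF V p \<subseteq> AF U p" using flag_subset by (auto simp: AF_iff)

lemma flag_hd: "flag U k xs \<Longrightarrow> xs \<noteq> [] \<Longrightarrow> hd xs \<in> U \<and> hd xs \<in> T"
  using P_topspace by (cases xs) auto

text \<open>The residue along the first part \<open>ys\<close> of a flag.\<close>

definition residue :: "'x list \<Rightarrow> ('x set \<times> 'b) set \<Rightarrow> ('x set \<times> 'c) set set" where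
  "residue ys a = ncomp (nu X I) 0 ys (iota (hd ys) a)"

definition bad :: "'x set \<Rightarrow> nat \<Rightarrow> ('x list \<Rightarrow> ('x set \<times> 'b) set) \<Rightarrow> nat \<Rightarrow> 'x list \<Rightarrow> 'x list set" where
  "bad U p f m xs = {ys. seg 0 m ys \<and> flag U 0 (ys @ xs) \<and> length (ys @ xs) = Suc p \<and>
     residue ys (f (ys @ xs)) \<noteq> oneH m (last ys)}"

text \<open>As a flag determines its type, the finiteness conditions for all types can be stated together.\<close>

lemma As_carrier: "f \<in> carrier (As p U) \<longleftrightarrow> f \<in> extensional (AF U p) \<and>
    (\<forall>xs\<in>AF U p. f xs \<in> carrier (Fx (hd xs))) \<and> (\<forall>m xs. flag U (Suc m) xs \<longrightarrow> finite (bad U p f m xs))"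
proof
  assume f: "f \<in> carrier (As p U)"
  then have ext: "f \<in> extensional (AF U p)"
    and A: "\<And>is. is \<in> flag_types d p \<Longrightarrow> restrict f (flags X U is) \<in> adele_A X F I \<epsilon> U is"
    by (auto simp: adele_sections_def)
  have "f xs \<in> carrier (Fx (hd xs))" if xs: "xs \<in> AF U p" for xs
  proof -
    obtain "is" where i: "is \<in> flag_types d p" "xs \<in> flags X U is" using xs by (auto simp: all_flags_def)
    then have "restrict f (flags X U is) \<in> adele_C X F U is" using A by (simp add: adele_A_def)
    then show ?thesis using i(2) by (auto simp: adele_C_def PiE_iff)
  qed
  moreover have "finite (bad U p f m xs)" if xs: "flag U (Suc m) xs" for m xs
  proof (cases "m \<le> d \<and> Suc m + length xs = Suc p")
    case False
    have "bad U p f m xs = {}"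
    proof (rule ccontr)
      assume "bad U p f m xs \<noteq> {}"
      then obtain ys where s: "seg 0 m ys" "length (ys @ xs) = Suc p" by (auto simp: bad_def)
      then have "m \<le> d" using codim_le[OF seg_last[OF le0 s(1)]] by simp
      moreover have "length ys = Suc m" using s(1) by (simp add: seg_def)
      ultimately show False using s(2) False by simp
    qed
    then show ?thesis by simp
  next
    case True
    obtain js where j: "xs \<in> flags X U js" "sorted_wrt (<) js" "set js \<subseteq> {Suc m..d}" "length js = length xs"
      using flags_of_flag[OF xs] by (elim exE conjE)
    let ?is = "[0..<Suc m] @ js"
    have "sorted_wrt (<) ?is" using j by (auto simp: sorted_wrt_append simp del: upt_Suc)
    then have ft: "?is \<in> flag_types d p" using True j by (auto simp: flag_types_def simp del: upt_Suc)
    have "int m \<le> depth ?is" by (subst le_depth_iff) (auto simp del: upt_Suc)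
    moreover have "drop (Suc m) ?is = js" by (simp del: upt_Suc)
    ultimately have "finite {ys\<in>flags X U [0..<Suc m]. ys @ xs \<in> flags X U ?is \<and>
         nu_comp X I 0 ys (iota (hd ys) (restrict f (flags X U ?is) (ys @ xs))) \<noteq> oneH m (last ys)}" (is "finite ?B")
      using A[OF ft] j(1) unfolding adele_A_def by auto
    moreover have "bad U p f m xs \<subseteq> ?B"
    proof
      fix ys assume ys: "ys \<in> bad U p f m xs"
      then have s: "seg 0 m ys" "flag U 0 (ys @ xs)" by (auto simp: bad_def)
      have fl: "ys @ xs \<in> flags X U ?is" by (rule seg_flags[OF s j(1)])
      have "length ys = length [0..<Suc m]" using s(1) by (simp add: seg_def)
      then have "ys \<in> flags X U [0..<Suc m]" using flags_append[OF fl] by simp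
      then show "ys \<in> ?B" using fl ys by (simp add: bad_def residue_def nu_comp_eq del: upt_Suc)
    qed
    ultimately show ?thesis by (rule finite_subset[rotated])
  qed
  ultimately show "f \<in> extensional (AF U p) \<and>
    (\<forall>xs\<in>AF U p. f xs \<in> carrier (Fx (hd xs))) \<and> (\<forall>m xs. flag U (Suc m) xs \<longrightarrow> finite (bad U p f m xs))"
    using ext by blast
next
  assume f: "f \<in> extensional (AF U p) \<and>
    (\<forall>xs\<in>AF U p. f xs \<in> carrier (Fx (hd xs))) \<and> (\<forall>m xs. flag U (Suc m) xs \<longrightarrow> finite (bad U p f m xs))"
  have "restrict f (flags X U is) \<in> adele_A X F I \<epsilon> U is" if ft: "is \<in> flag_types d p" for "is"
  proof -
    have sub: "flags X U is \<subseteq> AF U p" using ft by (auto simp: all_flags_def)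
    have ne: "is \<noteq> []" and srt: "sorted_wrt (<) is" using ft by (auto simp: flag_types_def)
    have "restrict f (flags X U is) \<in> adele_C X F U is" using f sub by (auto simp: adele_C_def)
    moreover have "finite {ys\<in>flags X U [0..<Suc m]. ys @ xs \<in> flags X U is \<and>
         nu_comp X I 0 ys (iota (hd ys) (restrict f (flags X U is) (ys @ xs))) \<noteq> oneH m (last ys)}" (is "finite ?B")
      if m: "int m \<le> depth is" and xs: "xs \<in> flags X U (drop (Suc m) is)" for m xs
    proof -
      have mt: "m < length is" "take (Suc m) is = [0..<Suc m]" using m le_depth_iff[OF ne] by auto
      have "is = take (Suc m) is @ drop (Suc m) is" by simp
      then have e: "is = [0..<Suc m] @ drop (Suc m) is" using mt(2) by simp
      have "flag U (Suc m) xs"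
      proof (rule flag_of_flags[OF xs])
        show "sorted_wrt (<) (drop (Suc m) is)" using srt by (rule sorted_wrt_drop)
        show "Suc m \<le> hd (drop (Suc m) is)" if "drop (Suc m) is \<noteq> []"
        proof -
          have "sorted_wrt (<) ([0..<Suc m] @ drop (Suc m) is)" using srt e by simp
          then have "m < hd (drop (Suc m) is)" using that by (simp add: sorted_wrt_append)
          then show ?thesis by simp
        qed
      qed
      then have "finite (bad U p f m xs)" using f by blast
      moreover have "?B \<subseteq> bad U p f m xs"
      proof
        fix ys assume ys: "ys \<in> ?B"
        then have "ys @ xs \<in> AF U p" "seg 0 m ys" using sub flags_seg by blast+
        moreover have "ys @ xs \<in> flags X U is" using ys by blast
        ultimately show "ys \<in> bad U p f m xs" using ys unfolding AF_iff by (simp add: bad_def residue_def nu_comp_eq del: upt_Suc)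
      qed
      ultimately show ?thesis by (rule finite_subset[rotated])
    qed
    ultimately show ?thesis by (simp add: adele_A_def)
  qed
  then show "f \<in> carrier (As p U)" using f by (simp add: adele_sections_def)
qed

lemma As_D:
  assumes "f \<in> carrier (As p U)"
  shows "f \<in> extensional (AF U p)" "xs \<in> AF U p \<Longrightarrow> f xs \<in> carrier (Fx (hd xs))"
    "flag U (Suc m) xs \<Longrightarrow> finite (bad U p f m xs)"
  using assms unfolding As_carrier by blast+

lemma residue_hom:
  assumes "seg 0 m ys" "flag U 0 (ys @ xs)"
  shows "residue ys \<in> hom (Fx (hd ys)) (H m (last ys))" "hd ys \<in> P 0" "last ys \<in> P m"
proof -
  obtain a zs where s: "ys = a # zs" using seg_nonempty[OF le0 assms(1)] by (cases ys) auto
  show h: "hd ys \<in> P 0" using assms(1) s seg_Cons[of 0 m a zs] by simp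
  have "residue ys = ncomp (nu X I) 0 ys \<circ> iota (hd ys)" by (auto simp: residue_def)
  then show "residue ys \<in> hom (Fx (hd ys)) (H m (last ys))"
    using hom_compose[OF iota_iso(1)[OF h] ncomp_hom[OF le0 assms]] by simp
  show "last ys \<in> P m" by (rule seg_last[OF le0 assms(1)])
qed

lemma Fx_comm: "xs \<in> AF U p \<Longrightarrow> comm_group (Fx (hd xs))"
  using flag_hd[of U 0 xs] Fp.stalk_comm_group[of "hd xs"] by (cases xs) (auto simp: AF_iff)

lemma residue_one:
  assumes "seg 0 m ys" "flag U 0 (ys @ xs)"
  shows "residue ys \<one>\<^bsub>Fx (hd ys)\<^esub> = oneH m (last ys)"
  by (rule hom_one_comm[OF Fp.stalk_comm_group[OF P_topspace] H_comm]) (rule residue_hom[OF assms])+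

lemma hd_app: "seg 0 m ys \<Longrightarrow> hd (ys @ xs) = hd ys"
  using seg_nonempty[OF le0] by simp

lemma As_mult: "f \<otimes>\<^bsub>As p U\<^esub> g = (\<lambda>xs\<in>AF U p. f xs \<otimes>\<^bsub>Fx (hd xs)\<^esub> g xs)"
  and As_one: "\<one>\<^bsub>As p U\<^esub> = (\<lambda>xs\<in>AF U p. \<one>\<^bsub>Fx (hd xs)\<^esub>)"
  by (simp_all add: adele_sections_def)

lemma bad_flags: "ys \<in> bad U p f m xs \<Longrightarrow> ys @ xs \<in> AF U p" by (auto simp: bad_def AF_iff)

lemma As_one_carrier: "\<one>\<^bsub>As p U\<^esub> \<in> carrier (As p U)"
  unfolding As_carrier As_one
proof (intro conjI ballI allI impI)
  fix xs assume xs: "xs \<in> AF U p"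
  interpret comm_group "Fx (hd xs)" by (rule Fx_comm[OF xs])
  show "(\<lambda>xs\<in>AF U p. \<one>\<^bsub>Fx (hd xs)\<^esub>) xs \<in> carrier (Fx (hd xs))" using xs by simp
next
  fix m xs
  have "bad U p (\<lambda>xs\<in>AF U p. \<one>\<^bsub>Fx (hd xs)\<^esub>) m xs = {}"
    using residue_one by (auto simp: bad_def AF_iff hd_app)
  then show "finite (bad U p (\<lambda>xs\<in>AF U p. \<one>\<^bsub>Fx (hd xs)\<^esub>) m xs)" by simp
qed simp

lemma As_mult_carrier:
  assumes f: "f \<in> carrier (As p U)" and g: "g \<in> carrier (As p U)"
  shows "f \<otimes>\<^bsub>As p U\<^esub> g \<in> carrier (As p U)"
  unfolding As_carrier As_mult
proof (intro conjI ballI allI impI)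
  let ?h = "\<lambda>xs\<in>AF U p. f xs \<otimes>\<^bsub>Fx (hd xs)\<^esub> g xs"
  fix xs assume xs: "xs \<in> AF U p"
  interpret comm_group "Fx (hd xs)" by (rule Fx_comm[OF xs])
  show "?h xs \<in> carrier (Fx (hd xs))" using xs As_D(2)[OF f xs] As_D(2)[OF g xs] by simp
next
  let ?h = "\<lambda>xs\<in>AF U p. f xs \<otimes>\<^bsub>Fx (hd xs)\<^esub> g xs"
  fix m xs assume xs: "flag U (Suc m) xs"
  have "bad U p ?h m xs \<subseteq> bad U p f m xs \<union> bad U p g m xs"
  proof
    fix ys assume ys: "ys \<in> bad U p ?h m xs"
    then have s: "seg 0 m ys" "flag U 0 (ys @ xs)" by (auto simp: bad_def)
    have A: "ys @ xs \<in> AF U p" by (rule bad_flags[OF ys])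
    note r = residue_hom[OF s]
    interpret comm_group "H m (last ys)" by (rule H_comm[OF r(3)])
    have "residue ys (?h (ys @ xs)) = residue ys (f (ys @ xs)) \<otimes>\<^bsub>H m (last ys)\<^esub> residue ys (g (ys @ xs))"
      using A As_D(2)[OF f A] As_D(2)[OF g A] hom_mult[OF r(1)] by (simp add: hd_app[OF s(1)])
    then show "ys \<in> bad U p f m xs \<union> bad U p g m xs" using ys by (auto simp: bad_def)
  qed
  then show "finite (bad U p ?h m xs)" using As_D(3)[OF f xs] As_D(3)[OF g xs] finite_subset by blast
qed simp

lemma As_inv_carrier:
  assumes f: "f \<in> carrier (As p U)"
  shows "(\<lambda>xs\<in>AF U p. inv\<^bsub>Fx (hd xs)\<^esub> f xs) \<in> carrier (As p U)"
  unfolding As_carrier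
proof (intro conjI ballI allI impI)
  let ?h = "\<lambda>xs\<in>AF U p. inv\<^bsub>Fx (hd xs)\<^esub> f xs"
  fix xs assume xs: "xs \<in> AF U p"
  interpret comm_group "Fx (hd xs)" by (rule Fx_comm[OF xs])
  show "?h xs \<in> carrier (Fx (hd xs))" using xs As_D(2)[OF f xs] by simp
next
  let ?h = "\<lambda>xs\<in>AF U p. inv\<^bsub>Fx (hd xs)\<^esub> f xs"
  fix m xs assume xs: "flag U (Suc m) xs"
  have "bad U p ?h m xs \<subseteq> bad U p f m xs"
  proof
    fix ys assume ys: "ys \<in> bad U p ?h m xs"
    then have s: "seg 0 m ys" "flag U 0 (ys @ xs)" by (auto simp: bad_def)
    have A: "ys @ xs \<in> AF U p" by (rule bad_flags[OF ys])
    note r = residue_hom[OF s]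
    interpret comm_group "H m (last ys)" by (rule H_comm[OF r(3)])
    have "residue ys (?h (ys @ xs)) = inv\<^bsub>H m (last ys)\<^esub> residue ys (f (ys @ xs))"
      using A As_D(2)[OF f A] hom_inv_comm[OF Fp.stalk_comm_group[OF P_topspace[OF r(2)]] H_comm[OF r(3)] r(1)]
      by (simp add: hd_app[OF s(1)])
    then show "ys \<in> bad U p f m xs" using ys by (auto simp: bad_def)
  qed
  then show "finite (bad U p ?h m xs)" using As_D(3)[OF f xs] finite_subset by blast
qed simp

lemma As_comm_group: "comm_group (As p U)"
proof (rule comm_groupI)
  have ext: "(\<lambda>xs\<in>AF U p. h xs) = f" if "f \<in> carrier (As p U)" "\<And>xs. xs \<in> AF U p \<Longrightarrow> h xs = f xs" for h f
    using As_D(1)[OF that(1)] that(2) by (auto simp: fun_eq_iff extensional_def)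
  show "\<one>\<^bsub>As p U\<^esub> \<in> carrier (As p U)" by (rule As_one_carrier)
  fix f assume f: "f \<in> carrier (As p U)"
  show "\<one>\<^bsub>As p U\<^esub> \<otimes>\<^bsub>As p U\<^esub> f = f" unfolding As_mult As_one
  proof (rule ext[OF f])
    fix xs assume xs: "xs \<in> AF U p"
    interpret comm_group "Fx (hd xs)" by (rule Fx_comm[OF xs])
    show "(\<lambda>xs\<in>AF U p. \<one>\<^bsub>Fx (hd xs)\<^esub>) xs \<otimes>\<^bsub>Fx (hd xs)\<^esub> f xs = f xs" using xs As_D(2)[OF f xs] by simp
  qed
  show "\<exists>g\<in>carrier (As p U). g \<otimes>\<^bsub>As p U\<^esub> f = \<one>\<^bsub>As p U\<^esub>"
  proof (rule bexI[OF _ As_inv_carrier[OF f]])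
    have "(\<lambda>xs\<in>AF U p. inv\<^bsub>Fx (hd xs)\<^esub> f xs) xs \<otimes>\<^bsub>Fx (hd xs)\<^esub> f xs = \<one>\<^bsub>Fx (hd xs)\<^esub>" if xs: "xs \<in> AF U p" for xs
    proof -
      interpret comm_group "Fx (hd xs)" by (rule Fx_comm[OF xs])
      show ?thesis using xs As_D(2)[OF f xs] by simp
    qed
    then show "(\<lambda>xs\<in>AF U p. inv\<^bsub>Fx (hd xs)\<^esub> f xs) \<otimes>\<^bsub>As p U\<^esub> f = \<one>\<^bsub>As p U\<^esub>"
      unfolding As_mult As_one by (rule restrict_ext)
  qed
  fix g assume g: "g \<in> carrier (As p U)"
  show "f \<otimes>\<^bsub>As p U\<^esub> g \<in> carrier (As p U)" by (rule As_mult_carrier[OF f g])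
  show "f \<otimes>\<^bsub>As p U\<^esub> g = g \<otimes>\<^bsub>As p U\<^esub> f" unfolding As_mult
  proof (rule restrict_ext)
    fix xs assume xs: "xs \<in> AF U p"
    interpret comm_group "Fx (hd xs)" by (rule Fx_comm[OF xs])
    show "f xs \<otimes>\<^bsub>Fx (hd xs)\<^esub> g xs = g xs \<otimes>\<^bsub>Fx (hd xs)\<^esub> f xs" using As_D(2)[OF f xs] As_D(2)[OF g xs] by (rule m_comm)
  qed
  fix h assume h: "h \<in> carrier (As p U)"
  show "f \<otimes>\<^bsub>As p U\<^esub> g \<otimes>\<^bsub>As p U\<^esub> h = f \<otimes>\<^bsub>As p U\<^esub> (g \<otimes>\<^bsub>As p U\<^esub> h)" unfolding As_mult
  proof (rule restrict_ext)
    fix xs assume xs: "xs \<in> AF U p"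
    interpret comm_group "Fx (hd xs)" by (rule Fx_comm[OF xs])
    show "(\<lambda>xs\<in>AF U p. f xs \<otimes>\<^bsub>Fx (hd xs)\<^esub> g xs) xs \<otimes>\<^bsub>Fx (hd xs)\<^esub> h xs = f xs \<otimes>\<^bsub>Fx (hd xs)\<^esub> (\<lambda>xs\<in>AF U p. g xs \<otimes>\<^bsub>Fx (hd xs)\<^esub> h xs) xs"
      using xs As_D(2)[OF f xs] As_D(2)[OF g xs] As_D(2)[OF h xs] by (simp add: m_assoc)
  qed
qed

lemma As_inv: "f \<in> carrier (As p U) \<Longrightarrow> inv\<^bsub>As p U\<^esub> f = (\<lambda>xs\<in>AF U p. inv\<^bsub>Fx (hd xs)\<^esub> f xs)"
proof -
  assume f: "f \<in> carrier (As p U)"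
  interpret comm_group "As p U" by (rule As_comm_group)
  have "(\<lambda>xs\<in>AF U p. inv\<^bsub>Fx (hd xs)\<^esub> f xs) xs \<otimes>\<^bsub>Fx (hd xs)\<^esub> f xs = \<one>\<^bsub>Fx (hd xs)\<^esub>" if xs: "xs \<in> AF U p" for xs
  proof -
    interpret S: comm_group "Fx (hd xs)" by (rule Fx_comm[OF xs])
    show ?thesis using xs As_D(2)[OF f xs] by simp
  qed
  then have "(\<lambda>xs\<in>AF U p. inv\<^bsub>Fx (hd xs)\<^esub> f xs) \<otimes>\<^bsub>As p U\<^esub> f = \<one>\<^bsub>As p U\<^esub>"
    unfolding As_mult As_one by (rule restrict_ext)
  then show ?thesis by (rule inv_equality[OF _ f As_inv_carrier[OF f]])
qed

abbreviation A :: "('x, 'x list \<Rightarrow> ('x set \<times> 'b) set) sheaf_complex" where "A \<equiv> adelic_complex X F I \<epsilon> d"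

lemma A_simps: "sections (obj A p) U = As p U" "restr (obj A p) U V f = restrict f (AF V p)"
  "diff A = adele_diff X F d"
  by (simp_all add: adelic_complex_def)

lemma A_restr_carrier:
  assumes V: "V \<subseteq> U" and f: "f \<in> carrier (As p U)"
  shows "restrict f (AF V p) \<in> carrier (As p V)"
  unfolding As_carrier
proof (intro conjI ballI allI impI)
  show "restrict f (AF V p) xs \<in> carrier (Fx (hd xs))" if "xs \<in> AF V p" for xs
    using As_D(2)[OF f] that AF_mono[OF V] by auto
  fix m xs assume xs: "flag V (Suc m) xs"
  have "bad V p (restrict f (AF V p)) m xs \<subseteq> bad U p f m xs"
    using flag_subset[OF _ V] by (auto simp: bad_def AF_iff)
  then show "finite (bad V p (restrict f (AF V p)) m xs)"
    using As_D(3)[OF f flag_subset[OF xs V]] finite_subset by blast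
qed simp

lemma A_presheaf: "strict_presheaf X (obj A p)"
proof (rule strict_presheaf.intro[OF group_presheaf.intro strict_presheaf_axioms.intro])
  fix U assume U: "openin X U"
  show "comm_group (sections (obj A p) U)" unfolding A_simps by (rule As_comm_group)
  show "restr (obj A p) U U s = s" if "s \<in> carrier (sections (obj A p) U)" for s
    using As_D(1)[of s p U] that unfolding A_simps by (simp add: extensional_restrict)
  fix V assume V: "openin X V" "V \<subseteq> U"
  show "restr (obj A p) U V \<in> hom (sections (obj A p) U) (sections (obj A p) V)"
    unfolding A_simps(1)
  proof (rule homI)
    fix f assume f: "f \<in> carrier (As p U)"
    show "restr (obj A p) U V f \<in> carrier (As p V)" unfolding A_simps by (rule A_restr_carrier[OF V(2) f])
    fix g assume g: "g \<in> carrier (As p U)"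
    show "restr (obj A p) U V (f \<otimes>\<^bsub>As p U\<^esub> g) = restr (obj A p) U V f \<otimes>\<^bsub>As p V\<^esub> restr (obj A p) U V g"
      unfolding A_simps As_mult using AF_mono[OF V(2), of p] by (auto simp: fun_eq_iff restrict_def)
  qed
next
  have st: "restr (obj A p) V W (restr (obj A p) U V s) = restr (obj A p) U W s" if "V \<subseteq> U" "W \<subseteq> V" for U V W s
    using AF_mono[OF that(2), of p] unfolding A_simps by (auto simp: fun_eq_iff restrict_def)
  show "restr (obj A p) V W (restr (obj A p) U V s) = restr (obj A p) U W s" if "V \<subseteq> U" "W \<subseteq> V" for U V W s
    by (rule st[OF that])
  show "restr (obj A p) V W (restr (obj A p) U V s) = restr (obj A p) U W s" if "V \<subseteq> U" "W \<subseteq> V" for U V W s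
    by (rule st[OF that])
qed

lemma A_group_presheaf: "group_presheaf X (obj A p)"
  by (rule strict_presheaf.axioms(1)[OF A_presheaf])

section \<open>The adelic differential\<close>

abbreviation dA :: "nat \<Rightarrow> 'x set \<Rightarrow> ('x list \<Rightarrow> ('x set \<times> 'b) set) \<Rightarrow> 'x list \<Rightarrow> ('x set \<times> 'b) set" where
  "dA p U f \<equiv> adele_diff X F d p U f"

lemma face_AF:
  assumes "xs \<in> AF U (Suc p)" "ys \<in> set (faces xs)"
  shows "ys \<in> AF U p" "hd ys \<in> cl (hd xs)"
proof -
  have fl: "flag U 0 xs" "length xs = Suc (Suc p)" using assms(1) by (auto simp: AF_iff)
  have "flag U 0 ys" by (rule face_flag(1)[OF fl(1) assms(2)])
  then show "ys \<in> AF U p" using faces_length[OF assms(2)] fl(2) by (simp add: AF_iff)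
  obtain a zs where t: "xs = a # zs" using fl(2) by (cases xs) auto
  then have "a \<in> cl a" "zs \<noteq> [] \<longrightarrow> hd zs \<in> cl a" using fl(1) P_self by auto
  moreover have "zs \<noteq> []" using fl(2) t by auto
  ultimately show "hd ys \<in> cl (hd xs)" using assms(2) t by auto
qed

lemma cosp_face:
  assumes f: "\<And>xs. xs \<in> AF U p \<Longrightarrow> f xs \<in> carrier (Fx (hd xs))" and xs: "xs \<in> AF U (Suc p)" and ys: "ys \<in> set (faces xs)"
  shows "cosp (hd xs) (f ys) \<in> carrier (Fx (hd xs))"
  by (rule cosp_carrier[OF face_AF(2)[OF xs ys] f[OF face_AF(1)[OF xs ys]]])

lemma dA_alt:
  assumes f: "\<And>xs. xs \<in> AF U p \<Longrightarrow> f xs \<in> carrier (Fx (hd xs))" and xs: "xs \<in> AF U (Suc p)"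
  shows "dA p U f xs = alt (Fx (hd xs)) (\<lambda>ys. cosp (hd xs) (f ys)) xs"
proof -
  obtain a zs where t: "xs = a # zs" "length zs = Suc p" using xs by (cases xs) (auto simp: AF_iff)
  have "dA p U f xs = finprod (Fx (hd xs)) (\<lambda>i. if even i then cosp (hd xs) (f (omit i (a # zs)))
       else inv\<^bsub>Fx (hd xs)\<^esub> cosp (hd xs) (f (omit i (a # zs)))) {..length zs}"
    using xs unfolding t(1) by (simp add: adele_diff_def Let_def t(2))
  also have "\<dots> = alt (Fx (hd xs)) (\<lambda>ys. cosp (hd xs) (f ys)) (a # zs)"
    by (rule finprod_alt[OF Fx_comm[OF xs]]) (use cosp_face[OF f xs] t in auto)
  finally show ?thesis using t by simp
qed

text \<open>Only the first face requires a cospecialization map.\<close>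

lemma dA_Cons:
  assumes f: "\<And>xs. xs \<in> AF U p \<Longrightarrow> f xs \<in> carrier (Fx (hd xs))" and xs: "a # xs \<in> AF U (Suc p)"
  shows "dA p U f (a # xs) = cosp a (f xs) \<otimes>\<^bsub>Fx a\<^esub> inv\<^bsub>Fx a\<^esub> alt (Fx a) (\<lambda>ys. f (a # ys)) xs"
proof -
  have aT: "a \<in> T" using flag_hd[of U 0 "a # xs"] xs by (simp add: AF_iff)
  have "cosp a (f (a # ys)) = f (a # ys)" if "ys \<in> set (faces xs)" for ys
    using cosp_self[OF aT] f[OF face_AF(1)[OF xs], of "a # ys"] that by auto
  then show ?thesis using dA_alt[OF f xs] alt_cong[of xs "\<lambda>ys. cosp a (f (a # ys))" "\<lambda>ys. f (a # ys)" "Fx a"] by simp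
qed

lemma dA_ext: "dA p U f \<in> extensional (AF U (Suc p))" by (simp add: adele_diff_def)

lemma dA_closed:
  assumes f: "\<And>xs. xs \<in> AF U p \<Longrightarrow> f xs \<in> carrier (Fx (hd xs))" and xs: "xs \<in> AF U (Suc p)"
  shows "dA p U f xs \<in> carrier (Fx (hd xs))"
proof -
  have e: "dA p U f xs = alt (Fx (hd xs)) (\<lambda>ys. cosp (hd xs) (f ys)) xs" by (rule dA_alt[OF f xs])
  show ?thesis unfolding e by (rule alt_closed[OF Fx_comm[OF xs] cosp_face[OF f xs]])
qed

lemma dA_restr:
  assumes V: "V \<subseteq> U" and f: "\<And>xs. xs \<in> AF U p \<Longrightarrow> f xs \<in> carrier (Fx (hd xs))"
  shows "restrict (dA p U f) (AF V (Suc p)) = dA p V (restrict f (AF V p))"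
proof (rule extensionalityI[of _ "AF V (Suc p)"])
  fix xs assume xs: "xs \<in> AF V (Suc p)"
  then have xsU: "xs \<in> AF U (Suc p)" using AF_mono[OF V] by blast
  have fV: "restrict f (AF V p) ys \<in> carrier (Fx (hd ys))" if "ys \<in> AF V p" for ys
    using f that AF_mono[OF V] by auto
  have "restrict (dA p U f) (AF V (Suc p)) xs = alt (Fx (hd xs)) (\<lambda>ys. cosp (hd xs) (f ys)) xs"
    using xs dA_alt[OF f xsU] by simp
  also have "\<dots> = alt (Fx (hd xs)) (\<lambda>ys. cosp (hd xs) (restrict f (AF V p) ys)) xs"
    by (rule alt_cong) (use face_AF(1)[OF xs] in simp)
  also have "\<dots> = dA p V (restrict f (AF V p)) xs" by (rule dA_alt[OF fV xs, symmetric])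
  finally show "restrict (dA p U f) (AF V (Suc p)) xs = dA p V (restrict f (AF V p)) xs" .
qed (simp_all add: dA_ext)

lemma dA_mult:
  assumes f: "f \<in> carrier (As p U)" and g: "g \<in> carrier (As p U)"
  shows "dA p U (f \<otimes>\<^bsub>As p U\<^esub> g) = (\<lambda>xs\<in>AF U (Suc p). dA p U f xs \<otimes>\<^bsub>Fx (hd xs)\<^esub> dA p U g xs)"
proof (rule extensionalityI[of _ "AF U (Suc p)"])
  fix xs assume xs: "xs \<in> AF U (Suc p)"
  have fg: "f \<otimes>\<^bsub>As p U\<^esub> g \<in> carrier (As p U)" by (rule As_mult_carrier[OF f g])
  have "dA p U (f \<otimes>\<^bsub>As p U\<^esub> g) xs = alt (Fx (hd xs)) (\<lambda>ys. cosp (hd xs) ((f \<otimes>\<^bsub>As p U\<^esub> g) ys)) xs"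
    by (rule dA_alt[OF As_D(2)[OF fg] xs])
  also have "\<dots> = alt (Fx (hd xs)) (\<lambda>ys. cosp (hd xs) (f ys) \<otimes>\<^bsub>Fx (hd xs)\<^esub> cosp (hd xs) (g ys)) xs"
  proof (rule alt_cong)
    fix ys assume ys: "ys \<in> set (faces xs)"
    note s = face_AF[OF xs ys]
    show "cosp (hd xs) ((f \<otimes>\<^bsub>As p U\<^esub> g) ys) = cosp (hd xs) (f ys) \<otimes>\<^bsub>Fx (hd xs)\<^esub> cosp (hd xs) (g ys)"
      using s(1) hom_mult[OF cosp_hom[OF s(2)] As_D(2)[OF f s(1)] As_D(2)[OF g s(1)]] by (simp add: As_mult)
  qed
  also have "\<dots> = alt (Fx (hd xs)) (\<lambda>ys. cosp (hd xs) (f ys)) xs \<otimes>\<^bsub>Fx (hd xs)\<^esub> alt (Fx (hd xs)) (\<lambda>ys. cosp (hd xs) (g ys)) xs"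
    by (rule alt_mult[OF Fx_comm[OF xs] cosp_face[OF As_D(2)[OF f] xs] cosp_face[OF As_D(2)[OF g] xs]])
  also have "alt (Fx (hd xs)) (\<lambda>ys. cosp (hd xs) (f ys)) xs = dA p U f xs" by (rule dA_alt[OF As_D(2)[OF f] xs, symmetric])
  also have "alt (Fx (hd xs)) (\<lambda>ys. cosp (hd xs) (g ys)) xs = dA p U g xs" by (rule dA_alt[OF As_D(2)[OF g] xs, symmetric])
  finally show "dA p U (f \<otimes>\<^bsub>As p U\<^esub> g) xs = (\<lambda>xs\<in>AF U (Suc p). dA p U f xs \<otimes>\<^bsub>Fx (hd xs)\<^esub> dA p U g xs) xs"
    using xs by simp
qed (simp_all add: dA_ext)

lemma dA_one: "dA p U \<one>\<^bsub>As p U\<^esub> = \<one>\<^bsub>As (Suc p) U\<^esub>"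
proof (rule extensionalityI[of _ "AF U (Suc p)"])
  fix xs assume xs: "xs \<in> AF U (Suc p)"
  interpret comm_group "Fx (hd xs)" by (rule Fx_comm[OF xs])
  have o: "\<one>\<^bsub>As p U\<^esub> \<in> carrier (As p U)" by (rule As_one_carrier)
  have "dA p U \<one>\<^bsub>As p U\<^esub> xs \<in> carrier (Fx (hd xs))" by (rule dA_closed[OF As_D(2)[OF o] xs])
  moreover have "dA p U \<one>\<^bsub>As p U\<^esub> xs \<otimes>\<^bsub>Fx (hd xs)\<^esub> dA p U \<one>\<^bsub>As p U\<^esub> xs = dA p U \<one>\<^bsub>As p U\<^esub> xs"
  proof -
    interpret B: comm_group "As p U" by (rule As_comm_group)
    show ?thesis using fun_cong[OF dA_mult[OF o o], of xs] xs by simp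
  qed
  ultimately have "dA p U \<one>\<^bsub>As p U\<^esub> xs = \<one>\<^bsub>Fx (hd xs)\<^esub>" by simp
  then show "dA p U \<one>\<^bsub>As p U\<^esub> xs = \<one>\<^bsub>As (Suc p) U\<^esub> xs" using xs by (simp add: As_one[where p = "Suc p"])
qed (simp_all add: dA_ext As_one)

abbreviation ag :: "nat \<Rightarrow> 'x \<Rightarrow> 'x set \<Rightarrow> ('x list \<Rightarrow> ('x set \<times> 'b) set) \<Rightarrow> ('x set \<times> ('x list \<Rightarrow> ('x set \<times> 'b) set)) set"
  where "ag p x U f \<equiv> germ X (obj A p) x U f"

lemma ag_restr: "openin X W \<Longrightarrow> x \<in> W \<Longrightarrow> W \<subseteq> U \<Longrightarrow> ag p x W (restrict f (AF W p)) = ag p x U f"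
  using strict_presheaf.germ_restr_any[OF A_presheaf, of W x U p f] by (simp add: A_simps)

lemma A_cobd:
  assumes x: "x \<in> U" and U: "openin X U" and f: "f \<in> carrier (As p U)"
  shows "cobd (stalk_complex X A x) p (ag p x U f) = ag (Suc p) x U (dA p U f)"
proof -
  have "stalk_map X (obj A (Suc p)) x (diff A p) (ag p x U f) = ag (Suc p) x U (diff A p U f)"
  proof (rule stalk_map_germ[OF A_group_presheaf U x])
    show "f \<in> carrier (sections (obj A p) U)" using f by (simp add: A_simps)
    fix U W s assume a: "openin X U" "openin X W" "x \<in> W" "W \<subseteq> U" "s \<in> carrier (sections (obj A p) U)"
    then have s: "s \<in> carrier (As p U)" by (simp add: A_simps)
    have e: "dA p W (restrict s (AF W p)) = restrict (dA p U s) (AF W (Suc p))"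
      by (rule dA_restr[OF a(4) As_D(2)[OF s], symmetric])
    show "ag (Suc p) x U (diff A p U s) = ag (Suc p) x W (diff A p W (restr (obj A p) U W s))"
      unfolding A_simps e by (rule ag_restr[OF a(2,3,4), symmetric])
  qed auto
  then show ?thesis by (simp add: stalk_complex_def A_simps)
qed

lemma A_one: "openin X U \<Longrightarrow> x \<in> U \<Longrightarrow> \<one>\<^bsub>stalk X (obj A p) x\<^esub> = ag p x U \<one>\<^bsub>As p U\<^esub>"
  using group_presheaf.stalk_one[OF A_group_presheaf] by (simp add: A_simps)

lemma A_cobd_one:
  assumes x: "x \<in> T"
  shows "cobd (stalk_complex X A x) n \<one>\<^bsub>stalk X (obj A n) x\<^esub> = \<one>\<^bsub>stalk X (obj A (Suc n)) x\<^esub>"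
  unfolding A_one[OF openin_topspace x] A_cobd[OF x openin_topspace As_one_carrier] dA_one ..

lemma A_stalk_obtain:
  assumes "z \<in> carrier (stalk X (obj A p) x)"
  obtains U f where "openin X U" "x \<in> U" "f \<in> carrier (As p U)" "z = ag p x U f"
  using group_presheaf.stalk_obtain[OF A_group_presheaf assms, unfolded A_simps(1)] .

lemma cocycle_obtain:
  assumes "z \<in> cocycles (stalk_complex X A x) p"
  obtains U f where "openin X U" "x \<in> U" "f \<in> carrier (As p U)" "z = ag p x U f"
    "\<forall>xs\<in>AF U (Suc p). dA p U f xs = \<one>\<^bsub>Fx (hd xs)\<^esub>"
proof -
  have z: "z \<in> carrier (stalk X (obj A p) x)" "cobd (stalk_complex X A x) p z = \<one>\<^bsub>stalk X (obj A (Suc p)) x\<^esub>"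
    using assms by (auto simp: cocycles_def stalk_complex_def)
  obtain U f where U: "openin X U" "x \<in> U" "f \<in> carrier (As p U)" "z = ag p x U f" using A_stalk_obtain[OF z(1)] .
  have "ag (Suc p) x U (dA p U f) = ag (Suc p) x U \<one>\<^bsub>As (Suc p) U\<^esub>"
    using z(2) U A_cobd[OF U(2,1,3)] A_one[OF U(1,2)] by simp
  moreover have "(U, \<one>\<^bsub>As (Suc p) U\<^esub>) \<in> ag (Suc p) x U \<one>\<^bsub>As (Suc p) U\<^esub>"
    using group_presheaf.germ_self[OF A_group_presheaf U(1,2)] As_one_carrier by (simp add: A_simps)
  ultimately have "(U, \<one>\<^bsub>As (Suc p) U\<^esub>) \<in> ag (Suc p) x U (dA p U f)" by simp
  then obtain W where W: "openin X W" "x \<in> W" "W \<subseteq> U \<inter> U"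
    "restr (obj A (Suc p)) U W (dA p U f) = restr (obj A (Suc p)) U W \<one>\<^bsub>As (Suc p) U\<^esub>"
    by (rule strict_presheaf.germ_mem_any[OF A_presheaf])
  have WU: "W \<subseteq> U" using W(3) by simp
  let ?f = "restrict f (AF W p)"
  have "dA p W ?f xs = \<one>\<^bsub>Fx (hd xs)\<^esub>" if xs: "xs \<in> AF W (Suc p)" for xs
  proof -
    have "dA p W ?f xs = restrict \<one>\<^bsub>As (Suc p) U\<^esub> (AF W (Suc p)) xs"
      using W(4) dA_restr[OF WU As_D(2)[OF U(3)]] by (simp add: A_simps)
    then show ?thesis using xs AF_mono[OF WU] by (auto simp: As_one)
  qed
  moreover have "z = ag p x W ?f" using U(4) ag_restr[OF W(1,2) WU] by simp
  ultimately show thesis by (intro that[OF W(1,2) A_restr_carrier[OF WU U(3)]] ballI)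
qed

text \<open>A coboundary is near \<open>x\<close> the value of the differential at an adelic family such that this value is itself adelic.
  On the families with this property the differential is additive.\<close>

lemma coboundaries_subgroup:
  assumes x: "x \<in> T"
  shows "subgroup (coboundaries (stalk_complex X A x) (Suc n)) (stalk X (obj A (Suc n)) x)"
proof -
  let ?B = "coboundaries (stalk_complex X A x) (Suc n)" and ?S = "stalk X (obj A (Suc n)) x"
  have cb: "z \<in> ?B \<longleftrightarrow> z \<in> carrier ?S \<and> (\<exists>y\<in>carrier (stalk X (obj A n) x). cobd (stalk_complex X A x) n y = z)" for z
    by (auto simp: coboundaries_def stalk_complex_def)
  interpret S: comm_group ?S by (rule group_presheaf.stalk_comm_group[OF A_group_presheaf x])
  interpret S0: comm_group "stalk X (obj A n) x" by (rule group_presheaf.stalk_comm_group[OF A_group_presheaf x])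
  have rep: "\<exists>U f. openin X U \<and> x \<in> U \<and> f \<in> carrier (As n U) \<and> dA n U f \<in> carrier (As (Suc n) U) \<and> z = ag (Suc n) x U (dA n U f)"
    if z: "z \<in> ?B" for z
  proof -
    obtain y where y: "y \<in> carrier (stalk X (obj A n) x)" "cobd (stalk_complex X A x) n y = z" using z cb by blast
    obtain U f where U: "openin X U" "x \<in> U" "f \<in> carrier (As n U)" "y = ag n x U f" using A_stalk_obtain[OF y(1)] .
    have zU: "z = ag (Suc n) x U (dA n U f)" using y(2) A_cobd[OF U(2,1,3)] U(4) by simp
    obtain V t where V: "openin X V" "x \<in> V" "t \<in> carrier (As (Suc n) V)" "z = ag (Suc n) x V t"
      using A_stalk_obtain z cb by blast
    have "(V, t) \<in> ag (Suc n) x V t"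
      using group_presheaf.germ_self[OF A_group_presheaf V(1,2)] V(3) by (simp add: A_simps)
    then have "(V, t) \<in> ag (Suc n) x U (dA n U f)" using V(4) zU by simp
    then obtain W where W: "openin X W" "x \<in> W" "W \<subseteq> U \<inter> V"
      "restr (obj A (Suc n)) U W (dA n U f) = restr (obj A (Suc n)) V W t"
      by (rule strict_presheaf.germ_mem_any[OF A_presheaf])
    have WU: "W \<subseteq> U" and WV: "W \<subseteq> V" using W(3) by auto
    have e: "dA n W (restrict f (AF W n)) = restrict t (AF W (Suc n))"
      using W(4) dA_restr[OF WU As_D(2)[OF U(3)]] by (simp add: A_simps)
    then have "dA n W (restrict f (AF W n)) \<in> carrier (As (Suc n) W)" using A_restr_carrier[OF WV V(3)] by simp
    moreover have "z = ag (Suc n) x W (dA n W (restrict f (AF W n)))"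
      unfolding e V(4) by (rule ag_restr[OF W(1,2) WV, symmetric])
    ultimately show ?thesis using W A_restr_carrier[OF WU U(3)] by blast
  qed
  have mk: "ag (Suc n) x U (dA n U f) \<in> ?B"
    if U: "openin X U" "x \<in> U" and f: "f \<in> carrier (As n U)" "dA n U f \<in> carrier (As (Suc n) U)" for U f
  proof -
    have "ag (Suc n) x U (dA n U f) \<in> carrier ?S" "ag n x U f \<in> carrier (stalk X (obj A n) x)"
      using group_presheaf.germ_carrier[OF A_group_presheaf U] f by (simp_all add: A_simps)
    then show ?thesis using cb A_cobd[OF U(2,1) f(1)] by blast
  qed
  show ?thesis
  proof (rule subgroup_commI[OF S.comm_group_axioms])
    show "?B \<subseteq> carrier ?S" using cb by blast
    show "\<one>\<^bsub>?S\<^esub> \<in> ?B" using cb A_cobd_one[OF x] S.one_closed S0.one_closed by blast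
    fix a assume a: "a \<in> ?B"
    obtain U f where U: "openin X U" "x \<in> U" "f \<in> carrier (As n U)" "dA n U f \<in> carrier (As (Suc n) U)"
      "a = ag (Suc n) x U (dA n U f)" using rep[OF a] by blast
    let ?g = "inv\<^bsub>As n U\<^esub> f"
    interpret AU: comm_group "As n U" by (rule As_comm_group)
    interpret AU': comm_group "As (Suc n) U" by (rule As_comm_group)
    have g: "?g \<in> carrier (As n U)" using U(3) by simp
    have "dA n U ?g = inv\<^bsub>As (Suc n) U\<^esub> dA n U f"
    proof (rule extensionalityI[of _ "AF U (Suc n)"])
      fix xs assume xs: "xs \<in> AF U (Suc n)"
      interpret Y: comm_group "Fx (hd xs)" by (rule Fx_comm[OF xs])
      have "dA n U ?g xs \<otimes>\<^bsub>Fx (hd xs)\<^esub> dA n U f xs = \<one>\<^bsub>Fx (hd xs)\<^esub>"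
        using fun_cong[OF dA_mult[OF g U(3)], of xs] xs U(3) dA_one[of n U] by (simp add: As_one)
      then have "inv\<^bsub>Fx (hd xs)\<^esub> dA n U f xs = dA n U ?g xs"
        by (rule Y.inv_equality) (rule dA_closed[OF As_D(2) xs], rule U(3) g, assumption)+
      then show "dA n U ?g xs = (inv\<^bsub>As (Suc n) U\<^esub> dA n U f) xs" using As_inv[OF U(4)] xs by simp
    qed (simp_all add: dA_ext As_inv[OF U(4)])
    then show "inv\<^bsub>?S\<^esub> a \<in> ?B"
      using mk[OF U(1,2) g] group_presheaf.stalk_inv_germ[OF A_group_presheaf U(1,2), of "dA n U f" "Suc n"] U(4,5)
      by (simp add: A_simps)
    fix b assume b: "b \<in> ?B"
    obtain V h where V: "openin X V" "x \<in> V" "h \<in> carrier (As n V)" "dA n V h \<in> carrier (As (Suc n) V)"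
      "b = ag (Suc n) x V (dA n V h)" using rep[OF b] by blast
    let ?W = "U \<inter> V"
    have W: "openin X ?W" "x \<in> ?W" using U V by auto
    let ?f = "restrict f (AF ?W n)" and ?h = "restrict h (AF ?W n)"
    have fc: "?f \<in> carrier (As n ?W)" "?h \<in> carrier (As n ?W)" using A_restr_carrier[of ?W] U(3) V(3) by auto
    have df: "dA n ?W ?f = restrict (dA n U f) (AF ?W (Suc n))" "dA n ?W ?h = restrict (dA n V h) (AF ?W (Suc n))"
      using dA_restr[of ?W U n f] dA_restr[of ?W V n h] As_D(2)[OF U(3)] As_D(2)[OF V(3)] by auto
    have dfc: "dA n ?W ?f \<in> carrier (As (Suc n) ?W)" "dA n ?W ?h \<in> carrier (As (Suc n) ?W)"
      unfolding df using A_restr_carrier[of ?W] U(4) V(4) by auto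
    have ab: "a = ag (Suc n) x ?W (dA n ?W ?f)" "b = ag (Suc n) x ?W (dA n ?W ?h)"
      unfolding df U(5) V(5) using ag_restr[OF W, of U] ag_restr[OF W, of V] by auto
    have "dA n ?W (?f \<otimes>\<^bsub>As n ?W\<^esub> ?h) = dA n ?W ?f \<otimes>\<^bsub>As (Suc n) ?W\<^esub> dA n ?W ?h"
      using dA_mult[OF fc] by (simp only: As_mult)
    then have "ag (Suc n) x ?W (dA n ?W (?f \<otimes>\<^bsub>As n ?W\<^esub> ?h)) = a \<otimes>\<^bsub>?S\<^esub> b"
      unfolding ab using group_presheaf.stalk_mult_germ[OF A_group_presheaf W, of "dA n ?W ?f" "Suc n" "dA n ?W ?h"] dfc
      by (simp add: A_simps)
    moreover have "dA n ?W (?f \<otimes>\<^bsub>As n ?W\<^esub> ?h) \<in> carrier (As (Suc n) ?W)"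
      unfolding \<open>dA n ?W (?f \<otimes>\<^bsub>As n ?W\<^esub> ?h) = dA n ?W ?f \<otimes>\<^bsub>As (Suc n) ?W\<^esub> dA n ?W ?h\<close>
      by (rule As_mult_carrier[OF dfc])
    ultimately show "a \<otimes>\<^bsub>?S\<^esub> b \<in> ?B" using mk[OF W As_mult_carrier[OF fc]] by simp
  qed
qed

section \<open>Exactness\<close>

text \<open>The alternating sum of the values of \<open>f\<close> on the flags \<open>\<eta> # ys\<close>, with \<open>ys\<close> a face of \<open>xs\<close>, is the image of \<open>f xs\<close> in
  the stalk at \<open>\<eta>\<close>, and the images of an element of a stalk form a family in the kernel of the Cousin
  differential.\<close>

lemma cocycle_datum:
  assumes U: "openin X U" and f: "f \<in> carrier (As n U)"
    and df: "\<And>xs. xs \<in> AF U (Suc n) \<Longrightarrow> dA n U f xs = \<one>\<^bsub>Fx (hd xs)\<^esub>"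
  shows "datum n U 0 (\<lambda>zs. iota (hd zs) (f zs))"
    and "\<And>\<eta> xs. \<eta> \<in> P 0 \<Longrightarrow> \<eta> # xs \<in> AF U (Suc n) \<Longrightarrow> cosp \<eta> (f xs) = alt (Fx \<eta>) (\<lambda>ys. f (\<eta> # ys)) xs"
proof -
  show co: "cosp \<eta> (f xs) = alt (Fx \<eta>) (\<lambda>ys. f (\<eta> # ys)) xs" if \<eta>: "\<eta> \<in> P 0" and xs: "\<eta> # xs \<in> AF U (Suc n)" for \<eta> xs
  proof -
    have c: "cosp \<eta> (f xs) \<in> carrier (Fx \<eta>)" using cosp_face[OF As_D(2)[OF f] xs, of xs] by simp
    have a: "alt (Fx \<eta>) (\<lambda>ys. f (\<eta> # ys)) xs \<in> carrier (Fx \<eta>)"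
    proof (rule alt_closed[OF Fp.stalk_comm_group[OF P_topspace[OF \<eta>]]])
      fix ys assume "ys \<in> set (faces xs)"
      then have "\<eta> # ys \<in> set (faces (\<eta> # xs))" by simp
      then show "f (\<eta> # ys) \<in> carrier (Fx \<eta>)" using As_D(2)[OF f face_AF(1)[OF xs, of "\<eta> # ys"]] by simp
    qed
    show ?thesis
      using dA_Cons[OF As_D(2)[OF f] xs] df[OF xs] div_one_iff[OF Fp.stalk_comm_group[OF P_topspace[OF \<eta>]] c a] by simp
  qed
  show "datum n U 0 (\<lambda>zs. iota (hd zs) (f zs))"
    unfolding datum_def
  proof (intro conjI allI impI ballI)
    show "iota (hd (\<eta> # xs)) (f (\<eta> # xs)) \<in> carrier (H 0 \<eta>)"
      if "\<eta> \<in> P 0" "flag U 0 (\<eta> # xs)" "length xs = n - 0" for \<eta> xs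
      using As_D(2)[OF f, of "\<eta> # xs"] that iota_iso(1)[OF that(1)] by (simp add: AF_iff hom_def Pi_iff)
    show "finite {ys. seg 0 m ys \<and> flag U 0 (ys @ xs) \<and> length (ys @ xs) = Suc n - 0 \<and>
       ncomp (nu X I) 0 ys (iota (hd (ys @ xs)) (f (ys @ xs))) \<noteq> oneH m (last ys)}" if "flag U (Suc m) xs" for m xs
    proof (rule finite_subset[OF _ As_D(3)[OF f that]])
      show "{ys. seg 0 m ys \<and> flag U 0 (ys @ xs) \<and> length (ys @ xs) = Suc n - 0 \<and>
         ncomp (nu X I) 0 ys (iota (hd (ys @ xs)) (f (ys @ xs))) \<noteq> oneH m (last ys)} \<subseteq> bad U n f m xs"
        by (auto simp: bad_def residue_def hd_app)
    qed
    fix xs \<xi> assume xs: "flag U (Suc 0) xs" "length xs = Suc n - 0" and \<xi>: "\<xi> \<in> above U (Suc 0) xs"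
    have ne: "xs \<noteq> []" using xs(2) by auto
    have \<xi>P: "\<xi> \<in> P (Suc 0)" "hd xs \<in> cl \<xi>" using \<xi> ne by (auto simp: above_def)
    have hT: "hd xs \<in> T" using flag_hd[OF xs(1) ne] by simp
    have xsA: "xs \<in> AF U n" using flag_mono[OF xs(1)] xs(2) by (simp add: AF_iff)
    note ft = As_D(2)[OF f xsA]
    have G: "\<xi> \<in> Gen 1 (hd xs)" using \<xi>P by (simp add: Gen_def)
    have sub: "Gen 0 \<xi> \<subseteq> Gen 0 (hd xs)" by (rule Gen_trans[OF G])
    have "D 0 \<xi> (\<lambda>\<eta>. alt (H 0 \<eta>) (\<lambda>ys. iota (hd (\<eta> # ys)) (f (\<eta> # ys))) xs) = D 0 \<xi> (\<lambda>\<eta>. iota \<eta> (cosp \<eta> (f xs)))"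
    proof (rule D_cong[OF \<xi>P(1) fam_mono[OF stalk_fam(1)[OF hT ft] sub], symmetric])
      fix \<eta> assume \<eta>: "\<eta> \<in> Gen 0 \<xi>"
      have \<eta>P: "\<eta> \<in> P 0" using Gen_D[OF \<eta>] by simp
      have "\<eta> \<in> above U 0 xs" using Gen_above[OF U \<xi>] \<eta> by blast
      then have fl: "\<eta> # xs \<in> AF U (Suc n)" using flag_Cons[of \<eta> U 0 xs] xs by (simp add: AF_iff)
      have fc: "f (\<eta> # ys) \<in> carrier (Fx \<eta>)" if "ys \<in> set (faces xs)" for ys
        using As_D(2)[OF f face_AF(1)[OF fl, of "\<eta> # ys"]] that by simp
      have "iota \<eta> (cosp \<eta> (f xs)) = iota \<eta> (alt (Fx \<eta>) (\<lambda>ys. f (\<eta> # ys)) xs)" using co[OF \<eta>P fl] by simp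
      also have "\<dots> = alt (H 0 \<eta>) (\<lambda>ys. iota \<eta> (f (\<eta> # ys))) xs"
        by (rule alt_hom[OF Fp.stalk_comm_group[OF P_topspace[OF \<eta>P]] H_comm[OF \<eta>P] iota_iso(1)[OF \<eta>P] fc])
      finally show "iota \<eta> (cosp \<eta> (f xs)) = alt (H 0 \<eta>) (\<lambda>ys. iota (hd (\<eta> # ys)) (f (\<eta> # ys))) xs" by simp
    qed
    then show "D 0 \<xi> (\<lambda>\<eta>. alt (H 0 \<eta>) (\<lambda>ys. iota (hd (\<eta> # ys)) (f (\<eta> # ys))) xs) = oneH (Suc 0) \<xi>"
      using stalk_fam(2)[OF hT ft G] by simp
  qed
qed

text \<open>A solution \<open>v\<close> prescribes the values of \<open>g\<close> on the flags that begin with a point of codimension \<open>0\<close>.  On another flag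
  \<open>zs\<close> the sums of the values of the datum and the alternating sums of \<open>v\<close> form a family in the kernel of the
  Cousin differential, which is the family of images of a unique element of the stalk, the value \<open>g zs\<close>.\<close>

lemma adelic_exact:
  assumes U: "openin X U" "x \<in> U" and f: "f \<in> carrier (As (Suc p) U)"
    and df: "\<And>xs. xs \<in> AF U (Suc (Suc p)) \<Longrightarrow> dA (Suc p) U f xs = \<one>\<^bsub>Fx (hd xs)\<^esub>"
  obtains V g where "openin X V" "x \<in> V" "V \<subseteq> U" "g \<in> carrier (As p V)" "dA p V g = restrict f (AF V (Suc p))"
proof -
  define u where "u zs = iota (hd zs) (f zs)" for zs
  have uU: "datum (Suc p) U 0 u" unfolding u_def[abs_def] by (rule cocycle_datum(1)[OF U(1) f df])
  from solution_exists[OF le0 U(2,1) uU]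
  obtain V v where V: "openin X V" "x \<in> V" "V \<subseteq> U" and v: "solution (Suc p) V 0 u v" by (elim exE conjE)
  note uV = datum_restrict[OF uU V(3)]
  define w where "w zs \<eta> = u (\<eta> # zs) \<otimes>\<^bsub>H 0 \<eta>\<^esub> alt (H 0 \<eta>) (\<lambda>ys. v (\<eta> # ys)) zs" for zs \<eta>
  define good where "good zs z \<longleftrightarrow> z \<in> carrier (Fx (hd zs)) \<and>
     (if hd zs \<in> P 0 then iota (hd zs) z = v zs else \<forall>\<eta>\<in>Gen 0 (hd zs). iota \<eta> (cosp \<eta> z) = w zs \<eta>)" for zs z
  have ex: "\<exists>z. good zs z" if zs: "zs \<in> AF V p" for zs
  proof (cases "hd zs \<in> P 0")
    case True
    obtain a xs where r: "zs = a # xs" using zs by (cases zs) (auto simp: AF_iff)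
    have "v zs \<in> carrier (H 0 (hd zs))"
      unfolding r list.sel(1)
    proof (rule solution_carrier[OF v])
      show "a \<in> P 0" using True unfolding r by simp
      show "flag V 0 (a # xs)" "Suc (length xs) = Suc p - 0" using zs unfolding AF_iff r by simp_all
    qed
    then have "v zs \<in> iota (hd zs) ` carrier (Fx (hd zs))" using iota_iso(2)[OF True] by (simp add: bij_betw_def)
    then obtain z where "v zs = iota (hd zs) z" "z \<in> carrier (Fx (hd zs))" by (rule imageE)
    then show ?thesis using True by (intro exI[of _ z]) (simp add: good_def)
  next
    case False
    have fl: "flag V 0 zs" "length zs = Suc p" using zs by (auto simp: AF_iff)
    have ne: "zs \<noteq> []" using fl(2) by auto
    have fl1: "flag V (Suc 0) zs" by (rule flag_Suc[OF fl(1)]) (use False in simp)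
    have hV: "hd zs \<in> V" and hT: "hd zs \<in> T" using flag_hd[OF fl(1) ne] by auto
    have ab: "above V l zs = Gen l (hd zs)" for l by (rule above_Gen_hd[OF V(1) ne hV])
    have "fam 0 (Gen 0 (hd zs)) (w zs)"
      unfolding w_def[abs_def] ab[symmetric]
      by (rule fam_mult[OF above_P datum_fam[OF uV le0 fl1] fam_alt[OF above_P, where u = "\<lambda>\<eta> ys. v (\<eta> # ys)", OF face_fam_solution[OF v fl1]]])
        (use fl(2) in auto)
    moreover have "D 0 \<xi> (w zs) = oneH 1 \<xi>" if "\<xi> \<in> Gen 1 (hd zs)" for \<xi>
      using solution_eq[OF v fl1, of \<xi>] that fl(2) ab[of 1] unfolding w_def[abs_def] by simp
    ultimately obtain z where "z \<in> carrier (Fx (hd zs))" "\<forall>\<eta>\<in>Gen 0 (hd zs). iota \<eta> (cosp \<eta> z) = w zs \<eta>"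
      by (rule stalk_surj[OF hT])
    then show ?thesis using False by (auto simp: good_def)
  qed
  define g where "g = (\<lambda>zs\<in>AF V p. SOME z. good zs z)"
  have g: "good zs (g zs)" if "zs \<in> AF V p" for zs
    using someI_ex[OF ex[OF that]] that by (simp add: g_def)
  have gc: "g zs \<in> carrier (Fx (hd zs))" if "zs \<in> AF V p" for zs using g[OF that] by (simp add: good_def)
  have g0: "iota \<eta> (g (\<eta> # xs)) = v (\<eta> # xs)" if "\<eta> # xs \<in> AF V p" "\<eta> \<in> P 0" for \<eta> xs
    using g[OF that(1)] that(2) by (simp add: good_def)
  have g1: "iota \<eta> (cosp \<eta> (g zs)) = w zs \<eta>" if "zs \<in> AF V p" "hd zs \<notin> P 0" "\<eta> \<in> Gen 0 (hd zs)" for \<eta> zs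
    using g[OF that(1)] that(2,3) by (simp add: good_def)
  have gA: "g \<in> carrier (As p V)" unfolding As_carrier
  proof (intro conjI ballI allI impI gc)
    show "g \<in> extensional (AF V p)" by (simp add: g_def)
    fix m xs assume xs: "flag V (Suc m) xs"
    have "bad V p g m xs \<subseteq> {ys. seg 0 m ys \<and> flag V 0 (ys @ xs) \<and> length (ys @ xs) = Suc p - 0 \<and> v (ys @ xs) \<noteq> oneH 0 (hd ys)}"
    proof
      fix ys assume ys: "ys \<in> bad V p g m xs"
      then have s: "seg 0 m ys" "flag V 0 (ys @ xs)" "length (ys @ xs) = Suc p"
        and ne: "residue ys (g (ys @ xs)) \<noteq> oneH m (last ys)" by (auto simp: bad_def)
      note r = residue_hom[OF s(1,2)]
      obtain a zs where sa: "ys = a # zs" using seg_nonempty[OF le0 s(1)] by (cases ys) auto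
      have "ys @ xs \<in> AF V p" using s by (simp add: AF_iff)
      then have "iota (hd ys) (g (ys @ xs)) = v (ys @ xs)" using g0[of a "zs @ xs"] sa r(2) by simp
      then have "ncomp (nu X I) 0 ys (v (ys @ xs)) \<noteq> oneH m (last ys)" using ne by (simp add: residue_def)
      then have "v (ys @ xs) \<noteq> oneH 0 (hd ys)"
        using hom_one_comm[OF H_comm[OF r(2)] H_comm[OF r(3)] ncomp_hom[OF le0 s(1,2)]] by auto
      then show "ys \<in> {ys. seg 0 m ys \<and> flag V 0 (ys @ xs) \<and> length (ys @ xs) = Suc p - 0 \<and> v (ys @ xs) \<noteq> oneH 0 (hd ys)}"
        using s by simp
    qed
    then show "finite (bad V p g m xs)" using solution_finite[OF v le0 xs] finite_subset by simp
  qed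
  let ?f = "restrict f (AF V (Suc p))"
  have fV: "?f \<in> carrier (As (Suc p) V)" by (rule A_restr_carrier[OF V(3) f])
  have dfV: "cosp \<eta> (f xs) = alt (Fx \<eta>) (\<lambda>ys. f (\<eta> # ys)) xs" if "\<eta> \<in> P 0" "\<eta> # xs \<in> AF V (Suc (Suc p))" for \<eta> xs
    by (rule cocycle_datum(2)[OF U(1) f df that(1)]) (use that(2) AF_mono[OF V(3)] in auto)
  (* The equation dg = f on a flag that begins with a point of codimension 0. *)
  have low: "dA p V g (\<eta> # zs) = f (\<eta> # zs)" if \<eta>: "\<eta> \<in> P 0" and fl: "\<eta> # zs \<in> AF V (Suc p)" for \<eta> zs
  proof -
    have \<eta>T: "\<eta> \<in> T" by (rule P_topspace[OF \<eta>])
    interpret S: comm_group "Fx \<eta>" by (rule Fp.stalk_comm_group[OF \<eta>T])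
    interpret Hc: comm_group "H 0 \<eta>" by (rule H_comm[OF \<eta>])
    have zsA: "zs \<in> AF V p" using face_AF(1)[OF fl, of zs] by simp
    have ne: "zs \<noteq> []" using zsA by (auto simp: AF_iff)
    have fl0: "flag V (Suc 0) zs" "\<eta> \<in> above V 0 zs" using flag_ConsD[of V 0 \<eta> zs] fl \<eta> by (auto simp: AF_iff)
    have n0: "hd zs \<notin> P 0" using fl0(1) ne P_unique by (cases zs) fastforce+
    have \<eta>G: "\<eta> \<in> Gen 0 (hd zs)" using fl0(2) ne by (auto simp: above_def Gen_def)
    have cc: "cosp \<eta> (g zs) \<in> carrier (Fx \<eta>)" using cosp_carrier[OF _ gc[OF zsA]] Gen_D[OF \<eta>G] by blast
    have gs: "g (\<eta> # ys) \<in> carrier (Fx \<eta>)" "\<eta> # ys \<in> AF V p" if "ys \<in> set (faces zs)" for ys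
      using gc[OF face_AF(1)[OF fl, of "\<eta> # ys"]] face_AF(1)[OF fl, of "\<eta> # ys"] that by auto
    have ac: "alt (Fx \<eta>) (\<lambda>ys. g (\<eta> # ys)) zs \<in> carrier (Fx \<eta>)" by (rule alt_closed[OF S.comm_group_axioms gs(1)])
    have "iota \<eta> (alt (Fx \<eta>) (\<lambda>ys. g (\<eta> # ys)) zs) = alt (H 0 \<eta>) (\<lambda>ys. iota \<eta> (g (\<eta> # ys))) zs"
      by (rule alt_hom[OF S.comm_group_axioms Hc.comm_group_axioms iota_iso(1)[OF \<eta>] gs(1)])
    also have "\<dots> = alt (H 0 \<eta>) (\<lambda>ys. v (\<eta> # ys)) zs" by (rule alt_cong) (rule g0[OF gs(2) \<eta>])
    finally have ia: "iota \<eta> (alt (Fx \<eta>) (\<lambda>ys. g (\<eta> # ys)) zs) = alt (H 0 \<eta>) (\<lambda>ys. v (\<eta> # ys)) zs" .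
    have vc: "alt (H 0 \<eta>) (\<lambda>ys. v (\<eta> # ys)) zs \<in> carrier (H 0 \<eta>)"
      unfolding ia[symmetric] by (rule hom_in_carrier[OF iota_iso(1)[OF \<eta>] ac])
    have fc: "f (\<eta> # zs) \<in> carrier (Fx \<eta>)" using As_D(2)[OF fV fl] fl by simp
    have uc: "u (\<eta> # zs) \<in> carrier (H 0 \<eta>)" using fc iota_iso(1)[OF \<eta>] by (simp add: u_def hom_def Pi_iff)
    have dg: "dA p V g (\<eta> # zs) = cosp \<eta> (g zs) \<otimes>\<^bsub>Fx \<eta>\<^esub> inv\<^bsub>Fx \<eta>\<^esub> alt (Fx \<eta>) (\<lambda>ys. g (\<eta> # ys)) zs"
      by (rule dA_Cons[OF gc fl])
    have "iota \<eta> (dA p V g (\<eta> # zs)) = w zs \<eta> \<otimes>\<^bsub>H 0 \<eta>\<^esub> inv\<^bsub>H 0 \<eta>\<^esub> alt (H 0 \<eta>) (\<lambda>ys. v (\<eta> # ys)) zs"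
      unfolding dg using hom_mult[OF iota_iso(1)[OF \<eta>] cc S.inv_closed[OF ac]]
        hom_inv_comm[OF S.comm_group_axioms Hc.comm_group_axioms iota_iso(1)[OF \<eta>] ac] ia g1[OF zsA n0 \<eta>G] by simp
    also have "\<dots> = u (\<eta> # zs)" unfolding w_def using uc vc by (simp add: Hc.m_assoc)
    finally have "iota \<eta> (dA p V g (\<eta> # zs)) = iota \<eta> (f (\<eta> # zs))" by (simp add: u_def)
    then show ?thesis
      using iota_iso(2)[OF \<eta>] dA_closed[OF gc fl] fc by (auto simp: bij_betw_def dest: inj_onD)
  qed
  (* On the other flags the two sides are compared in the stalks at the points of codimension 0. *)
  have "dA p V g xs = f xs" if xs: "xs \<in> AF V (Suc p)" for xs
  proof (cases "hd xs \<in> P 0")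
    case True
    obtain a zs where "xs = a # zs" using xs by (cases xs) (auto simp: AF_iff)
    then show ?thesis using low[of a zs] True xs by simp
  next
    case False
    have ne: "xs \<noteq> []" using xs by (auto simp: AF_iff)
    have fl: "flag V 0 xs" "length xs = Suc (Suc p)" using xs by (auto simp: AF_iff)
    have fl1: "flag V (Suc 0) xs" by (rule flag_Suc[OF fl(1)]) (use False in simp)
    have hT: "hd xs \<in> T" and hV: "hd xs \<in> V" using flag_hd[OF fl(1) ne] by auto
    have fc: "f xs \<in> carrier (Fx (hd xs))" using As_D(2)[OF fV xs] xs by simp
    show ?thesis
    proof (rule stalk_inj[OF hT dA_closed[OF gc xs] fc])
      fix \<eta> assume \<eta>G: "\<eta> \<in> Gen 0 (hd xs)"
      have \<eta>: "\<eta> \<in> P 0" "hd xs \<in> cl \<eta>" using Gen_D[OF \<eta>G] by auto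
      have \<eta>T: "\<eta> \<in> T" by (rule P_topspace[OF \<eta>(1)])
      interpret S: comm_group "Fx \<eta>" by (rule Fp.stalk_comm_group[OF \<eta>T])
      have "\<eta> \<in> above V 0 xs" using \<eta>G above_Gen_hd[OF V(1) ne hV] by simp
      then have flc: "\<eta> # xs \<in> AF V (Suc (Suc p))" using flag_Cons[of \<eta> V 0 xs] fl1 fl by (simp add: AF_iff)
      have face: "\<eta> # ys \<in> AF V (Suc p)" if "ys \<in> set (faces xs)" for ys
        using face_AF(1)[OF flc, of "\<eta> # ys"] that by simp
      have fface: "f (\<eta> # ys) \<in> carrier (Fx \<eta>)" if "ys \<in> set (faces xs)" for ys
        using As_D(2)[OF fV face[OF that]] face[OF that] by simp
      have gface: "g (\<eta> # zs) \<in> carrier (Fx \<eta>)" if "ys \<in> set (faces xs)" "zs \<in> set (faces ys)" for ys zs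
        using gc[OF face_AF(1)[OF face[OF that(1)], of "\<eta> # zs"]] that by simp
      have aface: "alt (Fx \<eta>) (\<lambda>zs. g (\<eta> # zs)) ys \<in> carrier (Fx \<eta>)" if "ys \<in> set (faces xs)" for ys
        by (rule alt_closed[OF S.comm_group_axioms gface[OF that]])
      have cg: "cosp \<eta> (g ys) = f (\<eta> # ys) \<otimes>\<^bsub>Fx \<eta>\<^esub> alt (Fx \<eta>) (\<lambda>zs. g (\<eta> # zs)) ys" if ys: "ys \<in> set (faces xs)" for ys
      proof -
        have c: "cosp \<eta> (g ys) \<in> carrier (Fx \<eta>)"
          using cosp_face[OF gc face[OF ys], of ys] by simp
        have "f (\<eta> # ys) = cosp \<eta> (g ys) \<otimes>\<^bsub>Fx \<eta>\<^esub> inv\<^bsub>Fx \<eta>\<^esub> alt (Fx \<eta>) (\<lambda>zs. g (\<eta> # zs)) ys"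
          using low[OF \<eta>(1) face[OF ys]] dA_Cons[OF gc face[OF ys]] by simp
        then show ?thesis using c aface[OF ys] by (simp add: S.m_assoc)
      qed
      have gt: "cosp (hd xs) (g ys) \<in> carrier (Fx (hd xs))" if "ys \<in> set (faces xs)" for ys
        by (rule cosp_face[OF gc xs that])
      have "cosp \<eta> (dA p V g xs) = cosp \<eta> (alt (Fx (hd xs)) (\<lambda>ys. cosp (hd xs) (g ys)) xs)"
        using dA_alt[OF gc xs] by simp
      also have "\<dots> = alt (Fx \<eta>) (\<lambda>ys. cosp \<eta> (cosp (hd xs) (g ys))) xs"
        by (rule alt_hom[OF Fp.stalk_comm_group[OF hT] S.comm_group_axioms cosp_hom[OF \<eta>(2)] gt])
      also have "\<dots> = alt (Fx \<eta>) (\<lambda>ys. f (\<eta> # ys) \<otimes>\<^bsub>Fx \<eta>\<^esub> alt (Fx \<eta>) (\<lambda>zs. g (\<eta> # zs)) ys) xs"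
      proof (rule alt_cong)
        fix ys assume ys: "ys \<in> set (faces xs)"
        show "cosp \<eta> (cosp (hd xs) (g ys)) = f (\<eta> # ys) \<otimes>\<^bsub>Fx \<eta>\<^esub> alt (Fx \<eta>) (\<lambda>zs. g (\<eta> # zs)) ys"
          using cosp_trans[OF \<eta>(2) face_AF(2)[OF xs ys] gc[OF face_AF(1)[OF xs ys]]] cg[OF ys] by simp
      qed
      also have "\<dots> = alt (Fx \<eta>) (\<lambda>ys. f (\<eta> # ys)) xs \<otimes>\<^bsub>Fx \<eta>\<^esub> alt (Fx \<eta>) (alt (Fx \<eta>) (\<lambda>zs. g (\<eta> # zs))) xs"
        by (rule alt_mult[OF S.comm_group_axioms fface aface])
      also have "alt (Fx \<eta>) (alt (Fx \<eta>) (\<lambda>zs. g (\<eta> # zs))) xs = \<one>\<^bsub>Fx \<eta>\<^esub>"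
        by (rule alt_alt[OF S.comm_group_axioms gface])
      also have "alt (Fx \<eta>) (\<lambda>ys. f (\<eta> # ys)) xs \<otimes>\<^bsub>Fx \<eta>\<^esub> \<one>\<^bsub>Fx \<eta>\<^esub> = cosp \<eta> (f xs)"
      proof -
        have "alt (Fx \<eta>) (\<lambda>ys. f (\<eta> # ys)) xs \<in> carrier (Fx \<eta>)" by (rule alt_closed[OF S.comm_group_axioms fface])
        then show ?thesis using dfV[OF \<eta>(1) flc] by simp
      qed
      finally show "iota \<eta> (cosp \<eta> (dA p V g xs)) = iota \<eta> (cosp \<eta> (f xs))" by simp
    qed
  qed
  then have "dA p V g = ?f"
    by (intro extensionalityI[of _ "AF V (Suc p)"]) (simp_all add: dA_ext)
  then show thesis by (rule that[OF V gA])
qed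

abbreviation Aaug :: "'x set \<Rightarrow> 'b \<Rightarrow> 'x list \<Rightarrow> ('x set \<times> 'b) set" where "Aaug \<equiv> adelic_aug X F d"

lemma AF_0: "xs \<in> AF U 0 \<longleftrightarrow> (\<exists>y p. xs = [y] \<and> y \<in> U \<and> y \<in> P p)"
  by (auto simp: AF_iff length_Suc_conv)

lemma Aaug_carrier:
  assumes U: "openin X U" and s: "s \<in> Fp.sec U"
  shows "Aaug U s \<in> carrier (As 0 U)"
  unfolding As_carrier
proof (intro conjI ballI allI impI)
  show "Aaug U s \<in> extensional (AF U 0)" by (simp add: adelic_aug_def)
  show "Aaug U s xs \<in> carrier (Fx (hd xs))" if "xs \<in> AF U 0" for xs
    using that U s by (auto simp: adelic_aug_def AF_0 intro!: Fp.germ_carrier)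
  fix m xs
  have "bad U 0 (Aaug U s) m xs \<subseteq> (\<lambda>y. [y]) ` P 0"
  proof
    fix ys assume "ys \<in> bad U 0 (Aaug U s) m xs"
    then have s: "seg 0 m ys" "length (ys @ xs) = Suc 0" by (auto simp: bad_def)
    then have "m = 0" by (auto simp: seg_def)
    then show "ys \<in> (\<lambda>y. [y]) ` P 0" using s by (auto simp: seg_self)
  qed
  then show "finite (bad U 0 (Aaug U s) m xs)" using finite_P0 finite_subset by blast
qed

lemma Aaug_hom: "sheaf_hom X F (obj A 0) Aaug"
  unfolding sheaf_hom_def
proof (intro conjI allI impI ballI)
  fix U assume U: "openin X U"
  show "Aaug U \<in> hom (sections F U) (sections (obj A 0) U)" unfolding A_simps(1)
  proof (rule homI[OF Aaug_carrier[OF U]])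
    fix s t assume s: "s \<in> Fp.sec U" and t: "t \<in> Fp.sec U"
    show "Aaug U (s \<otimes>\<^bsub>sections F U\<^esub> t) = Aaug U s \<otimes>\<^bsub>As 0 U\<^esub> Aaug U t"
      unfolding As_mult adelic_aug_def
      by (rule restrict_ext) (use Fp.stalk_mult_germ[OF U _ s t] in \<open>auto simp: AF_0\<close>)
  qed
  fix V s assume V: "openin X V" "V \<subseteq> U" and s: "s \<in> Fp.sec U"
  have e: "germ X F y U s = germ X F y V (restr F U V s)" if "y \<in> V" for y
    using Fp.germ_restr[OF U V(1) that V(2) s] by simp
  show "restr (obj A 0) U V (Aaug U s) = Aaug V (restr F U V s)"
    unfolding A_simps adelic_aug_def
    by (rule restrict_ext) (use e V(2) AF_mono[OF V(2), of 0] in \<open>auto simp: AF_0\<close>)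
qed

lemma Aaug_germ:
  assumes "openin X U" "x \<in> U" "s \<in> Fp.sec U"
  shows "stalk_map X (obj A 0) x Aaug (germ X F x U s) = ag 0 x U (Aaug U s)"
  by (rule stalk_map_germ_hom[OF F_presheaf A_group_presheaf Aaug_hom assms])

text \<open>A family of degree \<open>0\<close> in the kernel of the differential agrees near \<open>x\<close> with the germs of a section:
  this holds at the finitely many points of codimension \<open>0\<close>, and the stalks embed in the product of the
  stalks at these points.\<close>

lemma Aaug_bij:
  assumes x: "x \<in> T"
  shows "bij_betw (stalk_map X (obj A 0) x Aaug) (carrier (Fx x)) (cocycles (stalk_complex X A x) 0)"
  unfolding bij_betw_def
proof (intro conjI equalityI subsetI)
  let ?\<psi> = "stalk_map X (obj A 0) x Aaug"
  show "inj_on ?\<psi> (carrier (Fx x))"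
  proof (rule inj_onI)
    fix z w assume z: "z \<in> carrier (Fx x)" and w: "w \<in> carrier (Fx x)" and eq: "?\<psi> z = ?\<psi> w"
    obtain U s t where U: "openin X U" "x \<in> U" "s \<in> Fp.sec U" "t \<in> Fp.sec U" "z = germ X F x U s" "w = germ X F x U t"
      using Fp.stalk_obtain2[OF z w] .
    have "ag 0 x U (Aaug U s) = ag 0 x U (Aaug U t)" using eq Aaug_germ[OF U(1,2)] U by simp
    then obtain W where W: "x \<in> W" "W \<subseteq> U" "restrict (Aaug U s) (AF W 0) = restrict (Aaug U t) (AF W 0)" "openin X W"
      using group_presheaf.germ_eq_iff[OF A_group_presheaf U(1,1,2), of "Aaug U s" 0 "Aaug U t"]
        Aaug_carrier[OF U(1,3)] Aaug_carrier[OF U(1,4)] by (auto simp: A_simps)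
    show "z = w"
    proof (rule stalk_inj[OF x z w])
      fix \<eta> assume \<eta>: "\<eta> \<in> Gen 0 x"
      have e: "\<eta> \<in> P 0" "x \<in> cl \<eta>" using Gen_D[OF \<eta>] by auto
      have \<eta>W: "\<eta> \<in> W" by (rule closure_of_nbhd[OF e(2) W(4,1)])
      have "[\<eta>] \<in> AF W 0" "[\<eta>] \<in> AF U 0" using e \<eta>W W(2) by (auto simp: AF_0)
      then have "germ X F \<eta> U s = germ X F \<eta> U t" using fun_cong[OF W(3), of "[\<eta>]"] by (simp add: adelic_aug_def)
      then show "iota \<eta> (cosp \<eta> z) = iota \<eta> (cosp \<eta> w)" using cosp_germ[OF e(2) U(1,2)] U by simp
    qed
  qed
  fix a assume "a \<in> ?\<psi> ` carrier (Fx x)"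
  then obtain z where z: "z \<in> carrier (Fx x)" "a = ?\<psi> z" by blast
  obtain U s where U: "openin X U" "x \<in> U" "s \<in> Fp.sec U" "z = germ X F x U s" using Fp.stalk_obtain[OF z(1)] .
  have a: "a = ag 0 x U (Aaug U s)" using z(2) U Aaug_germ by simp
  note ac = Aaug_carrier[OF U(1,3)]
  have "dA 0 U (Aaug U s) = \<one>\<^bsub>As (Suc 0) U\<^esub>"
  proof (rule extensionalityI[of _ "AF U (Suc 0)"])
    fix xs assume xs: "xs \<in> AF U (Suc 0)"
    then obtain y w where t: "xs = [y, w]" by (auto simp: AF_iff length_Suc_conv)
    interpret comm_group "Fx y" using Fx_comm[OF xs] t by simp
    have f: "[w] \<in> AF U 0" "[y] \<in> AF U 0" "w \<in> cl y" using face_AF(1)[OF xs] xs t by (auto simp: AF_iff)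
    then have yw: "w \<in> U" "y \<in> U" by (auto simp: AF_0)
    have "dA 0 U (Aaug U s) (y # [w]) = cosp y (Aaug U s [w]) \<otimes>\<^bsub>Fx y\<^esub> inv\<^bsub>Fx y\<^esub> alt (Fx y) (\<lambda>ys. Aaug U s (y # ys)) [w]"
      by (rule dA_Cons[OF As_D(2)[OF ac]]) (use xs t in auto)
    also have "cosp y (Aaug U s [w]) = germ X F y U s"
      using f cosp_germ[OF f(3) U(1) yw(1) U(3)] by (simp add: adelic_aug_def)
    also have "alt (Fx y) (\<lambda>ys. Aaug U s (y # ys)) [w] = germ X F y U s"
      using f Fp.germ_carrier[OF U(1) yw(2) U(3)] by (simp add: adelic_aug_def)
    finally show "dA 0 U (Aaug U s) xs = \<one>\<^bsub>As (Suc 0) U\<^esub> xs"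
      using Fp.germ_carrier[OF U(1) yw(2) U(3)] t xs by (simp add: As_one)
  qed (simp_all add: dA_ext As_one)
  then show "a \<in> cocycles (stalk_complex X A x) 0"
    using A_cobd[OF U(2,1) ac] group_presheaf.germ_carrier[OF A_group_presheaf U(1,2)] ac A_one[OF U(1,2)]
    unfolding a cocycles_def by (simp add: stalk_complex_def A_simps)
next
  let ?\<psi> = "stalk_map X (obj A 0) x Aaug"
  fix a assume "a \<in> cocycles (stalk_complex X A x) 0"
  then obtain U f where U: "openin X U" "x \<in> U" and f: "f \<in> carrier (As 0 U)" "a = ag 0 x U f"
    and df0: "\<forall>xs\<in>AF U (Suc 0). dA 0 U f xs = \<one>\<^bsub>Fx (hd xs)\<^esub>" by (rule cocycle_obtain)
  note df = bspec[OF df0]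
  have df': "cosp y (f [w]) = f [y]" if fl: "[y, w] \<in> AF U (Suc 0)" for y w
  proof -
    interpret comm_group "Fx y" using Fx_comm[OF fl] by simp
    have c: "cosp y (f [w]) \<in> carrier (Fx y)" using cosp_face[OF As_D(2)[OF f(1)] fl, of "[w]"] by simp
    have c': "f [y] \<in> carrier (Fx y)" using As_D(2)[OF f(1) face_AF(1)[OF fl, of "[y]"]] by simp
    show ?thesis
      using dA_Cons[OF As_D(2)[OF f(1)] fl] df[OF fl] div_one_iff[OF comm_group_axioms c c'] c' by simp
  qed
  let ?h = "\<lambda>\<eta>. iota \<eta> (f [\<eta>])"
  have GU: "\<eta> \<in> U" "\<eta> \<in> P 0" if "\<eta> \<in> Gen 0 x" for \<eta> using Gen_D[OF that] closure_of_nbhd[OF _ U] by auto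
  have fA: "f [\<eta>] \<in> carrier (Fx \<eta>)" if "\<eta> \<in> U" "\<eta> \<in> P p" for \<eta> p
    using As_D(2)[OF f(1), of "[\<eta>]"] that by (auto simp: AF_0)
  have fh: "fam 0 (Gen 0 x) ?h" unfolding fam_def
  proof (intro conjI ballI)
    show "?h \<eta> \<in> carrier (H 0 \<eta>)" if "\<eta> \<in> Gen 0 x" for \<eta>
      using fA[OF GU[OF that]] iota_iso(1)[OF GU(2)[OF that]] by (simp add: hom_def Pi_iff)
    show "finite {\<eta> \<in> Gen 0 x. ?h \<eta> \<noteq> oneH 0 \<eta>}"
      by (rule finite_subset[OF _ finite_P0]) (use GU in auto)
  qed
  have "D 0 \<xi> ?h = oneH 1 \<xi>" if \<xi>: "\<xi> \<in> Gen 1 x" for \<xi>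
  proof -
    have \<xi>P: "\<xi> \<in> P (Suc 0)" "x \<in> cl \<xi>" using Gen_D[OF \<xi>] by auto
    have \<xi>T: "\<xi> \<in> T" and \<xi>U: "\<xi> \<in> U" using P_topspace[OF \<xi>P(1)] closure_of_nbhd[OF \<xi>P(2) U] by auto
    note fx = fA[OF \<xi>U \<xi>P(1)]
    have "D 0 \<xi> (\<lambda>\<eta>. iota \<eta> (cosp \<eta> (f [\<xi>]))) = D 0 \<xi> ?h"
    proof (rule D_cong[OF \<xi>P(1) stalk_fam(1)[OF \<xi>T fx]])
      fix \<eta> assume \<eta>: "\<eta> \<in> Gen 0 \<xi>"
      have "\<eta> \<in> P 0" "\<xi> \<in> cl \<eta>" using Gen_D[OF \<eta>] by auto
      moreover have "\<eta> \<in> U" using closure_of_nbhd[OF _ U(1) \<xi>U] calculation by blast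
      ultimately have "[\<eta>, \<xi>] \<in> AF U (Suc 0)" using \<xi>U \<xi>P by (auto simp: AF_iff)
      then show "iota \<eta> (cosp \<eta> (f [\<xi>])) = ?h \<eta>" using df' by simp
    qed
    then show ?thesis using stalk_fam(2)[OF \<xi>T fx, of \<xi>] \<xi>P P_self[OF \<xi>P(1)] by (simp add: Gen_def)
  qed
  then obtain z where z: "z \<in> carrier (Fx x)" "\<forall>\<eta>\<in>Gen 0 x. iota \<eta> (cosp \<eta> z) = ?h \<eta>"
    by (rule stalk_surj[OF x fh])
  obtain U1 s where U1: "openin X U1" "x \<in> U1" "s \<in> Fp.sec U1" "z = germ X F x U1 s" using Fp.stalk_obtain[OF z(1)] .
  have fin: "finite (P 0 - Gen 0 x)" using finite_P0 by simp
  have nG: "x \<notin> cl \<eta>" if "\<eta> \<in> P 0 - Gen 0 x" for \<eta> using that by (auto simp: Gen_def)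
  have UU: "openin X (U \<inter> U1)" "x \<in> U \<inter> U1" using U U1 by auto
  obtain V where V: "openin X V" "x \<in> V" "V \<subseteq> U \<inter> U1" "V \<inter> (P 0 - Gen 0 x) = {}"
    by (rule avoid_finite[OF fin UU(2,1) nG])
  have VU: "V \<subseteq> U" "V \<subseteq> U1" using V(3) by auto
  have "restrict f (AF V 0) = restrict (Aaug U1 s) (AF V 0)"
  proof (rule restrict_ext)
    fix xs assume "xs \<in> AF V 0"
    then obtain y p where y: "xs = [y]" "y \<in> V" "y \<in> P p" by (auto simp: AF_0)
    have yT: "y \<in> T" by (rule P_topspace[OF y(3)])
    have yU: "y \<in> U" "y \<in> U1" using y(2) VU by auto
    have gc: "germ X F y U1 s \<in> carrier (Fx y)" by (rule Fp.germ_carrier[OF U1(1) yU(2) U1(3)])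
    note fy = fA[OF yU(1) y(3)]
    have "f [y] = germ X F y U1 s"
    proof (rule stalk_inj[OF yT fy gc])
      fix \<eta> assume \<eta>: "\<eta> \<in> Gen 0 y"
      have e: "\<eta> \<in> P 0" "y \<in> cl \<eta>" using Gen_D[OF \<eta>] by auto
      have "\<eta> \<in> V" by (rule closure_of_nbhd[OF e(2) V(1) y(2)])
      then have \<eta>x: "\<eta> \<in> Gen 0 x" using V(4) e by blast
      have \<eta>T: "\<eta> \<in> T" by (rule P_topspace[OF e(1)])
      have xe: "x \<in> cl \<eta>" using Gen_D[OF \<eta>x] by simp
      have "cosp \<eta> (f [y]) = f [\<eta>]"
      proof (cases "p = 0")
        case True
        then have "y = \<eta>" using codim_eq[of y 0 \<eta>] y e by simp
        then show ?thesis using cosp_self[OF \<eta>T] fy by simp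
      next
        case False
        then have "Suc 0 \<le> p" by simp
        then have "flag U (Suc 0) [y]" using y(3) yU(1) by auto
        moreover have "\<eta> \<in> above U 0 [y]" using e GU[OF \<eta>x] by (simp add: above_def)
        ultimately have "[\<eta>, y] \<in> AF U (Suc 0)" using flag_Cons[of \<eta> U 0 "[y]"] by (simp add: AF_iff)
        then show ?thesis by (rule df')
      qed
      moreover have "cosp \<eta> z = germ X F \<eta> U1 s" using cosp_germ[OF xe U1(1,2,3)] U1(4) by simp
      moreover have "cosp \<eta> (germ X F y U1 s) = germ X F \<eta> U1 s" by (rule cosp_germ[OF e(2) U1(1) yU(2) U1(3)])
      ultimately show "iota \<eta> (cosp \<eta> (f [y])) = iota \<eta> (cosp \<eta> (germ X F y U1 s))" using bspec[OF z(2) \<eta>x] by simp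
    qed
    then show "f xs = Aaug U1 s xs" using y yU by (auto simp: adelic_aug_def AF_0)
  qed
  then have "ag 0 x U f = ag 0 x U1 (Aaug U1 s)"
    using ag_restr[OF V(1,2) VU(1), of 0 f] ag_restr[OF V(1,2) VU(2), of 0 "Aaug U1 s"] by simp
  then have "a = ?\<psi> z" using f(2) Aaug_germ[OF U1(1,2,3)] U1(4) by simp
  then show "a \<in> ?\<psi> ` carrier (Fx x)" using z(1) by blast
qed

theorem adelic_quasi_iso: "quasi_iso X (in_degree_0 F) A (from_degree_0 A Aaug)"
proof (rule quasi_iso_degree_0I[OF F_presheaf A_group_presheaf])
  fix x assume x: "x \<in> T"
  show "bij_betw (stalk_map X (obj A 0) x Aaug) (carrier (Fx x)) (cocycles (stalk_complex X A x) 0)"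
    by (rule Aaug_bij[OF x])
  show "stalk_map X (obj A 0) x Aaug \<in> hom (Fx x) (stalk X (obj A 0) x)"
    by (rule stalk_map_hom[OF F_presheaf A_group_presheaf Aaug_hom])
  fix n
  show "cobd (stalk_complex X A x) n \<one>\<^bsub>stalk X (obj A n) x\<^esub> = \<one>\<^bsub>stalk X (obj A (Suc n)) x\<^esub>"
    by (rule A_cobd_one[OF x])
next
  fix x n assume x: "x \<in> T" and "0 < (n::nat)"
  then obtain p where n: "n = Suc p" by (cases n) auto
  show "subgroup (coboundaries (stalk_complex X A x) n) (stalk X (obj A n) x)"
    unfolding n by (rule coboundaries_subgroup[OF x])
  show "cocycles (stalk_complex X A x) n \<subseteq> coboundaries (stalk_complex X A x) n"
  proof
    fix z assume z: "z \<in> cocycles (stalk_complex X A x) n"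
    obtain U f where U: "openin X U" "x \<in> U" and f: "f \<in> carrier (As (Suc p) U)" "z = ag (Suc p) x U f"
      and df: "\<forall>xs\<in>AF U (Suc (Suc p)). dA (Suc p) U f xs = \<one>\<^bsub>Fx (hd xs)\<^esub>"
      by (rule cocycle_obtain[OF z[unfolded n]])
    obtain V g where V: "openin X V" "x \<in> V" "V \<subseteq> U" and g: "g \<in> carrier (As p V)" "dA p V g = restrict f (AF V (Suc p))"
      by (rule adelic_exact[OF U f(1) bspec[OF df]])
    have "cobd (stalk_complex X A x) p (ag p x V g) = z"
      using A_cobd[OF V(2,1) g(1)] g(2) ag_restr[OF V] f(2) by simp
    moreover have "ag p x V g \<in> carrier (stalk X (obj A p) x)"
      using group_presheaf.germ_carrier[OF A_group_presheaf V(1,2)] g(1) by (simp add: A_simps)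
    moreover have "z \<in> carrier (stalk X (obj A n) x)" using z by (simp add: cocycles_def stalk_complex_def)
    ultimately show "z \<in> coboundaries (stalk_complex X A x) n"
      unfolding n by (auto simp: coboundaries_def stalk_complex_def)
  qed
qed

end

theorem corollary2p47:
  fixes X :: "'x topology" and OX :: "('x, 'a) ring_presheaf"
    and F :: "('x, 'b) ab_presheaf"
    and I :: "('x, 'c) sheaf_complex" and \<epsilon> :: "'x set \<Rightarrow> 'b \<Rightarrow> 'c"
    and d :: nat
  assumes "noetherian_scheme X OX"
    and "catenary X"
    and "\<forall>Z\<in>irreducible_components X. krull_dim (subtopology X Z) = enat d"
    and "ab_sheaf X F"
    and "injective_resolution X F I \<epsilon>"
    and "cohen_macaulay X F I \<epsilon>"
  shows "quasi_iso X (in_degree_0 F) (adelic_complex X F I \<epsilon> d)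
    (from_degree_0 (adelic_complex X F I \<epsilon> d) (adelic_aug X F d))"
proof -
  have s: "noetherian_sober X" by (rule noetherian_scheme_sober[OF assms(1)])
  note r = assms(5)[unfolded injective_resolution_def]
  have "injective_complex X I"
  proof (rule injective_complex.intro[OF s injective_complex_axioms.intro])
    show "injective_sheaf X (obj I n)" for n using r by simp
    show "sheaf_hom X (obj I n) (obj I (Suc n)) (diff I n)" for n using r by simp
    show "diff I (Suc n) U (diff I n U s) = \<one>\<^bsub>sections (obj I (Suc (Suc n))) U\<^esub>"
      if "openin X U" "s \<in> carrier (sections (obj I n) U)" for n U s using r that by simp
  qed
  then have "cm_sheaf X I F \<epsilon>"
    using assms(4,6) by (intro cm_sheaf.intro cousin_setup.intro cm_sheaf_axioms.intro)
  moreover have "adelic_axioms X d"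
    by (rule adelic_axioms.intro) (rule noetherian_sober.codim_le_dim[OF s assms(3)])
  ultimately have "adelic X I F \<epsilon> d" by (rule adelic.intro)
  then show ?thesis by (rule adelic.adelic_quasi_iso)
qed

end
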